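(* Let $p\in(0,1)$, let $\mu$ be a non-trivial finite Borel measure on $\mathbb{S}^{n-1}$, let $\operatorname{supp}\mu$ be its support, and let $L=\operatorname{lin}\operatorname{supp}\mu$ be the linear span of $\operatorname{supp}\mu$. Suppose that either $\operatorname{supp}\mu$ spans $\mathbb{R}^n$, or $\dim L\le n-1$ and $\operatorname{pos}\operatorname{supp}\mu\neq L$. Then there exists $K\in\mathcal{K}_0^n$ such that $\mu=S_{K,p}$, i.e. $\mu$ is the $L_p$-surface area measure of $K$. In addition, if $\mu$ is invariant under a closed subgroup $G$ of $O(n)$ acting as the identity on $L^\perp$, then $K$ can be chosen to be invariant under $G$.
   Context: A convex body in $\mathbb{R}^n$ is a compact convex set with non-empty interior; $\mathcal{K}_0^n$ is the family of convex bodies in $\mathbb{R}^n$ containing the origin $o$. The support function of $K$ is $h_K(u)=\max\{\langle x,u\rangle: x\in K\}$. For $x\in\partial K$, $\nu_K(x)$ is the set of all unit exterior normal vectors to $K$ at $x$. The surface area measure of $K$ is the Borel measure on $\mathbb{S}^{n-1}$ given by $S_K(\omega)=\mathcal{H}^{n-1}(\{x\in\partial K:\nu_K(x)\cap\omega\ne\emptyset\})$, where $\mathcal{H}^{n-1}$ is $(n-1)$-dimensional Hausdorff measure. For $p<1$ and $K\in\mathcal{K}_0^n$ the $L_p$-surface area measure is $dS_{K,p}=h_K^{1-p}\,dS_K$. For $X\subset\mathbb{R}^n$, $\operatorname{pos}X=\{\sum_{i=1}^k\lambda_ix_i:\ \lambda_i\ge 0,\ x_i\in X,\ k\ge 1\}$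 is its positive hull. A measure $\mu$ (resp. a body $K$) is invariant under $G$ if $\mu(A\omega)=\mu(\omega)$ for all Borel $\omega$ (resp. $AK=K$) and all $A\in G$. *)

theory Defs
  imports "HOL-Analysis.Analysis"
begin

section \<open>Hausdorff measure\<close>

text \<open>
  The \<open>k\<close>-dimensional Hausdorff outer measure for an integer \<open>k\<close>, normalised by the volume of the
  \<open>k\<close>-dimensional unit ball so that it agrees with Lebesgue measure in \<open>k\<close>-dimensional
  Euclidean space. Empty covering sets contribute nothing, whereas a singleton contributes \<open>1\<close>
  if \<open>k = 0\<close> (here \<open>0 ^ 0 = 1\<close>), so that the case \<open>k = 0\<close> is the counting measure.
  Boundedness of the covering sets has to be required explicitly, because the library's
  \<^const>\<open>diameter\<close> is meaningful for bounded sets only.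
\<close>

definition hausdorff_gauge :: "nat \<Rightarrow> 'a::metric_space set \<Rightarrow> ennreal" where
  "hausdorff_gauge k C =
     (if C = {} then 0 else ennreal (unit_ball_vol (real k) * (diameter C / 2) ^ k))"

definition hausdorff_premeasure :: "nat \<Rightarrow> real \<Rightarrow> 'a::metric_space set \<Rightarrow> ennreal" where
  "hausdorff_premeasure k \<delta> A =
     (INF C \<in> {C :: nat \<Rightarrow> 'a set. A \<subseteq> (\<Union>i. C i) \<and> (\<forall>i. bounded (C i) \<and> diameter (C i) \<le> \<delta>)}.
        \<Sum>i. hausdorff_gauge k (C i))"

definition hausdorff_measure :: "nat \<Rightarrow> 'a::metric_space set \<Rightarrow> ennreal" where
  "hausdorff_measure k A = (SUP \<delta> \<in> {0<..}. hausdorff_premeasure k \<delta> A)"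


section \<open>Convex bodies and their surface area measures\<close>

definition convex_body :: "'a::euclidean_space set \<Rightarrow> bool" where
  "convex_body K \<longleftrightarrow> compact K \<and> convex K \<and> interior K \<noteq> {}"

text \<open>The origin may lie on the boundary of the body.\<close>

definition convex_bodies_0 :: "'a::euclidean_space set set" where
  "convex_bodies_0 = {K. convex_body K \<and> 0 \<in> K}"

text \<open>For nonempty compact \<open>K\<close> the supremum is attained.\<close>

definition support_fun :: "'a::euclidean_space set \<Rightarrow> 'a \<Rightarrow> real" where
  "support_fun K u = (SUP x\<in>K. x \<bullet> u)"

definition unit_normals :: "'a::euclidean_space set \<Rightarrow> 'a \<Rightarrow> 'a set" where
  "unit_normals K x = {u \<in> sphere 0 1. \<forall>y\<in>K. (y - x) \<bullet> u \<le> 0}"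

abbreviation sphere_borel :: "'a::euclidean_space measure" where
  "sphere_borel \<equiv> restrict_space borel (sphere 0 1)"

text \<open>
  The set function below is countably additive on the Borel subsets of the sphere whenever \<open>K\<close> is
  a convex body, as the boundary points with several unit normals form a null set. Otherwise
  \<^const>\<open>measure_of\<close> would return the null measure.
\<close>

definition surface_area_measure :: "'a::euclidean_space set \<Rightarrow> 'a measure" where
  "surface_area_measure K =
     measure_of (sphere 0 1) (sets sphere_borel)
       (\<lambda>\<omega>. hausdorff_measure (DIM('a) - 1) {x \<in> frontier K. unit_normals K x \<inter> \<omega> \<noteq> {}})"

text \<open>
  Intended for \<open>p < 1\<close> and bodies containing the origin. The support function is then nonnegative,
  and \<open>0 powr (1 - p) = 0\<close>.
\<close>

definition Lp_surface_area_measure :: "real \<Rightarrow> 'a::euclidean_space set \<Rightarrow> 'a measure" where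
  "Lp_surface_area_measure p K =
     density (surface_area_measure K) (\<lambda>u. ennreal (support_fun K u powr (1 - p)))"


section \<open>Supports, positive hulls and invariance\<close>

text \<open>Support relative to the subspace topology of the underlying space of the measure.\<close>

definition measure_supp :: "'a::topological_space measure \<Rightarrow> 'a set" where
  "measure_supp \<mu> =
     {x \<in> space \<mu>. \<forall>U. open U \<and> x \<in> U \<longrightarrow> emeasure \<mu> (U \<inter> space \<mu>) > 0}"

definition pos_hull :: "'a::real_vector set \<Rightarrow> 'a set" where
  "pos_hull X =
     {\<Sum>i=1..k. c i *\<^sub>R x i | (k::nat) (c :: nat \<Rightarrow> real) (x :: nat \<Rightarrow> 'a).
        k \<ge> 1 \<and> (\<forall>i\<in>{1..k}. c i \<ge> 0 \<and> x i \<in> X)}"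

text \<open>
  The orthogonal group is closed in the space of all matrices, so being closed in it is the same
  as being closed in the space of all matrices.
\<close>

definition closed_orthogonal_subgroup :: "(real^'n^'n) set \<Rightarrow> bool" where
  "closed_orthogonal_subgroup G \<longleftrightarrow>
     G \<subseteq> {A. orthogonal_matrix A} \<and> mat 1 \<in> G \<and>
     (\<forall>A\<in>G. \<forall>B\<in>G. A ** B \<in> G) \<and> (\<forall>A\<in>G. matrix_inv A \<in> G) \<and> closed G"

definition measure_invariant :: "(real^'n^'n) set \<Rightarrow> (real^'n) measure \<Rightarrow> bool" where
  "measure_invariant G \<mu> \<longleftrightarrow>
     (\<forall>A\<in>G. \<forall>\<omega>\<in>sets \<mu>. emeasure \<mu> ((\<lambda>x. A *v x) ` \<omega>) = emeasure \<mu> \<omega>)"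

definition body_invariant :: "(real^'n^'n) set \<Rightarrow> (real^'n) set \<Rightarrow> bool" where
  "body_invariant G K \<longleftrightarrow> (\<forall>A\<in>G. (\<lambda>x. A *v x) ` K = K)"

end

theory Submission
  imports Defs "HOL-Complex_Analysis.Great_Picard" "HOL-Real_Asymp.Real_Asymp"
begin

text \<open>
  For a body \<open>K\<close> with \<open>0 \<in> K\<close> put \<open>\<Psi> K \<xi> = \<integral> (h_K(u) - \<xi> \<bullet> u)^p d\<mu>(u)\<close>. Among the \<open>G\<close>-invariant bodies of volume
  at least \<open>1\<close> whose origin maximises \<open>\<Psi> K\<close> over \<open>K\<close>, a body minimising \<open>\<Psi> K 0\<close> exists: a bound on \<open>\<Psi> K 0\<close>
  bounds the widths of \<open>K\<close> in the directions of \<open>L\<close>, and if \<open>L\<close> is a proper subspace, then the bodies are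
  cut out by the normals in the support and by finitely many auxiliary directions \<open>v - w\<close>, with
  \<open>w = \<integral> u d\<mu>(u)\<close> and the \<open>v\<close> being the vertices of a simplex in the complement of \<open>L\<close>, so that the
  hypothesis on the positive hull bounds the remaining widths.

  Since \<open>t powr p\<close> has infinite slope at \<open>0\<close>, maximality of the origin forces \<open>h_K > 0\<close> almost
  everywhere for \<open>\<mu>\<close>. Comparing the minimiser with the Wulff shapes of \<open>h_K + t f\<close>, for continuous
  invariant \<open>f\<close> vanishing where \<open>h_K\<close> is small, and using that the first variation of the volume is
  \<open>\<integral> f dS_K\<close>, gives \<open>c \<integral> f dS_K = \<integral> h_K^(p-1) f d\<mu>\<close>. Both measures being \<open>G\<close>-invariant, averaging extends this to all
  continuous \<open>f\<close>, so \<open>\<mu>\<close> is a multiple of \<open>h_K^(1-p) S_K\<close>, and a dilate of \<open>K\<close> is the required body.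

  The first variation formula rests on comparing \<open>S_K\<close> with the cone-volume measure: almost flat pieces
  of the boundary are projected centrally to tangent planes, and on a plane Hausdorff measure is a
  constant multiple of Lebesgue measure by translation invariance, so that the value of the constant
  never matters.
\<close>

section \<open>Hausdorff measure\<close>

text \<open>The origin may lie on the boundary of the minimiser K, where neither its gauge nor the
  power h_K^(p-1) is under control. Two devices deal with this. The geometry of the boundary is
  studied for a translate of K with the origin in its interior, which has the same surface area
  measure. And the test functions vanish where h_K is below some \<open>\<eta> > 0\<close>, so that
  h_K^(p-1) is bounded wherever it is used; the sets where h_K is at least \<open>2 * \<eta>\<close>
  exhaust the set where h_K > 0. Nothing has to be known about S_K where h_K = 0, since the density
  h_K^(1-p) vanishes there and \<open>\<mu>\<close> has no mass there.

  The volume is written as n + 1 times the integral of \<open>max 0 (1 - g)\<close>, with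
  \<open>g\<close> the gauge. This integrand is Lipschitz in the gauge, so the volume can be
  differentiated under the integral sign, pointwise outside a null set.

  The constraint on the volume is removed by homogeneity: the minimum property becomes an inequality
  of degree p under dilations, in which Wulff shapes can be inserted as they are. The last dilation
  exists because the L_p-surface area measure has degree n - p > 0.\<close>

lemma hausdorff_gauge_empty [simp]: "hausdorff_gauge k {} = 0"
  by (simp add: hausdorff_gauge_def)

lemma hausdorff_premeasure_le:
  assumes "A \<subseteq> (\<Union>i. C i)" "\<And>i. bounded (C i)" "\<And>i. diameter (C i) \<le> \<delta>"
  shows "hausdorff_premeasure k \<delta> A \<le> (\<Sum>i. hausdorff_gauge k (C i))"
  unfolding hausdorff_premeasure_def
  by (rule INF_lower) (use assms in auto)

lemma hausdorff_premeasure_mono: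
  assumes "A \<subseteq> B"
  shows "hausdorff_premeasure k \<delta> A \<le> hausdorff_premeasure k \<delta> B"
  unfolding hausdorff_premeasure_def
  by (rule INF_superset_mono) (use assms in auto)

lemma hausdorff_premeasure_antimono:
  assumes "\<delta> \<le> \<delta>'"
  shows "hausdorff_premeasure k \<delta>' A \<le> hausdorff_premeasure k \<delta> A"
  unfolding hausdorff_premeasure_def
  by (rule INF_superset_mono) (use assms in \<open>auto intro: order_trans\<close>)

lemma hausdorff_premeasure_empty [simp]:
  assumes "\<delta> > 0" shows "hausdorff_premeasure k \<delta> {} = 0"
proof -
  have "hausdorff_premeasure k \<delta> {} \<le> (\<Sum>i. hausdorff_gauge k ((\<lambda>_::nat. {}) i))"
    using hausdorff_premeasure_le[of "{}" "\<lambda>_. {}" \<delta> k] assms by simp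
  then show ?thesis by simp
qed

lemma hausdorff_premeasure_UN:
  fixes A :: "nat \<Rightarrow> 'a::metric_space set"
  shows "hausdorff_premeasure k \<delta> (\<Union>i. A i) \<le> (\<Sum>i. hausdorff_premeasure k \<delta> (A i))"
proof (rule ennreal_le_epsilon)
  fix e :: real assume e: "0 < e" and fin: "(\<Sum>i. hausdorff_premeasure k \<delta> (A i)) < top"
  have fin': "hausdorff_premeasure k \<delta> (A i) < top" for i
    using fin by (metis ennreal_suminf_lessD)
  have "\<exists>C. A i \<subseteq> (\<Union>j. C j) \<and> (\<forall>j. bounded (C j) \<and> diameter (C j) \<le> \<delta>) \<and>
          (\<Sum>j. hausdorff_gauge k (C j)) \<le> hausdorff_premeasure k \<delta> (A i) + ennreal (e * (1/2)^Suc i)" for i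
  proof -
    have "hausdorff_premeasure k \<delta> (A i) < hausdorff_premeasure k \<delta> (A i) + ennreal (e * (1/2)^Suc i)"
      using fin'[of i] e by (auto simp: less_top)
    then have "\<exists>C\<in>{C :: nat \<Rightarrow> 'a set. A i \<subseteq> (\<Union>i. C i) \<and> (\<forall>i. bounded (C i) \<and> diameter (C i) \<le> \<delta>)}.
       (\<Sum>j. hausdorff_gauge k (C j)) < hausdorff_premeasure k \<delta> (A i) + ennreal (e * (1/2)^Suc i)"
      by (subst (asm) (1) hausdorff_premeasure_def) (simp only: INF_less_iff)
    then show ?thesis by (auto intro: less_imp_le)
  qed
  then obtain C where C: "\<And>i. A i \<subseteq> (\<Union>j. C i j)" "\<And>i j. bounded (C i j)" "\<And>i j. diameter (C i j) \<le> \<delta>"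
      "\<And>i. (\<Sum>j. hausdorff_gauge k (C i j)) \<le> hausdorff_premeasure k \<delta> (A i) + ennreal (e * (1/2)^Suc i)"
    by metis
  define D where "D n = (case prod_decode n of (i,j) \<Rightarrow> C i j)" for n
  have "hausdorff_premeasure k \<delta> (\<Union>i. A i) \<le> (\<Sum>n. hausdorff_gauge k (D n))"
  proof (rule hausdorff_premeasure_le)
    show "(\<Union>i. A i) \<subseteq> (\<Union>n. D n)"
    proof
      fix x assume "x \<in> (\<Union>i. A i)"
      then obtain i j where "x \<in> C i j" using C(1) by blast
      then have "x \<in> D (prod_encode (i,j))" by (simp add: D_def)
      then show "x \<in> (\<Union>n. D n)" by blast
    qed
  qed (auto simp: D_def C split: prod.split)
  also have "\<dots> = (\<Sum>i. \<Sum>j. hausdorff_gauge k (C i j))"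
    using suminf_ennreal_2dimen[of "\<lambda>i. \<Sum>j. hausdorff_gauge k (C i j)"
        "\<lambda>p. hausdorff_gauge k (case p of (i,j) \<Rightarrow> C i j)"]
    by (simp add: D_def)
  also have "\<dots> \<le> (\<Sum>i. hausdorff_premeasure k \<delta> (A i) + ennreal (e * (1/2)^Suc i))"
    by (intro suminf_le C) auto
  also have "\<dots> = (\<Sum>i. hausdorff_premeasure k \<delta> (A i)) + (\<Sum>i. ennreal (e * (1/2)^Suc i))"
    by (rule suminf_add[symmetric]) auto
  also have "(\<Sum>i. ennreal (e * (1/2)^Suc i)) = ennreal e"
  proof -
    have "(\<lambda>i. e * (1/2)^Suc i) sums (e * 1)"
      by (rule sums_mult) (rule power_half_series)
    then show ?thesis using e by (intro suminf_ennreal_eq) auto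
  qed
  finally show "hausdorff_premeasure k \<delta> (\<Union>i. A i) \<le> (\<Sum>i. hausdorff_premeasure k \<delta> (A i)) + ennreal e" .
qed

lemma hausdorff_premeasure_le_measure: "\<delta> > 0 \<Longrightarrow> hausdorff_premeasure k \<delta> A \<le> hausdorff_measure k A"
  unfolding hausdorff_measure_def by (rule SUP_upper) auto

lemma hausdorff_measure_leI:
  assumes "\<And>\<delta>. \<delta> > 0 \<Longrightarrow> hausdorff_premeasure k \<delta> A \<le> B"
  shows "hausdorff_measure k A \<le> B"
  unfolding hausdorff_measure_def using assms by (auto intro: SUP_least)

lemma hausdorff_measure_empty [simp]: "hausdorff_measure k {} = 0"
  using hausdorff_measure_leI[of k "{}" 0] by simp

lemma hausdorff_measure_mono: "A \<subseteq> B \<Longrightarrow> hausdorff_measure k A \<le> hausdorff_measure k B"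
  unfolding hausdorff_measure_def
  by (rule SUP_mono) (use hausdorff_premeasure_mono in blast)

lemma hausdorff_measure_UN:
  fixes A :: "nat \<Rightarrow> 'a::metric_space set"
  shows "hausdorff_measure k (\<Union>i. A i) \<le> (\<Sum>i. hausdorff_measure k (A i))"
proof (rule hausdorff_measure_leI)
  fix \<delta> :: real assume "\<delta> > 0"
  have "hausdorff_premeasure k \<delta> (\<Union>i. A i) \<le> (\<Sum>i. hausdorff_premeasure k \<delta> (A i))"
    by (rule hausdorff_premeasure_UN)
  also have "\<dots> \<le> (\<Sum>i. hausdorff_measure k (A i))"
    by (intro suminf_le hausdorff_premeasure_le_measure \<open>\<delta> > 0\<close>) auto
  finally show "hausdorff_premeasure k \<delta> (\<Union>i. A i) \<le> (\<Sum>i. hausdorff_measure k (A i))" .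
qed

lemma hausdorff_measure_Un: "hausdorff_measure k (A \<union> B) \<le> hausdorff_measure k A + hausdorff_measure k B"
proof -
  have "A \<union> B \<subseteq> (\<Union>i. case i of 0 \<Rightarrow> A | Suc 0 \<Rightarrow> B | Suc (Suc i) \<Rightarrow> {})"
    using UN_upper[of 0 UNIV "\<lambda>i. case i of 0 \<Rightarrow> A | Suc 0 \<Rightarrow> B | Suc (Suc i) \<Rightarrow> {}"]
      UN_upper[of "Suc 0" UNIV "\<lambda>i. case i of 0 \<Rightarrow> A | Suc 0 \<Rightarrow> B | Suc (Suc i) \<Rightarrow> {}"] by simp
  from hausdorff_measure_mono[OF this, of k] have "hausdorff_measure k (A \<union> B) \<le> (\<Sum>i. hausdorff_measure k (case i of 0 \<Rightarrow> A | Suc 0 \<Rightarrow> B | Suc (Suc i) \<Rightarrow> {}))"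
    using hausdorff_measure_UN[of k "\<lambda>i. case i of 0 \<Rightarrow> A | Suc 0 \<Rightarrow> B | Suc (Suc i) \<Rightarrow> {}"] by (rule order_trans)
  also have "\<dots> = (\<Sum>i\<in>{0,Suc 0}. hausdorff_measure k (case i of 0 \<Rightarrow> A | Suc 0 \<Rightarrow> B | Suc (Suc i) \<Rightarrow> {}))"
    by (rule suminf_finite) (auto split: nat.splits)
  finally show ?thesis by simp
qed

text \<open>A set of diameter at most \<open>\<delta>\<close> cannot meet both \<open>A\<close> and
  \<open>B\<close>, so every admissible cover of the union contains two disjoint subfamilies, one
  covering \<open>A\<close> and one covering \<open>B\<close>.\<close>

lemma hausdorff_premeasure_separated:
  fixes A B :: "'a::metric_space set"
  assumes sep: "\<And>x y. x \<in> A \<Longrightarrow> y \<in> B \<Longrightarrow> \<delta> < dist x y" 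
  shows "hausdorff_premeasure k \<delta> A + hausdorff_premeasure k \<delta> B \<le> hausdorff_premeasure k \<delta> (A \<union> B)"
  unfolding hausdorff_premeasure_def[of k \<delta> "A \<union> B"]
proof (rule INF_greatest)
  fix C :: "nat \<Rightarrow> 'a set"
  assume "C \<in> {C. A \<union> B \<subseteq> (\<Union>i. C i) \<and> (\<forall>i. bounded (C i) \<and> diameter (C i) \<le> \<delta>)}"
  then have C: "A \<union> B \<subseteq> (\<Union>i. C i)" "\<And>i. bounded (C i)" "\<And>i. diameter (C i) \<le> \<delta>" by auto
  define CA where "CA i = (if C i \<inter> A = {} then {} else C i)" for i
  define CB where "CB i = (if C i \<inter> B = {} then {} else C i)" for i
  have d0: "0 \<le> \<delta>" using C(3)[of 0] diameter_ge_0[OF C(2)[of 0]] by linarith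
  have "hausdorff_premeasure k \<delta> A \<le> (\<Sum>i. hausdorff_gauge k (CA i))"
    by (rule hausdorff_premeasure_le) (use C d0 in \<open>auto simp: CA_def\<close>, blast)
  moreover have "hausdorff_premeasure k \<delta> B \<le> (\<Sum>i. hausdorff_gauge k (CB i))"
    by (rule hausdorff_premeasure_le) (use C d0 in \<open>auto simp: CB_def\<close>, blast)
  ultimately have "hausdorff_premeasure k \<delta> A + hausdorff_premeasure k \<delta> B
      \<le> (\<Sum>i. hausdorff_gauge k (CA i)) + (\<Sum>i. hausdorff_gauge k (CB i))"
    by (rule add_mono)
  also have "\<dots> = (\<Sum>i. hausdorff_gauge k (CA i) + hausdorff_gauge k (CB i))"
    by (rule suminf_add) auto
  also have "\<dots> \<le> (\<Sum>i. hausdorff_gauge k (C i))"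
  proof (intro suminf_le)
    fix i
    have "C i \<inter> A = {} \<or> C i \<inter> B = {}"
    proof (rule ccontr)
      assume "\<not> ?thesis"
      then obtain x y where "x \<in> C i" "x \<in> A" "y \<in> C i" "y \<in> B" by blast
      then have "dist x y \<le> \<delta>" "\<delta> < dist x y"
        using diameter_bounded_bound[OF C(2)[of i], of x y] C(3)[of i] sep by auto
      then show False by simp
    qed
    then show "hausdorff_gauge k (CA i) + hausdorff_gauge k (CB i) \<le> hausdorff_gauge k (C i)"
      by (auto simp: CA_def CB_def)
  qed auto
  finally show "hausdorff_premeasure k \<delta> A + hausdorff_premeasure k \<delta> B \<le> (\<Sum>i. hausdorff_gauge k (C i))" .
qed

text \<open>The premeasures grow as \<open>\<delta>\<close> shrinks. Hence only scales below the gap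
  matter, and the two suprema may be added, being taken over a directed family.\<close>

lemma hausdorff_measure_separated:
  fixes A B :: "'a::metric_space set"
  assumes d: "0 < d" and sep: "\<And>x y. x \<in> A \<Longrightarrow> y \<in> B \<Longrightarrow> d \<le> dist x y"
  shows "hausdorff_measure k A + hausdorff_measure k B \<le> hausdorff_measure k (A \<union> B)"
proof -
  have "hausdorff_measure k A + hausdorff_measure k B
    = (SUP \<delta>\<in>{0<..}. hausdorff_premeasure k \<delta> A + hausdorff_premeasure k \<delta> B)"
    unfolding hausdorff_measure_def
    by (rule SUP_add_directed_ennreal[symmetric])
       (metis add_mono hausdorff_premeasure_antimono greaterThan_iff linear)
  also have "\<dots> \<le> hausdorff_measure k (A \<union> B)"
  proof (rule SUP_least)
    fix \<delta> :: real assume "\<delta> \<in> {0<..}"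
    define e where "e = min \<delta> (d/2)"
    have e: "0 < e" "e \<le> \<delta>" "e < d" using \<open>\<delta> \<in> {0<..}\<close> d by (auto simp: e_def)
    have "hausdorff_premeasure k \<delta> A + hausdorff_premeasure k \<delta> B
       \<le> hausdorff_premeasure k e A + hausdorff_premeasure k e B"
      by (intro add_mono hausdorff_premeasure_antimono e)
    also have "\<dots> \<le> hausdorff_premeasure k e (A \<union> B)"
      by (rule hausdorff_premeasure_separated) (use sep e in force)
    also have "\<dots> \<le> hausdorff_measure k (A \<union> B)"
      by (rule hausdorff_premeasure_le_measure) (rule e)
    finally show "hausdorff_premeasure k \<delta> A + hausdorff_premeasure k \<delta> B \<le> hausdorff_measure k (A \<union> B)" .
  qed
  finally show ?thesis .
qed

section \<open>Borel sets are Caratheodory measurable\<close>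

lemma suminf_ennreal_offset_tendsto_0:
  fixes f :: "nat \<Rightarrow> ennreal"
  assumes "suminf f \<noteq> top"
  shows "(\<lambda>n. \<Sum>i. f (i + n)) \<longlonglongrightarrow> 0"
proof -
  have fin: "(\<Sum>j<n. f j) \<noteq> top" for n
    using assms by (metis sum_le_suminf finite_lessThan summableI zero_le top.extremum_uniqueI)
  have "(\<Sum>i. f (i + n)) = suminf f - (\<Sum>j<n. f j)" for n
    using suminf_offset[of f n] fin[of n] by (simp add: ennreal_add_diff_cancel_right)
  moreover have "(\<lambda>n. suminf f - (\<Sum>j<n. f j)) \<longlonglongrightarrow> suminf f - suminf f"
    by (intro tendsto_diff_ennreal tendsto_const summable_LIMSEQ) (use assms in auto)
  ultimately show ?thesis using assms by simp
qed

text \<open>Caratheodory's argument for metric outer measures: the shells between consecutive level sets of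
  the distance to \<open>F\<close> are separated from every second shell, which makes their measures summable.\<close>

lemma hausdorff_measure_closed_split:
  fixes F A :: "'a::metric_space set"
  assumes F: "closed F"
  shows "hausdorff_measure k (A \<inter> F) + hausdorff_measure k (A - F) \<le> hausdorff_measure k A"
proof (cases "hausdorff_measure k A = top \<or> F = {}")
  case True then show ?thesis by auto
next
  case False
  then have fin: "hausdorff_measure k A < top" and Fne: "F \<noteq> {}" by (auto simp: less_top)
  let ?H = "hausdorff_measure k"
  define A' where "A' n = {x\<in>A. infdist x F \<ge> 1 / real (Suc n)}" for n
  define R where "R n = {x\<in>A. 1 / real (Suc (Suc n)) \<le> infdist x F \<and> infdist x F < 1 / real (Suc n)}" for n
  have sub: "A' n \<subseteq> A" "R n \<subseteq> A" for n by (auto simp: A'_def R_def)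
  have step: "?H (A \<inter> F) + ?H (A' n) \<le> ?H A" for n
  proof -
    have "?H (A \<inter> F) + ?H (A' n) \<le> ?H (A \<inter> F \<union> A' n)"
    proof (rule hausdorff_measure_separated[where d="1 / real (Suc n)"])
      fix x y assume "x \<in> A \<inter> F" "y \<in> A' n"
      then have "infdist y F \<le> dist y x" by (intro infdist_le) auto
      then show "1 / real (Suc n) \<le> dist x y" using \<open>y \<in> A' n\<close> by (auto simp: A'_def dist_commute)
    qed auto
    also have "\<dots> \<le> ?H A" by (rule hausdorff_measure_mono) (auto simp: A'_def)
    finally show ?thesis .
  qed
  \<comment> \<open>\<open>c\<close> is the parity: 0 for the even shells, 1 for the odd
    ones.\<close>
  have sums: "(\<Sum>i<m. ?H (R (2*i + c))) \<le> ?H A" for m c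
  proof -
    have "(\<Sum>i<m. ?H (R (2*i + c))) \<le> ?H (\<Union>i<m. R (2*i + c))"
    proof (induction m)
      case (Suc m)
      define d where "d = (1 / real (2*m+c) - 1 / real (Suc (2*m+c)))"
      have "?H (\<Union>i<m. R (2*i + c)) + ?H (R (2*m+c)) \<le> ?H ((\<Union>i<m. R (2*i + c)) \<union> R (2*m+c))"
      \<comment> \<open>For \<open>m = 0\<close> the number \<open>d\<close> is no gap and may
        contain \<open>1 / 0\<close>, but then the union on the left is empty.\<close>
      proof (cases "m = 0")
        case False
        have "d > 0" using False by (simp add: d_def divide_strict_left_mono)
        moreover have "d \<le> dist x y" if x: "x \<in> (\<Union>i<m. R (2*i + c))" and y: "y \<in> R (2*m+c)" for x y
        proof -
          obtain i where i: "i < m" "x \<in> R (2*i + c)" using x by auto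
          have "1 / real (2*m+c) \<le> 1 / real (Suc (Suc (2*i+c)))"
            using i by (intro divide_left_mono) auto
          moreover have "infdist x F \<le> infdist y F + dist x y" by (rule infdist_triangle)
          ultimately show ?thesis using i y by (auto simp: R_def d_def)
        qed
        ultimately show ?thesis by (intro hausdorff_measure_separated[of d]) auto
      qed auto
      then show ?case using Suc by (auto simp: lessThan_Suc Un_commute add.commute intro: order_trans add_mono add_left_mono)
    qed auto
    also have "\<dots> \<le> ?H A" by (rule hausdorff_measure_mono) (auto simp: R_def)
    finally show ?thesis .
  qed
  have sumR: "(\<Sum>i<n. ?H (R i)) \<le> ?H A + ?H A" for n
  proof -
    have "(\<Sum>i<n. ?H (R i)) \<le> (\<Sum>i<2*n. ?H (R i))" by (rule sum_mono2) auto
    also have "\<dots> = (\<Sum>i<n. ?H (R (2*i+0))) + (\<Sum>i<n. ?H (R (2*i+1)))"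
      by (induction n) (auto simp: algebra_simps)
    also have "\<dots> \<le> ?H A + ?H A" by (intro add_mono sums)
    finally show ?thesis .
  qed
  then have "(\<Sum>i. ?H (R i)) \<le> ?H A + ?H A"
    by (intro suminf_le_const) auto
  then have finR: "(\<Sum>i. ?H (R i)) \<noteq> top"
    using fin by (metis ennreal_add_eq_top less_irrefl top.extremum_uniqueI)
  have "?H (A - F) \<le> ?H (A' n) + (\<Sum>i. ?H (R (i + n)))" for n
  proof -
    have "A - F \<subseteq> A' n \<union> (\<Union>i. R (i + n))"
    proof
      fix x assume x: "x \<in> A - F"
      then have pos: "infdist x F > 0" using F Fne
        by (metis DiffD2 closure_closed in_closure_iff_infdist_zero infdist_nonneg less_eq_real_def)
      show "x \<in> A' n \<union> (\<Union>i. R (i + n))"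
      proof (cases "x \<in> A' n")
        case False
        then have lt: "infdist x F < 1 / real (Suc n)" using x by (auto simp: A'_def)
        obtain m where m: "inverse (real (Suc m)) < infdist x F" using reals_Archimedean[OF pos] by auto
        define j where "j = (LEAST j. 1 / real (Suc j) \<le> infdist x F)"
        have j: "1 / real (Suc j) \<le> infdist x F"
          unfolding j_def by (rule LeastI[of _ m]) (use m in \<open>simp add: inverse_eq_divide\<close>)
        have jn: "n < j"
        proof (rule ccontr)
          assume "\<not> n < j"
          then have "1 / real (Suc n) \<le> 1 / real (Suc j)" by (intro divide_left_mono) auto
          then show False using j lt by linarith
        qed
        then obtain i where i: "j = Suc (i + n)" by (metis add.commute less_imp_Suc_add)
        have "\<not> 1 / real (Suc (i+n)) \<le> infdist x F"
          using not_less_Least[of "i+n" "\<lambda>j. 1 / real (Suc j) \<le> infdist x F"] i by (auto simp: j_def)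
        then have "x \<in> R (i + n)" using j i x by (auto simp: R_def)
        then show ?thesis by blast
      qed auto
    qed
    then have "?H (A - F) \<le> ?H (A' n \<union> (\<Union>i. R (i + n)))" by (rule hausdorff_measure_mono)
    also have "\<dots> \<le> ?H (A' n) + ?H (\<Union>i. R (i + n))" by (rule hausdorff_measure_Un)
    also have "\<dots> \<le> ?H (A' n) + (\<Sum>i. ?H (R (i + n)))" by (intro add_left_mono hausdorff_measure_UN)
    finally show ?thesis .
  qed
  then have "?H (A \<inter> F) + ?H (A - F) \<le> ?H A + (\<Sum>i. ?H (R (i + n)))" for n
  proof -
    assume *: "\<And>n. ?H (A - F) \<le> ?H (A' n) + (\<Sum>i. ?H (R (i + n)))"
    have "?H (A \<inter> F) + ?H (A - F) \<le> ?H (A \<inter> F) + (?H (A' n) + (\<Sum>i. ?H (R (i + n))))"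
      by (intro add_left_mono *)
    also have "\<dots> \<le> ?H A + (\<Sum>i. ?H (R (i + n)))"
      using step[of n] by (metis add.assoc add_right_mono)
    finally show ?thesis .
  qed
  moreover have "(\<lambda>n. ?H A + (\<Sum>i. ?H (R (i + n)))) \<longlonglongrightarrow> ?H A + 0"
    by (intro tendsto_add tendsto_const suminf_ennreal_offset_tendsto_0) (use finR in auto)
  ultimately show ?thesis
    by (intro Lim_bounded2[of "\<lambda>n. ?H A + (\<Sum>i. ?H (R (i + n)))" _ 0]) auto
qed

definition hausdorff_borel :: "nat \<Rightarrow> 'a::metric_space measure" where
  "hausdorff_borel k = measure_of UNIV (sets borel) (hausdorff_measure k)"

lemma outer_measure_space_hausdorff:
  "outer_measure_space (UNIV :: 'a set set) (hausdorff_measure k :: 'a::metric_space set \<Rightarrow> ennreal)"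
  unfolding outer_measure_space_def
  by (auto simp: positive_def increasing_def countably_subadditive_def
      intro: hausdorff_measure_mono hausdorff_measure_UN)

lemma hausdorff_measure_space:
  "measure_space UNIV (sets borel) (hausdorff_measure k :: 'a::metric_space set \<Rightarrow> ennreal)"
proof -
  let ?L = "lambda_system UNIV UNIV (hausdorff_measure k :: 'a set \<Rightarrow> ennreal)"
  have "sigma_algebra (UNIV :: 'a set) UNIV" using sigma_algebra_Pow[of "UNIV :: 'a set"] by simp
  then have ms: "measure_space UNIV ?L (hausdorff_measure k)"
    by (rule sigma_algebra.caratheodory_lemma[OF _ outer_measure_space_hausdorff])
  have sa: "sigma_algebra UNIV ?L" using ms by (simp add: measure_space_def)
  have "F \<in> ?L" if "closed F" for F :: "'a set"
  proof -
    have "hausdorff_measure k (F \<inter> A) + hausdorff_measure k ((UNIV - F) \<inter> A) = hausdorff_measure k A" for A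
    proof (rule antisym)
      have "F \<inter> A = A \<inter> F" "(UNIV - F) \<inter> A = A - F" by auto
      then show "hausdorff_measure k (F \<inter> A) + hausdorff_measure k ((UNIV - F) \<inter> A) \<le> hausdorff_measure k A"
        using hausdorff_measure_closed_split[OF that, of k A] by simp
      have "A = (F \<inter> A) \<union> ((UNIV - F) \<inter> A)" by auto
      then show "hausdorff_measure k A \<le> hausdorff_measure k (F \<inter> A) + hausdorff_measure k ((UNIV - F) \<inter> A)"
        by (metis hausdorff_measure_Un)
    qed
    then show ?thesis by (simp add: lambda_system_def)
  qed
  then have "sigma_sets UNIV (Collect closed) \<subseteq> ?L"
    by (intro sigma_algebra.sigma_sets_subset[OF sa]) auto
  then have "sets borel \<subseteq> ?L"
    by (simp add: borel_eq_closed)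
  then show ?thesis
    using measure_down[OF ms, of "sets borel"] by (metis sets.sigma_algebra_axioms space_borel)
qed

lemma sets_hausdorff_borel [simp, measurable_cong]: "sets (hausdorff_borel k :: 'a::metric_space measure) = sets borel"
  using sets.sigma_sets_eq[of "borel :: 'a measure"] by (simp add: hausdorff_borel_def)

lemma space_hausdorff_borel [simp]: "space (hausdorff_borel k) = UNIV"
  by (simp add: hausdorff_borel_def space_measure_of_conv)

lemma emeasure_hausdorff_borel:
  assumes "A \<in> sets borel" shows "emeasure (hausdorff_borel k) A = hausdorff_measure k A"
  unfolding hausdorff_borel_def
  by (rule emeasure_measure_of_sigma)
     (use hausdorff_measure_space[of k] assms in \<open>auto simp: measure_space_def\<close>)

section \<open>Lipschitz maps, isometries and dilations\<close>

lemma hausdorff_measure_lipschitz_image_le: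
  fixes f :: "'a::metric_space \<Rightarrow> 'b::metric_space"
  assumes L: "L > 0" and lip: "\<And>x y. x \<in> A \<Longrightarrow> y \<in> A \<Longrightarrow> dist (f x) (f y) \<le> L * dist x y"
  shows "hausdorff_measure k (f ` A) \<le> ennreal (L ^ k) * hausdorff_measure k A"
proof (rule hausdorff_measure_leI)
  fix \<delta> :: real assume d: "\<delta> > 0"
  have "hausdorff_premeasure k \<delta> (f ` A) \<le> ennreal (L ^ k) * (\<Sum>i. hausdorff_gauge k (C i))"
    if C: "A \<subseteq> (\<Union>i. C i)" "\<And>i. bounded (C i)" "\<And>i. diameter (C i) \<le> \<delta> / L" for C :: "nat \<Rightarrow> 'a set"
  proof -
    \<comment> \<open>\<open>f\<close> is controlled on \<open>A\<close> only, so the covering sets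
      are cut down to \<open>A\<close> before they are mapped.\<close>
    define E where "E i = f ` (C i \<inter> A)" for i
    have dE: "dist u v \<le> L * diameter (C i)" if uv: "u \<in> E i" "v \<in> E i" for u v i
    proof -
      obtain x y where xy: "u = f x" "v = f y" "x \<in> C i \<inter> A" "y \<in> C i \<inter> A"
        using uv by (auto simp: E_def)
      then have "dist u v \<le> L * dist x y" using lip by auto
      also have "\<dots> \<le> L * diameter (C i)"
        using diameter_bounded_bound[OF C(2)[of i], of x y] xy L by (intro mult_left_mono) auto
      finally show ?thesis .
    qed
    have bE: "bounded (E i)" for i
    proof (cases "E i = {}")
      case False
      then obtain u where "u \<in> E i" by auto
      then show ?thesis unfolding bounded_def by (intro exI[of _ u] exI[of _ "L * diameter (C i)"]) (use dE in auto)
    qed auto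
    have diE: "diameter (E i) \<le> L * diameter (C i)" for i
    proof (cases "E i = {}")
      case True
      then show ?thesis using L diameter_ge_0[OF C(2)[of i]] by (simp add: diameter_def)
    next
      case False
      then show ?thesis unfolding diameter_def[of "E i"] by (auto intro!: cSUP_least dE)
    qed
    have "hausdorff_premeasure k \<delta> (f ` A) \<le> (\<Sum>i. hausdorff_gauge k (E i))"
    proof (rule hausdorff_premeasure_le[OF _ bE])
      show "f ` A \<subseteq> (\<Union>i. E i)" using C(1) unfolding E_def by blast
      fix i
      have "L * diameter (C i) \<le> L * (\<delta> / L)" using C(3) L by (intro mult_left_mono) auto
      then show "diameter (E i) \<le> \<delta>" using diE[of i] L by simp
    qed
    also have "\<dots> \<le> (\<Sum>i. ennreal (L ^ k) * hausdorff_gauge k (C i))"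
    proof (intro suminf_le)
      fix i
      show "hausdorff_gauge k (E i) \<le> ennreal (L ^ k) * hausdorff_gauge k (C i)"
      proof (cases "E i = {}")
        case False
        then have ne: "C i \<noteq> {}" by (auto simp: E_def)
        have "(diameter (E i) / 2) ^ k \<le> (L * diameter (C i) / 2) ^ k"
          using diE[of i] diameter_ge_0[OF bE] by (intro power_mono) auto
        also have "\<dots> = L ^ k * (diameter (C i) / 2) ^ k"
          by (simp add: power_mult_distrib power_divide)
        finally have "unit_ball_vol (real k) * (diameter (E i) / 2) ^ k
            \<le> unit_ball_vol (real k) * (L ^ k * (diameter (C i) / 2) ^ k)"
          by (intro mult_left_mono) auto
        also have "\<dots> = L ^ k * (unit_ball_vol (real k) * (diameter (C i) / 2) ^ k)" by simp
        finally show ?thesis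
          using False ne L diameter_ge_0[OF C(2)[of i]]
          by (simp add: hausdorff_gauge_def ennreal_mult[symmetric] ennreal_leI)
      qed auto
    qed auto
    also have "\<dots> = ennreal (L ^ k) * (\<Sum>i. hausdorff_gauge k (C i))" by simp
    finally show ?thesis .
  qed
  then have "hausdorff_premeasure k \<delta> (f ` A) / ennreal (L ^ k) \<le> hausdorff_premeasure k (\<delta> / L) A"
    unfolding hausdorff_premeasure_def[of k "\<delta>/L"]
    using L by (intro INF_greatest) (auto simp: divide_le_posI_ennreal mult.commute)
  also have "\<dots> \<le> hausdorff_measure k A"
    by (rule hausdorff_premeasure_le_measure) (use d L in auto)
  finally have "ennreal (L ^ k) * (hausdorff_premeasure k \<delta> (f ` A) / ennreal (L ^ k)) \<le> ennreal (L ^ k) * hausdorff_measure k A"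
    by (rule mult_left_mono) auto
  moreover have "ennreal (L ^ k) * (hausdorff_premeasure k \<delta> (f ` A) / ennreal (L ^ k)) = hausdorff_premeasure k \<delta> (f ` A)"
    using L by (subst ennreal_times_divide, subst mult.commute, intro mult_divide_eq_ennreal) auto
  ultimately show "hausdorff_premeasure k \<delta> (f ` A) \<le> ennreal (L ^ k) * hausdorff_measure k A"
    by simp
qed

lemma hausdorff_measure_isometry:
  fixes f :: "'a::metric_space \<Rightarrow> 'b::metric_space"
  assumes "\<And>x y. dist (f x) (f y) = dist x y"
  shows "hausdorff_measure k (f ` A) = hausdorff_measure k A"
proof (rule antisym)
  show "hausdorff_measure k (f ` A) \<le> hausdorff_measure k A"
    using hausdorff_measure_lipschitz_image_le[of 1 A f k] assms by simp
  have inj: "inj f" using assms by (intro injI) (metis dist_eq_0_iff)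
  have "hausdorff_measure k (inv f ` f ` A) \<le> hausdorff_measure k (f ` A)"
    using hausdorff_measure_lipschitz_image_le[of 1 "f ` A" "inv f" k] inj
    by (force simp: assms)
  then show "hausdorff_measure k A \<le> hausdorff_measure k (f ` A)"
    using inj by (simp add: image_image)
qed

lemma hausdorff_measure_scaleR:
  fixes A :: "'a::real_normed_vector set"
  assumes "s > 0"
  shows "hausdorff_measure k ((\<lambda>x. s *\<^sub>R x) ` A) = ennreal (s ^ k) * hausdorff_measure k A"
proof (rule antisym)
  have le: "hausdorff_measure k ((\<lambda>x. s *\<^sub>R x) ` A) \<le> ennreal (s ^ k) * hausdorff_measure k A"
    if "s > 0" for s and A :: "'a set"
    by (rule hausdorff_measure_lipschitz_image_le) (use that in \<open>auto simp: dist_norm scaleR_diff_right[symmetric]\<close>)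
  show "hausdorff_measure k ((\<lambda>x. s *\<^sub>R x) ` A) \<le> ennreal (s ^ k) * hausdorff_measure k A"
    by (rule le) (rule assms)
  have "hausdorff_measure k A = hausdorff_measure k ((\<lambda>x. (1/s) *\<^sub>R x) ` (\<lambda>x. s *\<^sub>R x) ` A)"
    using assms by (simp add: image_image)
  also have "\<dots> \<le> ennreal ((1/s)^k) * hausdorff_measure k ((\<lambda>x. s *\<^sub>R x) ` A)"
    by (rule le) (use assms in auto)
  finally have "ennreal (s ^ k) * hausdorff_measure k A
     \<le> ennreal (s ^ k) * (ennreal ((1/s)^k) * hausdorff_measure k ((\<lambda>x. s *\<^sub>R x) ` A))"
    by (rule mult_left_mono) auto
  also have "ennreal (s ^ k) * (ennreal ((1/s)^k) * hausdorff_measure k ((\<lambda>x. s *\<^sub>R x) ` A))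
     = ennreal (s ^ k * (1/s)^k) * hausdorff_measure k ((\<lambda>x. s *\<^sub>R x) ` A)"
    using assms by (simp add: ennreal_mult mult.assoc)
  also have "s ^ k * (1/s)^k = 1" using assms by (simp add: power_divide)
  finally show "ennreal (s ^ k) * hausdorff_measure k A \<le> hausdorff_measure k ((\<lambda>x. s *\<^sub>R x) ` A)" by simp
qed

section \<open>Lebesgue measure under linear maps\<close>

text \<open>Uniqueness of Haar measure by double counting: integrate \<open>1\<^sub>Q(x) 1\<^sub>B(x + y - a)\<close> against
  \<open>M \<otimes> N\<close> in both orders.\<close>

lemma translation_invariant_unique:
  fixes M N :: "'a::euclidean_space measure"
  assumes sM [measurable_cong]: "sets M = sets borel" and sN [measurable_cong]: "sets N = sets borel"
    and sfM: "sigma_finite_measure M" and sfN: "sigma_finite_measure N"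
    and supM: "AE x in M. x - a \<in> E" and supN: "AE x in N. x - a \<in> E"
    and minus: "\<And>e. e \<in> E \<Longrightarrow> - e \<in> E"
    and invM: "\<And>e. e \<in> E \<Longrightarrow> distr M borel ((+) e) = M"
    and invN: "\<And>e. e \<in> E \<Longrightarrow> distr N borel ((+) e) = N"
    and Q [measurable]: "Q \<in> sets borel" and B [measurable]: "B \<in> sets borel"
  shows "emeasure N ((\<lambda>y. 2 *\<^sub>R a - y) -` Q) * emeasure M B = emeasure M Q * emeasure N B"
proof -
  interpret M: sigma_finite_measure M by fact
  interpret N: sigma_finite_measure N by fact
  interpret P: pair_sigma_finite M N ..
  have spM: "space M = UNIV" and spN: "space N = UNIV"
    using sM sN by (auto dest: sets_eq_imp_space_eq)
  have shiftM: "(\<integral>\<^sup>+x. g (e + x) \<partial>M) = (\<integral>\<^sup>+x. g x \<partial>M)" if "e \<in> E" "g \<in> borel_measurable borel" for g e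
    using that by (subst (2) invM[symmetric, OF that(1)]) (simp add: nn_integral_distr)
  have shiftN: "(\<integral>\<^sup>+x. g (e + x) \<partial>N) = (\<integral>\<^sup>+x. g x \<partial>N)" if "e \<in> E" "g \<in> borel_measurable borel" for g e
    using that by (subst (2) invN[symmetric, OF that(1)]) (simp add: nn_integral_distr)
  let ?f = "\<lambda>x y. indicator Q x * indicator B (x + y - a) :: ennreal"
  let ?g = "\<lambda>x y. indicator Q (x - y + a) * indicator B x :: ennreal"
  have "(\<integral>\<^sup>+x. (\<integral>\<^sup>+y. ?f x y \<partial>N) \<partial>M) = (\<integral>\<^sup>+x. indicator Q x * emeasure N B \<partial>M)"
  proof (rule nn_integral_cong_AE)
    show "AE x in M. (\<integral>\<^sup>+y. ?f x y \<partial>N) = indicator Q x * emeasure N B"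
      using supM
    proof eventually_elim
      case (elim x)
      have "(\<integral>\<^sup>+y. ?f x y \<partial>N) = indicator Q x * (\<integral>\<^sup>+y. indicator B ((x - a) + y) \<partial>N)"
        by (subst nn_integral_cmult[symmetric]) (auto intro!: nn_integral_cong simp: algebra_simps)
      also have "(\<integral>\<^sup>+y. indicator B ((x - a) + y) \<partial>N) = (\<integral>\<^sup>+y. indicator B y \<partial>N)"
        by (rule shiftN[OF elim]) simp
      finally show ?case by simp
    qed
  qed
  also have "\<dots> = emeasure M Q * emeasure N B"
    by (simp add: nn_integral_multc)
  finally have 1: "(\<integral>\<^sup>+x. (\<integral>\<^sup>+y. ?f x y \<partial>N) \<partial>M) = emeasure M Q * emeasure N B" .
  have "(\<integral>\<^sup>+y. (\<integral>\<^sup>+x. ?f x y \<partial>M) \<partial>N) = (\<integral>\<^sup>+y. (\<integral>\<^sup>+x. ?g x y \<partial>M) \<partial>N)"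
  proof (rule nn_integral_cong_AE)
    show "AE y in N. (\<integral>\<^sup>+x. ?f x y \<partial>M) = (\<integral>\<^sup>+x. ?g x y \<partial>M)"
      using supN
    proof eventually_elim
      case (elim y)
      have "(\<integral>\<^sup>+x. ?f x y \<partial>M) = (\<integral>\<^sup>+x. ?g ((y - a) + x) y \<partial>M)"
        by (rule nn_integral_cong) (auto simp: algebra_simps)
      also have "\<dots> = (\<integral>\<^sup>+x. ?g x y \<partial>M)"
        by (rule shiftM[OF elim]) measurable
      finally show ?case .
    qed
  qed
  also have "\<dots> = (\<integral>\<^sup>+x. (\<integral>\<^sup>+y. ?g x y \<partial>N) \<partial>M)"
    by (rule P.Fubini') measurable
  also have "\<dots> = (\<integral>\<^sup>+x. emeasure N ((\<lambda>y. 2 *\<^sub>R a - y) -` Q) * indicator B x \<partial>M)"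
  proof (rule nn_integral_cong_AE)
    show "AE x in M. (\<integral>\<^sup>+y. ?g x y \<partial>N) = emeasure N ((\<lambda>y. 2 *\<^sub>R a - y) -` Q) * indicator B x"
      using supM
    proof eventually_elim
      case (elim x)
      have [measurable]: "(\<lambda>y. 2 *\<^sub>R a - y) -` Q \<in> sets borel"
        using measurable_sets[of "\<lambda>y. 2 *\<^sub>R a - y" borel borel Q] by simp
      have "(\<integral>\<^sup>+y. ?g x y \<partial>N) = (\<integral>\<^sup>+y. indicator Q (x - y + a) \<partial>N) * indicator B x"
        by (rule nn_integral_multc) measurable
      \<comment> \<open>The variable \<open>y\<close> enters with a minus sign, so a translation
        leads to the reflection of \<open>Q\<close> in the point \<open>a\<close>. This is the
        origin of the preimage in the conclusion; in the applications \<open>Q\<close> is symmetric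
        about \<open>a\<close>.\<close>
      also have "(\<integral>\<^sup>+y. indicator Q (x - y + a) \<partial>N) = (\<integral>\<^sup>+y. indicator ((\<lambda>y. 2 *\<^sub>R a - y) -` Q) (- (x - a) + y) \<partial>N)"
        by (rule nn_integral_cong) (auto simp: indicator_def algebra_simps scaleR_2)
      also have "\<dots> = (\<integral>\<^sup>+y. indicator ((\<lambda>y. 2 *\<^sub>R a - y) -` Q) y \<partial>N)"
        by (rule shiftN[OF minus[OF elim]]) simp
      also have "\<dots> = emeasure N ((\<lambda>y. 2 *\<^sub>R a - y) -` Q)"
        by (rule nn_integral_indicator) simp
      finally show ?case .
    qed
  qed
  also have "\<dots> = emeasure N ((\<lambda>y. 2 *\<^sub>R a - y) -` Q) * emeasure M B"
    by (simp add: nn_integral_cmult)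
  finally have 2: "(\<integral>\<^sup>+y. (\<integral>\<^sup>+x. ?f x y \<partial>M) \<partial>N) = emeasure N ((\<lambda>y. 2 *\<^sub>R a - y) -` Q) * emeasure M B" .
  have "(\<integral>\<^sup>+y. (\<integral>\<^sup>+x. ?f x y \<partial>M) \<partial>N) = (\<integral>\<^sup>+x. (\<integral>\<^sup>+y. ?f x y \<partial>N) \<partial>M)"
    by (rule P.Fubini') measurable
  with 1 2 show ?thesis by simp
qed

lemma sigma_finite_measure_ball_finite:
  fixes M :: "'a::euclidean_space measure"
  assumes sM: "sets M = sets borel" and fin: "\<And>k::nat. emeasure M (ball 0 (real k)) < \<infinity>"
  shows "sigma_finite_measure M"
proof
  show "\<exists>A. countable A \<and> A \<subseteq> sets M \<and> \<Union>A = space M \<and> (\<forall>a\<in>A. emeasure M a \<noteq> \<infinity>)"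
  proof (intro exI[of _ "range (\<lambda>k::nat. ball (0::'a) (real k))"] conjI)
    have "\<exists>k::nat. norm x < real k" for x :: 'a by (rule reals_Archimedean2)
    then show "\<Union> (range (\<lambda>k::nat. ball (0::'a) (real k))) = space M"
      using sM by (auto dest: sets_eq_imp_space_eq)
  qed (use fin sM in \<open>auto simp: less_top\<close>)
qed

lemma emeasure_lborel_ball_pos: "0 < r \<Longrightarrow> 0 < emeasure lborel (ball (a::'a::euclidean_space) r)"
proof -
  assume "0 < r"
  then have "\<not> negligible (ball a r)" using open_not_negligible[of "ball a r"] by auto
  then show ?thesis
    by (auto simp: negligible_iff_null_sets null_sets_def zero_less_iff_neq_zero)
qed

text \<open>The ball serves as a reference set, so that no determinant occurs.\<close>

lemma lborel_linear_vimage: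
  fixes T :: "'a::euclidean_space \<Rightarrow> 'a"
  assumes T: "linear T" and T': "linear T'" and inv: "\<And>x. T (T' x) = x" "\<And>x. T' (T x) = x"
    and B: "B \<in> sets borel"
  shows "emeasure lborel (T -` B) * emeasure lborel (ball (0::'a) 1)
       = emeasure lborel (T -` ball 0 1) * emeasure lborel B"
proof -
  have mT [measurable]: "T \<in> borel \<rightarrow>\<^sub>M borel"
    by (intro borel_measurable_continuous_onI linear_continuous_on linear_conv_bounded_linear[THEN iffD1] T)
  define M where "M = distr lborel borel T"
  have [simp]: "sets M = sets borel" by (simp add: M_def)
  have eM: "emeasure M A = emeasure lborel (T -` A)" if "A \<in> sets borel" for A
    using that by (simp add: M_def emeasure_distr)
  have "emeasure lborel ((\<lambda>y. 2 *\<^sub>R 0 - y) -` ball (0::'a) 1) * emeasure M B = emeasure M (ball 0 1) * emeasure lborel B"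
  proof (rule translation_invariant_unique[where E=UNIV])
    show "sigma_finite_measure M"
    proof (rule sigma_finite_measure_ball_finite)
      fix k :: nat
      have "T -` ball 0 (real k) = T' ` ball 0 (real k)"
        using inv by (intro set_eqI) (metis imageE imageI vimageE vimageI)
      moreover have "bounded (T' ` ball 0 (real k))"
        by (intro bounded_linear_image bounded_ball linear_conv_bounded_linear[THEN iffD1] T')
      ultimately show "emeasure M (ball 0 (real k)) < \<infinity>"
        using emeasure_bounded_finite[of "T' ` ball 0 (real k)"] by (simp add: eM)
    qed simp
    show "distr M borel ((+) e) = M" for e
    proof -
      have "distr M borel ((+) e) = distr lborel borel (\<lambda>x. e + T x)"
        by (simp add: M_def distr_distr comp_def)
      also have "(\<lambda>x. e + T x) = (\<lambda>x. T (T' e + x))"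
        by (simp add: linear_add[OF T] inv)
      also have "distr lborel borel (\<lambda>x. T (T' e + x)) = distr (distr lborel borel ((+) (T' e))) borel T"
        by (simp add: distr_distr comp_def)
      finally show ?thesis by (simp add: lborel_distr_plus M_def)
    qed
  qed (use B sigma_finite_lborel in \<open>auto simp: lborel_distr_plus\<close>)
  moreover have "(\<lambda>y. 2 *\<^sub>R 0 - y) -` ball (0::'a) 1 = ball 0 1" by auto
  ultimately show ?thesis using B by (simp add: eM mult.commute)
qed

text \<open>The unit ball is its own preimage, and its positive finite volume cancels.\<close>

lemma emeasure_lborel_orthogonal_vimage:
  fixes T :: "'a::euclidean_space \<Rightarrow> 'a"
  assumes T: "orthogonal_transformation T" and B: "B \<in> sets borel"
  shows "emeasure lborel (T -` B) = emeasure lborel B"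
proof -
  have bij: "bij T" by (rule orthogonal_transformation_bij[OF T])
  have "emeasure lborel (T -` B) * emeasure lborel (ball (0::'a) 1)
       = emeasure lborel (T -` ball 0 1) * emeasure lborel B"
    by (rule lborel_linear_vimage[where T'="inv T"])
       (use T B bij orthogonal_transformation_inv[OF T] in \<open>auto simp: orthogonal_transformation_linear bij_is_surj surj_f_inv_f bij_is_inj\<close>)
  also have "T -` ball 0 1 = ball 0 1"
    by (auto simp: orthogonal_transformation_norm[OF T])
  finally show ?thesis
    using emeasure_lborel_ball_pos[of 1 "0::'a"] emeasure_lborel_ball_finite[of "0::'a" 1]
    by (auto simp: mult.commute[of _ "emeasure lborel (ball (0::'a) 1)"] ennreal_mult_cancel_left)
qed

lemma distr_lborel_orthogonal:
  fixes T :: "'a::euclidean_space \<Rightarrow> 'a"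
  assumes T: "orthogonal_transformation T"
  shows "distr lborel borel T = lborel"
proof (rule measure_eqI)
  have mT: "T \<in> borel \<rightarrow>\<^sub>M borel"
    using orthogonal_transformation_linear[OF T]
    by (intro borel_measurable_continuous_onI linear_continuous_on) (simp add: linear_conv_bounded_linear)
  fix A assume "A \<in> sets (distr lborel borel T)"
  then show "emeasure (distr lborel borel T) A = emeasure lborel A"
    using emeasure_lborel_orthogonal_vimage[OF T, of A] mT by (simp add: emeasure_distr)
qed simp

text \<open>For \<open>d = 0\<close> the quotient is \<open>0 / 0 = 0\<close> and the map is the
  identity, so the statement holds for every \<open>d\<close>.\<close>

lemma orthogonal_transformation_reflection:
  fixes d :: "'a::euclidean_space"
  shows "orthogonal_transformation (\<lambda>x. x - (2 * (x \<bullet> d) / (d \<bullet> d)) *\<^sub>R d)"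
  unfolding orthogonal_transformation_def
proof (intro conjI allI)
  show "linear (\<lambda>x. x - (2 * (x \<bullet> d) / (d \<bullet> d)) *\<^sub>R d)"
    by (rule linearI) (auto simp: inner_simps algebra_simps add_divide_distrib)
  fix v w
  show "(v - (2 * (v \<bullet> d) / (d \<bullet> d)) *\<^sub>R d) \<bullet> (w - (2 * (w \<bullet> d) / (d \<bullet> d)) *\<^sub>R d) = v \<bullet> w"
    by (cases "d = 0") (auto simp: inner_simps field_simps inner_commute)
qed

text \<open>Vectors of equal length are exchanged by the reflection along their difference.\<close>

lemma orthogonal_transformation_exists_euclidean:
  fixes a b :: "'a::euclidean_space"
  assumes "norm a = norm b"
  obtains T where "orthogonal_transformation T" "T a = b"
proof (cases "a = b")
  case True
  then show ?thesis using that[of "\<lambda>x. x"] by simp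
next
  case False
  define d where "d = a - b"
  have "a \<bullet> a = b \<bullet> b" using assms by (simp add: norm_eq_sqrt_inner)
  then have "2 * (a \<bullet> d) = d \<bullet> d" by (simp add: d_def inner_simps inner_commute)
  then have "a - (2 * (a \<bullet> d) / (d \<bullet> d)) *\<^sub>R d = b" using False by (simp add: d_def)
  then show ?thesis using that[OF orthogonal_transformation_reflection[of d]] by simp
qed

text \<open>The shears along \<open>w\<close> and \<open>-w\<close> are mutually inverse and conjugate by a reflection,
  so their volume factor is \<open>1\<close>.\<close>

lemma emeasure_lborel_shear_vimage:
  fixes u w :: "'a::euclidean_space"
  assumes uw: "u \<bullet> w = 0" and B: "B \<in> sets borel"
  shows "emeasure lborel ((\<lambda>x. x + (x \<bullet> u) *\<^sub>R w) -` B) = emeasure lborel B"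
proof -
  define T where "T s x = x + (x \<bullet> u) *\<^sub>R (s *\<^sub>R w)" for s :: real and x
  define R where "R x = x - (2 * (x \<bullet> w) / (w \<bullet> w)) *\<^sub>R w" for x
  let ?b = "ball (0::'a) 1"
  have Rorth: "orthogonal_transformation R" unfolding R_def by (rule orthogonal_transformation_reflection)
  have lin: "linear (T s)" for s
    unfolding T_def by (rule linearI) (auto simp: inner_simps algebra_simps)
  have TT: "T s (T (-s) x) = x" for s x
    using uw by (simp add: T_def inner_simps inner_commute)
  have TR: "T (-1) x = R (T 1 (R x))" for x
  proof (cases "w = 0")
    case False
    have Rw: "R (a + b *\<^sub>R w) = R a - b *\<^sub>R w" for a b
      using False by (simp add: R_def inner_simps algebra_simps add_divide_distrib scaleR_2[symmetric])
    have "R (R x) = x" using False by (simp add: R_def inner_simps algebra_simps)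
    moreover have "R x \<bullet> u = x \<bullet> u" using uw by (simp add: R_def inner_simps inner_commute)
    ultimately show ?thesis by (simp add: T_def Rw)
  qed (simp add: T_def R_def)
  have mT [measurable]: "T s \<in> borel \<rightarrow>\<^sub>M borel" for s
    unfolding T_def by measurable
  have mR [measurable]: "R \<in> borel \<rightarrow>\<^sub>M borel" unfolding R_def by measurable
  have vT: "T s -` A \<in> sets borel" "R -` A \<in> sets borel" if "A \<in> sets borel" for s A
    using measurable_sets[OF mT that] measurable_sets[OF mR that] by auto
  define c where "c = emeasure lborel (T 1 -` ?b)"
  have cT: "emeasure lborel (T 1 -` A) * emeasure lborel ?b = c * emeasure lborel A" if "A \<in> sets borel" for A
    unfolding c_def by (rule lborel_linear_vimage[where T'="T (-1)"]) (use lin TT[of 1] TT[of "-1"] that in auto)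
  have conj: "emeasure lborel (T (-1) -` A) = emeasure lborel (T 1 -` (R -` A))" if "A \<in> sets borel" for A
  proof -
    have "T (-1) -` A = R -` (T 1 -` (R -` A))" by (auto simp: TR)
    then show ?thesis using emeasure_lborel_orthogonal_vimage[OF Rorth, of "T 1 -` (R -` A)"] that vT by simp
  qed
  have b: "emeasure lborel ?b \<noteq> 0" "emeasure lborel ?b \<noteq> top"
    using emeasure_lborel_ball_pos[of 1 "0::'a"] emeasure_lborel_ball_finite[of "0::'a" 1] by (auto simp: less_top)
  have cT': "emeasure lborel (T (-1) -` A) * emeasure lborel ?b = c * emeasure lborel A" if "A \<in> sets borel" for A
    using cT[of "R -` A"] emeasure_lborel_orthogonal_vimage[OF Rorth that] vT that by (simp add: conj)
  \<comment> \<open>Undoing the shear of the ball by the opposite shear, which has the same factor,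
    shows that \<open>c\<close> and the volume of the ball have the same square.\<close>
  have "T (-1) -` (T 1 -` ?b) = ?b"
    using TT[of 1] by (auto simp: vimage_def)
  then have sq: "emeasure lborel ?b * emeasure lborel ?b = c * c"
    using cT'[of "T 1 -` ?b"] vT by (simp add: c_def)
  moreover obtain m where m: "emeasure lborel ?b = ennreal m" "m \<ge> 0"
    using b(2) by (cases "emeasure lborel ?b") auto
  ultimately have "c \<noteq> top" by (auto simp: ennreal_mult[symmetric])
  then obtain r where "c = ennreal r" "r \<ge> 0" by (cases c) auto
  with sq m have "r * r = m * m" by (simp add: ennreal_mult[symmetric])
  then have "r = m" using \<open>r \<ge> 0\<close> \<open>m \<ge> 0\<close> by (metis abs_of_nonneg real_sqrt_mult_self real_sqrt_abs2)
  then have "c = emeasure lborel ?b" using \<open>c = ennreal r\<close> m by simp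
  then have "emeasure lborel (T 1 -` B) = emeasure lborel B"
    using cT[OF B] b by (simp add: mult.commute[of _ "emeasure lborel (ball (0::'a) 1)"] ennreal_mult_cancel_left)
  then show ?thesis by (simp add: T_def[abs_def])
qed

lemma emeasure_lborel_scaleR:
  fixes A :: "'a::euclidean_space set"
  assumes s: "s > 0" and A: "A \<in> sets borel"
  shows "emeasure lborel ((\<lambda>x. s *\<^sub>R x) ` A) = ennreal (s ^ DIM('a)) * emeasure lborel A"
    and "(\<lambda>x. s *\<^sub>R x) ` A \<in> sets borel"
proof -
  have im: "(\<lambda>x. s *\<^sub>R x) ` A = (\<lambda>x. (1/s) *\<^sub>R x) -` A \<inter> space borel"
  proof (intro set_eqI iffI)
    fix x assume "x \<in> (\<lambda>x. (1/s) *\<^sub>R x) -` A \<inter> space borel"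
    then show "x \<in> (\<lambda>x. s *\<^sub>R x) ` A" using s by (intro image_eqI[of _ _ "(1/s) *\<^sub>R x"]) auto
  qed (use s in auto)
  show [measurable]: "(\<lambda>x. s *\<^sub>R x) ` A \<in> sets borel"
    unfolding im by (rule measurable_sets[OF _ A]) measurable
  have [measurable]: "A \<in> sets borel" by fact
  have "emeasure lborel ((\<lambda>x. s *\<^sub>R x) ` A)
     = emeasure (density (distr lborel borel (\<lambda>x. 0 + s *\<^sub>R x)) (\<lambda>_. \<bar>s\<bar>^DIM('a))) ((\<lambda>x. s *\<^sub>R x) ` A)"
    using lborel_affine[of s "0::'a"] s by simp
  also have "\<dots> = ennreal (s ^ DIM('a)) * emeasure lborel ((\<lambda>x. s *\<^sub>R x) -` (\<lambda>x. s *\<^sub>R x) ` A)"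
    using s by (subst emeasure_density_const) (auto simp: emeasure_distr)
  also have "(\<lambda>x. s *\<^sub>R x) -` (\<lambda>x. s *\<^sub>R x) ` A = A" using s by auto
  finally show "emeasure lborel ((\<lambda>x. s *\<^sub>R x) ` A) = ennreal (s ^ DIM('a)) * emeasure lborel A" .
qed

section \<open>Hausdorff measure on hyperplanes\<close>

text \<open>The volume of the cone with apex 0 over a subset of the plane
  \<open>x \<bullet> u = 1\<close>. It plays the role of Lebesgue measure on that plane, up to a
  constant and without a choice of coordinates.\<close>

definition cone_measure :: "'a::euclidean_space \<Rightarrow> 'a measure" where
  "cone_measure u = distr (density lborel (indicator {x. 0 < x \<bullet> u \<and> x \<bullet> u \<le> 1})) borel (\<lambda>x. x /\<^sub>R (x \<bullet> u))"

lemma sets_cone_measure [simp, measurable_cong]: "sets (cone_measure u) = sets borel"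
  by (simp add: cone_measure_def)

lemma space_cone_measure [simp]: "space (cone_measure u) = UNIV"
  by (simp add: cone_measure_def)

lemma cone_set_borel [measurable]:
  fixes u :: "'a::euclidean_space"
  assumes [measurable]: "B \<in> sets borel"
  shows "{x. 0 < x \<bullet> u \<and> x \<bullet> u \<le> 1 \<and> x /\<^sub>R (x \<bullet> u) \<in> B} \<in> sets borel"
  by measurable

lemma emeasure_cone_measure:
  fixes u :: "'a::euclidean_space"
  assumes [measurable]: "B \<in> sets borel"
  shows "emeasure (cone_measure u) B = emeasure lborel {x. 0 < x \<bullet> u \<and> x \<bullet> u \<le> 1 \<and> x /\<^sub>R (x \<bullet> u) \<in> B}"
proof -
  have v: "(\<lambda>x. x /\<^sub>R (x \<bullet> u)) -` B \<in> sets borel"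
    using measurable_sets[of "\<lambda>x. x /\<^sub>R (x \<bullet> u)" borel borel B] by simp
  have "emeasure (cone_measure u) B = emeasure (density lborel (indicator {x. 0 < x \<bullet> u \<and> x \<bullet> u \<le> 1})) ((\<lambda>x. x /\<^sub>R (x \<bullet> u)) -` B)"
    by (simp add: cone_measure_def emeasure_distr)
  also have "\<dots> = emeasure lborel ({x. 0 < x \<bullet> u \<and> x \<bullet> u \<le> 1} \<inter> ((\<lambda>x. x /\<^sub>R (x \<bullet> u)) -` B))"
    using v by (subst emeasure_density) (auto simp: indicator_inter_arith[symmetric] intro!: nn_integral_indicator)
  finally show ?thesis by (simp add: Int_def conj_assoc)
qed

lemma cone_measure_plane: "AE x in cone_measure u. x \<bullet> u = 1"
proof -
  have b: "- {x. x \<bullet> u = 1} \<in> sets borel"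
    by (intro borel_comp borel_closed closed_Collect_eq continuous_intros)
  have "{x. 0 < x \<bullet> u \<and> x \<bullet> u \<le> 1 \<and> x /\<^sub>R (x \<bullet> u) \<in> - {x. x \<bullet> u = 1}} = {}" by auto
  with emeasure_cone_measure[OF b, of u] have "emeasure (cone_measure u) (- {x. x \<bullet> u = 1}) = 0"
    by (simp only: emeasure_empty)
  with b have "- {x. x \<bullet> u = 1} \<in> null_sets (cone_measure u)"
    unfolding null_sets_def by simp
  then show ?thesis by (intro AE_I'[of "- {x. x \<bullet> u = 1}"]) auto
qed

lemma cone_measure_bounded_finite:
  assumes "B \<subseteq> ball 0 k" "B \<in> sets borel"
  shows "emeasure (cone_measure u) B < \<infinity>"
proof -
  have "{x. 0 < x \<bullet> u \<and> x \<bullet> u \<le> 1 \<and> x /\<^sub>R (x \<bullet> u) \<in> B} \<subseteq> ball 0 k"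
  proof
    fix x assume "x \<in> {x. 0 < x \<bullet> u \<and> x \<bullet> u \<le> 1 \<and> x /\<^sub>R (x \<bullet> u) \<in> B}"
    then have x: "0 < x \<bullet> u" "x \<bullet> u \<le> 1" "norm (x /\<^sub>R (x \<bullet> u)) < k" using assms by auto
    have "norm x = (x \<bullet> u) * norm (x /\<^sub>R (x \<bullet> u))" using x by simp
    also have "\<dots> \<le> 1 * norm (x /\<^sub>R (x \<bullet> u))" using x by (intro mult_right_mono) auto
    finally show "x \<in> ball 0 k" using x by simp
  qed
  then have "bounded {x. 0 < x \<bullet> u \<and> x \<bullet> u \<le> 1 \<and> x /\<^sub>R (x \<bullet> u) \<in> B}"
    by (rule bounded_subset[OF bounded_ball])
  from emeasure_bounded_finite[OF this] show ?thesis
    unfolding emeasure_cone_measure[OF assms(2)] .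
qed

lemma sigma_finite_cone_measure: "sigma_finite_measure (cone_measure u)"
  by (rule sigma_finite_measure_ball_finite[OF _ cone_measure_bounded_finite[OF order_refl]]) auto

text \<open>Translating the base of a cone by \<open>e\<close> within its plane shears the cone
  along \<open>e\<close>, and shears preserve volume.\<close>

lemma cone_measure_translate:
  fixes u :: "'a::euclidean_space"
  assumes e: "e \<bullet> u = 0"
  shows "distr (cone_measure u) borel ((+) e) = cone_measure u"
proof (rule measure_eqI)
  fix B assume "B \<in> sets (distr (cone_measure u) borel ((+) e))"
  then have B [measurable]: "B \<in> sets borel" by simp
  have v: "(+) e -` B \<in> sets borel"
    using measurable_sets[of "(+) e" borel borel B] by simp
  let ?C = "\<lambda>B. {x. 0 < x \<bullet> u \<and> x \<bullet> u \<le> 1 \<and> x /\<^sub>R (x \<bullet> u) \<in> B}"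
  have "emeasure (distr (cone_measure u) borel ((+) e)) B = emeasure lborel (?C ((+) e -` B))"
    using v by (simp add: emeasure_distr emeasure_cone_measure)
  also have "?C ((+) e -` B) = (\<lambda>x. x + (x \<bullet> u) *\<^sub>R e) -` ?C B"
    using e by (auto simp: inner_simps algebra_simps)
  also have "emeasure lborel \<dots> = emeasure lborel (?C B)"
    by (rule emeasure_lborel_shear_vimage) (use e in \<open>auto simp: inner_commute\<close>)
  finally show "emeasure (distr (cone_measure u) borel ((+) e)) B = emeasure (cone_measure u) B"
    by (simp add: emeasure_cone_measure)
qed simp

definition hausdorff_plane :: "'a::euclidean_space \<Rightarrow> 'a measure" where
  "hausdorff_plane u = density (hausdorff_borel (DIM('a) - 1)) (indicator {x. x \<bullet> u = 1})"

lemma sets_hausdorff_plane [simp, measurable_cong]: "sets (hausdorff_plane u) = sets borel"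
  by (simp add: hausdorff_plane_def)

lemma space_hausdorff_plane [simp]: "space (hausdorff_plane u) = UNIV"
  by (simp add: hausdorff_plane_def)

lemma emeasure_hausdorff_plane:
  fixes u :: "'a::euclidean_space"
  assumes [measurable]: "B \<in> sets borel"
  shows "emeasure (hausdorff_plane u) B = hausdorff_measure (DIM('a) - 1) (B \<inter> {x. x \<bullet> u = 1})"
proof -
  have "{x. x \<bullet> u = 1} \<in> sets borel" by measurable
  then have "emeasure (hausdorff_plane u) B = emeasure (hausdorff_borel (DIM('a) - 1)) ({x. x \<bullet> u = 1} \<inter> B)"
    unfolding hausdorff_plane_def
    by (subst emeasure_density) (auto simp: indicator_inter_arith[symmetric] intro!: nn_integral_indicator)
  with assms \<open>{x. x \<bullet> u = 1} \<in> sets borel\<close> show ?thesis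
    by (simp add: emeasure_hausdorff_borel Int_commute)
qed

lemma hausdorff_plane_plane: "AE x in hausdorff_plane u. x \<bullet> u = 1"
  unfolding hausdorff_plane_def by (subst AE_density) (auto simp: indicator_def)

lemma hausdorff_plane_translate:
  fixes u :: "'a::euclidean_space"
  assumes e: "e \<bullet> u = 0"
  shows "distr (hausdorff_plane u) borel ((+) e) = hausdorff_plane u"
proof (rule measure_eqI)
  fix B assume "B \<in> sets (distr (hausdorff_plane u) borel ((+) e))"
  then have B [measurable]: "B \<in> sets borel" by simp
  have v: "(+) e -` B \<in> sets borel"
    using measurable_sets[of "(+) e" borel borel B] by simp
  have "emeasure (distr (hausdorff_plane u) borel ((+) e)) B
      = hausdorff_measure (DIM('a) - 1) (((+) e -` B) \<inter> {x. x \<bullet> u = 1})"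
    using v by (simp add: emeasure_distr emeasure_hausdorff_plane)
  also have "\<dots> = hausdorff_measure (DIM('a) - 1) ((+) e ` (((+) e -` B) \<inter> {x. x \<bullet> u = 1}))"
    by (rule hausdorff_measure_isometry[symmetric]) simp
  also have "(+) e ` (((+) e -` B) \<inter> {x. x \<bullet> u = 1}) = B \<inter> {x. x \<bullet> u = 1}"
  proof (intro set_eqI iffI)
    fix x assume "x \<in> B \<inter> {x. x \<bullet> u = 1}"
    then show "x \<in> (+) e ` (((+) e -` B) \<inter> {x. x \<bullet> u = 1})"
      using e by (intro image_eqI[of _ _ "x - e"]) (auto simp: inner_simps)
  qed (use e in \<open>auto simp: inner_simps\<close>)
  finally show "emeasure (distr (hausdorff_plane u) borel ((+) e)) B = emeasure (hausdorff_plane u) B"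
    by (simp add: emeasure_hausdorff_plane)
qed simp

text \<open>A grid of m^(n-1) cells, each of half-diameter at most n k / m, covers the set. The
  resulting bound for the sum of the gauges is the same for every m, hence independent of
  \<open>\<delta>\<close>.\<close>

lemma hausdorff_measure_coordinate_plane_finite:
  fixes e :: "'a::euclidean_space"
  assumes e: "e \<in> Basis" and k: "k > 0"
  shows "hausdorff_measure (DIM('a) - 1) {x. x \<bullet> e = 1 \<and> (\<forall>b\<in>Basis. \<bar>x \<bullet> b\<bar> \<le> k)} < \<infinity>" (is "hausdorff_measure ?d ?A < _")
proof -
  define n where "n = DIM('a)"
  define K where "K = unit_ball_vol (real ?d) * (real n * k) ^ ?d"
  have K0: "K \<ge> 0" using k by (simp add: K_def)
  have "hausdorff_premeasure ?d \<delta> ?A \<le> ennreal K" if \<delta>: "\<delta> > 0" for \<delta>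
  proof -
    obtain m0 :: nat where m0: "real n * 2 * k / \<delta> < real m0" using reals_Archimedean2 by blast
    define m where "m = Suc m0"
    have m: "m > 0" "real n * (2 * k / real m) \<le> \<delta>"
      using m0 \<delta> by (auto simp: m_def field_simps)
    define B' where "B' = (Basis :: 'a set) - {e}"
    have fB: "finite B'" "card B' = ?d" using e by (auto simp: B'_def)
    define F where "F = (B' \<rightarrow>\<^sub>E {..<m})"
    have F: "finite F" "card F = m ^ ?d" using fB by (auto simp: F_def card_PiE intro!: finite_PiE)
    define C where "C \<phi> = {x::'a. x \<bullet> e = 1 \<and> (\<forall>b\<in>B'. - k + 2 * k * real (\<phi> b) / real m \<le> x \<bullet> b
        \<and> x \<bullet> b \<le> - k + 2 * k * (real (\<phi> b) + 1) / real m)}" for \<phi>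
    have dC: "norm (x - y) \<le> real n * (2 * k / real m)" if "x \<in> C \<phi>" "y \<in> C \<phi>" for x y \<phi>
    proof -
      have "norm (x - y) \<le> (\<Sum>b\<in>Basis. \<bar>(x - y) \<bullet> b\<bar>)" by (rule norm_le_l1)
      also have "\<dots> \<le> (\<Sum>b\<in>(Basis::'a set). 2 * k / real m)"
      proof (rule sum_mono)
        fix b :: 'a assume b: "b \<in> Basis"
        show "\<bar>(x - y) \<bullet> b\<bar> \<le> 2 * k / real m"
        proof (cases "b = e")
          case True
          then show ?thesis using that k by (simp add: C_def inner_diff_left)
        next
          case False
          then have "b \<in> B'" using b by (simp add: B'_def)
          then have "- k + 2 * k * real (\<phi> b) / real m \<le> z \<bullet> b" "z \<bullet> b \<le> - k + 2 * k * (real (\<phi> b) + 1) / real m" if "z \<in> {x,y}" for z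
            using that \<open>x \<in> C \<phi>\<close> \<open>y \<in> C \<phi>\<close> by (auto simp: C_def)
          from this[of x] this[of y] show ?thesis
            by (simp add: inner_diff_left distrib_left add_divide_distrib)
        qed
      qed
      finally show ?thesis by (simp add: n_def)
    qed
    have bC: "bounded (C \<phi>)" for \<phi>
    proof (cases "C \<phi> = {}")
      case False
      then obtain y where "y \<in> C \<phi>" by auto
      then show ?thesis using dC unfolding bounded_def dist_norm by blast
    qed auto
    have diC: "diameter (C \<phi>) \<le> real n * (2 * k / real m)" for \<phi>
      by (rule diameter_le) (use dC k m in auto)
    obtain h where h: "bij_betw h {..<card F} F" using F(1) ex_bij_betw_nat_finite atLeast0LessThan by metis
    define D where "D i = (if i < card F then C (h i) else {})" for i :: nat
    have cover: "?A \<subseteq> (\<Union>i. D i)"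
    proof
      fix x assume x: "x \<in> ?A"
      \<comment> \<open>The index of the cell of x in direction \<open>b\<close>. The right end
        point \<open>x \<bullet> b = k\<close> would obtain the index \<open>m\<close> from the
        floor and is put into the last cell instead.\<close>
      define \<phi> where "\<phi> = (\<lambda>b\<in>B'. nat (if x \<bullet> b = k then int m - 1 else \<lfloor>(x \<bullet> b + k) * real m / (2 * k)\<rfloor>))"
      have *: "\<phi> b < m \<and> - k + 2 * k * real (\<phi> b) / real m \<le> x \<bullet> b \<and> x \<bullet> b \<le> - k + 2 * k * (real (\<phi> b) + 1) / real m"
        if b: "b \<in> B'" for b
      proof (cases "x \<bullet> b = k")
        case True
        then have "\<phi> b = m - 1" using b m by (simp add: \<phi>_def nat_diff_distrib)
        then show ?thesis using True m k by (simp add: field_simps of_nat_diff)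
      next
        case False
        define t where "t = (x \<bullet> b + k) * real m / (2 * k)"
        have xk: "0 \<le> x \<bullet> b + k" "x \<bullet> b + k < 2 * k" using x b False by (auto simp: B'_def abs_le_iff)
        have t: "0 \<le> t" using xk k by (simp add: t_def)
        have "(x \<bullet> b + k) * real m < 2 * k * real m" using xk m by (intro mult_strict_right_mono) auto
        then have tm: "t < real m" using k by (simp add: t_def pos_divide_less_eq mult.commute)
        have ph: "\<phi> b = nat \<lfloor>t\<rfloor>" using False b by (simp add: \<phi>_def t_def)
        have "real (\<phi> b) \<le> t" "t < real (\<phi> b) + 1" using t by (auto simp: ph)
        moreover have "x \<bullet> b = - k + 2 * k * t / real m" using k m by (simp add: t_def)
        moreover have "\<phi> b < m" using ph t tm by (simp add: nat_less_iff floor_less_iff)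
        ultimately show ?thesis using k m by (simp add: divide_right_mono mult_left_mono)
      qed
      then have "\<phi> \<in> F" by (auto simp: F_def \<phi>_def)
      then obtain i where "i < card F" "h i = \<phi>"
        using bij_betw_imp_surj_on[OF h] by (metis imageE lessThan_iff)
      moreover have "x \<in> C \<phi>" using * x by (auto simp: C_def)
      ultimately show "x \<in> (\<Union>i. D i)" by (auto simp: D_def intro!: exI[of _ i])
    qed
    have "hausdorff_premeasure ?d \<delta> ?A \<le> (\<Sum>i. hausdorff_gauge ?d (D i))"
    proof (rule hausdorff_premeasure_le[OF cover])
      show "bounded (D i)" for i by (simp add: D_def bC)
      show "diameter (D i) \<le> \<delta>" for i using diC[of "h i"] m(2) \<delta> by (auto simp: D_def intro: order_trans)
    qed
    also have "\<dots> = (\<Sum>i<card F. hausdorff_gauge ?d (D i))"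
      by (rule suminf_finite) (auto simp: D_def)
    also have "\<dots> \<le> (\<Sum>i<card F. ennreal (unit_ball_vol (real ?d) * (real n * k / real m) ^ ?d))"
    proof (rule sum_mono)
      fix i
      have "diameter (D i) / 2 \<le> real n * (2 * k / real m) / 2"
        using diC[of "h i"] k by (auto simp: D_def mult_ac)
      then have "(diameter (D i) / 2) ^ ?d \<le> (real n * k / real m) ^ ?d"
        using diameter_ge_0[of "D i"] bC by (intro power_mono) (auto simp: D_def)
      then show "hausdorff_gauge ?d (D i) \<le> ennreal (unit_ball_vol (real ?d) * (real n * k / real m) ^ ?d)"
        by (auto simp: hausdorff_gauge_def intro!: ennreal_leI mult_left_mono)
    qed
    also have "\<dots> = ennreal K"
      using k m by (simp add: F K_def ennreal_of_nat_eq_real_of_nat ennreal_mult[symmetric] power_divide)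
    finally show ?thesis .
  qed
  then have "hausdorff_measure ?d ?A \<le> ennreal K" by (rule hausdorff_measure_leI)
  then show ?thesis by (simp add: le_less_trans)
qed

lemma sigma_finite_hausdorff_plane:
  assumes "e \<in> Basis" shows "sigma_finite_measure (hausdorff_plane e)"
proof (rule sigma_finite_measure_ball_finite)
  fix k :: nat
  have "hausdorff_measure (DIM('a) - 1) (ball 0 (real k) \<inter> {x. x \<bullet> e = 1})
      \<le> hausdorff_measure (DIM('a) - 1) {x::'a. x \<bullet> e = 1 \<and> (\<forall>b\<in>Basis. \<bar>x \<bullet> b\<bar> \<le> real k + 1)}"
  proof (rule hausdorff_measure_mono, safe)
    fix x b :: 'a assume "x \<in> ball 0 (real k)" "b \<in> Basis"
    then show "\<bar>x \<bullet> b\<bar> \<le> real k + 1" using Basis_le_norm[of b x] by simp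
  qed
  also have "\<dots> < \<infinity>" by (rule hausdorff_measure_coordinate_plane_finite[OF assms]) simp
  finally show "emeasure (hausdorff_plane e) (ball 0 (real k)) < \<infinity>"
    by (simp add: emeasure_hausdorff_plane)
qed simp

text \<open>A translation within the plane moves the centre to \<open>e\<close>, and the cone over
  the ball about \<open>e\<close> lies in a box with one side of length 1 and all others of length
  \<open>2 * d\<close>.\<close>

lemma cone_measure_cball_le:
  fixes e a :: "'a::euclidean_space"
  assumes e: "e \<in> Basis" and a: "a \<bullet> e = 1" and d: "d \<ge> 0"
  shows "emeasure (cone_measure e) (cball a d) \<le> ennreal ((2 * d) ^ (DIM('a) - 1))"
proof -
  define v where "v = e - a"
  have ee: "e \<bullet> e = 1" using e by simp
  have v: "v \<bullet> e = 0" using a ee by (simp add: v_def inner_diff_left)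
  have "(+) v -` cball e d = cball a d" by (auto simp: v_def dist_norm algebra_simps)
  then have "emeasure (cone_measure e) (cball a d) = emeasure (cone_measure e) (cball e d)"
    by (subst (2) cone_measure_translate[OF v, symmetric]) (simp add: emeasure_distr)
  also have "\<dots> = emeasure lborel {x. 0 < x \<bullet> e \<and> x \<bullet> e \<le> 1 \<and> x /\<^sub>R (x \<bullet> e) \<in> cball e d}"
    by (rule emeasure_cone_measure) simp
  also have "\<dots> \<le> emeasure lborel (cbox (\<Sum>b\<in>Basis. (if b = e then 0 else - d) *\<^sub>R b) (\<Sum>b\<in>Basis. (if b = e then 1 else d) *\<^sub>R b))"
  proof (rule emeasure_mono)
    show "{x. 0 < x \<bullet> e \<and> x \<bullet> e \<le> 1 \<and> x /\<^sub>R (x \<bullet> e) \<in> cball e d}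
       \<subseteq> cbox (\<Sum>b\<in>Basis. (if b = e then 0 else - d) *\<^sub>R b) (\<Sum>b\<in>Basis. (if b = e then 1 else d) *\<^sub>R b)"
    proof
      fix x assume "x \<in> {x. 0 < x \<bullet> e \<and> x \<bullet> e \<le> 1 \<and> x /\<^sub>R (x \<bullet> e) \<in> cball e d}"
      then have x: "0 < x \<bullet> e" "x \<bullet> e \<le> 1" "norm (e - x /\<^sub>R (x \<bullet> e)) \<le> d" by (auto simp: dist_norm)
      have "\<bar>x \<bullet> b\<bar> \<le> d" if b: "b \<in> Basis" "b \<noteq> e" for b
      proof -
        have "\<bar>(e - x /\<^sub>R (x \<bullet> e)) \<bullet> b\<bar> \<le> d" using Basis_le_norm[OF b(1), of "e - x /\<^sub>R (x \<bullet> e)"] x by linarith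
        moreover have "e \<bullet> b = 0" using b e by (simp add: inner_not_same_Basis)
        ultimately have "\<bar>x \<bullet> b\<bar> / (x \<bullet> e) \<le> d" using x by (simp add: inner_diff_left abs_mult divide_inverse mult.commute)
        then have "\<bar>x \<bullet> b\<bar> \<le> d * (x \<bullet> e)" using x by (simp add: field_simps)
        also have "\<dots> \<le> d * 1" using x d by (intro mult_left_mono) auto
        finally show ?thesis by simp
      qed
      then show "x \<in> cbox (\<Sum>b\<in>Basis. (if b = e then 0 else - d) *\<^sub>R b) (\<Sum>b\<in>Basis. (if b = e then 1 else d) *\<^sub>R b)"
        using x by (simp add: mem_box abs_le_iff minus_le_iff)
    qed
  qed simp
  also have "\<dots> = (\<Prod>b\<in>Basis. if b = e then 1 else 2 * d)"
  proof -
    have "(\<Prod>b\<in>Basis. ((\<Sum>b\<in>Basis. (if b = e then 1 else d) *\<^sub>R b) - (\<Sum>b\<in>Basis. (if b = e then 0 else - d) *\<^sub>R b)) \<bullet> b)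
       = (\<Prod>b\<in>Basis. if b = e then 1 else 2 * d)"
      by (rule prod.cong) (auto simp: inner_diff_left)
    then show ?thesis using d by (subst emeasure_lborel_cbox) auto
  qed
  also have "(\<Prod>b\<in>Basis. if b = e then 1 else 2 * d) = (2 * d) ^ (DIM('a) - 1)"
    using e by (subst prod.remove[of _ e]) (auto simp: card_Diff_singleton)
  finally show ?thesis .
qed

text \<open>A mass distribution argument; its purpose is to show that Hausdorff measure does not
  vanish on the plane. Each covering set is replaced by a ball about one of its points with the
  diameter as radius, and the power of 4 compares \<open>2 * diameter\<close> with
  \<open>diameter / 2\<close>.\<close>

lemma hausdorff_plane_ge_cone_measure:
  fixes e :: "'a::euclidean_space"
  assumes e: "e \<in> Basis" and A: "A \<in> sets borel"
  shows "emeasure (cone_measure e) A \<le> ennreal (4 ^ (DIM('a) - 1) / unit_ball_vol (real (DIM('a) - 1))) * emeasure (hausdorff_plane e) A"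
    (is "_ \<le> ennreal ?K * _")
proof -
  let ?d = "DIM('a) - 1"
  let ?A = "A \<inter> {x. x \<bullet> e = 1}"
  have "unit_ball_vol (real ?d) > 0" by (rule unit_ball_vol_pos) simp
  then have K: "?K > 0" by (rule divide_pos_pos[rotated]) simp
  have "emeasure (cone_measure e) A / ennreal ?K \<le> hausdorff_premeasure ?d 1 ?A"
    unfolding hausdorff_premeasure_def
  proof (rule INF_greatest)
    fix C :: "nat \<Rightarrow> 'a set"
    assume "C \<in> {C. ?A \<subseteq> (\<Union>i. C i) \<and> (\<forall>i. bounded (C i) \<and> diameter (C i) \<le> 1)}"
    then have C: "?A \<subseteq> (\<Union>i. C i)" "\<And>i. bounded (C i)" by auto
    define D where "D i = (if C i \<inter> {x. x \<bullet> e = 1} = {} then {} else cball (SOME x. x \<in> C i \<inter> {x. x \<bullet> e = 1}) (diameter (C i)))" for i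
    have some: "(SOME x. x \<in> C i \<inter> {x. x \<bullet> e = 1}) \<in> C i \<inter> {x. x \<bullet> e = 1}" if "C i \<inter> {x. x \<bullet> e = 1} \<noteq> {}" for i
      using that by (metis ex_in_conv someI_ex)
    have D: "D i \<in> sets borel" for i by (simp add: D_def)
    have "emeasure (cone_measure e) A \<le> emeasure (cone_measure e) (\<Union>i. D i)"
    proof (rule emeasure_mono_AE)
      show "AE x in cone_measure e. x \<in> A \<longrightarrow> x \<in> (\<Union>i. D i)"
        using cone_measure_plane
      proof eventually_elim
        case (elim x)
        show ?case
        proof
          assume "x \<in> A"
          then obtain i where i: "x \<in> C i" using C elim by auto
          then have ne: "C i \<inter> {x. x \<bullet> e = 1} \<noteq> {}" using elim by auto
          have "x \<in> D i" using some[OF ne] i ne diameter_bounded_bound[OF C(2)[of i]] by (simp add: D_def)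
          then show "x \<in> (\<Union>i. D i)" by auto
        qed
      qed
    qed (use D in auto)
    also have "\<dots> \<le> (\<Sum>i. emeasure (cone_measure e) (D i))"
      by (rule emeasure_subadditive_countably) (use D in auto)
    also have "\<dots> \<le> (\<Sum>i. ennreal ?K * hausdorff_gauge ?d (C i))"
    proof (intro suminf_le)
      fix i
      show "emeasure (cone_measure e) (D i) \<le> ennreal ?K * hausdorff_gauge ?d (C i)"
      proof (cases "C i \<inter> {x. x \<bullet> e = 1} = {}")
        case False
        have d0: "diameter (C i) \<ge> 0" by (rule diameter_ge_0[OF C(2)])
        have "emeasure (cone_measure e) (D i) \<le> ennreal ((2 * diameter (C i)) ^ ?d)"
        proof -
          have "(SOME x. x \<in> C i \<inter> {x. x \<bullet> e = 1}) \<bullet> e = 1" using some[OF False] by blast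
          from cone_measure_cball_le[OF e this d0] False show ?thesis by (simp only: D_def if_False)
        qed
        also have "(2 * diameter (C i)) ^ ?d = (4 * (diameter (C i) / 2)) ^ ?d" by simp
        also have "\<dots> = 4 ^ ?d * (diameter (C i) / 2) ^ ?d" by (rule power_mult_distrib)
        also have "\<dots> = ?K * (unit_ball_vol (real ?d) * (diameter (C i) / 2) ^ ?d)"
        proof -
          have *: "a * b = a / V * (V * b)" if "V > 0" for a b V :: real using that by simp
          show ?thesis by (rule *) (rule unit_ball_vol_pos, simp)
        qed
        finally show ?thesis using False K d0 by (auto simp: hausdorff_gauge_def ennreal_mult[symmetric])
      qed (simp add: D_def)
    qed auto
    also have "\<dots> = ennreal ?K * (\<Sum>i. hausdorff_gauge ?d (C i))" by simp
    finally show "emeasure (cone_measure e) A / ennreal ?K \<le> (\<Sum>i. hausdorff_gauge ?d (C i))"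
      by (intro divide_le_posI_ennreal) (use K in auto)
  qed
  also have "\<dots> \<le> hausdorff_measure ?d ?A" by (rule hausdorff_premeasure_le_measure) simp
  also have "\<dots> = emeasure (hausdorff_plane e) A" by (simp add: emeasure_hausdorff_plane A)
  finally have "ennreal ?K * (emeasure (cone_measure e) A / ennreal ?K) \<le> ennreal ?K * emeasure (hausdorff_plane e) A"
    by (rule mult_left_mono) simp
  moreover have "ennreal ?K * (emeasure (cone_measure e) A / ennreal ?K) = emeasure (cone_measure e) A"
    using K by (subst ennreal_times_divide, subst mult.commute, intro mult_divide_eq_ennreal) (simp_all only: ennreal_eq_0_iff not_le ennreal_neq_top not_False_eq_True)
  ultimately show ?thesis by simp
qed

text \<open>Both measures are invariant under translations of the plane and positive and finite on a
  ball, hence proportional. This is carried out in a coordinate plane, where the grid bound is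
  available; orthogonal maps transport the identity, with the same constant, to every unit
  vector.\<close>

lemma hausdorff_plane_eq_cone_measure:
  "\<exists>c>0. \<forall>u::'a::euclidean_space. norm u = 1 \<longrightarrow>
     (\<forall>B\<in>sets borel. B \<subseteq> {x. x \<bullet> u = 1} \<longrightarrow>
        hausdorff_measure (DIM('a) - 1) B = ennreal c * emeasure (cone_measure u) B)"
proof -
  obtain e :: 'a where e: "e \<in> Basis" using nonempty_Basis by blast
  have ee: "e \<bullet> e = 1" using e by simp
  let ?H = "hausdorff_plane e" and ?N = "cone_measure e" and ?Q = "ball e 1"
  have eq: "emeasure ?N ?Q * emeasure ?H B = emeasure ?H ?Q * emeasure ?N B" if B: "B \<in> sets borel" for B
  proof -
    have "emeasure ?N ((\<lambda>y. 2 *\<^sub>R e - y) -` ?Q) * emeasure ?H B = emeasure ?H ?Q * emeasure ?N B"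
    proof (rule translation_invariant_unique[where E="{v. v \<bullet> e = 0}"])
      show "AE x in ?H. x - e \<in> {v. v \<bullet> e = 0}"
        using hausdorff_plane_plane by eventually_elim (simp add: inner_simps ee)
      show "AE x in ?N. x - e \<in> {v. v \<bullet> e = 0}"
        using cone_measure_plane by eventually_elim (simp add: inner_simps ee)
    qed (use e B in \<open>auto intro: sigma_finite_hausdorff_plane sigma_finite_cone_measure
          hausdorff_plane_translate cone_measure_translate\<close>)
    also have "(\<lambda>y. 2 *\<^sub>R e - y) -` ?Q = ?Q"
      by (auto simp: dist_norm scaleR_2 norm_minus_commute)
    finally show ?thesis .
  qed
  have Npos: "emeasure ?N ?Q > 0"
  proof -
    \<comment> \<open>An open set inside the cone over the ball that contains
      \<open>(1/2) *\<^sub>R e\<close>, so the cone has positive volume.\<close>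
    define S where "S = {x::'a. 0 < x \<bullet> e \<and> x \<bullet> e < 1 \<and> norm (x - (x \<bullet> e) *\<^sub>R e) < x \<bullet> e}"
    have "open S" unfolding S_def by (intro open_Collect_conj open_Collect_less continuous_intros)
    moreover have "(1/2) *\<^sub>R e \<in> S" by (simp add: S_def ee)
    ultimately obtain r where r: "r > 0" "ball ((1/2) *\<^sub>R e) r \<subseteq> S" by (meson open_contains_ball)
    have "S \<subseteq> {x. 0 < x \<bullet> e \<and> x \<bullet> e \<le> 1 \<and> x /\<^sub>R (x \<bullet> e) \<in> ?Q}"
    proof
      fix x assume "x \<in> S"
      then have x: "0 < x \<bullet> e" "x \<bullet> e < 1" "norm (x - (x \<bullet> e) *\<^sub>R e) < x \<bullet> e" by (auto simp: S_def)
      have "norm (x /\<^sub>R (x \<bullet> e) - e) = norm ((x - (x \<bullet> e) *\<^sub>R e) /\<^sub>R (x \<bullet> e))"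
        using x by (simp add: algebra_simps)
      also have "\<dots> = norm (x - (x \<bullet> e) *\<^sub>R e) / (x \<bullet> e)" using x by (simp add: divide_inverse mult.commute)
      also have "\<dots> < 1" using x by simp
      finally show "x \<in> {x. 0 < x \<bullet> e \<and> x \<bullet> e \<le> 1 \<and> x /\<^sub>R (x \<bullet> e) \<in> ?Q}"
        using x by (simp add: dist_norm norm_minus_commute)
    qed
    then have "emeasure lborel (ball ((1/2) *\<^sub>R e) r) \<le> emeasure ?N ?Q"
      using r by (subst emeasure_cone_measure) (auto intro!: emeasure_mono)
    then show ?thesis using emeasure_lborel_ball_pos[OF r(1), of "(1/2) *\<^sub>R e"] by (rule order.strict_trans2[rotated])
  qed
  have Nfin: "emeasure ?N ?Q < \<infinity>"
  proof (rule cone_measure_bounded_finite[of _ 2])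
    show "?Q \<subseteq> ball 0 2"
    proof
      fix x assume "x \<in> ?Q"
      then show "x \<in> ball 0 2" using norm_triangle_ineq[of e "x - e"] e by (simp add: dist_norm norm_minus_commute)
    qed
  qed simp
  have Hpos: "emeasure ?H ?Q > 0"
    using hausdorff_plane_ge_cone_measure[OF e, of ?Q] Npos by (auto simp: zero_less_iff_neq_zero)
  have Hfin: "emeasure ?H ?Q < \<infinity>"
  proof -
    have "emeasure ?H ?Q \<le> hausdorff_measure (DIM('a) - 1) {x::'a. x \<bullet> e = 1 \<and> (\<forall>b\<in>Basis. \<bar>x \<bullet> b\<bar> \<le> 2)}"
      unfolding emeasure_hausdorff_plane[OF borel_open[OF open_ball]]
    proof (rule hausdorff_measure_mono, safe)
      fix x b :: 'a assume x: "x \<in> ball e 1" and b: "b \<in> Basis"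
      have "\<bar>x \<bullet> b\<bar> \<le> norm x" using b by (rule Basis_le_norm)
      also have "norm x \<le> 2" using norm_triangle_ineq[of e "x - e"] e x by (simp add: dist_norm norm_minus_commute)
      finally show "\<bar>x \<bullet> b\<bar> \<le> 2" .
    qed
    also have "\<dots> < \<infinity>" by (rule hausdorff_measure_coordinate_plane_finite[OF e]) simp
    finally show ?thesis .
  qed
  obtain a b where ab: "emeasure ?H ?Q = ennreal a" "emeasure ?N ?Q = ennreal b" "a > 0" "b > 0"
    using Npos Nfin Hpos Hfin by (cases "emeasure ?H ?Q"; cases "emeasure ?N ?Q") auto
  define c where "c = a / b"
  have c: "c > 0" using ab by (simp add: c_def)
  have eqc: "emeasure ?H B = ennreal c * emeasure ?N B" if B: "B \<in> sets borel" for B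
  proof -
    have "ennreal (1/b) * (ennreal b * emeasure ?H B) = ennreal (1/b) * (ennreal a * emeasure ?N B)"
      using eq[OF B] ab by simp
    then show ?thesis
      using ab by (simp add: mult.assoc[symmetric] ennreal_mult[symmetric] c_def)
  qed
  show ?thesis
  proof (intro exI[of _ c] conjI c allI impI ballI)
    fix u :: 'a and B assume u: "norm u = 1" and B: "B \<in> sets borel" "B \<subseteq> {x. x \<bullet> u = 1}"
    obtain T where T: "orthogonal_transformation T" "T e = u"
      using orthogonal_transformation_exists_euclidean[of e u] u e by auto
    have mT [measurable]: "T \<in> borel \<rightarrow>\<^sub>M borel"
      using orthogonal_transformation_linear[OF T(1)]
      by (intro borel_measurable_continuous_onI linear_continuous_on) (simp add: linear_conv_bounded_linear)
    have vT: "T -` A \<in> sets borel" if "A \<in> sets borel" for A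
      using measurable_sets[OF mT that] by simp
    have Tu: "T x \<bullet> u = x \<bullet> e" for x using T by (auto simp: orthogonal_transformation_def)
    have surj: "T ` (T -` B) = B" using orthogonal_transformation_surj[OF T(1)] by (metis surj_image_vimage_eq)
    have "hausdorff_measure (DIM('a) - 1) B = hausdorff_measure (DIM('a) - 1) (T -` B)"
    proof -
      have "dist (T x) (T y) = dist x y" for x y
        unfolding dist_norm linear_diff[OF orthogonal_transformation_linear[OF T(1)], symmetric]
        by (rule orthogonal_transformation_norm[OF T(1)])
      from hausdorff_measure_isometry[of T "DIM('a) - 1" "T -` B", OF this] show ?thesis by (simp only: surj)
    qed
    also have "\<dots> = emeasure ?H (T -` B)"
    proof -
      have "T -` B \<inter> {x. x \<bullet> e = 1} = T -` B" using B(2) Tu by auto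
      then show ?thesis using vT[OF B(1)] by (simp add: emeasure_hausdorff_plane)
    qed
    also have "\<dots> = ennreal c * emeasure ?N (T -` B)" using vT[OF B(1)] by (rule eqc)
    also have "emeasure ?N (T -` B) = emeasure (cone_measure u) B"
    proof -
      have "{x. 0 < x \<bullet> e \<and> x \<bullet> e \<le> 1 \<and> x /\<^sub>R (x \<bullet> e) \<in> T -` B} = T -` {x. 0 < x \<bullet> u \<and> x \<bullet> u \<le> 1 \<and> x /\<^sub>R (x \<bullet> u) \<in> B}"
        using Tu linear_cmul[OF orthogonal_transformation_linear[OF T(1)]] by auto
      then show ?thesis
        unfolding emeasure_cone_measure[OF B(1)] emeasure_cone_measure[OF vT[OF B(1)]]
        using emeasure_lborel_orthogonal_vimage[OF T(1) cone_set_borel[OF B(1), of u]] by (simp only:)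
    qed
    finally show "hausdorff_measure (DIM('a) - 1) B = ennreal c * emeasure (cone_measure u) B" .
  qed
qed

section \<open>Support functions and Wulff shapes\<close>

lemma bdd_above_inner_compact: "compact (K::'a::euclidean_space set) \<Longrightarrow> bdd_above ((\<lambda>x. x \<bullet> u) ` K)"
  by (intro bounded_imp_bdd_above compact_imp_bounded compact_continuous_image continuous_intros)

lemma support_fun_upper: "compact K \<Longrightarrow> x \<in> K \<Longrightarrow> x \<bullet> u \<le> support_fun K u"
  unfolding support_fun_def by (rule cSUP_upper[OF _ bdd_above_inner_compact])

lemma support_fun_least: "K \<noteq> {} \<Longrightarrow> (\<And>x. x \<in> K \<Longrightarrow> x \<bullet> u \<le> c) \<Longrightarrow> support_fun K u \<le> c"
  unfolding support_fun_def by (rule cSUP_least)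

lemma support_fun_attained:
  assumes "compact K" "K \<noteq> {}"
  obtains x where "x \<in> K" "x \<bullet> u = support_fun K u"
proof -
  have "continuous_on K (\<lambda>x. x \<bullet> u)" by (intro continuous_intros)
  from continuous_attains_sup[OF assms this] obtain x where x: "x \<in> K" "\<And>y. y \<in> K \<Longrightarrow> y \<bullet> u \<le> x \<bullet> u" by blast
  then have "support_fun K u \<le> x \<bullet> u" by (intro support_fun_least assms)
  with support_fun_upper[OF assms(1) x(1), of u] x(1) show ?thesis using that[of x] by simp
qed

lemma support_fun_lipschitz:
  assumes "compact K" "K \<noteq> {}" "K \<subseteq> cball 0 R"
  shows "\<bar>support_fun K u - support_fun K v\<bar> \<le> R * norm (u - v)"
proof -
  have "support_fun K u \<le> support_fun K v + R * norm (u - v)" for u v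
  proof (rule support_fun_least[OF assms(2)])
    fix x assume x: "x \<in> K"
    have "x \<bullet> (u - v) \<le> norm x * norm (u - v)" by (rule norm_cauchy_schwarz)
    also have "\<dots> \<le> R * norm (u - v)" using x assms(3) by (intro mult_right_mono) auto
    finally show "x \<bullet> u \<le> support_fun K v + R * norm (u - v)"
      using support_fun_upper[OF assms(1) x, of v] by (simp add: inner_diff_right)
  qed
  from this[of u v] this[of v u] show ?thesis by (simp add: norm_minus_commute abs_le_iff)
qed

lemma continuous_on_support_fun:
  assumes "compact K" "K \<noteq> {}"
  shows "continuous_on S (support_fun K)"
proof -
  obtain R where R: "R > 0" "K \<subseteq> cball 0 R"
    using compact_imp_bounded[OF assms(1)] bounded_pos[of K] by (metis mem_cball_0 subsetI)
  have "R-lipschitz_on S (support_fun K)"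
    by (rule lipschitz_onI) (use support_fun_lipschitz[OF assms R(2)] R in \<open>auto simp: dist_norm\<close>)
  then show ?thesis by (rule lipschitz_on_continuous_on)
qed

lemma borel_measurable_support_fun:
  assumes "compact K" "K \<noteq> {}"
  shows "support_fun K \<in> borel_measurable borel"
  by (rule borel_measurable_continuous_onI) (rule continuous_on_support_fun[OF assms])

lemma convex_mem_iff_support_fun:
  assumes "compact K" "convex K" "K \<noteq> {}"
  shows "x \<in> K \<longleftrightarrow> (\<forall>u\<in>sphere 0 1. x \<bullet> u \<le> support_fun K u)"
proof
  assume "x \<in> K" then show "\<forall>u\<in>sphere 0 1. x \<bullet> u \<le> support_fun K u"
    using support_fun_upper[OF assms(1)] by blast
next
  assume *: "\<forall>u\<in>sphere 0 1. x \<bullet> u \<le> support_fun K u"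
  show "x \<in> K"
  proof (rule ccontr)
    assume "x \<notin> K"
    then obtain a b where ab: "a \<bullet> x < b" "\<And>y. y \<in> K \<Longrightarrow> a \<bullet> y > b"
      using separating_hyperplane_closed_point[OF assms(2) compact_imp_closed[OF assms(1)]] by metis
    obtain y where "y \<in> K" using assms(3) by auto
    with ab have a0: "a \<noteq> 0" by force
    define u where "u = (- 1 / norm a) *\<^sub>R a"
    have u: "u \<in> sphere 0 1" using a0 by (simp add: u_def)
    have "support_fun K u \<le> - b / norm a"
    proof (rule support_fun_least[OF assms(3)])
      fix y assume "y \<in> K"
      then have "y \<bullet> a > b" using ab(2) by (subst inner_commute)
      then show "y \<bullet> u \<le> - b / norm a" using a0 by (simp add: u_def divide_right_mono)
    qed
    also have "\<dots> < x \<bullet> u" using ab(1) a0 by (simp add: u_def inner_commute divide_strict_right_mono)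
    finally show False using * u by force
  qed
qed

lemma support_fun_plus:
  assumes "compact K" "K \<noteq> {}"
  shows "support_fun ((+) a ` K) u = support_fun K u + a \<bullet> u"
proof (rule antisym)
  show "support_fun ((+) a ` K) u \<le> support_fun K u + a \<bullet> u"
    by (rule support_fun_least) (use assms support_fun_upper[OF assms(1)] in \<open>auto simp: inner_add_left\<close>)
  obtain x where "x \<in> K" "x \<bullet> u = support_fun K u" using support_fun_attained[OF assms] by blast
  then have "support_fun K u + a \<bullet> u = (a + x) \<bullet> u" by (simp add: inner_add_left)
  also have "\<dots> \<le> support_fun ((+) a ` K) u"
    by (rule support_fun_upper) (use assms \<open>x \<in> K\<close> in \<open>auto intro: compact_translation\<close>)
  finally show "support_fun K u + a \<bullet> u \<le> support_fun ((+) a ` K) u" .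
qed

lemma support_fun_scaleR:
  assumes "compact K" "K \<noteq> {}" "s \<ge> 0"
  shows "support_fun ((*\<^sub>R) s ` K) u = s * support_fun K u"
proof (rule antisym)
  show "support_fun ((*\<^sub>R) s ` K) u \<le> s * support_fun K u"
    by (rule support_fun_least) (use assms support_fun_upper[OF assms(1)] in \<open>auto intro!: mult_left_mono\<close>)
  obtain x where "x \<in> K" "x \<bullet> u = support_fun K u" using support_fun_attained[OF assms(1,2)] by blast
  then have "s * support_fun K u = (s *\<^sub>R x) \<bullet> u" by simp
  also have "\<dots> \<le> support_fun ((*\<^sub>R) s ` K) u"
    by (rule support_fun_upper) (use assms \<open>x \<in> K\<close> in \<open>auto intro: compact_scaling\<close>)
  finally show "s * support_fun K u \<le> support_fun ((*\<^sub>R) s ` K) u" .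
qed

lemma unit_normals_iff:
  assumes "compact K" "x \<in> K"
  shows "u \<in> unit_normals K x \<longleftrightarrow> u \<in> sphere 0 1 \<and> x \<bullet> u = support_fun K u"
proof -
  have "(\<forall>y\<in>K. (y - x) \<bullet> u \<le> 0) \<longleftrightarrow> x \<bullet> u = support_fun K u"
  proof
    assume *: "\<forall>y\<in>K. (y - x) \<bullet> u \<le> 0"
    have "support_fun K u \<le> x \<bullet> u"
      by (rule support_fun_least) (use assms * in \<open>auto simp: inner_diff_left\<close>)
    then show "x \<bullet> u = support_fun K u" using support_fun_upper[OF assms, of u] by simp
  next
    assume "x \<bullet> u = support_fun K u"
    then show "\<forall>y\<in>K. (y - x) \<bullet> u \<le> 0" using support_fun_upper[OF assms(1), of _ u] by (auto simp: inner_diff_left)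
  qed
  then show ?thesis by (auto simp: unit_normals_def)
qed

text \<open>The Wulff shape, or Aleksandrov body, of \<open>H\<close>. Neither has \<open>H\<close>
  to be a support function nor \<open>\<Omega>\<close> the whole sphere, so constraints may be slack
  and the set may be unbounded.\<close>

definition wulff :: "'a::euclidean_space set \<Rightarrow> ('a \<Rightarrow> real) \<Rightarrow> 'a set" where
  "wulff \<Omega> H = {x. \<forall>u\<in>\<Omega>. x \<bullet> u \<le> H u}"

lemma closed_wulff: "closed (wulff \<Omega> H)"
proof -
  have "wulff \<Omega> H = (\<Inter>u\<in>\<Omega>. {x. x \<bullet> u \<le> H u})" by (auto simp: wulff_def)
  moreover have "closed {x. x \<bullet> u \<le> H u}" for u :: 'a by (intro closed_Collect_le continuous_intros)
  ultimately show ?thesis by auto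
qed

lemma convex_wulff: "convex (wulff \<Omega> H)"
proof -
  have "wulff \<Omega> H = (\<Inter>u\<in>\<Omega>. {x. u \<bullet> x \<le> H u})" by (auto simp: wulff_def inner_commute)
  then show ?thesis by (auto intro!: convex_INT convex_halfspace_le)
qed

text \<open>By compactness of \<open>\<Omega>\<close> the strict inequalities hold with a common
  gap, and a ball with this gap as radius fits because the normals are unit vectors.\<close>

lemma wulff_gap_interior:
  assumes "compact \<Omega>" "\<Omega> \<subseteq> sphere 0 1" "continuous_on \<Omega> H" "\<And>u. u \<in> \<Omega> \<Longrightarrow> x \<bullet> u < H u"
  shows "x \<in> interior (wulff \<Omega> H)"
proof -
  obtain m where m: "m > 0" "\<And>u. u \<in> \<Omega> \<Longrightarrow> m \<le> H u - x \<bullet> u"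
  proof (cases "\<Omega> = {}")
    case True then show ?thesis using that[of 1] by auto
  next
    case False
    have "continuous_on \<Omega> (\<lambda>u. H u - x \<bullet> u)" by (intro continuous_intros assms)
    from continuous_attains_inf[OF assms(1) False this] obtain v where "v \<in> \<Omega>" "\<And>u. u \<in> \<Omega> \<Longrightarrow> H v - x \<bullet> v \<le> H u - x \<bullet> u" by blast
    then show ?thesis using that[of "H v - x \<bullet> v"] assms(4) by auto
  qed
  have "ball x m \<subseteq> wulff \<Omega> H"
  proof
    fix y assume y: "y \<in> ball x m"
    show "y \<in> wulff \<Omega> H" unfolding wulff_def
    proof safe
      fix u assume u: "u \<in> \<Omega>"
      have "(y - x) \<bullet> u \<le> norm (y - x) * norm u" by (rule norm_cauchy_schwarz)
      also have "\<dots> \<le> m" using y u assms(2) by (auto simp: dist_norm norm_minus_commute)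
      finally show "y \<bullet> u \<le> H u" using m(2)[OF u] by (simp add: inner_diff_left)
    qed
  qed
  then show ?thesis using m(1) by (meson centre_in_ball interior_maximal open_ball subsetD)
qed

text \<open>This is how normals of a body are found inside \<open>\<Omega>\<close> and not merely on
  the sphere.\<close>

lemma wulff_frontier:
  assumes "compact \<Omega>" "\<Omega> \<subseteq> sphere 0 1" "continuous_on \<Omega> H" "x \<in> frontier (wulff \<Omega> H)"
  obtains u where "u \<in> \<Omega>" "x \<bullet> u = H u"
proof -
  have "x \<notin> interior (wulff \<Omega> H)" using assms(4) by (simp add: frontier_def)
  then obtain u where u: "u \<in> \<Omega>" "\<not> x \<bullet> u < H u" using wulff_gap_interior[OF assms(1-3)] by blast
  have "x \<in> wulff \<Omega> H" using assms(4) frontier_subset_closed[OF closed_wulff] by blast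
  then show ?thesis using u that[of u] by (force simp: wulff_def)
qed

text \<open>The radii provide the quantitative control: \<open>R\<close> is a Lipschitz constant of
  the support function and \<open>1 / r\<close> one of the gauge. A body with the origin on its
  boundary is treated through a translate.\<close>

locale body_around_0 =
  fixes K :: "'a::euclidean_space set" and r R :: real
  assumes compact: "compact K" and convex: "convex K" and r_pos: "0 < r"
    and inner_ball: "cball 0 r \<subseteq> K" and outer_ball: "K \<subseteq> cball 0 R"
begin

abbreviation h where "h \<equiv> support_fun K"

lemma nonempty: "K \<noteq> {}" using inner_ball r_pos by auto

lemma zero_interior: "0 \<in> interior K"
  using inner_ball r_pos by (meson ball_subset_cball centre_in_ball interior_maximal open_ball order_trans subsetD)

lemma frontier_subset: "frontier K \<subseteq> K"
  using compact by (simp add: compact_imp_closed frontier_subset_closed)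

lemma wulff_eq: "K = wulff (sphere 0 1) h"
  using convex_mem_iff_support_fun[OF compact convex nonempty] by (auto simp: wulff_def)

lemma h_ge: "norm u = 1 \<Longrightarrow> r \<le> h u"
  using support_fun_upper[OF compact, of "r *\<^sub>R u" u] inner_ball r_pos
  by (auto simp: subset_iff power2_norm_eq_inner[symmetric])

lemma h_pos: "norm u = 1 \<Longrightarrow> 0 < h u"
  using h_ge[of u] r_pos by simp

lemma R_ge_r: "r \<le> R"
proof -
  obtain b :: 'a where "b \<in> Basis" using nonempty_Basis by blast
  then have "r *\<^sub>R b \<in> cball 0 r" using r_pos by simp
  then have "r *\<^sub>R b \<in> cball 0 R" using inner_ball outer_ball by blast
  then show ?thesis using r_pos \<open>b \<in> Basis\<close> by simp
qed

lemma h_le: "norm u = 1 \<Longrightarrow> h u \<le> R"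
proof (rule support_fun_least[OF nonempty])
  fix x assume "norm u = 1" "x \<in> K"
  then show "x \<bullet> u \<le> R" using norm_cauchy_schwarz[of x u] outer_ball by auto
qed

lemma h_lipschitz: "\<bar>h u - h v\<bar> \<le> R * norm (u - v)"
  by (rule support_fun_lipschitz[OF compact nonempty outer_ball])

lemma continuous_h: "continuous_on S h"
  by (rule continuous_on_support_fun[OF compact nonempty])

lemma normal_exists:
  assumes "x \<in> frontier K"
  obtains u where "norm u = 1" "x \<bullet> u = h u"
  using wulff_frontier[of "sphere 0 1" h x] assms wulff_eq continuous_h by auto

lemma frontier_normalI:
  assumes "x \<in> K" "norm u = 1" "x \<bullet> u = h u"
  shows "x \<in> frontier K"
proof -
  have "x \<notin> interior K"
  proof
    assume "x \<in> interior K"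
    then obtain e where e: "e > 0" "cball x e \<subseteq> K" by (meson mem_interior_cball)
    then have "x + e *\<^sub>R u \<in> K" using assms by (auto simp: subset_iff dist_norm)
    from support_fun_upper[OF compact this, of u] show False
      using e assms by (simp add: inner_add_left power2_norm_eq_inner[symmetric])
  qed
  then show ?thesis using assms(1) compact by (simp add: frontier_def compact_imp_closed)
qed

definition cone :: "'a set \<Rightarrow> 'a set" where
  "cone A = {t *\<^sub>R a | t a. 0 < t \<and> t \<le> 1 \<and> a \<in> A}"

lemma zero_notin_frontier: "0 \<notin> frontier K"
  using zero_interior by (simp add: frontier_def)

lemma cone_borel:
  assumes "compact A" "0 \<notin> A"
  shows "cone A \<in> sets borel"
proof -
  have "cone A = (\<lambda>(t,a). t *\<^sub>R a) ` ({0..1} \<times> A) - {0}"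
  proof (intro set_eqI iffI)
    fix x assume "x \<in> cone A"
    then show "x \<in> (\<lambda>(t,a). t *\<^sub>R a) ` ({0..1} \<times> A) - {0}" using assms(2) by (force simp: cone_def)
  next
    fix x assume "x \<in> (\<lambda>(t,a). t *\<^sub>R a) ` ({0..1} \<times> A) - {0}"
    then obtain t a where "x = t *\<^sub>R a" "0 \<le> t" "t \<le> 1" "a \<in> A" "x \<noteq> 0" by auto
    then show "x \<in> cone A" unfolding cone_def by (intro CollectI exI[of _ t] exI[of _ a]) auto
  qed
  moreover have "compact ((\<lambda>(t,a). t *\<^sub>R a) ` ({0..1::real} \<times> A))"
    by (intro compact_continuous_image compact_Times assms compact_Icc)
       (auto simp: case_prod_unfold intro!: continuous_intros)
  ultimately show ?thesis by (auto intro: borel_closed compact_imp_closed)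
qed

text \<open>Central projection of a flat boundary piece to the plane \<open>x \<bullet> u = h u\<close> is almost isometric, and the
  cones over the piece and over its projection are almost equal.\<close>

lemma flat_piece:
  fixes u :: 'a
  assumes c: "\<And>u::'a. norm u = 1 \<Longrightarrow> (\<And>B. B \<in> sets borel \<Longrightarrow> B \<subseteq> {x. x \<bullet> u = 1} \<Longrightarrow>
        hausdorff_measure (DIM('a) - 1) B = ennreal c * emeasure (cone_measure u) B)"
    and u: "norm u = 1" and A: "compact A" "A \<subseteq> frontier K"
    and flat: "\<And>a. a \<in> A \<Longrightarrow> \<exists>v. norm v = 1 \<and> a \<bullet> v = h v \<and> norm (v - u) \<le> \<epsilon>"
    and q: "q = 8 * \<epsilon> * R / r" "q < 1" and eps: "0 \<le> \<epsilon>"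
  shows "ennreal ((1 - q) ^ (2 * DIM('a)) * h u) * hausdorff_measure (DIM('a) - 1) A \<le> ennreal c * emeasure lborel (cone A)"
    and "ennreal c * emeasure lborel (cone A) \<le> ennreal ((1 + q) ^ (2 * DIM('a)) * h u) * hausdorff_measure (DIM('a) - 1) A"
proof -
  let ?d = "DIM('a) - 1" and ?n = "DIM('a)"
  define w where "w = h u"
  have R0: "R > 0" using r_pos R_ge_r by simp
  have q0: "q \<ge> 0" using q eps r_pos R0 by simp
  have w: "w > 0" "r \<le> w" using h_pos[OF u] h_ge[OF u] by (auto simp: w_def)
  \<comment> \<open>The factor 8 in \<open>q\<close> is made for this estimate: \<open>q / 4\<close>
    bounds the relative error of the height \<open>a \<bullet> u\<close>, and \<open>q / 2\<close>
    each of the two parts of the distortion of the projection.\<close>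
  have eR: "4 * \<epsilon> * R \<le> (q / 2) * w"
  proof -
    have "4 * \<epsilon> * R = (q / 2) * r" using q(1) r_pos by (simp add: field_simps)
    also have "\<dots> \<le> (q / 2) * w" using w q0 by (intro mult_left_mono) auto
    finally show ?thesis .
  qed
  have AK: "a \<in> K" if "a \<in> A" for a using A frontier_subset that by blast
  have nA: "norm a \<le> R" if "a \<in> A" for a using AK[OF that] outer_ball by auto
  have au: "\<bar>a \<bullet> u - w\<bar> \<le> (q/4) * w" if a: "a \<in> A" for a
  proof -
    obtain v where v: "norm v = 1" "a \<bullet> v = h v" "norm (v - u) \<le> \<epsilon>" using flat[OF a] by blast
    have "a \<bullet> u - w = a \<bullet> (u - v) + (h v - h u)" using v by (simp add: inner_diff_right w_def)
    also have "\<bar>\<dots>\<bar> \<le> \<bar>a \<bullet> (u - v)\<bar> + \<bar>h v - h u\<bar>" by (rule abs_triangle_ineq)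
    also have "\<bar>a \<bullet> (u - v)\<bar> \<le> norm a * norm (u - v)" by (rule Cauchy_Schwarz_ineq2)
    also have "\<dots> \<le> R * \<epsilon>" using nA[OF a] v R0 by (intro mult_mono) (auto simp: norm_minus_commute)
    also have "\<bar>h v - h u\<bar> \<le> R * norm (v - u)" by (rule h_lipschitz)
    also have "\<dots> \<le> R * \<epsilon>" using v R0 by (intro mult_left_mono) auto
    also have "R * \<epsilon> + R * \<epsilon> \<le> (q/4) * w" using eR by (simp add: mult.commute)
    finally show ?thesis by simp
  qed
  have au': "(1 - q) * w \<le> a \<bullet> u" "a \<bullet> u \<le> (1 + q) * w" "w / 2 \<le> a \<bullet> u" if "a \<in> A" for a
  proof -
    have "(q/4) * w \<le> q * w" "(q/4) * w \<le> (1/2) * w"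
      using q0 q(2) w by (auto intro: mult_right_mono simp del: times_divide_eq_left)
    then show "(1 - q) * w \<le> a \<bullet> u" "a \<bullet> u \<le> (1 + q) * w" "w / 2 \<le> a \<bullet> u"
      using au[OF that] unfolding abs_le_iff by (simp_all add: algebra_simps)
  qed
  have au0: "a \<bullet> u > 0" if "a \<in> A" for a using au'(3)[OF that] w by linarith
  \<comment> \<open>Convexity enters here: \<open>b\<close> lies below the supporting plane at
    \<open>a\<close>, whose normal \<open>v\<close> is close to \<open>u\<close>, so the chord from
    \<open>a\<close> to \<open>b\<close> rises little in direction \<open>u\<close>. Exchanging
    \<open>a\<close> and \<open>b\<close> gives the other sign.\<close>
  have diff: "\<bar>(a - b) \<bullet> u\<bar> \<le> \<epsilon> * norm (a - b)" if a: "a \<in> A" and b: "b \<in> A" for a b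
  proof -
    have "(b - a) \<bullet> u \<le> \<epsilon> * norm (a - b)" if a: "a \<in> A" and b: "b \<in> A" for a b
    proof -
      obtain v where v: "norm v = 1" "a \<bullet> v = h v" "norm (v - u) \<le> \<epsilon>" using flat[OF a] by blast
      have "(b - a) \<bullet> v \<le> 0" using support_fun_upper[OF compact AK[OF b], of v] v by (simp add: inner_diff_left)
      then have "(b - a) \<bullet> u \<le> (b - a) \<bullet> (u - v)" by (simp add: inner_diff_right)
      also have "\<dots> \<le> norm (b - a) * norm (u - v)" by (rule norm_cauchy_schwarz)
      also have "\<dots> \<le> norm (b - a) * \<epsilon>" using v by (intro mult_left_mono) (auto simp: norm_minus_commute)
      finally show ?thesis by (simp add: mult.commute norm_minus_commute)
    qed
    from this[OF a b] this[OF b a] show ?thesis by (simp add: abs_le_iff inner_diff_left norm_minus_commute)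
  qed
  define prj where "prj a = a /\<^sub>R (a \<bullet> u)" for a
  define s where "s a = w / (a \<bullet> u)" for a
  \<comment> \<open>Central projection to the plane \<open>x \<bullet> u = w\<close> multiplies
    \<open>a\<close> by \<open>s a\<close>, a number close to 1 that varies slowly over
    \<open>A\<close>.\<close>
  have wP: "w *\<^sub>R prj a = s a *\<^sub>R a" for a by (simp add: prj_def s_def divide_inverse)
  have near: "norm ((w *\<^sub>R prj a - w *\<^sub>R prj b) - (a - b)) \<le> q * norm (a - b)" if a: "a \<in> A" and b: "b \<in> A" for a b
  proof -
    have s1: "\<bar>s a - 1\<bar> \<le> q / 2"
    proof -
      have "s a - 1 = (w - a \<bullet> u) / (a \<bullet> u)" using au0[OF a] by (simp add: s_def diff_divide_distrib)
      then have "\<bar>s a - 1\<bar> = \<bar>a \<bullet> u - w\<bar> / (a \<bullet> u)" using au0[OF a] by (simp add: abs_minus_commute)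
      also have "\<dots> \<le> ((q/4) * w) / (w/2)" using au[OF a] au'(3)[OF a] w q0 by (intro frac_le) auto
      also have "\<dots> = q / 2" using w by simp
      finally show ?thesis .
    qed
    have s2: "\<bar>s a - s b\<bar> \<le> (4 * \<epsilon> / w) * norm (a - b)"
    proof -
      have "s a - s b = w * (- ((a - b) \<bullet> u)) / ((a \<bullet> u) * (b \<bullet> u))"
        using au0[OF a] au0[OF b] by (simp add: s_def field_simps inner_diff_left)
      then have "\<bar>s a - s b\<bar> = w * \<bar>(a - b) \<bullet> u\<bar> / ((a \<bullet> u) * (b \<bullet> u))"
        using au0[OF a] au0[OF b] w by (simp add: abs_mult)
      also have "\<dots> \<le> w * (\<epsilon> * norm (a - b)) / ((w/2) * (w/2))"
        using au'(3)[OF a] au'(3)[OF b] w diff[OF a b] eps by (intro frac_le mult_mono mult_left_mono) auto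
      also have "\<dots> = (4 * \<epsilon> / w) * norm (a - b)" using w by (simp add: field_simps)
      finally show ?thesis .
    qed
    have "(w *\<^sub>R prj a - w *\<^sub>R prj b) - (a - b) = (s a - 1) *\<^sub>R (a - b) + (s a - s b) *\<^sub>R b"
      by (simp add: wP algebra_simps)
    then have "norm ((w *\<^sub>R prj a - w *\<^sub>R prj b) - (a - b)) \<le> \<bar>s a - 1\<bar> * norm (a - b) + \<bar>s a - s b\<bar> * norm b"
      by (metis norm_scaleR norm_triangle_ineq)
    also have "\<dots> \<le> (q/2) * norm (a - b) + ((4 * \<epsilon> / w) * norm (a - b)) * R"
      using s1 s2 nA[OF b] R0 q0 by (intro add_mono mult_mono) (auto intro: order_trans[OF abs_ge_zero s2])
    also have "((4 * \<epsilon> / w) * norm (a - b)) * R = (4 * \<epsilon> * R / w) * norm (a - b)" by simp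
    also have "\<dots> \<le> (q/2) * norm (a - b)" using eR w by (intro mult_right_mono) (auto simp: field_simps)
    finally show ?thesis by (simp add: field_simps)
  qed
  have contP: "continuous_on A prj" unfolding prj_def
    by (intro continuous_intros) (use au0 in force)
  have cP: "compact (prj ` A)" by (rule compact_continuous_image[OF contP A(1)])
  have PA: "prj ` A \<in> sets borel" "prj ` A \<subseteq> {x. x \<bullet> u = 1}"
    using cP au0 by (auto simp: prj_def compact_imp_closed intro!: borel_closed) force
  define P where "P = (*\<^sub>R) w ` prj ` A"
  define Co where "Co = {x. 0 < x \<bullet> u \<and> x \<bullet> u \<le> 1 \<and> x /\<^sub>R (x \<bullet> u) \<in> prj ` A}"
  have Cob: "Co \<in> sets borel" unfolding Co_def by (rule cone_set_borel[OF PA(1)])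
  let ?Hm = "hausdorff_measure ?d" and ?L = "emeasure lborel"
  have HP: "?Hm P = ennreal (w ^ ?d) * (ennreal c * ?L Co)"
  proof -
    have "?Hm P = ennreal (w ^ ?d) * ?Hm (prj ` A)" unfolding P_def by (rule hausdorff_measure_scaleR[OF w(1)])
    also have "?Hm (prj ` A) = ennreal c * ?L Co"
      using c[OF u PA] by (simp add: Co_def emeasure_cone_measure PA)
    finally show ?thesis .
  qed
  have imP: "P = (\<lambda>a. w *\<^sub>R prj a) ` A" by (auto simp: P_def)
  have up: "?Hm P \<le> ennreal ((1 + q) ^ ?d) * ?Hm A"
    unfolding imP
  proof (rule hausdorff_measure_lipschitz_image_le)
    fix a b assume "a \<in> A" "b \<in> A"
    then show "dist (w *\<^sub>R prj a) (w *\<^sub>R prj b) \<le> (1 + q) * dist a b"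
      using near[of a b] norm_triangle_ineq[of "(w *\<^sub>R prj a - w *\<^sub>R prj b) - (a - b)" "a - b"]
      by (simp add: dist_norm algebra_simps)
  qed (use q0 in auto)
  have expand: "(1 - q) * dist a b \<le> dist (w *\<^sub>R prj a) (w *\<^sub>R prj b)" if "a \<in> A" "b \<in> A" for a b
    using near[OF that] norm_triangle_ineq3[of "a - b" "(w *\<^sub>R prj a - w *\<^sub>R prj b)"]
    by (simp add: dist_norm algebra_simps norm_minus_commute)
  have lo: "?Hm A \<le> ennreal ((1 / (1 - q)) ^ ?d) * ?Hm P"
  proof -
    define f where "f a = w *\<^sub>R prj a" for a
    have inj: "inj_on f A"
    proof (rule inj_onI)
      fix a b assume "a \<in> A" "b \<in> A" "f a = f b"
      then have "(1 - q) * dist a b \<le> 0" using expand[of a b] unfolding f_def by (metis dist_self)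
      then show "a = b" using q(2) by (simp add: mult_le_0_iff)
    qed
    have "?Hm (the_inv_into A f ` f ` A) \<le> ennreal ((1 / (1 - q)) ^ ?d) * ?Hm (f ` A)"
    proof (rule hausdorff_measure_lipschitz_image_le)
      fix x y assume "x \<in> f ` A" "y \<in> f ` A"
      then obtain a b where ab: "a \<in> A" "b \<in> A" "x = f a" "y = f b" by auto
      have "dist a b \<le> dist x y / (1 - q)"
        using expand[OF ab(1,2)] q(2) ab by (simp add: f_def pos_le_divide_eq mult.commute)
      then show "dist (the_inv_into A f x) (the_inv_into A f y) \<le> 1 / (1 - q) * dist x y"
        by (simp add: the_inv_into_f_f[OF inj] ab)
    qed (use q in auto)
    moreover have "the_inv_into A f ` f ` A = A"
      by (metis inj the_inv_into_onto)
    ultimately show ?thesis by (simp add: imP f_def)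
  qed
  \<comment> \<open>The heights over \<open>A\<close> lie between \<open>(1 - q) * w\<close> and
    \<open>(1 + q) * w\<close>, so the dilates of \<open>Co\<close> with these two ratios lie inside
    and outside the cone over \<open>A\<close>.\<close>
  have sub1: "(\<lambda>x. ((1 - q) * w) *\<^sub>R x) ` Co \<subseteq> cone A"
  proof
    fix y assume "y \<in> (\<lambda>x. ((1 - q) * w) *\<^sub>R x) ` Co"
    then obtain x a where x: "0 < x \<bullet> u" "x \<bullet> u \<le> 1" "x /\<^sub>R (x \<bullet> u) = prj a" "a \<in> A" "y = ((1 - q) * w) *\<^sub>R x"
      by (auto simp: Co_def)
    have "x = (x \<bullet> u) *\<^sub>R (x /\<^sub>R (x \<bullet> u))" using x(1) by simp
    also have "\<dots> = ((x \<bullet> u) / (a \<bullet> u)) *\<^sub>R a" unfolding x(3) by (simp add: prj_def divide_inverse)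
    finally have "y = ((1 - q) * w) *\<^sub>R ((x \<bullet> u) / (a \<bullet> u)) *\<^sub>R a" using x(5) by (rule subst)
    then have "y = ((1 - q) * w * (x \<bullet> u) / (a \<bullet> u)) *\<^sub>R a" by simp
    moreover have "(1 - q) * w * (x \<bullet> u) \<le> (a \<bullet> u) * 1"
      using au'[OF x(4)] x q w au0[OF x(4)] by (intro mult_mono) auto
    ultimately show "y \<in> cone A" unfolding cone_def
      using x au0[OF x(4)] q w by (intro CollectI exI[of _ "(1 - q) * w * (x \<bullet> u) / (a \<bullet> u)"] exI[of _ a]) auto
  qed
  have sub2: "cone A \<subseteq> (\<lambda>x. ((1 + q) * w) *\<^sub>R x) ` Co"
  proof
    fix y assume "y \<in> cone A"
    then obtain t a where t: "y = t *\<^sub>R a" "0 < t" "t \<le> 1" "a \<in> A" by (auto simp: cone_def)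
    define z where "z = (1 + q) * w"
    have p: "z > 0" using q0 w by (simp add: z_def)
    define x where "x = (1 / z) *\<^sub>R y"
    have xu: "x \<bullet> u = t * (a \<bullet> u) / z" by (simp add: x_def t)
    have "t * (a \<bullet> u) \<le> 1 * z" unfolding z_def using t au'[OF t(4)] au0[OF t(4)] by (intro mult_mono) auto
    then have "x \<bullet> u \<le> 1" using p by (simp add: xu)
    moreover have "0 < x \<bullet> u" using p t au0[OF t(4)] by (simp add: xu)
    moreover have "x /\<^sub>R (x \<bullet> u) = prj a" using p t au0[OF t(4)] unfolding xu by (simp add: x_def prj_def inverse_eq_divide)
    ultimately have "x \<in> Co" using t by (auto simp: Co_def)
    moreover have "y = ((1 + q) * w) *\<^sub>R x" using p by (simp add: x_def z_def[symmetric])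
    ultimately show "y \<in> (\<lambda>x. ((1 + q) * w) *\<^sub>R x) ` Co" by blast
  qed
  have cb: "cone A \<in> sets borel" using cone_borel A zero_notin_frontier by blast
  have L1: "ennreal (((1 - q) * w) ^ ?n) * ?L Co \<le> ?L (cone A)"
  proof -
    have p: "(1 - q) * w > 0" using q w by simp
    show ?thesis using emeasure_mono[OF sub1, of lborel] cb emeasure_lborel_scaleR(1)[OF p Cob] by simp
  qed
  have L2: "?L (cone A) \<le> ennreal (((1 + q) * w) ^ ?n) * ?L Co"
  proof -
    have p: "(1 + q) * w > 0" using q0 w by simp
    show ?thesis using emeasure_mono[OF sub2, of lborel] emeasure_lborel_scaleR[OF p Cob] by simp
  qed
  have wn: "w ^ ?n = w * w ^ ?d" by (simp add: power_eq_if)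
  \<comment> \<open>The inverse projection loses a factor (1 - q)^(n-1) and the dilation a factor (1
    - q)^n; the exponent 2n covers both.\<close>
  show "ennreal ((1 - q) ^ (2 * ?n) * h u) * ?Hm A \<le> ennreal c * ?L (cone A)"
  proof -
    have "ennreal ((1 - q) ^ (2 * ?n) * w) * ?Hm A
       \<le> ennreal ((1 - q) ^ (2 * ?n) * w) * (ennreal ((1 / (1 - q)) ^ ?d) * (ennreal (w ^ ?d) * (ennreal c * ?L Co)))"
      using lo unfolding HP by (intro mult_left_mono) auto
    also have "\<dots> = ennreal ((1 - q) ^ (2 * ?n) * w * (1 / (1 - q)) ^ ?d * w ^ ?d) * (ennreal c * ?L Co)"
      using q w by (simp add: ennreal_mult' ennreal_mult'' mult.assoc)
    also have "(1 - q) ^ (2 * ?n) * w * (1 / (1 - q)) ^ ?d * w ^ ?d = ((1 - q) ^ ?n * (1 / (1 - q)) ^ ?d) * ((1 - q) * w) ^ ?n"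
      by (simp add: wn power_mult_distrib mult_2 power_add)
    also have "\<dots> \<le> 1 * ((1 - q) * w) ^ ?n"
    proof (rule mult_right_mono)
      have "(1 - q) ^ ?n * (1 / (1 - q)) ^ ?d \<le> (1 - q) ^ ?d * (1 / (1 - q)) ^ ?d"
        using q q0 by (intro mult_right_mono power_decreasing) auto
      also have "\<dots> = ((1 - q) * (1 / (1 - q))) ^ ?d" by (rule power_mult_distrib[symmetric])
      also have "(1 - q) * (1 / (1 - q)) = 1" using q(2) by simp
      finally show "(1 - q) ^ ?n * (1 / (1 - q)) ^ ?d \<le> 1" by simp
    qed (use q w in auto)
    finally have "ennreal ((1 - q) ^ (2 * ?n) * w) * ?Hm A \<le> ennreal (((1 - q) * w) ^ ?n) * (ennreal c * ?L Co)"
      by (simp add: ennreal_leI mult_right_mono)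
    also have "\<dots> = ennreal c * (ennreal (((1 - q) * w) ^ ?n) * ?L Co)" by (simp add: mult_ac)
    also have "\<dots> \<le> ennreal c * ?L (cone A)" by (rule mult_left_mono[OF L1]) simp
    finally show ?thesis by (simp add: w_def)
  qed
  show "ennreal c * ?L (cone A) \<le> ennreal ((1 + q) ^ (2 * ?n) * h u) * ?Hm A"
  proof -
    have "ennreal c * ?L (cone A) \<le> ennreal c * (ennreal (((1 + q) * w) ^ ?n) * ?L Co)"
      by (rule mult_left_mono[OF L2]) simp
    also have "\<dots> = ennreal ((1 + q) ^ ?n * w) * (ennreal (w ^ ?d) * (ennreal c * ?L Co))"
      using q0 w by (simp add: wn power_mult_distrib ennreal_mult' mult_ac)
    also have "\<dots> = ennreal ((1 + q) ^ ?n * w) * ?Hm P" by (simp only: HP)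
    also have "\<dots> \<le> ennreal ((1 + q) ^ ?n * w) * (ennreal ((1 + q) ^ ?d) * ?Hm A)"
      by (rule mult_left_mono[OF up]) simp
    also have "\<dots> = ennreal ((1 + q) ^ ?n * w * (1 + q) ^ ?d) * ?Hm A"
      using q0 w by (simp add: ennreal_mult' mult.assoc)
    also have "\<dots> \<le> ennreal ((1 + q) ^ (2 * ?n) * w) * ?Hm A"
    proof (intro mult_right_mono ennreal_leI)
      have "(1 + q) ^ ?n * (1 + q) ^ ?d \<le> (1 + q) ^ ?n * (1 + q) ^ ?n"
        using q0 by (intro mult_left_mono power_increasing) auto
      then have "((1 + q) ^ ?n * (1 + q) ^ ?d) * w \<le> ((1 + q) ^ ?n * (1 + q) ^ ?n) * w"
        using w by (intro mult_right_mono) auto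
      then show "(1 + q) ^ ?n * w * (1 + q) ^ ?d \<le> (1 + q) ^ (2 * ?n) * w"
        by (simp only: mult_2 power_add) (simp only: mult_ac)
    qed simp
    finally show ?thesis by (simp add: w_def)
  qed
qed

end

section \<open>Gauge and normal directions\<close>

text \<open>The measure of \<open>N\<close> equals the average of the measures of its translates by
  \<open>s *\<^sub>R b\<close> over s in [0, 1]. After exchanging the integrals, the inner one is
  the length of a countable set.\<close>

lemma lborel_null_if_lines_countable:
  fixes N :: "'a::euclidean_space set"
  assumes N [measurable]: "N \<in> sets borel" and cnt: "\<And>x. countable {s::real. x + s *\<^sub>R b \<in> N}"
  shows "N \<in> null_sets lborel"
proof -
  have t: "emeasure lborel N = (\<integral>\<^sup>+x. indicator N (x + s *\<^sub>R b) \<partial>lborel)" for s :: real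
  proof -
    have "emeasure lborel N = (\<integral>\<^sup>+x. indicator N x \<partial>distr lborel borel ((+) (s *\<^sub>R b)))"
      by (simp add: lborel_distr_plus)
    also have "\<dots> = (\<integral>\<^sup>+x. indicator N (s *\<^sub>R b + x) \<partial>lborel)"
      by (rule nn_integral_distr) auto
    finally show ?thesis by (simp add: add.commute)
  qed
  have "emeasure lborel N * emeasure lborel {0..1::real}
      = (\<integral>\<^sup>+s. (\<integral>\<^sup>+x. indicator N (x + s *\<^sub>R b) \<partial>lborel) * indicator {0..1} s \<partial>lborel)"
    by (simp add: t[symmetric] nn_integral_cmult)
  also have "\<dots> \<le> (\<integral>\<^sup>+s. (\<integral>\<^sup>+x. indicator N (x + s *\<^sub>R b) \<partial>lborel) \<partial>lborel)"
    by (intro nn_integral_mono) (auto simp: indicator_def)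
  also have "\<dots> = (\<integral>\<^sup>+x. (\<integral>\<^sup>+s. indicator N (x + s *\<^sub>R b) \<partial>lborel) \<partial>lborel)"
    by (rule lborel_pair.Fubini'[symmetric]) measurable
  also have "\<dots> = (\<integral>\<^sup>+(x::'a). 0 \<partial>lborel)"
  proof (rule nn_integral_cong)
    fix x
    have "(\<integral>\<^sup>+s. indicator N (x + s *\<^sub>R b) \<partial>lborel) = (\<integral>\<^sup>+s. indicator {s. x + s *\<^sub>R b \<in> N} s \<partial>lborel)"
      by (rule nn_integral_cong) (auto simp: indicator_def)
    also have "\<dots> = emeasure lborel {s. x + s *\<^sub>R b \<in> N}"
      using countable_imp_null_set_lborel[OF cnt[of x]] by (intro nn_integral_indicator) auto
    also have "\<dots> = 0" using countable_imp_null_set_lborel[OF cnt[of x]] by auto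
    finally show "(\<integral>\<^sup>+s. indicator N (x + s *\<^sub>R b) \<partial>lborel) = 0" .
  qed
  finally show ?thesis by (auto simp: null_sets_def)
qed

context body_around_0
begin

text \<open>The gauge (Minkowski functional) of K in dual form. With a supremum over unit vectors,
  the maximisers \<open>M x\<close> are the outer normals at the point where the ray through a
  nonzero x leaves K, and \<open>u /\<^sub>R h u\<close> is a subgradient at x for each maximiser
  u.\<close>

definition g :: "'a \<Rightarrow> real" where "g x = (SUP u\<in>sphere 0 1. x \<bullet> u / h u)"

definition M :: "'a \<Rightarrow> 'a set" where "M x = {u. norm u = 1 \<and> x \<bullet> u = g x * h u}"

lemma g_props:
  shows g_upper: "norm u = 1 \<Longrightarrow> x \<bullet> u \<le> g x * h u"
    and M_nonempty: "\<exists>u. u \<in> M x"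
    and g_least: "(\<And>u. norm u = 1 \<Longrightarrow> x \<bullet> u \<le> c * h u) \<Longrightarrow> g x \<le> c"
proof -
  have cont: "continuous_on (sphere 0 1) (\<lambda>u. x \<bullet> u / h u)"
    by (intro continuous_intros continuous_h) (use h_pos in force)
  obtain b :: 'a where b: "b \<in> Basis" using nonempty_Basis by blast
  then have ne: "sphere (0::'a) 1 \<noteq> {}" by auto
  obtain v where v: "v \<in> sphere 0 1" "\<And>u. u \<in> sphere 0 1 \<Longrightarrow> x \<bullet> u / h u \<le> x \<bullet> v / h v"
    using continuous_attains_sup[OF compact_sphere ne cont] by blast
  have gv: "g x = x \<bullet> v / h v"
    unfolding g_def by (rule cSup_eq_maximum) (use v in auto)
  show "x \<bullet> u \<le> g x * h u" if "norm u = 1" for u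
    using v(2)[of u] that h_pos[OF that] by (simp add: gv[symmetric] pos_divide_le_eq)
  show "\<exists>u. u \<in> M x"
    using v(1) h_pos[of v] by (intro exI[of _ v]) (simp add: M_def gv)
  show "g x \<le> c" if "\<And>u. norm u = 1 \<Longrightarrow> x \<bullet> u \<le> c * h u"
    using that[of v] v(1) h_pos[of v] by (simp add: gv pos_divide_le_eq)
qed

lemma M_norm: "u \<in> M x \<Longrightarrow> norm u = 1" and M_eq: "u \<in> M x \<Longrightarrow> x \<bullet> u = g x * h u"
  by (auto simp: M_def)

lemma g_ge: "norm x / R \<le> g x"
proof (cases "x = 0")
  case True
  obtain u where u: "u \<in> M x" using M_nonempty by blast
  then have "g x * h u = 0" using True M_eq[OF u] by simp
  then show ?thesis using True h_pos[OF M_norm[OF u]] by simp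
next
  case False
  define u where "u = x /\<^sub>R norm x"
  have u: "norm u = 1" using False by (simp add: u_def)
  have "norm x = x \<bullet> u" using False by (simp add: u_def power2_norm_eq_inner[symmetric] power2_eq_square)
  also have "\<dots> \<le> g x * h u" by (rule g_upper[OF u])
  finally have *: "norm x \<le> g x * h u" .
  have "0 < norm x" using False by simp
  then have "0 < g x * h u" using * by linarith
  then have "0 < g x" using h_pos[OF u] by (simp add: zero_less_mult_iff)
  then have "g x * h u \<le> g x * R" using h_le[OF u] by (intro mult_left_mono) auto
  with * show ?thesis using R_ge_r r_pos by (simp add: pos_divide_le_eq)
qed

lemma R_pos: "0 < R" using R_ge_r r_pos by simp

lemma g_nonneg: "0 \<le> g x"
  using g_ge[of x] R_pos by (meson divide_nonneg_pos norm_ge_zero order_trans)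

lemma g_pos: "x \<noteq> 0 \<Longrightarrow> 0 < g x"
  using g_ge[of x] R_pos by (meson divide_pos_pos order_less_le_trans zero_less_norm_iff)

lemma g_diff_le: "g x - g y \<le> norm (x - y) / r"
proof -
  have "g x \<le> g y + norm (x - y) / r"
  proof (rule g_least)
    fix u :: 'a assume u: "norm u = 1"
    have "x \<bullet> u = y \<bullet> u + (x - y) \<bullet> u" by (simp add: inner_diff_left)
    also have "(x - y) \<bullet> u \<le> norm (x - y)" using norm_cauchy_schwarz[of "x - y" u] u by simp
    also have "norm (x - y) = (norm (x - y) / r) * r" using r_pos by simp
    also have "\<dots> \<le> (norm (x - y) / r) * h u" using h_ge[OF u] r_pos by (intro mult_left_mono) auto
    also have "y \<bullet> u \<le> g y * h u" by (rule g_upper[OF u])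
    finally show "x \<bullet> u \<le> (g y + norm (x - y) / r) * h u" by (simp add: distrib_right)
  qed
  then show ?thesis by simp
qed

lemma continuous_g: "continuous_on S g"
proof -
  have "\<bar>g x - g y\<bar> \<le> 1 / r * dist x y" for x y
    using g_diff_le[of x y] g_diff_le[of y x] by (simp add: abs_le_iff dist_norm norm_minus_commute)
  then have "(1/r)-lipschitz_on S g"
    using r_pos by (intro lipschitz_onI) (auto simp: dist_real_def)
  then show ?thesis by (rule lipschitz_on_continuous_on)
qed

lemma g_borel [measurable]: "g \<in> borel_measurable borel"
  by (rule borel_measurable_continuous_onI) (rule continuous_g)

lemma g_scaleR: assumes "t \<ge> 0" shows "g (t *\<^sub>R x) = t * g x"
proof -
  have le: "g (t *\<^sub>R x) \<le> t * g x" if "t \<ge> 0" for t x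
    by (rule g_least) (use that g_upper[of _ x] in \<open>auto simp: mult.assoc intro: mult_left_mono\<close>)
  show ?thesis
  proof (cases "t = 0")
    case True
    then show ?thesis using le[of 0 x] g_nonneg[of 0] by simp
  next
    case False
    have "g x = g ((1/t) *\<^sub>R t *\<^sub>R x)" using False by simp
    also have "\<dots> \<le> (1/t) * g (t *\<^sub>R x)" using assms by (intro le) auto
    finally have "t * g x \<le> g (t *\<^sub>R x)" using False assms by (simp add: pos_le_divide_eq mult.commute)
    with le[OF assms, of x] show ?thesis by simp
  qed
qed

lemma M_scaleR: "t > 0 \<Longrightarrow> M (t *\<^sub>R x) = M x"
  by (auto simp: M_def g_scaleR)

lemma mem_iff_g: "x \<in> K \<longleftrightarrow> g x \<le> 1"
proof
  assume "x \<in> K" then show "g x \<le> 1"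
    using support_fun_upper[OF compact] by (intro g_least) auto
next
  assume "g x \<le> 1"
  have "x \<bullet> u \<le> h u" if "norm u = 1" for u
    using g_upper[OF that, of x] mult_right_mono[OF \<open>g x \<le> 1\<close>, of "h u"] h_pos[OF that] by linarith
  then show "x \<in> K" using wulff_eq by (auto simp: wulff_def)
qed

lemma frontier_iff_g: "x \<in> frontier K \<longleftrightarrow> g x = 1"
proof
  assume x: "x \<in> frontier K"
  obtain u where u: "norm u = 1" "x \<bullet> u = h u" using normal_exists[OF x] by blast
  then have "h u \<le> g x * h u" using g_upper[of u x] by simp
  then have "1 \<le> g x" using h_pos[OF u(1)] by simp
  moreover have "g x \<le> 1" using x frontier_subset mem_iff_g by blast
  ultimately show "g x = 1" by simp
next
  assume x: "g x = 1"
  obtain u where "u \<in> M x" using M_nonempty by blast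
  then show "x \<in> frontier K" using x by (intro frontier_normalI[of x u]) (auto simp: mem_iff_g M_def)
qed

lemma unit_normals_eq_M: "x \<in> frontier K \<Longrightarrow> unit_normals K x = M x"
  using unit_normals_iff[OF compact, of x] frontier_subset frontier_iff_g by (auto simp: M_def)

text \<open>A closed set is projected along the compact sphere. This gives the measurability of the
  normal map \<open>N\<close> and the compactness of the boundary pieces
  \<open>touch F\<close>.\<close>

lemma closed_M_hits:
  assumes "closed F" shows "closed {x. M x \<inter> F \<noteq> {}}"
proof -
  have "{x. M x \<inter> F \<noteq> {}} = {y. \<exists>u. u \<in> sphere 0 1 \<and> (u, y) \<in> {(u, x). u \<in> F \<and> x \<bullet> u = g x * h u}}"
    by (auto simp: M_def)
  moreover have "closed {(u, x). u \<in> F \<and> x \<bullet> u = g x * h u}"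
  proof -
    have "{(u, x). u \<in> F \<and> x \<bullet> u = g x * h u} = (F \<times> UNIV) \<inter> {z. snd z \<bullet> fst z = g (snd z) * h (fst z)}" by auto
    moreover have "closed {z. snd z \<bullet> fst z = g (snd z) * h (fst z)}"
      by (intro closed_Collect_eq continuous_intros continuous_on_compose2[OF continuous_g] continuous_on_compose2[OF continuous_h]) auto
    ultimately show ?thesis using assms by (auto intro: closed_Times)
  qed
  ultimately show ?thesis using closed_compact_projection[OF compact_sphere, of _ 0 1] by (simp only:)
qed

text \<open>The two quotients are the components in direction \<open>b\<close> of two subgradients
  of the gauge. Asking for a jump of size \<open>1 / real (Suc k)\<close>, not just for a
  difference, makes the set closed.\<close>

definition sing_at :: "'a \<Rightarrow> nat \<Rightarrow> 'a set" where
  "sing_at b k = {x. \<exists>u\<in>M x. \<exists>v\<in>M x. u \<bullet> b / h u - v \<bullet> b / h v \<ge> 1 / real (Suc k)}"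

definition sing :: "'a set" where "sing = (\<Union>b\<in>Basis. \<Union>k. sing_at b k)"

lemma closed_sing_at: "closed (sing_at b k)"
proof -
  let ?S = "sphere (0::'a) 1 \<times> sphere (0::'a) 1"
  let ?T = "{z. snd z \<bullet> fst (fst z) = g (snd z) * h (fst (fst z)) \<and> snd z \<bullet> snd (fst z) = g (snd z) * h (snd (fst z))
     \<and> 1 / real (Suc k) * (h (fst (fst z)) * h (snd (fst z))) \<le> fst (fst z) \<bullet> b * h (snd (fst z)) - snd (fst z) \<bullet> b * h (fst (fst z))}"
  have "closed ?T"
    by (intro closed_Collect_conj closed_Collect_eq closed_Collect_le continuous_intros
        continuous_on_compose2[OF continuous_g] continuous_on_compose2[OF continuous_h]) auto
  then have "closed {y. \<exists>z. z \<in> ?S \<and> (z, y) \<in> ?T}"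
    by (intro closed_compact_projection compact_Times compact_sphere)
  also have "{y. \<exists>z. z \<in> ?S \<and> (z, y) \<in> ?T} = sing_at b k"
  proof -
    have *: "1 / real (Suc k) * (h u * h v) \<le> u \<bullet> b * h v - v \<bullet> b * h u \<longleftrightarrow> u \<bullet> b / h u - v \<bullet> b / h v \<ge> 1 / real (Suc k)"
      if "norm u = 1" "norm v = 1" for u v
    proof -
      have "u \<bullet> b / h u - v \<bullet> b / h v = (u \<bullet> b * h v - v \<bullet> b * h u) / (h u * h v)"
        using h_pos[OF that(1)] h_pos[OF that(2)] by (simp add: diff_frac_eq)
      then show ?thesis using h_pos[OF that(1)] h_pos[OF that(2)] by (simp only: pos_le_divide_eq mult_pos_pos)
    qed
    show ?thesis
    proof (intro set_eqI iffI)
      fix y assume "y \<in> {y. \<exists>z. z \<in> ?S \<and> (z, y) \<in> ?T}"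
      then obtain u v where uv: "norm u = 1" "norm v = 1" "y \<bullet> u = g y * h u" "y \<bullet> v = g y * h v"
        "1 / real (Suc k) * (h u * h v) \<le> u \<bullet> b * h v - v \<bullet> b * h u" by auto
      then show "y \<in> sing_at b k" unfolding sing_at_def M_def using *[OF uv(1,2)] by blast
    next
      fix y assume "y \<in> sing_at b k"
      then obtain u v where uv: "norm u = 1" "norm v = 1" "y \<bullet> u = g y * h u" "y \<bullet> v = g y * h v"
        "u \<bullet> b / h u - v \<bullet> b / h v \<ge> 1 / real (Suc k)" by (auto simp: sing_at_def M_def)
      then show "y \<in> {y. \<exists>z. z \<in> ?S \<and> (z, y) \<in> ?T}"
        using *[OF uv(1,2)] by (intro CollectI exI[of _ "(u,v)"]) simp
    qed
  qed
  finally show ?thesis .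
qed

lemma sing_borel [measurable]: "sing \<in> sets borel"
proof -
  have "(\<Union>k. sing_at b k) \<in> sets borel" for b
    by (intro sets.countable_UN) (auto intro: borel_closed closed_sing_at)
  then show ?thesis unfolding sing_def by (rule sets.finite_UN[OF finite_Basis])
qed

text \<open>Subgradients of the gauge along a line are monotone, so jumps of a directional derivative occur
  at countably many points only.\<close>

lemma sing_at_line_countable: "countable {s::real. x + s *\<^sub>R b \<in> sing_at b k}"
proof -
  let ?S = "{s::real. x + s *\<^sub>R b \<in> sing_at b k}"
  define y where "y s = x + s *\<^sub>R b" for s :: real
  define d where "d u = u \<bullet> b / h u" for u :: 'a
  \<comment> \<open>A rational strictly inside the jump at \<open>s\<close>. By monotonicity the
    jumps at different parameters do not overlap, so the choice is injective.\<close>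
  have "\<exists>q::rat. \<exists>u\<in>M (y s). \<exists>v\<in>M (y s). d v < of_rat q \<and> of_rat q < d u" if s: "s \<in> ?S" for s
  proof -
    obtain u v where uv: "u \<in> M (y s)" "v \<in> M (y s)" "d u - d v \<ge> 1 / real (Suc k)"
      using s by (auto simp: sing_at_def y_def d_def)
    have "0 < 1 / real (Suc k)" by simp
    with uv have "d v < d u" by linarith
    then obtain q where "d v < of_rat q" "of_rat q < d u" using of_rat_dense by blast
    with uv show ?thesis by blast
  qed
  then obtain q :: "real \<Rightarrow> rat" where q: "\<And>s. s \<in> ?S \<Longrightarrow> \<exists>u\<in>M (y s). \<exists>v\<in>M (y s). d v < of_rat (q s) \<and> of_rat (q s) < d u"
    by metis
  have mono: "d u \<le> d v" if "s < s'" "u \<in> M (y s)" "v \<in> M (y s')" for s s' u v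
  proof -
    have sub: "g z + (w - z) \<bullet> u / h u \<le> g w" if "u \<in> M z" for z w u
    proof -
      have "(w - z) \<bullet> u \<le> (g w - g z) * h u"
        using g_upper[OF M_norm[OF that], of w] M_eq[OF that] by (simp add: inner_diff_left left_diff_distrib)
      then show ?thesis using h_pos[OF M_norm[OF that]] by (simp add: le_diff_eq[symmetric] add.commute[of "g z"] pos_divide_le_eq)
    qed
    have "g (y s) + (y s' - y s) \<bullet> u / h u \<le> g (y s')" by (rule sub) fact
    moreover have "g (y s') + (y s - y s') \<bullet> v / h v \<le> g (y s)" by (rule sub) fact
    moreover have "(y s' - y s) \<bullet> u / h u = (s' - s) * d u" "(y s - y s') \<bullet> v / h v = - ((s' - s) * d v)"
    proof -
      have "y s' - y s = (s' - s) *\<^sub>R b" "y s - y s' = - ((s' - s) *\<^sub>R b)" by (auto simp: y_def scaleR_left_diff_distrib)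
      then show "(y s' - y s) \<bullet> u / h u = (s' - s) * d u" "(y s - y s') \<bullet> v / h v = - ((s' - s) * d v)"
        by (simp_all add: d_def inner_commute[of b])
    qed
    ultimately have "(s' - s) * d u \<le> (s' - s) * d v" by linarith
    then show ?thesis using that(1) by simp
  qed
  have lt: "q s < q s'" if l: "s < s'" "s \<in> ?S" "s' \<in> ?S" for s s'
  proof -
    obtain u where u: "u \<in> M (y s)" "of_rat (q s) < d u" using q[OF l(2)] by blast
    obtain v where v: "v \<in> M (y s')" "d v < of_rat (q s')" using q[OF l(3)] by blast
    have "(of_rat (q s) :: real) < of_rat (q s')" using mono[OF l(1) u(1) v(1)] u v by linarith
    then show ?thesis by (simp add: of_rat_less)
  qed
  have "inj_on q ?S"
    by (rule inj_onI) (metis less_irrefl linorder_neqE_linordered_idom lt)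
  then show ?thesis using countable_image_inj_on[of q ?S] by (metis countableI_type)
qed

lemma sing_at_null: "sing_at b k \<in> null_sets lborel"
  by (rule lborel_null_if_lines_countable[of _ b]) (auto intro!: borel_closed closed_sing_at sing_at_line_countable)

lemma sing_null: "sing \<in> null_sets lborel"
proof -
  have "(\<Union>k. sing_at b k) \<in> null_sets lborel" for b
    by (intro null_sets_UN sing_at_null)
  then show ?thesis unfolding sing_def by (intro null_sets_UN'[OF countable_finite[OF finite_Basis]])
qed

lemma sing_scaleR: "t > 0 \<Longrightarrow> t *\<^sub>R x \<in> sing \<longleftrightarrow> x \<in> sing"
  by (auto simp: sing_def sing_at_def M_scaleR)

text \<open>Outside \<open>sing\<close> the vectors \<open>u /\<^sub>R h u\<close> agree in every
  coordinate, and the unit length then fixes the scalar factor.\<close>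

lemma M_unique:
  assumes "x \<notin> sing" "u \<in> M x" "v \<in> M x" shows "u = v"
proof -
  have le: "u \<bullet> b / h u - v \<bullet> b / h v \<le> 0" if "b \<in> Basis" "u \<in> M x" "v \<in> M x" for b u v
  proof (rule ccontr)
    assume "\<not> ?thesis"
    then obtain k where "inverse (real (Suc k)) < u \<bullet> b / h u - v \<bullet> b / h v"
      using reals_Archimedean[of "u \<bullet> b / h u - v \<bullet> b / h v"] by auto
    then have "x \<in> sing_at b k" using that by (force simp: sing_at_def inverse_eq_divide)
    then show False using assms(1) that by (auto simp: sing_def)
  qed
  have hu: "h u > 0" "h v > 0" using M_norm assms h_pos by auto
  have "u /\<^sub>R h u = v /\<^sub>R h v"
  proof (rule euclidean_eqI)
    fix b :: 'a assume "b \<in> Basis"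
    then show "(u /\<^sub>R h u) \<bullet> b = (v /\<^sub>R h v) \<bullet> b"
      using le[of b u v] le[of b v u] assms by (simp add: divide_inverse mult.commute)
  qed
  then have *: "h u *\<^sub>R (u /\<^sub>R h u) = h u *\<^sub>R (v /\<^sub>R h v)" by simp
  have **: "u = (h u / h v) *\<^sub>R v" using * hu by (simp add: divide_inverse)
  have "norm u = (h u / h v) * norm v" by (subst **) (use hu in simp)
  then have "h u / h v = 1" using M_norm[OF assms(2)] M_norm[OF assms(3)] by simp
  then show ?thesis using ** by simp
qed

text \<open>The outer unit normal where the ray through \<open>x\<close> leaves \<open>K\<close>; a dummy unit vector at singular points.\<close>

definition N :: "'a \<Rightarrow> 'a" where
  "N x = (if x \<in> sing then SOME b. b \<in> Basis else THE u. u \<in> M x)"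

lemma M_eq_N: assumes "x \<notin> sing" shows "M x = {N x}"
proof -
  obtain u where u: "u \<in> M x" using M_nonempty by blast
  have "(THE u. u \<in> M x) = u" by (rule the_equality) (use u M_unique[OF assms] in auto)
  then show ?thesis using u M_unique[OF assms] assms by (auto simp: N_def)
qed

lemma norm_N: "norm (N x) = 1"
proof (cases "x \<in> sing")
  case True
  have "(SOME b::'a. b \<in> Basis) \<in> Basis" using nonempty_Basis by (metis some_in_eq)
  then show ?thesis using True by (simp add: N_def)
next
  case False
  then show ?thesis using M_eq_N[OF False] M_norm by auto
qed

lemma N_borel [measurable]: "N \<in> borel \<rightarrow>\<^sub>M borel"
proof (rule borel_measurableI)
  fix U :: "'a set" assume "open U"
  define e where "e = (SOME b::'a. b \<in> Basis)"
  have Ne: "N x = e" if "x \<in> sing" for x using that by (simp add: N_def e_def)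
  have "N -` U = (if e \<in> U then sing else {}) \<union> (- {x. M x \<inter> (- U) \<noteq> {}} - sing)"
  proof (intro set_eqI iffI)
    fix x assume "x \<in> N -` U"
    then show "x \<in> (if e \<in> U then sing else {}) \<union> (- {x. M x \<inter> (- U) \<noteq> {}} - sing)"
      using M_eq_N[of x] Ne[of x] by (cases "x \<in> sing") auto
  next
    fix x assume "x \<in> (if e \<in> U then sing else {}) \<union> (- {x. M x \<inter> (- U) \<noteq> {}} - sing)"
    then show "x \<in> N -` U"
      using M_eq_N[of x] Ne[of x] by (cases "x \<in> sing") (auto split: if_splits)
  qed
  moreover have "closed {x. M x \<inter> (- U) \<noteq> {}}"
    by (rule closed_M_hits) (rule closed_Compl[OF \<open>open U\<close>])
  then have "- {x. M x \<inter> (- U) \<noteq> {}} - sing \<in> sets borel"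
    by (intro sets.Diff borel_comp borel_closed sing_borel)
  moreover have "(if e \<in> U then sing else {}) \<in> sets borel" using sing_borel by (cases "e \<in> U") simp_all
  ultimately show "N -` U \<inter> space borel \<in> sets borel" by (simp only: sets.Un space_borel Int_UNIV_right)
qed

end

section \<open>Surface area measure and cone-volume measure\<close>

text \<open>Inner regularity of the finite measure \<open>\<alpha>\<close> leads from compact sets
  to Borel sets inside one ball, and disjoint pieces add up because the factor \<open>k\<close> is
  common to all balls.\<close>

lemma finite_measures_le_by_pieces:
  fixes \<alpha> \<beta> :: "'a::euclidean_space measure"
  assumes sets: "sets \<alpha> = sets borel" "sets \<beta> = sets borel" and fin: "emeasure \<alpha> (space \<alpha>) \<noteq> \<infinity>"
    and C: "finite C" and cover: "emeasure \<alpha> (- (\<Union>u\<in>C. cball u \<epsilon>)) = 0"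
    and le: "\<And>u F. u \<in> C \<Longrightarrow> compact F \<Longrightarrow> F \<subseteq> cball u \<epsilon> \<Longrightarrow> emeasure \<alpha> F \<le> k * emeasure \<beta> F"
    and B: "B \<in> sets borel"
  shows "emeasure \<alpha> B \<le> k * emeasure \<beta> B"
proof -
  have piece: "emeasure \<alpha> B \<le> k * emeasure \<beta> B" if B: "B \<in> sets borel" "B \<subseteq> cball u \<epsilon>" and u: "u \<in> C" for B u
  proof -
    have "emeasure \<alpha> B = (SUP F \<in> {F. F \<subseteq> B \<and> compact F}. emeasure \<alpha> F)"
      by (rule inner_regular[OF sets(1) fin B(1)])
    also have "\<dots> \<le> k * emeasure \<beta> B"
    proof (rule SUP_least)
      fix F assume F: "F \<in> {F. F \<subseteq> B \<and> compact F}"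
      then have "emeasure \<alpha> F \<le> k * emeasure \<beta> F" using B u by (intro le[of u]) auto
      also have "\<dots> \<le> k * emeasure \<beta> B" using F B sets by (intro mult_left_mono emeasure_mono) auto
      finally show "emeasure \<alpha> F \<le> k * emeasure \<beta> B" .
    qed
    finally show ?thesis .
  qed
  have "emeasure \<alpha> (B \<inter> (\<Union>u\<in>D. cball u \<epsilon>)) \<le> k * emeasure \<beta> (B \<inter> (\<Union>u\<in>D. cball u \<epsilon>))" if "finite D" "D \<subseteq> C" for D
    using that
  proof (induction D)
    case (insert u D)
    let ?U = "\<Union>u\<in>D. cball u \<epsilon>"
    have U: "?U \<in> sets borel" using insert by (intro sets.finite_UN) auto
    have split: "B \<inter> (\<Union>u\<in>insert u D. cball u \<epsilon>) = (B \<inter> ?U) \<union> (B \<inter> cball u \<epsilon> - ?U)" by auto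
    have m: "B \<inter> ?U \<in> sets borel" "B \<inter> cball u \<epsilon> - ?U \<in> sets borel" using U B by auto
    have "emeasure \<alpha> (B \<inter> (\<Union>u\<in>insert u D. cball u \<epsilon>)) = emeasure \<alpha> (B \<inter> ?U) + emeasure \<alpha> (B \<inter> cball u \<epsilon> - ?U)"
      unfolding split by (rule plus_emeasure[symmetric]) (use m sets in auto)
    also have "\<dots> \<le> k * emeasure \<beta> (B \<inter> ?U) + k * emeasure \<beta> (B \<inter> cball u \<epsilon> - ?U)"
    proof (rule add_mono)
      show "emeasure \<alpha> (B \<inter> ?U) \<le> k * emeasure \<beta> (B \<inter> ?U)" using insert by blast
      show "emeasure \<alpha> (B \<inter> cball u \<epsilon> - ?U) \<le> k * emeasure \<beta> (B \<inter> cball u \<epsilon> - ?U)"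
        by (rule piece[OF m(2), of u]) (use insert in auto)
    qed
    also have "\<dots> = k * (emeasure \<beta> (B \<inter> ?U) + emeasure \<beta> (B \<inter> cball u \<epsilon> - ?U))"
      by (rule distrib_left[symmetric])
    also have "emeasure \<beta> (B \<inter> ?U) + emeasure \<beta> (B \<inter> cball u \<epsilon> - ?U) = emeasure \<beta> (B \<inter> (\<Union>u\<in>insert u D. cball u \<epsilon>))"
      unfolding split by (rule plus_emeasure) (use m sets in auto)
    finally show ?case .
  qed simp
  note all = this[OF C order_refl]
  define U where "U = (\<Union>u\<in>C. cball u \<epsilon>)"
  have 1: "emeasure \<alpha> (B \<inter> U) \<le> k * emeasure \<beta> (B \<inter> U)" unfolding U_def by (rule all)
  have U: "U \<in> sets borel" unfolding U_def using C by (intro sets.finite_UN) auto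
  have m: "B \<inter> U \<in> sets \<alpha>" "- U \<in> sets \<alpha>" "B \<in> sets \<beta>"
    using sets.Int[OF B U] borel_comp[OF U] B unfolding sets by simp_all
  have "emeasure \<alpha> B \<le> emeasure \<alpha> ((B \<inter> U) \<union> - U)"
    by (rule emeasure_mono) (use sets.Un[OF m(1,2)] in auto)
  also have "\<dots> \<le> emeasure \<alpha> (B \<inter> U) + emeasure \<alpha> (- U)"
    by (rule emeasure_subadditive[OF m(1,2)])
  also have "\<dots> \<le> k * emeasure \<beta> (B \<inter> U)" using 1 cover by (simp add: U_def)
  also have "\<dots> \<le> k * emeasure \<beta> B" by (intro mult_left_mono emeasure_mono m(3)) auto
  finally show ?thesis .
qed

lemma sphere_finite_cover:
  assumes "\<epsilon> > 0"
  obtains C where "finite C" "C \<subseteq> sphere (0::'a::euclidean_space) 1" "sphere 0 1 \<subseteq> (\<Union>u\<in>C. cball u \<epsilon>)"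
proof -
  have cov: "sphere (0::'a) 1 \<subseteq> (\<Union>u\<in>sphere 0 1. ball u \<epsilon>)"
  proof
    fix x :: 'a assume "x \<in> sphere 0 1"
    then show "x \<in> (\<Union>u\<in>sphere 0 1. ball u \<epsilon>)" using assms by (intro UN_I[of x]) simp_all
  qed
  obtain C where C: "C \<subseteq> sphere (0::'a) 1" "finite C" "sphere 0 1 \<subseteq> (\<Union>u\<in>C. ball u \<epsilon>)"
    by (rule compactE_image[OF compact_sphere _ cov]) (rule open_ball)
  have "(\<Union>u\<in>C. ball u \<epsilon>) \<subseteq> (\<Union>u\<in>C. cball u \<epsilon>)" by (rule UN_mono) auto
  with C(3) have "sphere 0 1 \<subseteq> (\<Union>u\<in>C. cball u \<epsilon>)" by (rule subset_trans)
  with C show ?thesis by (intro that)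
qed

context body_around_0
begin

text \<open>Known as the reverse spherical image of \<open>F\<close>.\<close>

definition touch :: "'a set \<Rightarrow> 'a set" where "touch F = {x \<in> frontier K. M x \<inter> F \<noteq> {}}"

lemma compact_frontier: "compact (frontier K)"
  using compact by (simp add: compact_frontier_bounded compact_imp_bounded)

lemma compact_touch: assumes "closed F" shows "compact (touch F)"
proof -
  have "touch F = frontier K \<inter> {x. M x \<inter> F \<noteq> {}}" by (auto simp: touch_def)
  then show ?thesis using compact_Int_closed[OF compact_frontier closed_M_hits[OF assms]] by simp
qed

text \<open>The normals are constant along rays, so the cone is described by \<open>M\<close>
  alone.\<close>

lemma cone_touch: "cone (touch F) = {x \<in> K. x \<noteq> 0 \<and> M x \<inter> F \<noteq> {}}"
proof (intro set_eqI iffI)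
  fix x assume "x \<in> cone (touch F)"
  then obtain t a where t: "x = t *\<^sub>R a" "0 < t" "t \<le> 1" "a \<in> frontier K" "M a \<inter> F \<noteq> {}"
    by (auto simp: cone_def touch_def)
  have "a \<noteq> 0" using t(4) zero_notin_frontier by auto
  moreover have "x \<in> K" using t frontier_iff_g[of a] by (simp add: mem_iff_g g_scaleR)
  ultimately show "x \<in> {x \<in> K. x \<noteq> 0 \<and> M x \<inter> F \<noteq> {}}" using t by (simp add: M_scaleR)
next
  fix x assume "x \<in> {x \<in> K. x \<noteq> 0 \<and> M x \<inter> F \<noteq> {}}"
  then have x: "g x \<le> 1" "0 < g x" "M x \<inter> F \<noteq> {}" using mem_iff_g g_pos by auto
  have "x = g x *\<^sub>R ((1 / g x) *\<^sub>R x)" using x by simp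
  moreover have "(1 / g x) *\<^sub>R x \<in> touch F"
    using x by (simp add: touch_def frontier_iff_g g_scaleR M_scaleR)
  ultimately show "x \<in> cone (touch F)" using x by (auto simp: cone_def)
qed

lemma cone_subset: "A \<subseteq> frontier K \<Longrightarrow> cone A \<subseteq> K"
  unfolding cone_def using frontier_iff_g by (force simp: mem_iff_g g_scaleR)

lemma flat_touch:
  assumes "A \<subseteq> touch (cball u \<epsilon>)" "a \<in> A"
  shows "\<exists>v. norm v = 1 \<and> a \<bullet> v = h v \<and> norm (v - u) \<le> \<epsilon>"
proof -
  have "a \<in> touch (cball u \<epsilon>)" using assms by blast
  then obtain v where v: "v \<in> M a" "v \<in> cball u \<epsilon>" "a \<in> frontier K" unfolding touch_def by blast
  then have "g a = 1" by (simp add: frontier_iff_g)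
  then show ?thesis using v by (intro exI[of _ v]) (auto simp: M_def dist_norm norm_minus_commute)
qed

text \<open>The radius \<open>r / (16 * R)\<close> makes the distortion \<open>q\<close> in
  \<open>flat_piece\<close> equal to 1/2. A bound as crude as this suffices for null sets and for
  finiteness.\<close>

lemma half_flat_bound:
  assumes A: "A \<subseteq> touch (cball u (r / (16 * R)))" "compact A" and u: "norm u = 1"
  obtains k :: real where "k > 0" "ennreal k * hausdorff_measure (DIM('a) - 1) A \<le> emeasure lborel (cone A)"
proof -
  obtain c where c: "c > 0" "\<forall>u::'a. norm u = 1 \<longrightarrow> (\<forall>B\<in>sets borel. B \<subseteq> {x. x \<bullet> u = 1} \<longrightarrow>
        hausdorff_measure (DIM('a) - 1) B = ennreal c * emeasure (cone_measure u) B)"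
    using hausdorff_plane_eq_cone_measure[where 'a='a] by blast
  note cc = c(2)[rule_format]
  have "A \<subseteq> frontier K" using A by (auto simp: touch_def)
  then have "ennreal ((1 - 1/2) ^ (2 * DIM('a)) * h u) * hausdorff_measure (DIM('a) - 1) A \<le> ennreal c * emeasure lborel (cone A)"
    by (intro flat_piece(1)[where \<epsilon>="r / (16 * R)"] u A cc flat_touch[OF A(1)]) (use r_pos R_pos in auto)
  then have "ennreal (1/c) * (ennreal ((1 - 1/2) ^ (2 * DIM('a)) * h u) * hausdorff_measure (DIM('a) - 1) A)
     \<le> ennreal (1/c) * (ennreal c * emeasure lborel (cone A))"
    by (rule mult_left_mono) simp
  also have "\<dots> = emeasure lborel (cone A)"
    using c(1) by (simp add: mult.assoc[symmetric] ennreal_mult[symmetric])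
  also have "ennreal (1/c) * (ennreal ((1 - 1/2) ^ (2 * DIM('a)) * h u) * hausdorff_measure (DIM('a) - 1) A)
     = ennreal ((1/c) * ((1 - 1/2) ^ (2 * DIM('a)) * h u)) * hausdorff_measure (DIM('a) - 1) A"
    using c(1) h_pos[OF u] by (subst mult.assoc[symmetric], subst ennreal_mult[symmetric]) auto
  finally show ?thesis
    using that[of "(1/c) * ((1 - 1/2) ^ (2 * DIM('a)) * h u)"] c(1) h_pos[OF u] by auto
qed

abbreviation HM where "HM \<equiv> hausdorff_borel (DIM('a) - 1) :: 'a measure"

text \<open>The singular set is invariant under dilations, so the cone over the singular part of a
  flat boundary piece is Lebesgue null; the half-flat bound turns this into a Hausdorff null
  set.\<close>

lemma frontier_sing_null: "frontier K \<inter> sing \<in> null_sets HM"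
proof -
  have e: "r / (16 * R) > 0" using r_pos R_pos by simp
  obtain C where C: "finite C" "C \<subseteq> sphere (0::'a) 1" "sphere 0 1 \<subseteq> (\<Union>u\<in>C. cball u (r / (16 * R)))"
    using sphere_finite_cover[OF e] by metis
  have 1: "touch (cball u (r / (16 * R))) \<inter> sing_at b k \<in> null_sets HM" if "u \<in> C" "b \<in> Basis" for u b k
  proof -
    let ?A = "touch (cball u (r / (16 * R))) \<inter> sing_at b k"
    have cA: "compact ?A" by (intro compact_Int_closed compact_touch closed_cball closed_sing_at)
    have u: "norm u = 1" using C that by auto
    obtain k' where k: "k' > 0" "ennreal k' * hausdorff_measure (DIM('a) - 1) ?A \<le> emeasure lborel (cone ?A)"
      using half_flat_bound[OF _ cA u] by blast
    have "?A \<subseteq> sing" using that(2) by (auto simp: sing_def)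
    then have "cone ?A \<subseteq> sing" unfolding cone_def using sing_scaleR by auto
    then have "emeasure lborel (cone ?A) \<le> emeasure lborel sing" by (intro emeasure_mono) simp_all
    also have "\<dots> = 0" using sing_null by auto
    finally have "ennreal k' * hausdorff_measure (DIM('a) - 1) ?A = 0" using k by simp
    then have "hausdorff_measure (DIM('a) - 1) ?A = 0" using k(1) by simp
    then show ?thesis using cA by (simp add: null_sets_def emeasure_hausdorff_borel borel_closed compact_imp_closed)
  qed
  have "frontier K \<inter> sing = (\<Union>u\<in>C. \<Union>b\<in>Basis. \<Union>k. touch (cball u (r / (16 * R))) \<inter> sing_at b k)"
  proof (intro set_eqI iffI)
    fix x assume x: "x \<in> frontier K \<inter> sing"
    obtain v where v: "v \<in> M x" using M_nonempty by blast
    then have "v \<in> sphere 0 1" by (simp add: M_def)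
    then obtain u where "u \<in> C" "v \<in> cball u (r / (16 * R))" using C(3) by blast
    then have "x \<in> touch (cball u (r / (16 * R)))" using x v unfolding touch_def by blast
    then show "x \<in> (\<Union>u\<in>C. \<Union>b\<in>Basis. \<Union>k. touch (cball u (r / (16 * R))) \<inter> sing_at b k)"
      using x \<open>u \<in> C\<close> unfolding sing_def by blast
  qed (auto simp: touch_def sing_def)
  also have "\<dots> \<in> null_sets HM"
  proof -
    have "(\<Union>k. touch (cball u (r / (16 * R))) \<inter> sing_at b k) \<in> null_sets HM" if "u \<in> C" "b \<in> Basis" for u b
      by (intro null_sets_UN 1 that)
    then have "(\<Union>b\<in>Basis. \<Union>k. touch (cball u (r / (16 * R))) \<inter> sing_at b k) \<in> null_sets HM" if "u \<in> C" for u
      using that by (intro null_sets_UN'[OF countable_finite[OF finite_Basis]])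
    then show ?thesis by (intro null_sets_UN'[OF countable_finite[OF C(1)]])
  qed
  finally show ?thesis .
qed

text \<open>Finitely many flat pieces cover the boundary, and the cone over each of them lies in the
  bounded set K.\<close>

lemma emeasure_frontier_finite: "emeasure HM (frontier K) < \<infinity>"
proof -
  have e: "r / (16 * R) > 0" using r_pos R_pos by simp
  obtain C where C: "finite C" "C \<subseteq> sphere (0::'a) 1" "sphere 0 1 \<subseteq> (\<Union>u\<in>C. cball u (r / (16 * R)))"
    using sphere_finite_cover[OF e] by metis
  let ?A = "\<lambda>u. touch (cball u (r / (16 * R)))"
  have fin: "emeasure HM (?A u) < \<infinity>" if "u \<in> C" for u
  proof -
    have cA: "compact (?A u)" by (intro compact_touch closed_cball)
    have u: "norm u = 1" using C that by auto
    obtain k' where k: "k' > 0" "ennreal k' * hausdorff_measure (DIM('a) - 1) (?A u) \<le> emeasure lborel (cone (?A u))"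
      using half_flat_bound[OF order_refl cA u] by blast
    have "cone (?A u) \<subseteq> K" by (rule cone_subset) (auto simp: touch_def)
    then have "emeasure lborel (cone (?A u)) < \<infinity>"
      using compact_imp_bounded[OF compact] by (intro emeasure_bounded_finite) (rule bounded_subset)
    with k have "ennreal k' * hausdorff_measure (DIM('a) - 1) (?A u) < top" by (auto simp: order_le_less_trans)
    then have "hausdorff_measure (DIM('a) - 1) (?A u) < top"
      using k(1) by (auto simp: ennreal_mult_less_top)
    then show ?thesis using cA by (simp add: emeasure_hausdorff_borel borel_closed compact_imp_closed)
  qed
  have sub: "frontier K \<subseteq> (\<Union>u\<in>C. ?A u)"
  proof
    fix x assume x: "x \<in> frontier K"
    obtain v where v: "v \<in> M x" using M_nonempty by blast
    then have "v \<in> sphere 0 1" by (simp add: M_def)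
    then obtain u where "u \<in> C" "v \<in> cball u (r / (16 * R))" using C(3) by blast
    then have "x \<in> ?A u" using x v unfolding touch_def by blast
    then show "x \<in> (\<Union>u\<in>C. ?A u)" using \<open>u \<in> C\<close> by blast
  qed
  have m: "?A u \<in> sets HM" for u using compact_touch[of "cball u (r / (16 * R))"] by (simp add: borel_closed compact_imp_closed)
  have "emeasure HM (frontier K) \<le> emeasure HM (\<Union>u\<in>C. ?A u)"
    by (rule emeasure_mono[OF sub]) (use m C in blast)
  also have "\<dots> \<le> (\<Sum>u\<in>C. emeasure HM (?A u))"
    by (rule emeasure_subadditive_finite) (use m C in auto)
  also have "\<dots> < \<infinity>" using fin by (simp add: C(1))
  finally show ?thesis .
qed

text \<open>The surface area measure as a Borel measure on the whole space. At regular points the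
  normal is unique, so this is an image measure and its countable additivity is automatic.\<close>

definition \<sigma> :: "'a measure" where
  "\<sigma> = distr (density HM (indicator (frontier K - sing))) borel N"

text \<open>The cone-volume measure: the mass of a set of normals is the volume of that part of K
  whose rays leave K with such a normal.\<close>

definition \<nu> :: "'a measure" where
  "\<nu> = distr (density lborel (indicator (K - sing - {0}))) borel N"

lemma sets_\<sigma> [simp, measurable_cong]: "sets \<sigma> = sets borel" by (simp add: \<sigma>_def)
lemma space_\<sigma> [simp]: "space \<sigma> = UNIV" by (simp add: \<sigma>_def)
lemma sets_\<nu> [simp, measurable_cong]: "sets \<nu> = sets borel" by (simp add: \<nu>_def)
lemma space_\<nu> [simp]: "space \<nu> = UNIV" by (simp add: \<nu>_def)

lemma N_vimage: "B \<in> sets borel \<Longrightarrow> N -` B \<in> sets borel"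
  using measurable_sets[OF N_borel, of B] by simp

lemma frontier_borel [measurable]: "frontier K \<in> sets borel"
  by (rule borel_closed) (rule frontier_closed)

lemma K_borel [measurable]: "K \<in> sets borel"
  by (rule borel_closed) (rule compact_imp_closed[OF compact])

lemma emeasure_\<sigma>:
  assumes B: "B \<in> sets borel"
  shows "emeasure \<sigma> B = hausdorff_measure (DIM('a) - 1) ((frontier K - sing) \<inter> N -` B)"
proof -
  have m: "frontier K - sing \<in> sets borel" by measurable
  have "emeasure \<sigma> B = emeasure (density HM (indicator (frontier K - sing))) (N -` B)"
    unfolding \<sigma>_def by (subst emeasure_distr) (use B in auto)
  also have "\<dots> = emeasure HM ((frontier K - sing) \<inter> N -` B)"
    by (rule emeasure_restricted) (use m N_vimage[OF B] in auto)
  also have "\<dots> = hausdorff_measure (DIM('a) - 1) ((frontier K - sing) \<inter> N -` B)"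
    using m N_vimage[OF B] by (intro emeasure_hausdorff_borel) auto
  finally show ?thesis .
qed

lemma emeasure_\<nu>:
  assumes B: "B \<in> sets borel"
  shows "emeasure \<nu> B = emeasure lborel ((K - sing - {0}) \<inter> N -` B)"
proof -
  have m: "K - sing - {0} \<in> sets borel" by measurable
  have "emeasure \<nu> B = emeasure (density lborel (indicator (K - sing - {0}))) (N -` B)"
    unfolding \<nu>_def by (subst emeasure_distr) (use B in auto)
  also have "\<dots> = emeasure lborel ((K - sing - {0}) \<inter> N -` B)"
    by (rule emeasure_restricted) (use m N_vimage[OF B] in auto)
  finally show ?thesis .
qed

lemma finite_\<sigma>: "emeasure \<sigma> UNIV < \<infinity>"
proof -
  have "emeasure \<sigma> UNIV = emeasure HM ((frontier K - sing) \<inter> N -` UNIV)"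
    by (subst emeasure_\<sigma>) (auto simp: emeasure_hausdorff_borel)
  also have "\<dots> \<le> emeasure HM (frontier K)" by (intro emeasure_mono) auto
  finally show ?thesis using emeasure_frontier_finite by simp
qed

lemma finite_\<nu>: "emeasure \<nu> UNIV < \<infinity>"
proof -
  have "emeasure \<nu> UNIV \<le> emeasure lborel K"
    by (subst emeasure_\<nu>) (auto intro!: emeasure_mono)
  also have "\<dots> < \<infinity>" by (rule emeasure_bounded_finite) (rule compact_imp_bounded[OF compact])
  finally show ?thesis .
qed

lemma AE_\<sigma>: "AE u in \<sigma>. norm u = 1"
  unfolding \<sigma>_def by (subst AE_distr_iff) (auto simp: norm_N)

lemma AE_\<nu>: "AE u in \<nu>. norm u = 1"
  unfolding \<nu>_def by (subst AE_distr_iff) (auto simp: norm_N)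

text \<open>The two sets of boundary points differ by singular ones only, which form a null set.
  Monotonicity and subadditivity of the outer measure handle the set on the left without a proof
  that it is Borel.\<close>

lemma normals_hit_measure:
  assumes B: "B \<in> sets borel"
  shows "hausdorff_measure (DIM('a) - 1) {x \<in> frontier K. M x \<inter> B \<noteq> {}} = emeasure \<sigma> B"
proof (rule antisym)
  have sub: "(frontier K - sing) \<inter> N -` B \<subseteq> {x \<in> frontier K. M x \<inter> B \<noteq> {}}" using M_eq_N by auto
  show "emeasure \<sigma> B \<le> hausdorff_measure (DIM('a) - 1) {x \<in> frontier K. M x \<inter> B \<noteq> {}}"
    unfolding emeasure_\<sigma>[OF B] by (rule hausdorff_measure_mono[OF sub])
  have "{x \<in> frontier K. M x \<inter> B \<noteq> {}} \<subseteq> ((frontier K - sing) \<inter> N -` B) \<union> (frontier K \<inter> sing)" using M_eq_N by force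
  then have "hausdorff_measure (DIM('a) - 1) {x \<in> frontier K. M x \<inter> B \<noteq> {}}
    \<le> hausdorff_measure (DIM('a) - 1) (((frontier K - sing) \<inter> N -` B) \<union> (frontier K \<inter> sing))" by (rule hausdorff_measure_mono)
  also have "\<dots> \<le> emeasure \<sigma> B + hausdorff_measure (DIM('a) - 1) (frontier K \<inter> sing)"
    unfolding emeasure_\<sigma>[OF B] by (rule hausdorff_measure_Un)
  also have "hausdorff_measure (DIM('a) - 1) (frontier K \<inter> sing) = 0"
    using frontier_sing_null by (simp add: null_sets_def emeasure_hausdorff_borel)
  finally show "hausdorff_measure (DIM('a) - 1) {x \<in> frontier K. M x \<inter> B \<noteq> {}} \<le> emeasure \<sigma> B" by simp
qed

lemma emeasure_cone_touch:
  assumes F: "closed F"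
  shows "emeasure lborel (cone (touch F)) = emeasure \<nu> F"
proof -
  have Fb: "F \<in> sets borel" using F by (rule borel_closed)
  have cb: "cone (touch F) \<in> sets borel"
    by (intro cone_borel compact_touch F) (use zero_notin_frontier in \<open>auto simp: touch_def\<close>)
  have "emeasure lborel (cone (touch F)) = emeasure lborel (cone (touch F) - sing)"
    by (rule emeasure_Diff_null_set[symmetric]) (use sing_null cb in auto)
  also have "cone (touch F) - sing = (K - sing - {0}) \<inter> N -` F"
    unfolding cone_touch using M_eq_N by auto
  finally show ?thesis by (simp add: emeasure_\<nu>[OF Fb])
qed

lemma sets_sphere_borel: "\<omega> \<in> sets (sphere_borel :: 'a measure) \<longleftrightarrow> \<omega> \<in> sets borel \<and> \<omega> \<subseteq> sphere 0 1"
  by (subst sets_restrict_space_iff) auto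

text \<open>The defining set function agrees with \<open>\<sigma>\<close> on the Borel sets of the
  sphere; this supplies the countable additivity that \<open>measure_of\<close> demands.\<close>

lemma emeasure_surface_area_measure:
  assumes "\<omega> \<in> sets (sphere_borel :: 'a measure)"
  shows "emeasure (surface_area_measure K) \<omega> = emeasure \<sigma> \<omega>"
proof -
  let ?f = "\<lambda>\<omega>. hausdorff_measure (DIM('a) - 1) {x \<in> frontier K. unit_normals K x \<inter> \<omega> \<noteq> {}}"
  have f: "?f \<omega> = emeasure \<sigma> \<omega>" if "\<omega> \<in> sets (sphere_borel :: 'a measure)" for \<omega>
  proof -
    have "{x \<in> frontier K. unit_normals K x \<inter> \<omega> \<noteq> {}} = {x \<in> frontier K. M x \<inter> \<omega> \<noteq> {}}"
      using unit_normals_eq_M by auto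
    then show ?thesis using normals_hit_measure[of \<omega>] that sets_sphere_borel by auto
  qed
  have sp: "space (sphere_borel :: 'a measure) = sphere 0 1" by (simp add: space_restrict_space)
  have sa: "sigma_algebra (sphere (0::'a) 1) (sets sphere_borel)"
    using sets.sigma_algebra_axioms[of "sphere_borel :: 'a measure"] unfolding sp .
  show ?thesis
  proof (subst f[OF assms, symmetric], unfold surface_area_measure_def, rule emeasure_measure_of_sigma[OF sa])
    show "positive (sets sphere_borel) ?f"
      by (simp add: positive_def)
    show "countably_additive (sets (sphere_borel :: 'a measure)) ?f"
      unfolding countably_additive_def
    proof (intro allI impI)
      fix A :: "nat \<Rightarrow> 'a set"
      assume A: "range A \<subseteq> sets sphere_borel" "disjoint_family A" "\<Union> (range A) \<in> sets sphere_borel"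
      then have "A i \<in> sets \<sigma>" for i using sets_sphere_borel by auto
      then have "(\<Sum>i. emeasure \<sigma> (A i)) = emeasure \<sigma> (\<Union> (range A))" using A(2) by (intro suminf_emeasure) auto
      then show "(\<Sum>i. ?f (A i)) = ?f (\<Union> (range A))" using A f by auto
    qed
  qed (rule assms)
qed

lemma sets_surface_area_measure: "sets (surface_area_measure K) = sets (sphere_borel :: 'a measure)"
proof -
  have sp: "space (sphere_borel :: 'a measure) = sphere 0 1" by (simp add: space_restrict_space)
  have "sigma_sets (sphere 0 1) (sets (sphere_borel :: 'a measure)) = sets sphere_borel"
    using sets.sigma_sets_eq[of "sphere_borel :: 'a measure"] unfolding sp .
  moreover have "sets (sphere_borel :: 'a measure) \<subseteq> Pow (sphere 0 1)" using sets_sphere_borel by auto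
  ultimately show ?thesis unfolding surface_area_measure_def by (simp add: sets_measure_of)
qed

text \<open>A cone over a flat piece has volume base times height up to a constant factor. On
  patches of normals whose radius is proportional to \<open>q\<close> the two measures agree up to
  the factor \<open>C q\<close>; it tends to 1 with \<open>q\<close> tending to 0, and finiteness
  turns the inequalities into an identity.\<close>

lemma density_\<sigma>_eq_\<nu>:
  obtains c :: real where "c > 0"
    "\<And>B. B \<in> sets borel \<Longrightarrow> (\<integral>\<^sup>+u. ennreal (h u) * indicator B u \<partial>\<sigma>) = ennreal c * emeasure \<nu> B"
proof -
  obtain c where c: "c > 0" "\<forall>u::'a. norm u = 1 \<longrightarrow> (\<forall>B\<in>sets borel. B \<subseteq> {x. x \<bullet> u = 1} \<longrightarrow>
        hausdorff_measure (DIM('a) - 1) B = ennreal c * emeasure (cone_measure u) B)"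
    using hausdorff_plane_eq_cone_measure[where 'a='a] by blast
  note cc = c(2)[rule_format]
  have hm [measurable]: "h \<in> borel_measurable borel"
    by (rule borel_measurable_support_fun[OF compact nonempty])
  define \<alpha> where "\<alpha> = density \<sigma> (\<lambda>u. ennreal (h u))"
  define \<beta> where "\<beta> = density \<nu> (\<lambda>_. ennreal c)"
  have s: "sets \<alpha> = sets borel" "sets \<beta> = sets borel" by (auto simp: \<alpha>_def \<beta>_def)
  have sp: "space \<alpha> = UNIV" "space \<beta> = UNIV" by (auto simp: \<alpha>_def \<beta>_def)
  have borel_UNIV: "(UNIV :: 'a set) \<in> sets borel" by simp
  have ea: "emeasure \<alpha> B = (\<integral>\<^sup>+u. ennreal (h u) * indicator B u \<partial>\<sigma>)" if "B \<in> sets borel" for B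
    unfolding \<alpha>_def using that by (subst emeasure_density) auto
  have eb: "emeasure \<beta> B = ennreal c * emeasure \<nu> B" if "B \<in> sets borel" for B
    unfolding \<beta>_def using that by (subst emeasure_density_const) auto
  have fa: "emeasure \<alpha> UNIV < \<infinity>"
  proof -
    have "emeasure \<alpha> UNIV \<le> (\<integral>\<^sup>+u. ennreal R \<partial>\<sigma>)"
      unfolding ea[OF borel_UNIV]
      by (rule nn_integral_mono_AE) (use AE_\<sigma> in \<open>eventually_elim, auto intro: ennreal_leI h_le\<close>)
    also have "\<dots> < \<infinity>" using finite_\<sigma> by (simp add: ennreal_mult_less_top)
    finally show ?thesis .
  qed
  have fb: "emeasure \<beta> UNIV < \<infinity>" using finite_\<nu> by (simp add: eb ennreal_mult_less_top)
  have cov: "emeasure \<alpha> (- U) = 0" "emeasure \<beta> (- U) = 0" if "sphere 0 1 \<subseteq> U" "U \<in> sets borel" for U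
  proof -
    have "emeasure \<alpha> (- U) = (\<integral>\<^sup>+u. 0 \<partial>\<sigma>)"
      unfolding ea[OF borel_comp[OF that(2)]]
      by (rule nn_integral_cong_AE) (use AE_\<sigma> in \<open>eventually_elim, use that(1) in \<open>auto simp: indicator_def\<close>\<close>)
    then show "emeasure \<alpha> (- U) = 0" by simp
    have "emeasure \<nu> (- U) = (\<integral>\<^sup>+u. indicator (- U) u \<partial>\<nu>)" using that(2) by simp
    also have "\<dots> = (\<integral>\<^sup>+u. 0 \<partial>\<nu>)"
      by (rule nn_integral_cong_AE) (use AE_\<nu> in \<open>eventually_elim, use that(1) in \<open>auto simp: indicator_def\<close>\<close>)
    finally show "emeasure \<beta> (- U) = 0" using borel_comp[OF that(2)] by (simp add: eb)
  qed
  \<comment> \<open>The exponent 2n comes from \<open>flat_piece\<close>, the additional 1 from the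
    oscillation of \<open>h\<close> on a patch.\<close>
  define C where "C q = (1 + q) ^ (2 * DIM('a) + 1) / (1 - q) ^ (2 * DIM('a) + 1)" for q :: real
  have key: "emeasure \<alpha> F \<le> ennreal (C q) * emeasure \<beta> F \<and> emeasure \<beta> F \<le> ennreal (C q) * emeasure \<alpha> F"
    if q: "0 < q" "q < 1" and F: "compact F" "F \<subseteq> cball u (q * r / (8 * R))" and u: "norm u = 1" for q F u
  proof -
    let ?n2 = "2 * DIM('a)" and ?e = "q * r / (8 * R)"
    have e0: "?e \<ge> 0" using q r_pos R_pos by simp
    have qe: "q = 8 * ?e * R / r" using r_pos R_pos by simp
    have Fb: "F \<in> sets borel" "closed F" using F by (auto simp: borel_closed compact_imp_closed)
    let ?A = "touch F"
    have A: "compact ?A" "?A \<subseteq> frontier K" "?A \<subseteq> touch (cball u ?e)"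
      using compact_touch[OF Fb(2)] F(2) by (auto simp: touch_def)
    have HA: "hausdorff_measure (DIM('a) - 1) ?A = emeasure \<sigma> F" using normals_hit_measure[OF Fb(1)] by (simp add: touch_def)
    have LA: "emeasure lborel (cone ?A) = emeasure \<nu> F" by (rule emeasure_cone_touch[OF Fb(2)])
    note fl = flat_piece[OF cc u A(1,2) flat_touch[OF A(3)] qe q(2) e0, unfolded HA LA]
    have hu: "\<bar>h v - h u\<bar> \<le> q * h u" if "v \<in> F" for v
    proof -
      have "\<bar>h v - h u\<bar> \<le> R * norm (v - u)" by (rule h_lipschitz)
      also have "\<dots> \<le> R * ?e" using that F(2) R_pos by (intro mult_left_mono) (auto simp: dist_norm norm_minus_commute)
      also have "\<dots> = q * (r / 8)" using R_pos by simp
      also have "\<dots> \<le> q * h u" using h_ge[OF u] q r_pos by (intro mult_left_mono) auto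
      finally show ?thesis .
    qed
    have h0: "h u > 0" by (rule h_pos[OF u])
    have up: "emeasure \<alpha> F \<le> ennreal ((1 + q) * h u) * emeasure \<sigma> F"
    proof -
      have "emeasure \<alpha> F \<le> (\<integral>\<^sup>+v. ennreal ((1 + q) * h u) * indicator F v \<partial>\<sigma>)"
        unfolding ea[OF Fb(1)] using hu by (intro nn_integral_mono) (auto simp: indicator_def abs_le_iff algebra_simps intro!: ennreal_leI)
      also have "\<dots> = ennreal ((1 + q) * h u) * emeasure \<sigma> F" using Fb by (simp add: nn_integral_cmult_indicator)
      finally show ?thesis .
    qed
    have lo: "ennreal ((1 - q) * h u) * emeasure \<sigma> F \<le> emeasure \<alpha> F"
    proof -
      have "ennreal ((1 - q) * h u) * emeasure \<sigma> F = (\<integral>\<^sup>+v. ennreal ((1 - q) * h u) * indicator F v \<partial>\<sigma>)"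
        using Fb by (simp add: nn_integral_cmult_indicator)
      also have "\<dots> \<le> emeasure \<alpha> F"
        unfolding ea[OF Fb(1)]
      proof (intro nn_integral_mono)
        fix v
        show "ennreal ((1 - q) * h u) * indicator F v \<le> ennreal (h v) * indicator F v"
          using hu[of v] by (auto simp: indicator_def abs_le_iff algebra_simps intro!: ennreal_leI)
      qed
      finally show ?thesis .
    qed
    define p where "p = 1 - q"
    have p: "0 < p" "p \<le> 1" using q by (auto simp: p_def)
    have "emeasure \<alpha> F \<le> ennreal ((1 + q) / p ^ ?n2) * (ennreal (p ^ ?n2 * h u) * emeasure \<sigma> F)"
    proof -
      have "ennreal ((1 + q) / p ^ ?n2) * (ennreal (p ^ ?n2 * h u) * emeasure \<sigma> F)
          = ennreal (((1 + q) / p ^ ?n2) * (p ^ ?n2 * h u)) * emeasure \<sigma> F"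
        using p q h0 by (subst mult.assoc[symmetric], subst ennreal_mult[symmetric]) auto
      also have "((1 + q) / p ^ ?n2) * (p ^ ?n2 * h u) = (1 + q) * h u" using p by simp
      finally show ?thesis using up by simp
    qed
    also have "\<dots> \<le> ennreal ((1 + q) / p ^ ?n2) * emeasure \<beta> F"
      unfolding eb[OF Fb(1)] by (rule mult_left_mono[OF fl(1)[folded p_def]]) (assumption | rule zero_le)+
    also have "\<dots> \<le> ennreal (C q) * emeasure \<beta> F"
    proof (intro mult_right_mono ennreal_leI)
      show "(1 + q) / p ^ ?n2 \<le> C q"
        unfolding C_def p_def[symmetric]
      proof (rule frac_le)
        show "1 + q \<le> (1 + q) ^ (?n2 + 1)" using power_increasing[of 1 "?n2+1" "1 + q"] q by simp
        show "p ^ (?n2 + 1) \<le> p ^ ?n2" using p by (intro power_decreasing) auto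
      qed (use p q in auto)
    qed simp
    finally have 1: "emeasure \<alpha> F \<le> ennreal (C q) * emeasure \<beta> F" .
    have "emeasure \<beta> F \<le> ennreal ((1 + q) ^ ?n2 * h u) * emeasure \<sigma> F"
      unfolding eb[OF Fb(1)] by (rule fl(2))
    also have "\<dots> = ennreal ((1 + q) ^ ?n2 / p) * (ennreal (p * h u) * emeasure \<sigma> F)"
    proof -
      have "ennreal ((1 + q) ^ ?n2 / p) * (ennreal (p * h u) * emeasure \<sigma> F)
        = ennreal (((1 + q) ^ ?n2 / p) * (p * h u)) * emeasure \<sigma> F"
        using p q h0 by (subst mult.assoc[symmetric], subst ennreal_mult[symmetric]) auto
      also have "((1 + q) ^ ?n2 / p) * (p * h u) = (1 + q) ^ ?n2 * h u" using p by simp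
      finally show ?thesis by simp
    qed
    also have "\<dots> \<le> ennreal ((1 + q) ^ ?n2 / p) * emeasure \<alpha> F"
      by (rule mult_left_mono[OF lo[folded p_def]]) (rule zero_le)
    also have "\<dots> \<le> ennreal (C q) * emeasure \<alpha> F"
    proof (intro mult_right_mono ennreal_leI)
      show "(1 + q) ^ ?n2 / p \<le> C q"
        unfolding C_def p_def[symmetric]
      proof (rule frac_le)
        show "(1 + q) ^ ?n2 \<le> (1 + q) ^ (?n2 + 1)" using q by (intro power_increasing) auto
        show "p ^ (?n2 + 1) \<le> p" using power_decreasing[of 1 "?n2+1" p] p by simp
      qed (use p q in auto)
    qed simp
    finally show ?thesis using 1 by blast
  qed
  have both: "emeasure \<alpha> B \<le> ennreal (C q) * emeasure \<beta> B \<and> emeasure \<beta> B \<le> ennreal (C q) * emeasure \<alpha> B"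
    if q: "0 < q" "q < 1" and B: "B \<in> sets borel" for q B
  proof -
    have e: "q * r / (8 * R) > 0" using q r_pos R_pos by simp
    obtain D where D: "finite D" "D \<subseteq> sphere (0::'a) 1" "sphere 0 1 \<subseteq> (\<Union>u\<in>D. cball u (q * r / (8 * R)))"
      using sphere_finite_cover[OF e] by metis
    have U: "(\<Union>u\<in>D. cball u (q * r / (8 * R))) \<in> sets borel" using D by (intro sets.finite_UN) auto
    have k: "emeasure \<alpha> F \<le> ennreal (C q) * emeasure \<beta> F \<and> emeasure \<beta> F \<le> ennreal (C q) * emeasure \<alpha> F"
      if "u \<in> D" "compact F" "F \<subseteq> cball u (q * r / (8 * R))" for u F
    proof -
      have "norm u = 1" using D(2) that(1) by auto
      from key[OF q that(2,3) this] show ?thesis .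
    qed
    have ne: "emeasure \<alpha> (space \<alpha>) \<noteq> \<infinity>" "emeasure \<beta> (space \<beta>) \<noteq> \<infinity>" using fa fb sp by simp_all
    show ?thesis
    proof
      show "emeasure \<alpha> B \<le> ennreal (C q) * emeasure \<beta> B"
        by (rule finite_measures_le_by_pieces[OF s ne(1) D(1) cov(1)[OF D(3) U] k[THEN conjunct1] B])
      show "emeasure \<beta> B \<le> ennreal (C q) * emeasure \<alpha> B"
        by (rule finite_measures_le_by_pieces[OF s(2,1) ne(2) D(1) cov(2)[OF D(3) U] k[THEN conjunct2] B])
    qed
  qed
  have "emeasure \<alpha> B = emeasure \<beta> B" if B: "B \<in> sets borel" for B
  proof -
    have fB: "emeasure \<alpha> B < top" "emeasure \<beta> B < top"
      using fa fb emeasure_space[of \<alpha> B] emeasure_space[of \<beta> B] sp by (auto simp: order_le_less_trans)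
    then obtain a b where ab: "emeasure \<alpha> B = ennreal a" "emeasure \<beta> B = ennreal b" "a \<ge> 0" "b \<ge> 0"
      by (cases "emeasure \<alpha> B"; cases "emeasure \<beta> B") auto
    define q where "q k = 1 / (real k + 2)" for k :: nat
    have q: "0 < q k" "q k < 1" for k by (auto simp: q_def)
    have C0: "C (q k) \<ge> 0" for k using q[of k] by (simp add: C_def)
    have le: "a \<le> C (q k) * b" "b \<le> C (q k) * a" for k
      using both[OF q[of k] B] C0[of k] ab by (auto simp: ennreal_mult[symmetric])
    have "q \<longlonglongrightarrow> 0" unfolding q_def by real_asymp
    then have "(\<lambda>k. C (q k)) \<longlonglongrightarrow> (1 + 0) ^ (2 * DIM('a) + 1) / (1 - 0) ^ (2 * DIM('a) + 1)"
      unfolding C_def by (intro tendsto_intros) auto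
    then have lim: "(\<lambda>k. C (q k) * t) \<longlonglongrightarrow> 1 * t" for t by (intro tendsto_mult tendsto_const) simp
    have "a \<le> b" using LIMSEQ_le_const[OF lim[of b], of a] le by auto
    moreover have "b \<le> a" using LIMSEQ_le_const[OF lim[of a], of b] le by auto
    ultimately show ?thesis using ab by simp
  qed
  then have "(\<integral>\<^sup>+u. ennreal (h u) * indicator B u \<partial>\<sigma>) = ennreal c * emeasure \<nu> B" if "B \<in> sets borel" for B
    using that ea eb by simp
  then show ?thesis using that c(1) by blast
qed

section \<open>Volume as an integral of the gauge\<close>

definition Kreg :: "'a set" where "Kreg = K - sing - {0}"

lemma Kreg_borel [measurable]: "Kreg \<in> sets borel"
  unfolding Kreg_def by measurable

lemma N_scaleR: assumes "0 < t" shows "N (t *\<^sub>R x) = N x"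
  using sing_scaleR[OF assms, of x] M_scaleR[OF assms, of x] by (simp add: N_def)

lemma nn_integral_power_unit: "(\<integral>\<^sup>+s. ennreal (s ^ n) * indicator {0..1} s \<partial>lborel) = ennreal (1 / (real n + 1))"
proof -
  have "(\<integral>\<^sup>+s. ennreal (s ^ n) * indicator {0..1} s \<partial>lborel) = ennreal (1 ^ Suc n / real (Suc n) - 0 ^ Suc n / real (Suc n))"
  proof (rule nn_integral_FTC_Icc)
    show "((\<lambda>s. s ^ Suc n / real (Suc n)) has_real_derivative s ^ n) (at s)" for s :: real
    proof -
      have "((\<lambda>s. s ^ Suc n / real (Suc n)) has_real_derivative (real (Suc n) * s ^ n) / real (Suc n)) (at s)"
        by (intro derivative_eq_intros | simp)+
      then show ?thesis by simp
    qed
  qed auto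
  then show ?thesis by (simp add: add.commute)
qed

text \<open>Layer-cake argument: \<open>1 - g x\<close> is the length of the interval from
  \<open>g x\<close> to 1, the points with gauge at most s form the dilate by s, of s^n times the
  volume, and the integral of s^n over [0, 1] is 1 / (n + 1).\<close>

lemma nn_integral_one_minus_g:
  assumes B [measurable]: "B \<in> sets borel"
  shows "(\<integral>\<^sup>+x. ennreal (1 - g x) * indicator (Kreg \<inter> N -` B) x \<partial>lborel) = ennreal (1 / (real DIM('a) + 1)) * emeasure \<nu> B"
proof -
  define D where "D = Kreg \<inter> N -` B"
  have D [measurable]: "D \<in> sets borel" unfolding D_def using N_vimage[OF B] Kreg_borel by (rule sets.Int[rotated])
  have nuD: "emeasure \<nu> B = emeasure lborel D" by (simp add: emeasure_\<nu>[OF B] D_def Kreg_def)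
  have scale: "emeasure lborel {x\<in>D. g x \<le> s} = ennreal (s ^ DIM('a)) * emeasure lborel D" if s: "0 < s" "s \<le> 1" for s
  proof -
    have "{x\<in>D. g x \<le> s} = (\<lambda>x. s *\<^sub>R x) ` D"
    proof (intro set_eqI iffI)
      fix x assume x: "x \<in> {x\<in>D. g x \<le> s}"
      have "(1/s) *\<^sub>R x \<in> D"
        using x s by (auto simp: D_def Kreg_def mem_iff_g g_scaleR N_scaleR sing_scaleR)
      moreover have "x = s *\<^sub>R ((1/s) *\<^sub>R x)" using s by simp
      ultimately show "x \<in> (\<lambda>x. s *\<^sub>R x) ` D" by blast
    next
      fix x assume "x \<in> (\<lambda>x. s *\<^sub>R x) ` D"
      then obtain y where y: "x = s *\<^sub>R y" "y \<in> D" by auto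
      then have "g y \<le> 1" by (auto simp: D_def Kreg_def mem_iff_g)
      then have "s * g y \<le> s * 1" using s by (intro mult_left_mono) auto
      then have "s * g y \<le> s" "s * g y \<le> 1" using s by linarith+
      then show "x \<in> {x\<in>D. g x \<le> s}"
        using y s by (auto simp: D_def Kreg_def mem_iff_g g_scaleR N_scaleR sing_scaleR)
    qed
    then show ?thesis using emeasure_lborel_scaleR(1)[OF s(1) D] by simp
  qed
  have "(\<integral>\<^sup>+x. ennreal (1 - g x) * indicator D x \<partial>lborel)
      = (\<integral>\<^sup>+x. (\<integral>\<^sup>+s. indicator D x * indicator {g x..1} s \<partial>lborel) \<partial>lborel)"
  proof (rule nn_integral_cong)
    fix x :: 'a
    show "ennreal (1 - g x) * indicator D x = (\<integral>\<^sup>+s. indicator D x * indicator {g x..1} s \<partial>lborel)"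
      by (subst nn_integral_cmult) (auto simp: mult.commute emeasure_lborel_Icc_eq ennreal_neg)
  qed
  also have "\<dots> = (\<integral>\<^sup>+s. (\<integral>\<^sup>+x. indicator D x * indicator {g x..1} s \<partial>lborel) \<partial>lborel)"
  proof (rule lborel_pair.Fubini'[symmetric])
    have "(\<lambda>(x, s). indicator D x * indicator {g x..1} s :: ennreal) = (\<lambda>z. indicator D (fst z) * indicator {z. g (fst z) \<le> snd z \<and> snd z \<le> 1} z)"
      by (auto simp: indicator_def fun_eq_iff)
    moreover have "\<dots> \<in> borel_measurable (lborel \<Otimes>\<^sub>M lborel)" by measurable
    ultimately show "(\<lambda>(x, s). indicator D x * indicator {g x..1} s :: ennreal) \<in> borel_measurable (lborel \<Otimes>\<^sub>M lborel)" by simp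
  qed
  also have "\<dots> = (\<integral>\<^sup>+s. (ennreal (s ^ DIM('a)) * indicator {0..1} s) * emeasure lborel D \<partial>lborel)"
  proof (rule nn_integral_cong)
    fix s :: real
    have "(\<integral>\<^sup>+x. indicator D x * indicator {g x..1} s \<partial>lborel) = (\<integral>\<^sup>+x. indicator {x\<in>D. g x \<le> s \<and> s \<le> 1} x \<partial>lborel)"
      by (rule nn_integral_cong) (auto simp: indicator_def)
    also have "\<dots> = emeasure lborel {x\<in>D. g x \<le> s \<and> s \<le> 1}"
    proof (rule nn_integral_indicator)
      have "{x. g x \<le> s \<and> s \<le> 1} \<in> sets borel" by measurable
      from sets.Int[OF D this] show "{x\<in>D. g x \<le> s \<and> s \<le> 1} \<in> sets lborel" by (simp add: Int_def)
    qed
    also have "\<dots> = (ennreal (s ^ DIM('a)) * indicator {0..1} s) * emeasure lborel D"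
    proof (cases "0 < s \<and> s \<le> 1")
      case True
      then show ?thesis using scale[of s] by simp
    next
      case False
      have "\<not> (g x \<le> s \<and> s \<le> 1)" if "x \<in> D" for x
        using False g_pos[of x] that by (auto simp: D_def Kreg_def)
      then have "{x\<in>D. g x \<le> s \<and> s \<le> 1} = {}" by auto
      moreover have "ennreal (s ^ DIM('a)) * indicator {0..1} s = 0"
        using False by (cases "s = 0") (auto simp: indicator_def)
      ultimately show ?thesis by (simp only: emeasure_empty mult_zero_left)
    qed
    finally show "(\<integral>\<^sup>+x. indicator D x * indicator {g x..1} s \<partial>lborel) = (ennreal (s ^ DIM('a)) * indicator {0..1} s) * emeasure lborel D" .
  qed
  also have "\<dots> = ennreal (1 / (real DIM('a) + 1)) * emeasure lborel D"
    by (subst nn_integral_multc) (auto simp: nn_integral_power_unit)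
  finally show ?thesis by (simp add: nuD D_def)
qed

text \<open>In contrast to the indicator of K, the integrand is Lipschitz in the gauge, which allows
  the volume to be differentiated under the integral sign.\<close>

lemma measure_lborel_K: "measure lborel K = (real DIM('a) + 1) * (\<integral>x. max 0 (1 - g x) \<partial>lborel)"
proof -
  let ?n = "real DIM('a) + 1"
  have fin: "emeasure lborel K \<noteq> \<infinity>" using emeasure_bounded_finite[OF compact_imp_bounded[OF compact]] by simp
  have null: "sing \<union> {0} \<in> null_sets lborel" using sing_null by (intro null_sets.Un) auto
  have "emeasure lborel K = emeasure lborel (K - (sing \<union> {0}))"
    by (rule emeasure_Diff_null_set[symmetric]) (use null in auto)
  also have "K - (sing \<union> {0}) = (K - sing - {0}) \<inter> N -` UNIV" by auto
  finally have 1: "emeasure lborel K = emeasure \<nu> UNIV" by (simp add: emeasure_\<nu>)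
  have "(\<integral>\<^sup>+x. ennreal (1 - g x) * indicator (Kreg \<inter> N -` UNIV) x \<partial>lborel) = (\<integral>\<^sup>+x. ennreal (max 0 (1 - g x)) \<partial>lborel)"
  proof (rule nn_integral_cong_AE)
    show "AE x in lborel. ennreal (1 - g x) * indicator (Kreg \<inter> N -` UNIV) x = ennreal (max 0 (1 - g x))"
      using AE_not_in[OF null]
    proof eventually_elim
      case (elim x)
      then show ?case
        by (cases "x \<in> K") (auto simp: Kreg_def indicator_def mem_iff_g ennreal_neg max_def)
    qed
  qed
  with nn_integral_one_minus_g[of UNIV] 1
  have 2: "(\<integral>\<^sup>+x. ennreal (max 0 (1 - g x)) \<partial>lborel) = ennreal (1 / ?n) * emeasure lborel K" by simp
  then have "(\<integral>x. max 0 (1 - g x) \<partial>lborel) = enn2real (ennreal (1 / ?n) * emeasure lborel K)"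
    by (subst integral_eq_nn_integral) auto
  also have "\<dots> = (1 / ?n) * measure lborel K"
    by (simp add: enn2real_mult measure_def)
  finally show ?thesis by simp
qed

text \<open>Writing g as 1 - (1 - g) gives the factor n / (n + 1) = 1 - 1 / (n + 1). The left side
  is the form in which the derivative of the volume arises.\<close>

lemma integral_g_N:
  assumes \<phi> [measurable]: "\<phi> \<in> borel_measurable borel"
  shows "(\<integral>x. indicator Kreg x * (g x * \<phi> (N x)) \<partial>lborel) = real DIM('a) / (real DIM('a) + 1) * (\<integral>u. \<phi> u \<partial>\<nu>)"
proof -
  let ?k = "real DIM('a) / (real DIM('a) + 1)"
  define m1 where "m1 = distr (density lborel (\<lambda>x. ennreal (indicator Kreg x * g x))) borel N"
  define m2 where "m2 = density \<nu> (\<lambda>_. ennreal ?k)"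
  have "m1 = m2"
  proof (rule measure_eqI)
    fix B assume "B \<in> sets m1"
    then have B [measurable]: "B \<in> sets borel" by (simp add: m1_def)
    have DB [measurable]: "Kreg \<inter> N -` B \<in> sets borel" using N_vimage[OF B] Kreg_borel by (rule sets.Int[rotated])
    have "emeasure m1 B = (\<integral>\<^sup>+x. ennreal (indicator Kreg x * g x) * indicator (N -` B) x \<partial>lborel)"
      unfolding m1_def using N_vimage[OF B] by (simp add: emeasure_distr emeasure_density)
    also have "\<dots> = (\<integral>\<^sup>+x. ennreal (g x) * indicator (Kreg \<inter> N -` B) x \<partial>lborel)"
      by (rule nn_integral_cong) (auto simp: indicator_def)
    finally have e1: "emeasure m1 B = (\<integral>\<^sup>+x. ennreal (g x) * indicator (Kreg \<inter> N -` B) x \<partial>lborel)" .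
    have "emeasure \<nu> B = (\<integral>\<^sup>+x. indicator (Kreg \<inter> N -` B) x \<partial>lborel)"
      using DB by (simp add: emeasure_\<nu>[OF B] Kreg_def)
    also have "\<dots> = (\<integral>\<^sup>+x. ennreal (1 - g x) * indicator (Kreg \<inter> N -` B) x + ennreal (g x) * indicator (Kreg \<inter> N -` B) x \<partial>lborel)"
    proof (rule nn_integral_cong)
      fix x :: 'a
      have "ennreal (1 - g x) + ennreal (g x) = 1" if "x \<in> Kreg"
        using that g_nonneg[of x] by (simp add: ennreal_plus[symmetric] Kreg_def mem_iff_g del: ennreal_plus)
      then show "indicator (Kreg \<inter> N -` B) x = ennreal (1 - g x) * indicator (Kreg \<inter> N -` B) x + ennreal (g x) * indicator (Kreg \<inter> N -` B) x"
        by (auto simp: indicator_def)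
    qed
    also have "\<dots> = ennreal (1 / (real DIM('a) + 1)) * emeasure \<nu> B + emeasure m1 B"
      by (subst nn_integral_add) (auto simp: nn_integral_one_minus_g[OF B] e1)
    finally have sum: "emeasure \<nu> B = ennreal (1 / (real DIM('a) + 1)) * emeasure \<nu> B + emeasure m1 B" .
    have "emeasure \<nu> B < top" using finite_\<nu> emeasure_space[of \<nu> B] by (auto simp: order_le_less_trans)
    then obtain v where v: "emeasure \<nu> B = ennreal v" "v \<ge> 0" by (cases "emeasure \<nu> B") auto
    have "emeasure m1 B \<noteq> top" using sum v by auto
    then obtain m where m: "emeasure m1 B = ennreal m" "m \<ge> 0" by (cases "emeasure m1 B") auto
    have "ennreal v = ennreal (1 / (real DIM('a) + 1) * v + m)"
      using sum v m by (simp only: ennreal_mult'[symmetric] ennreal_plus[symmetric] zero_le_mult_iff zero_le_divide_iff)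
        (simp add: ennreal_plus[symmetric] ennreal_mult'[symmetric] del: ennreal_plus)
    then have "v = 1 / (real DIM('a) + 1) * v + m" using v m by (subst (asm) ennreal_inj) auto
    then have "m = ?k * v" by (simp add: field_simps)
    then show "emeasure m1 B = emeasure m2 B"
      using m v B by (simp only: m2_def emeasure_density_const sets_\<nu>) (simp add: ennreal_mult'[symmetric])
  qed (simp add: m1_def m2_def)
  have "(\<integral>u. \<phi> u \<partial>m1) = (\<integral>x. \<phi> (N x) \<partial>density lborel (\<lambda>x. ennreal (indicator Kreg x * g x)))"
    unfolding m1_def by (rule integral_distr) auto
  also have "\<dots> = (\<integral>x. (indicator Kreg x * g x) *\<^sub>R \<phi> (N x) \<partial>lborel)"
    by (rule integral_density) (auto simp: g_nonneg)
  finally have "(\<integral>x. indicator Kreg x * (g x * \<phi> (N x)) \<partial>lborel) = (\<integral>u. \<phi> u \<partial>m1)" by (simp add: mult.assoc)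
  also have "\<dots> = (\<integral>u. ?k *\<^sub>R \<phi> u \<partial>\<nu>)"
    unfolding \<open>m1 = m2\<close> m2_def by (rule integral_density) auto
  finally show ?thesis by simp
qed

lemma integral_\<nu>_eq_\<sigma>:
  obtains c :: real where "c > 0" "\<And>f :: 'a \<Rightarrow> real. f \<in> borel_measurable borel \<Longrightarrow> c * (\<integral>u. f u / h u \<partial>\<nu>) = (\<integral>u. f u \<partial>\<sigma>)"
proof -
  obtain c where c: "c > 0" "\<And>B. B \<in> sets borel \<Longrightarrow> (\<integral>\<^sup>+u. ennreal (h u) * indicator B u \<partial>\<sigma>) = ennreal c * emeasure \<nu> B"
    using density_\<sigma>_eq_\<nu> by metis
  have hm [measurable]: "h \<in> borel_measurable borel" by (rule borel_measurable_support_fun[OF compact nonempty])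
  have eq: "density \<sigma> (\<lambda>u. ennreal (max 0 (h u))) = density \<nu> (\<lambda>_. ennreal c)"
  proof (rule measure_eqI)
    fix B assume "B \<in> sets (density \<sigma> (\<lambda>u. ennreal (max 0 (h u))))"
    then have B: "B \<in> sets borel" by simp
    have "ennreal (max 0 x) = ennreal x" for x by (cases "x \<ge> 0") (auto simp: ennreal_neg max_def)
    then show "emeasure (density \<sigma> (\<lambda>u. ennreal (max 0 (h u)))) B = emeasure (density \<nu> (\<lambda>_. ennreal c)) B"
      using B c(2)[OF B] by (subst emeasure_density_const) (simp_all add: emeasure_density)
  qed simp
  show ?thesis
  proof (rule that[OF c(1)])
    fix f :: "'a \<Rightarrow> real" assume f [measurable]: "f \<in> borel_measurable borel"
    have "c * (\<integral>u. f u / h u \<partial>\<nu>) = (\<integral>u. c *\<^sub>R (f u / h u) \<partial>\<nu>)"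
      by (simp only: integral_mult_right_zero real_scaleR_def)
    also have "\<dots> = (\<integral>u. f u / h u \<partial>density \<nu> (\<lambda>_. ennreal c))"
      by (rule integral_density[symmetric]) (use c in auto)
    also have "\<dots> = (\<integral>u. max 0 (h u) *\<^sub>R (f u / h u) \<partial>\<sigma>)"
      unfolding eq[symmetric] by (rule integral_density) auto
    also have "\<dots> = (\<integral>u. f u \<partial>\<sigma>)"
      by (rule integral_cong_AE) (use AE_\<sigma> in \<open>auto elim!: eventually_mono simp: max_def dest: h_pos\<close>)
    finally show "c * (\<integral>u. f u / h u \<partial>\<nu>) = (\<integral>u. f u \<partial>\<sigma>)" .
  qed
qed

end

section \<open>Wulff shapes of perturbed support functions\<close>

locale wulff_perturbation = body_around_0 K r R for K :: "'a::euclidean_space set" and r R +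
  fixes \<Omega> :: "'a set" and f :: "'a \<Rightarrow> real" and F :: real and t :: real
  assumes \<Omega>_compact: "compact \<Omega>" and \<Omega>_sphere: "\<Omega> \<subseteq> sphere 0 1" and K_wulff: "K = wulff \<Omega> h"
    and f_cont: "continuous_on (sphere 0 1) f" and f_bound: "\<And>u. norm u = 1 \<Longrightarrow> \<bar>f u\<bar> \<le> F"
    and t_pos: "t > 0" and t_small: "t * F \<le> r / 2"
begin

definition Kt where "Kt = wulff \<Omega> (\<lambda>u. h u + t * f u)"

text \<open>The relative size of the perturbation: on unit vectors \<open>t * f\<close> is at most
  \<open>\<delta>\<close> times \<open>h\<close> in absolute value, so the perturbed body lies
  between the dilates of K by \<open>1 - \<delta>\<close> and \<open>1 + \<delta>\<close>.\<close>

definition \<delta> where "\<delta> = t * F / r"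

lemma F_nonneg: "F \<ge> 0"
proof -
  obtain b :: 'a where "b \<in> Basis" using nonempty_Basis by blast
  then show ?thesis using f_bound[of b] abs_ge_zero[of "f b"] by (simp del: abs_ge_zero)
qed

lemma \<delta>: "0 \<le> \<delta>" "\<delta> \<le> 1/2"
  using F_nonneg t_pos t_small r_pos by (auto simp: \<delta>_def divide_simps)

lemma tf_le: "norm u = 1 \<Longrightarrow> \<bar>t * f u\<bar> \<le> \<delta> * h u"
proof -
  assume u: "norm u = 1"
  have "\<bar>t * f u\<bar> \<le> t * F" using f_bound[OF u] t_pos by (simp add: abs_mult)
  also have "t * F = \<delta> * r" using r_pos by (simp add: \<delta>_def)
  also have "\<dots> \<le> \<delta> * h u" using h_ge[OF u] \<delta> by (intro mult_left_mono) auto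
  finally show ?thesis .
qed

lemma mem_scaled_K: assumes "s > 0" shows "(\<forall>u\<in>\<Omega>. x \<bullet> u \<le> s * h u) \<longleftrightarrow> g x \<le> s"
proof -
  have "(\<forall>u\<in>\<Omega>. x \<bullet> u \<le> s * h u) \<longleftrightarrow> (1/s) *\<^sub>R x \<in> K"
    using assms by (subst K_wulff) (auto simp: wulff_def pos_divide_le_eq mult.commute)
  then show ?thesis using assms by (simp add: mem_iff_g g_scaleR pos_divide_le_eq)
qed

lemma Kt_sub: "x \<in> Kt \<Longrightarrow> g x \<le> 1 + \<delta>"
proof -
  assume x: "x \<in> Kt"
  have "x \<bullet> u \<le> (1 + \<delta>) * h u" if u: "u \<in> \<Omega>" for u
    using x u tf_le[of u] \<Omega>_sphere by (force simp: Kt_def wulff_def algebra_simps abs_le_iff)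
  then show ?thesis using mem_scaled_K[of "1 + \<delta>" x] \<delta> by auto
qed

lemma Kt_sup: "g x \<le> 1 - \<delta> \<Longrightarrow> x \<in> Kt"
proof -
  assume x: "g x \<le> 1 - \<delta>"
  show "x \<in> Kt" unfolding Kt_def wulff_def
  proof safe
    fix u assume u: "u \<in> \<Omega>"
    then have "norm u = 1" using \<Omega>_sphere by auto
    then have "x \<bullet> u \<le> g x * h u" "\<bar>t * f u\<bar> \<le> \<delta> * h u" "0 < h u" by (auto intro: g_upper tf_le h_pos)
    moreover have "g x * h u \<le> (1 - \<delta>) * h u" using x \<open>0 < h u\<close> by (intro mult_right_mono) auto
    ultimately show "x \<bullet> u \<le> h u + t * f u" by (simp add: algebra_simps abs_le_iff)
  qed
qed

lemma g_le_norm: "g x \<le> norm x / r"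
  using g_diff_le[of x 0] g_scaleR[of 0 0] by simp

sublocale T: body_around_0 Kt "r/2" "2*R"
proof
  show sub: "Kt \<subseteq> cball 0 (2 * R)"
  proof
    fix x assume "x \<in> Kt"
    then have "norm x / R \<le> 2" using Kt_sub[of x] g_ge[of x] \<delta> by linarith
    then show "x \<in> cball 0 (2 * R)" using R_pos by (simp add: pos_divide_le_eq)
  qed
  show "compact Kt" using sub closed_wulff[of \<Omega>] bounded_subset[OF bounded_cball] unfolding Kt_def by (metis compact_eq_bounded_closed)
  show "convex Kt" unfolding Kt_def by (rule convex_wulff)
  show "cball 0 (r / 2) \<subseteq> Kt"
  proof
    fix x :: 'a assume "x \<in> cball 0 (r / 2)"
    then have "norm x / r \<le> 1 / 2" using r_pos by (simp add: pos_divide_le_eq)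
    then show "x \<in> Kt" using Kt_sup[of x] g_le_norm[of x] \<delta> by linarith
  qed
qed (use r_pos in auto)

abbreviation gt where "gt \<equiv> T.g"

lemma mem_scaled_Kt: "s > 0 \<Longrightarrow> gt x \<le> s \<longleftrightarrow> (\<forall>u\<in>\<Omega>. x \<bullet> u \<le> s * (h u + t * f u))"
proof -
  assume s: "s > 0"
  have "gt x \<le> s \<longleftrightarrow> (1/s) *\<^sub>R x \<in> Kt" using s by (simp add: T.mem_iff_g T.g_scaleR pos_divide_le_eq)
  also have "\<dots> \<longleftrightarrow> (\<forall>u\<in>\<Omega>. x \<bullet> u \<le> s * (h u + t * f u))"
    using s by (auto simp: Kt_def wulff_def pos_divide_le_eq mult.commute)
  finally show ?thesis .
qed

lemma Ht_pos: "norm u = 1 \<Longrightarrow> h u / 2 \<le> h u + t * f u"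
proof -
  assume u: "norm u = 1"
  have "\<delta> * h u \<le> (1/2) * h u" using \<delta> h_pos[OF u] by (intro mult_right_mono) auto
  then show ?thesis using tf_le[OF u] by (simp add: abs_le_iff)
qed

lemma gt_upper: assumes "u \<in> \<Omega>" shows "x \<bullet> u \<le> gt x * (h u + t * f u)"
proof (cases "x = 0")
  case True then show ?thesis using T.g_scaleR[of 0 0] by simp
next
  case False
  then show ?thesis using mem_scaled_Kt[of "gt x" x] T.g_pos[of x] assms by auto
qed

text \<open>The gauge \<open>gt\<close> is defined by the support function of \<open>Kt\<close>,
  which may be smaller than h + t f. A constraint that is tight where the ray through x meets the
  boundary shows that on \<open>\<Omega>\<close> the data h + t f can be used instead.\<close>

lemma gt_attained: assumes "x \<noteq> 0" obtains u where "u \<in> \<Omega>" "x \<bullet> u = gt x * (h u + t * f u)"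
proof -
  have p: "gt x > 0" by (rule T.g_pos[OF assms])
  have 1: "(1 / gt x) *\<^sub>R x \<in> frontier (wulff \<Omega> (\<lambda>u. h u + t * f u))"
    using p unfolding Kt_def[symmetric] by (simp add: T.frontier_iff_g T.g_scaleR)
  have 2: "continuous_on \<Omega> (\<lambda>u. h u + t * f u)"
    by (intro continuous_intros continuous_h continuous_on_subset[OF f_cont \<Omega>_sphere])
  obtain u where "u \<in> \<Omega>" "((1 / gt x) *\<^sub>R x) \<bullet> u = h u + t * f u"
    by (rule wulff_frontier[OF \<Omega>_compact \<Omega>_sphere 2 1])
  then show ?thesis using that[of u] p by (simp add: field_simps)
qed

text \<open>Both bounds come from the inclusions between \<open>Kt\<close> and dilates of K, with
  \<open>1 / (1 - \<delta>) \<le> 1 + 2 * \<delta>\<close> because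
  \<open>\<delta> \<le> 1/2\<close>.\<close>

lemma gt_diff: "\<bar>gt x - g x\<bar> \<le> 2 * \<delta> * g x"
proof (cases "x = 0")
  case True then show ?thesis using T.g_scaleR[of 0 0] g_scaleR[of 0 0] by simp
next
  case False
  have p: "g x > 0" "gt x > 0" using g_pos[OF False] T.g_pos[OF False] by auto
  have "gt x \<le> g x / (1 - \<delta>)"
  proof -
    have "((1 - \<delta>) / g x) *\<^sub>R x \<in> Kt" using p \<delta> by (intro Kt_sup) (simp add: g_scaleR)
    then have "(1 - \<delta>) / g x * gt x \<le> 1" using p \<delta> by (simp add: T.mem_iff_g T.g_scaleR)
    then show ?thesis using p \<delta> by (simp add: field_simps)
  qed
  also have "g x / (1 - \<delta>) \<le> g x * (1 + 2 * \<delta>)"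
  proof -
    have "0 \<le> \<delta> * (1 - 2 * \<delta>)" using \<delta> by simp
    then have "1 \<le> (1 + 2 * \<delta>) * (1 - \<delta>)" by (simp add: algebra_simps)
    from mult_left_mono[OF this, of "g x"] show ?thesis using p \<delta> by (simp add: pos_divide_le_eq mult.assoc)
  qed
  finally have 1: "gt x \<le> g x * (1 + 2 * \<delta>)" .
  have "g x / gt x \<le> 1 + \<delta>"
  proof -
    have "(1 / gt x) *\<^sub>R x \<in> Kt" using p by (simp add: T.mem_iff_g T.g_scaleR)
    then show ?thesis using Kt_sub[of "(1 / gt x) *\<^sub>R x"] p by (simp add: g_scaleR)
  qed
  then have "g x \<le> (1 + \<delta>) * gt x" using p by (simp add: pos_divide_le_eq)
  moreover have "\<delta> * gt x \<le> \<delta> * (2 * g x)"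
  proof (rule mult_left_mono)
    have "g x * (1 + 2 * \<delta>) \<le> g x * 2" using p \<delta> by (intro mult_left_mono) auto
    then show "gt x \<le> 2 * g x" using 1 by linarith
  qed (rule \<delta>)
  ultimately show ?thesis using 1 by (simp add: abs_le_iff algebra_simps)
qed

text \<open>Danskin's inequalities for the difference quotient of the gauge: the lower bound uses a maximiser
  for \<open>K\<close>, the upper bound one for the perturbed body.\<close>

lemma danskin_lower:
  assumes "u \<in> \<Omega>" "x \<bullet> u = g x * h u"
  shows "- (g x * f u / (h u + t * f u)) \<le> (gt x - g x) / t"
proof -
  have u: "norm u = 1" using assms \<Omega>_sphere by auto
  have p: "h u + t * f u > 0" using Ht_pos[OF u] h_pos[OF u] by linarith
  have "g x * h u \<le> gt x * (h u + t * f u)" using gt_upper[OF assms(1), of x] assms(2) by simp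
  then have "- (t * (g x * f u)) \<le> (gt x - g x) * (h u + t * f u)" by (simp add: algebra_simps)
  then have "- (t * (g x * f u)) / (h u + t * f u) \<le> gt x - g x" using p by (simp only: pos_divide_le_eq)
  then have "t * (- (g x * f u / (h u + t * f u))) \<le> gt x - g x" by simp
  then show ?thesis using t_pos by (simp add: pos_le_divide_eq mult.commute)
qed

lemma danskin_upper:
  assumes "u \<in> \<Omega>" "x \<bullet> u = gt x * (h u + t * f u)"
  shows "(gt x - g x) / t \<le> - (g x * f u / (h u + t * f u))"
proof -
  have u: "norm u = 1" using assms \<Omega>_sphere by auto
  have p: "h u + t * f u > 0" using Ht_pos[OF u] h_pos[OF u] by linarith
  have "gt x * (h u + t * f u) \<le> g x * h u" using g_upper[OF u, of x] assms(2) by simp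
  then have "(gt x - g x) * (h u + t * f u) \<le> - (t * (g x * f u))" by (simp add: algebra_simps)
  then have "gt x - g x \<le> - (t * (g x * f u)) / (h u + t * f u)" using p by (simp only: pos_le_divide_eq)
  then have "gt x - g x \<le> t * (- (g x * f u / (h u + t * f u)))" by simp
  then show ?thesis using t_pos by (simp add: pos_divide_le_eq mult.commute)
qed

end

section \<open>First variation of volume\<close>

locale wulff_variation = body_around_0 K r R for K :: "'a::euclidean_space set" and r R +
  fixes \<Omega> :: "'a set" and f :: "'a \<Rightarrow> real" and F :: real and t :: "nat \<Rightarrow> real"
  assumes \<Omega>_compact: "compact \<Omega>" and \<Omega>_sphere: "\<Omega> \<subseteq> sphere 0 1" and K_wulff: "K = wulff \<Omega> h"
    and f_cont: "continuous_on (sphere 0 1) f" and f_meas: "f \<in> borel_measurable borel"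
    and f_bound: "\<And>u. norm u = 1 \<Longrightarrow> \<bar>f u\<bar> \<le> F"
    and t_pos: "\<And>k. t k > 0" and t_small: "\<And>k. t k * F \<le> r / 2" and t_lim: "t \<longlonglongrightarrow> 0"
begin

lemma pert: "wulff_perturbation K r R \<Omega> f F (t k)"
  by unfold_locales (use \<Omega>_compact \<Omega>_sphere K_wulff f_cont f_bound t_pos t_small in auto)

sublocale P: wulff_perturbation K r R \<Omega> f F "t k" for k
  by (rule pert)

definition Gk :: "nat \<Rightarrow> 'a \<Rightarrow> real" where "Gk k = body_around_0.g (P.Kt k)"

text \<open>Only the constraints with normals in \<open>\<Omega>\<close> are perturbed. As almost
  every ray leaves K with such a normal, the derivative can still be expressed by
  \<open>N\<close>.\<close>

lemma N_in_\<Omega>: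
  assumes "x \<noteq> 0" "x \<notin> sing" shows "N x \<in> \<Omega>"
proof -
  have p: "g x > 0" by (rule g_pos[OF assms(1)])
  have 1: "(1 / g x) *\<^sub>R x \<in> frontier (wulff \<Omega> h)"
    using p unfolding K_wulff[symmetric] by (simp add: frontier_iff_g g_scaleR)
  obtain u where u: "u \<in> \<Omega>" "((1 / g x) *\<^sub>R x) \<bullet> u = h u"
    by (rule wulff_frontier[OF \<Omega>_compact \<Omega>_sphere continuous_h 1])
  then have "x \<bullet> u = g x * h u" using p by (simp add: field_simps)
  then have "u \<in> M x" using u \<Omega>_sphere by (auto simp: M_def)
  then show ?thesis using M_eq_N[OF assms(2)] u by auto
qed

lemma N_eq: "x \<notin> sing \<Longrightarrow> x \<bullet> N x = g x * h (N x)"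
  using M_eq_N[of x] M_eq[of "N x" x] by auto

lemma Gk_diff: "\<bar>Gk k x - g x\<bar> \<le> 2 * (t k * F / r) * g x"
  using P.gt_diff[of k x] by (simp add: Gk_def P.\<delta>_def)

lemma Gk_lim: "(\<lambda>k. Gk k x) \<longlonglongrightarrow> g x"
proof -
  have "(\<lambda>k. 2 * (t k * F / r) * g x) \<longlonglongrightarrow> 2 * (0 * F / r) * g x"
    by (intro tendsto_intros t_lim) (use r_pos in simp)
  then have l: "(\<lambda>k. 2 * (t k * F / r) * g x) \<longlonglongrightarrow> 0" by (simp only: mult_zero_left div_0 mult_zero_right)
  have "(\<lambda>k. Gk k x - g x) \<longlonglongrightarrow> 0"
    by (rule Lim_null_comparison[OF always_eventually l]) (simp only: Gk_diff real_norm_def simp_thms)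
  then show ?thesis by (rule LIM_zero_cancel)
qed

text \<open>At a nonsingular point the maximiser for K is unique, so the maximisers
  \<open>v k\<close> for the perturbed bodies converge to it and the two Danskin bounds have the
  same limit.\<close>

lemma gauge_quotient_lim:
  assumes x: "x \<noteq> 0" "x \<notin> sing"
  shows "(\<lambda>k. (Gk k x - g x) / t k) \<longlonglongrightarrow> - (g x * f (N x) / h (N x))"
proof -
  define u0 where "u0 = N x"
  have u0: "u0 \<in> \<Omega>" "x \<bullet> u0 = g x * h u0" "norm u0 = 1"
    using N_in_\<Omega>[OF x] N_eq[OF x(2)] norm_N by (auto simp: u0_def)
  have h0: "h u0 > 0" by (rule h_pos[OF u0(3)])
  have "\<exists>u. u \<in> \<Omega> \<and> x \<bullet> u = Gk k x * (h u + t k * f u)" for k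
    using P.gt_attained[OF x(1), of k] unfolding Gk_def by blast
  then obtain v where v: "\<And>k. v k \<in> \<Omega>" "\<And>k. x \<bullet> v k = Gk k x * (h (v k) + t k * f (v k))" by metis
  have nv: "norm (v k) = 1" for k using v(1)[of k] \<Omega>_sphere by auto
  have vlim: "v \<longlonglongrightarrow> u0"
  proof (rule LIMSEQ_I)
    fix e :: real assume e: "e > 0"
    let ?S = "sphere (0::'a) 1 - ball u0 e"
    have cS: "compact ?S" by (intro compact_diff compact_sphere open_ball)
    \<comment> \<open>By uniqueness of the maximiser the defect
      \<open>g x * h u - x \<bullet> u\<close> is bounded away from 0 outside the ball about
      \<open>u0\<close>, whereas the defect of \<open>v k\<close> tends to 0 by
      \<open>est\<close>.\<close>
    obtain m where m: "m > 0" "\<And>u. u \<in> ?S \<Longrightarrow> m \<le> g x * h u - x \<bullet> u"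
    proof (cases "?S = {}")
      case True
      then have "1 \<le> g x * h u - x \<bullet> u" if "u \<in> ?S" for u using that by blast
      then show ?thesis by (rule that[OF zero_less_one])
    next
      case False
      have "continuous_on ?S (\<lambda>u. g x * h u - x \<bullet> u)" by (intro continuous_intros continuous_h)
      from continuous_attains_inf[OF cS False this]
      obtain w where w: "w \<in> ?S" "\<And>u. u \<in> ?S \<Longrightarrow> g x * h w - x \<bullet> w \<le> g x * h u - x \<bullet> u" by blast
      have "norm w = 1" "w \<noteq> u0" using w(1) e by auto
      then have "w \<notin> M x" unfolding M_eq_N[OF x(2)] u0_def by blast
      then have "g x * h w - x \<bullet> w \<noteq> 0" using \<open>norm w = 1\<close> unfolding M_def by simp
      moreover have "g x * h w - x \<bullet> w \<ge> 0" using g_upper[OF \<open>norm w = 1\<close>, of x] by simp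
      ultimately show ?thesis using that[of "g x * h w - x \<bullet> w"] w(2) by auto
    qed
    have est: "g x * h (v k) - x \<bullet> v k \<le> \<bar>Gk k x - g x\<bar> * R + \<bar>Gk k x\<bar> * (t k * F)" for k
    proof -
      have "g x * h (v k) - x \<bullet> v k = (g x - Gk k x) * h (v k) + - (Gk k x) * (t k * f (v k))"
        by (simp add: v(2) algebra_simps)
      also have "(g x - Gk k x) * h (v k) \<le> \<bar>Gk k x - g x\<bar> * R"
        using h_le[OF nv] h_pos[OF nv, of k] by (intro mult_mono) auto
      also have "- (Gk k x) * (t k * f (v k)) \<le> \<bar>- (Gk k x) * (t k * f (v k))\<bar>" by (rule abs_ge_self)
      also have "\<bar>- (Gk k x) * (t k * f (v k))\<bar> = \<bar>Gk k x\<bar> * (t k * \<bar>f (v k)\<bar>)"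
        using t_pos[of k] by (simp add: abs_mult)
      also have "\<bar>Gk k x\<bar> * (t k * \<bar>f (v k)\<bar>) \<le> \<bar>Gk k x\<bar> * (t k * F)"
        using f_bound[OF nv, of k] t_pos[of k] by (intro mult_left_mono) auto
      finally show ?thesis by simp
    qed
    have "(\<lambda>k. \<bar>Gk k x - g x\<bar> * R + \<bar>Gk k x\<bar> * (t k * F)) \<longlonglongrightarrow> \<bar>g x - g x\<bar> * R + \<bar>g x\<bar> * (0 * F)"
      by (intro tendsto_intros Gk_lim t_lim)
    then have "eventually (\<lambda>k. \<bar>Gk k x - g x\<bar> * R + \<bar>Gk k x\<bar> * (t k * F) < m) sequentially"
      using m(1) by (intro order_tendstoD(2)[where a=m]) auto
    then obtain k0 where k0: "\<And>k. k \<ge> k0 \<Longrightarrow> \<bar>Gk k x - g x\<bar> * R + \<bar>Gk k x\<bar> * (t k * F) < m"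
      by (auto simp: eventually_sequentially)
    have "norm (v k - u0) < e" if "k \<ge> k0" for k
    proof (rule ccontr)
      assume "\<not> ?thesis"
      then have "v k \<in> ?S" using nv[of k] by (auto simp: dist_norm norm_minus_commute)
      then show False using m(2)[of "v k"] est[of k] k0[OF that] by linarith
    qed
    then show "\<exists>k0. \<forall>k\<ge>k0. norm (v k - u0) < e" by blast
  qed
  have f_lim: "(\<lambda>k. f (v k)) \<longlonglongrightarrow> f u0"
    using f_cont vlim nv u0(3) unfolding continuous_on_sequentially by (auto simp: comp_def)
  have h_lim: "(\<lambda>k. h (v k)) \<longlonglongrightarrow> h u0"
    using continuous_h[of "sphere 0 1"] vlim nv u0(3) unfolding continuous_on_sequentially by (auto simp: comp_def)
  show ?thesis unfolding u0_def[symmetric]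
  proof (rule tendsto_sandwich)
    show "\<forall>\<^sub>F k in sequentially. - (g x * f u0 / (h u0 + t k * f u0)) \<le> (Gk k x - g x) / t k"
      using P.danskin_lower[OF u0(1,2)] by (simp add: Gk_def)
    show "\<forall>\<^sub>F k in sequentially. (Gk k x - g x) / t k \<le> - (g x * f (v k) / (h (v k) + t k * f (v k)))"
    proof (intro always_eventually allI)
      fix k
      show "(Gk k x - g x) / t k \<le> - (g x * f (v k) / (h (v k) + t k * f (v k)))"
        using P.danskin_upper[OF v(1)[of k], of x k] v(2)[of k] unfolding Gk_def by blast
    qed
    have "(\<lambda>k. - (g x * f u0 / (h u0 + t k * f u0))) \<longlonglongrightarrow> - (g x * f u0 / (h u0 + 0 * f u0))"
      by (intro tendsto_intros t_lim) (use h0 in simp)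
    then show "(\<lambda>k. - (g x * f u0 / (h u0 + t k * f u0))) \<longlonglongrightarrow> - (g x * f u0 / h u0)" by simp
    have "(\<lambda>k. - (g x * f (v k) / (h (v k) + t k * f (v k)))) \<longlonglongrightarrow> - (g x * f u0 / (h u0 + 0 * f u0))"
      by (intro tendsto_intros t_lim f_lim h_lim) (use h0 in simp)
    then show "(\<lambda>k. - (g x * f (v k) / (h (v k) + t k * f (v k)))) \<longlonglongrightarrow> - (g x * f u0 / h u0)" by simp
  qed
qed

lemma frontier_null: "frontier K \<in> null_sets lborel"
proof -
  have "negligible (frontier K)" by (rule negligible_convex_frontier[OF convex])
  then show ?thesis
    using null_sets_completion_iff[of "frontier K" lborel] by (simp add: negligible_iff_null_sets)
qed

lemma F_nonneg: "F \<ge> 0" by (rule P.F_nonneg)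

lemma measure_P: "measure lborel (P.Kt k) = (real DIM('a) + 1) * (\<integral>x. max 0 (1 - Gk k x) \<partial>lborel)"
  unfolding Gk_def by (rule P.T.measure_lborel_K)

lemma Gk_borel [measurable]: "Gk k \<in> borel_measurable borel"
  unfolding Gk_def by (rule P.T.g_borel)

lemma integrable_bounded_support:
  fixes w :: "'a \<Rightarrow> real"
  assumes [measurable]: "w \<in> borel_measurable borel" and "\<And>x. \<bar>w x\<bar> \<le> C" and "\<And>x. g x > 2 \<Longrightarrow> w x = 0"
  shows "integrable lborel w"
proof -
  have m: "{x. g x \<le> 2} \<in> sets borel" by measurable
  have "{x. g x \<le> 2} \<subseteq> cball 0 (2 * R)"
  proof
    fix x assume "x \<in> {x. g x \<le> 2}"
    then have "norm x / R \<le> 2" using g_ge[of x] by simp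
    then show "x \<in> cball 0 (2 * R)" using R_pos by (simp add: pos_divide_le_eq)
  qed
  then have "emeasure lborel {x. g x \<le> 2} < \<infinity>"
    using bounded_subset[OF bounded_cball] by (intro emeasure_bounded_finite)
  then have "integrable lborel (\<lambda>x. C * indicator {x. g x \<le> 2} x)"
    using m by (intro integrable_mult_right integrable_real_indicator) (auto simp: less_top)
  then show ?thesis
  proof (rule Bochner_Integration.integrable_bound)
    show "AE x in lborel. norm (w x) \<le> norm (C * indicator {x. g x \<le> 2} x)"
    proof (rule AE_I2)
      fix x
      have "\<bar>w x\<bar> \<le> \<bar>C\<bar>" using assms(2)[of x] by linarith
      then show "norm (w x) \<le> norm (C * indicator {x. g x \<le> 2} x)" using assms(3)[of x] by (auto simp: indicator_def)
    qed
  qed simp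
qed

text \<open>Aleksandrov's variational formula, by dominated convergence. By the relation between
  cone-volume and surface area the limit is a constant multiple of the integral of \<open>f\<close>
  with respect to the latter.\<close>

lemma volume_quotient_lim:
  "(\<lambda>k. (measure lborel (P.Kt k) - measure lborel K) / t k) \<longlonglongrightarrow> real DIM('a) * (\<integral>u. f u / h u \<partial>\<nu>)"
proof -
  have hm [measurable]: "h \<in> borel_measurable borel" by (rule borel_measurable_support_fun[OF compact nonempty])
  note f_meas [measurable]
  define q where "q k x = (max 0 (1 - Gk k x) - max 0 (1 - g x)) / t k" for k x
  define L where "L x = indicator Kreg x * (g x * (f (N x) / h (N x)))" for x
  \<comment> \<open>Where \<open>g x \<le> 2\<close>, the gauges differ by at most 4 t F / r.
    Elsewhere both positive parts vanish, because the perturbed bodies lie in the dilate of K by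
    2.\<close>
  define w where "w x = 4 * (F / r) * indicator {x. g x \<le> 2} x" for x
  have small: "2 * (t k * F / r) \<le> 1" for k using t_small[of k] r_pos by (simp add: divide_simps)
  have qle: "\<bar>q k x\<bar> \<le> w x" for k x
  proof (cases "g x \<le> 2")
    case True
    have "\<bar>max 0 (1 - Gk k x) - max 0 (1 - g x)\<bar> \<le> \<bar>Gk k x - g x\<bar>" by linarith
    also have "\<dots> \<le> 2 * (t k * F / r) * g x" by (rule Gk_diff)
    also have "\<dots> \<le> 2 * (t k * F / r) * 2"
      using True t_pos[of k] F_nonneg r_pos by (intro mult_left_mono) auto
    also have "2 * (t k * F / r) * 2 = t k * (4 * (F / r))" by simp
    finally have "\<bar>max 0 (1 - Gk k x) - max 0 (1 - g x)\<bar> \<le> t k * (4 * (F / r))" .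
    then have "\<bar>max 0 (1 - Gk k x) - max 0 (1 - g x)\<bar> / t k \<le> 4 * (F / r)"
      using t_pos[of k] by (simp only: pos_divide_le_eq mult.commute[of "t k"])
    then show ?thesis using True t_pos[of k] by (simp add: q_def w_def abs_divide)
  next
    case False
    have "\<bar>Gk k x - g x\<bar> \<le> (t k * F / r) * 2 * g x" using Gk_diff[of k x] by (simp add: mult.commute mult.left_commute)
    also have "\<dots> \<le> (1/2) * 2 * g x"
      using small[of k] g_nonneg[of x] by (intro mult_right_mono) (auto simp: mult_ac)
    finally have "Gk k x \<ge> 0" by linarith
    have "2 * (t k * F / r) * g x \<le> (1/2 + 1/2) * g x"
      using small[of k] g_nonneg[of x] by (intro mult_right_mono) auto
    have d: "2 * (t k * F / r) \<le> 1" by (rule small)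
    have "Gk k x \<ge> 1"
    proof -
      have "g x \<le> (1 + t k * F / r) * Gk k x"
      proof -
        have "(1 / Gk k x) *\<^sub>R x \<in> P.Kt k"
        proof -
          have "x \<noteq> 0" using False g_scaleR[of 0 0] by auto
          then have "Gk k x > 0" unfolding Gk_def by (rule P.T.g_pos)
          then show ?thesis unfolding P.T.mem_iff_g using P.T.g_scaleR[of "1 / Gk k x" k x] by (simp add: Gk_def)
        qed
        then have "g ((1 / Gk k x) *\<^sub>R x) \<le> 1 + t k * F / r" using P.Kt_sub[of _ k] by (simp add: P.\<delta>_def)
        moreover have "x \<noteq> 0" using False g_scaleR[of 0 0] by auto
        then have p: "Gk k x > 0" unfolding Gk_def by (rule P.T.g_pos)
        ultimately show ?thesis by (simp add: g_scaleR pos_divide_le_eq)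
      qed
      moreover have "(1 + t k * F / r) * Gk k x \<le> 2 * Gk k x"
        using d \<open>Gk k x \<ge> 0\<close> t_pos[of k] F_nonneg r_pos by (intro mult_right_mono) auto
      ultimately show ?thesis using False by linarith
    qed
    then show ?thesis using False by (simp add: q_def w_def)
  qed
  \<comment> \<open>Besides the singular directions, the boundary is excluded: there
    \<open>g x = 1\<close> and the positive part has its kink. Convexity of K makes the boundary
    null.\<close>
  have null: "sing \<union> ({0} \<union> frontier K) \<in> null_sets lborel"
    using sing_null frontier_null by (intro null_sets.Un) auto
  have lim: "AE x in lborel. (\<lambda>k. q k x) \<longlonglongrightarrow> L x"
    using AE_not_in[OF null]
  proof eventually_elim
    case (elim x)
    then have x: "x \<noteq> 0" "x \<notin> sing" "g x \<noteq> 1" by (auto simp: frontier_iff_g)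
    show ?case
    proof (cases "g x < 1")
      case True
      then have "eventually (\<lambda>k. Gk k x < 1) sequentially" using Gk_lim by (intro order_tendstoD(2)) auto
      then have ev: "eventually (\<lambda>k. - ((Gk k x - g x) / t k) = q k x) sequentially"
        by eventually_elim (use True in \<open>simp add: q_def minus_divide_left\<close>)
      have "(\<lambda>k. - ((Gk k x - g x) / t k)) \<longlonglongrightarrow> - (- (g x * f (N x) / h (N x)))"
        by (intro tendsto_minus gauge_quotient_lim x)
      then have "(\<lambda>k. q k x) \<longlonglongrightarrow> g x * f (N x) / h (N x)"
        using tendsto_cong[OF ev] by simp
      then show ?thesis using x True by (simp add: L_def Kreg_def mem_iff_g)
    next
      case False
      then have "g x > 1" using x by simp
      then have "eventually (\<lambda>k. Gk k x > 1) sequentially" using Gk_lim by (intro order_tendstoD(1)) auto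
      then have ev: "eventually (\<lambda>k. 0 = q k x) sequentially"
        by eventually_elim (use \<open>g x > 1\<close> in \<open>simp add: q_def\<close>)
      have "(\<lambda>k. q k x) \<longlonglongrightarrow> 0"
        using tendsto_cong[OF ev, of 0] by simp
      then show ?thesis using \<open>g x > 1\<close> by (simp add: L_def Kreg_def mem_iff_g)
    qed
  qed
  have "{x. g x \<le> 2} \<in> sets borel" by measurable
  then have wm [measurable]: "w \<in> borel_measurable borel" unfolding w_def by measurable
  have wi: "integrable lborel w"
    by (rule integrable_bounded_support[where C="4 * (F / r)"]) (use F_nonneg r_pos in \<open>auto simp: w_def indicator_def\<close>)
  have qm: "q k \<in> borel_measurable borel" for k unfolding q_def by measurable
  have Lm: "L \<in> borel_measurable borel" unfolding L_def by measurable
  have "(\<lambda>k. \<integral>x. q k x \<partial>lborel) \<longlonglongrightarrow> (\<integral>x. L x \<partial>lborel)"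
    by (rule integral_dominated_convergence[where w=w]) (use qm Lm wi lim qle in auto)
  moreover have "(\<integral>x. q k x \<partial>lborel) = ((\<integral>x. max 0 (1 - Gk k x) \<partial>lborel) - (\<integral>x. max 0 (1 - g x) \<partial>lborel)) / t k" for k
  proof -
    have i0: "integrable lborel (\<lambda>x. max 0 (1 - g x))"
      by (rule integrable_bounded_support[where C=1]) (use g_nonneg in \<open>auto simp: max_def abs_le_iff\<close>)
    have qi: "integrable lborel (q k)"
      by (rule Bochner_Integration.integrable_bound[OF wi]) (use qm qle abs_ge_zero in \<open>auto intro: order_trans[OF qle abs_ge_self]\<close>)
    have "(\<lambda>x. max 0 (1 - Gk k x)) = (\<lambda>x. t k * q k x + max 0 (1 - g x))"
      using t_pos[of k] by (auto simp: q_def)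
    then have "(\<integral>x. max 0 (1 - Gk k x) \<partial>lborel) = t k * (\<integral>x. q k x \<partial>lborel) + (\<integral>x. max 0 (1 - g x) \<partial>lborel)"
      using qi i0 by simp
    then show ?thesis using t_pos[of k] by simp
  qed
  ultimately have "(\<lambda>k. (real DIM('a) + 1) * (((\<integral>x. max 0 (1 - Gk k x) \<partial>lborel) - (\<integral>x. max 0 (1 - g x) \<partial>lborel)) / t k))
     \<longlonglongrightarrow> (real DIM('a) + 1) * (\<integral>x. L x \<partial>lborel)"
    by (intro tendsto_mult tendsto_const) simp
  moreover have "(real DIM('a) + 1) * (((\<integral>x. max 0 (1 - Gk k x) \<partial>lborel) - (\<integral>x. max 0 (1 - g x) \<partial>lborel)) / t k)
     = (measure lborel (P.Kt k) - measure lborel K) / t k" for k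
    unfolding measure_P measure_lborel_K by (simp add: right_diff_distrib)
  moreover have "(real DIM('a) + 1) * (\<integral>x. L x \<partial>lborel) = real DIM('a) * (\<integral>u. f u / h u \<partial>\<nu>)"
    unfolding L_def by (subst integral_g_N) (auto simp: field_simps)
  ultimately show ?thesis by (simp only:)
qed

end

section \<open>The variational problem\<close>

lemma powr_le_tangent:
  fixes x y p :: real
  assumes p: "0 < p" "p < 1" and x: "0 \<le> x" and y: "0 < y"
  shows "x powr p \<le> y powr p + p * y powr (p - 1) * (x - y)"
proof (cases "x = 0")
  case True
  have base: "y powr (p - 1) * y = y powr p" using y powr_mult_base[of y "p - 1"] by (simp add: mult.commute)
  have e: "p * y powr (p - 1) * (x - y) = - (p * (y powr (p - 1) * y))" using True by simp
  have "p * y powr p \<le> 1 * y powr p" using p by (intro mult_right_mono) auto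
  then show ?thesis unfolding e base using True p by simp
next
  case False
  define z where "z = x / y"
  have z: "z > 0" "x = z * y" using False x y by (auto simp: z_def)
  \<comment> \<open>The weighted arithmetic-geometric mean inequality for z and 1, as convexity of
    \<open>exp\<close> at the points \<open>ln z\<close> and 0; this is the tangent inequality at
    1.\<close>
  have "exp (p * ln z + (1 - p) * 0) \<le> p * exp (ln z) + (1 - p) * exp 0"
    using exp_convex p unfolding convex_on_def by (metis UNIV_I add.commute diff_add_cancel diff_ge_0_iff_ge less_eq_real_def real_scaleR_def)
  then have "z powr p \<le> p * z + (1 - p)" using z by (simp add: powr_def)
  then have "y powr p * z powr p \<le> y powr p * (p * z + (1 - p))" by (intro mult_left_mono) auto
  moreover have "y powr p * z powr p = x powr p" using z y by (simp add: powr_mult mult.commute)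
  moreover have yy: "y powr p = y powr (p - 1) * y" using y powr_mult_base[of y "p - 1"] by (simp add: mult.commute)
  have "y powr p * (p * z + (1 - p)) = y powr p + p * y powr p * (z - 1)" by (simp add: algebra_simps)
  moreover have "p * y powr p * (z - 1) = p * y powr (p - 1) * (x - y)"
    unfolding yy z(2) by (simp add: algebra_simps)
  ultimately show ?thesis by linarith
qed

lemma powr_concave_unit:
  fixes a b p s :: real
  assumes p: "0 < p" "p < 1" and ab: "0 \<le> a" "0 \<le> b" and s: "0 \<le> s" "s \<le> 1"
  shows "(1 - s) * a powr p + s * b powr p \<le> ((1 - s) * a + s * b) powr p"
proof -
  define m where "m = (1 - s) * a + s * b"
  have m0: "m \<ge> 0" using ab s by (simp add: m_def)
  show ?thesis
  proof (cases "m = 0")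
    case True
    then have "(1 - s) * a = 0" "s * b = 0" using ab s by (auto simp: m_def add_nonneg_eq_0_iff)
    then show ?thesis by auto
  next
    case False
    then have m: "m > 0" using m0 by simp
    have "(1 - s) * a powr p + s * b powr p
       \<le> (1 - s) * (m powr p + p * m powr (p - 1) * (a - m)) + s * (m powr p + p * m powr (p - 1) * (b - m))"
      using s powr_le_tangent[OF p _ m] ab by (intro add_mono mult_left_mono) auto
    also have "\<dots> = m powr p + p * m powr (p - 1) * ((1 - s) * a + s * b - m)" by (simp add: algebra_simps)
    also have "\<dots> = m powr p" by (simp add: m_def)
    finally show ?thesis by (simp add: m_def)
  qed
qed

text \<open>A consequence of subadditivity. It provides a modulus of continuity for
  \<open>\<Psi>\<close> that is valid down to gap 0, where the power is not Lipschitz.\<close>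

lemma powr_diff_le:
  fixes a b p :: real
  assumes p: "0 < p" "p < 1" and ab: "0 \<le> a" "0 \<le> b"
  shows "\<bar>a powr p - b powr p\<bar> \<le> \<bar>a - b\<bar> powr p"
proof -
  have sub: "(x + y) powr p \<le> x powr p + y powr p" if xy: "0 \<le> x" "0 \<le> y" for x y :: real
  proof (cases "x + y = 0")
    case True
    then show ?thesis using xy by (simp add: add_nonneg_eq_0_iff)
  next
    case False
    define s where "s = x + y"
    have s: "s > 0" using False xy by (simp add: s_def)
    have le: "t / s \<le> (t / s) powr p" if "0 \<le> t" "t \<le> s" for t
    proof (cases "t = 0")
      case False
      then have "0 < t / s" "t / s \<le> 1" using that s by auto
      then have "(t / s) powr 1 \<le> (t / s) powr p" using p by (intro powr_mono') auto
      moreover have "(t / s) powr 1 = t / s" using \<open>0 < t / s\<close> by (intro powr_one) simp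
      ultimately show ?thesis by linarith
    qed simp
    have "1 = x / s + y / s" using s by (simp add: s_def add_divide_distrib[symmetric])
    also have "\<dots> \<le> (x / s) powr p + (y / s) powr p" using le[of x] le[of y] xy by (simp add: s_def)
    also have "\<dots> = (x powr p + y powr p) / s powr p" using xy s by (simp add: powr_divide add_divide_distrib)
    finally show ?thesis using s by (simp add: s_def[symmetric] pos_le_divide_eq)
  qed
  have "a powr p \<le> b powr p + \<bar>a - b\<bar> powr p" if "0 \<le> a" "0 \<le> b" for a b :: real
  proof -
    have "a powr p \<le> (b + \<bar>a - b\<bar>) powr p" using that p by (intro powr_mono2) auto
    also have "\<dots> \<le> b powr p + \<bar>a - b\<bar> powr p" using that by (intro sub) auto
    finally show ?thesis .
  qed
  from this[OF ab] this[OF ab(2,1)] show ?thesis by (simp add: abs_le_iff abs_minus_commute)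
qed

text \<open>Slack values of \<open>H\<close> may be lowered to the support function without changing
  the body, so every compact nonempty Wulff shape satisfies the fixed-point equation required in
  \<open>good\<close>.\<close>

lemma wulff_support_idem:
  assumes "compact (wulff \<Omega> H)" "wulff \<Omega> H \<noteq> {}"
  shows "wulff \<Omega> H = wulff \<Omega> (support_fun (wulff \<Omega> H))"
proof
  show "wulff \<Omega> H \<subseteq> wulff \<Omega> (support_fun (wulff \<Omega> H))"
    using support_fun_upper[OF assms(1)] by (auto simp: wulff_def[of \<Omega> "support_fun _"])
  have "support_fun (wulff \<Omega> H) u \<le> H u" if "u \<in> \<Omega>" for u
    by (rule support_fun_least[OF assms(2)]) (use that in \<open>auto simp: wulff_def\<close>)
  then show "wulff \<Omega> (support_fun (wulff \<Omega> H)) \<subseteq> wulff \<Omega> H"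
    by (force simp: wulff_def[of \<Omega> "support_fun _"] wulff_def[of \<Omega> H] intro: order_trans)
qed

lemma support_fun_wulff_le:
  assumes "wulff \<Omega> H \<noteq> {}" "u \<in> \<Omega>" shows "support_fun (wulff \<Omega> H) u \<le> H u"
  by (rule support_fun_least[OF assms(1)]) (use assms(2) in \<open>auto simp: wulff_def\<close>)

lemma wulff_translate: "(+) a ` wulff \<Omega> H = wulff \<Omega> (\<lambda>u. H u + a \<bullet> u)"
proof (intro set_eqI iffI)
  fix x assume "x \<in> wulff \<Omega> (\<lambda>u. H u + a \<bullet> u)"
  then have "x - a \<in> wulff \<Omega> H" by (auto simp: wulff_def inner_diff_left algebra_simps)
  then show "x \<in> (+) a ` wulff \<Omega> H" by (intro image_eqI[of _ _ "x - a"]) auto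
qed (auto simp: wulff_def inner_add_left)

lemma wulff_scale:
  assumes "s > 0" shows "(*\<^sub>R) s ` wulff \<Omega> H = wulff \<Omega> (\<lambda>u. s * H u)"
proof (intro set_eqI iffI)
  fix x assume "x \<in> wulff \<Omega> (\<lambda>u. s * H u)"
  then have "(1/s) *\<^sub>R x \<in> wulff \<Omega> H" using assms by (auto simp: wulff_def pos_divide_le_eq mult.commute)
  then show "x \<in> (*\<^sub>R) s ` wulff \<Omega> H" using assms by (intro image_eqI[of _ _ "(1/s) *\<^sub>R x"]) auto
qed (use assms in \<open>auto simp: wulff_def\<close>)

text \<open>If the support of \<open>\<mu>\<close> spans the space, then \<open>\<Omega>\<close> is the sphere and \<open>L\<close> the whole space. Otherwise
  \<open>\<Omega>\<close> consists of the support and finitely many auxiliary directions that make the admissible bodies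
  bounded; the solution contains the origin in its facets with auxiliary normals, so these directions
  do not contribute to its \<open>L\<^sub>p\<close>-surface area measure.\<close>

locale Lp_problem =
  fixes p :: real and \<mu> :: "'a::euclidean_space measure" and \<Omega> L :: "'a set" and \<G> :: "('a \<Rightarrow> 'a) set"
  assumes p: "0 < p" "p < 1"
    and sets_\<mu>: "sets \<mu> = sets sphere_borel" and fin_\<mu>: "finite_measure \<mu>"
    and \<Omega>_compact: "compact \<Omega>" and \<Omega>_sphere: "\<Omega> \<subseteq> sphere 0 1" and AE_\<Omega>: "AE u in \<mu>. u \<in> \<Omega>"
    and L: "subspace L" and AE_L: "AE u in \<mu>. u \<in> L"
    and nondeg: "\<And>e. e \<in> L \<Longrightarrow> e \<noteq> 0 \<Longrightarrow> \<not> (AE u in \<mu>. e \<bullet> u = 0)"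
    and nontriv: "emeasure \<mu> (space \<mu>) \<noteq> 0"
    and \<G>_orth: "\<And>T. T \<in> \<G> \<Longrightarrow> orthogonal_transformation T"
    and \<G>_\<Omega>: "\<And>T. T \<in> \<G> \<Longrightarrow> T ` \<Omega> = \<Omega>"
    and \<G>_\<mu>: "\<And>T \<omega>. T \<in> \<G> \<Longrightarrow> \<omega> \<in> sets \<mu> \<Longrightarrow> emeasure \<mu> (T ` \<omega>) = emeasure \<mu> \<omega>"
    and bounded_unit: "bounded (wulff \<Omega> (\<lambda>_. 1))"
    and bounded_control: "\<And>D. \<exists>B. \<forall>K. compact K \<and> convex K \<and> K = wulff \<Omega> (support_fun K) \<and>
          (\<forall>x\<in>K. \<forall>y\<in>K. \<forall>e\<in>L. \<bar>(x - y) \<bullet> e\<bar> \<le> D * norm e) \<longrightarrow> (\<forall>x\<in>K. \<forall>y\<in>K. norm (x - y) \<le> B)"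
begin

interpretation finite_measure \<mu> by (rule fin_\<mu>)

lemma space_\<mu>: "space \<mu> = sphere 0 1"
  using sets_eq_imp_space_eq[OF sets_\<mu>] by (simp add: space_restrict_space)

lemma meas_\<mu>: "f \<in> borel_measurable borel \<Longrightarrow> f \<in> borel_measurable \<mu>"
  using measurable_restrict_space1[of f borel borel "sphere 0 1"] measurable_cong_sets[OF sets_\<mu> refl] by blast

lemma integrable_\<mu>:
  fixes f :: "'a \<Rightarrow> real"
  assumes "f \<in> borel_measurable borel" "\<And>u. norm u = 1 \<Longrightarrow> \<bar>f u\<bar> \<le> C"
  shows "integrable \<mu> f"
  by (rule integrable_const_bound[of _ C]) (use assms meas_\<mu> space_\<mu> in auto)

lemma integral_\<G>:
  fixes f :: "'a \<Rightarrow> real"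
  assumes T: "T \<in> \<G>" and f: "f \<in> borel_measurable borel"
  shows "(\<integral>u. f (T u) \<partial>\<mu>) = (\<integral>u. f u \<partial>\<mu>)"
proof -
  have orth: "orthogonal_transformation T" by (rule \<G>_orth[OF T])
  have Tb: "T \<in> borel \<rightarrow>\<^sub>M borel"
    using orthogonal_transformation_linear[OF orth]
    by (intro borel_measurable_continuous_onI linear_continuous_on) (simp add: linear_conv_bounded_linear)
  have Tm: "T \<in> measurable \<mu> \<mu>"
  proof -
    have "T \<in> measurable (restrict_space borel (sphere 0 1)) (restrict_space borel (sphere 0 1))"
      by (rule measurable_restrict_space3[OF Tb]) (auto simp: orthogonal_transformation_norm[OF orth])
    then show ?thesis using measurable_cong_sets[OF sets_\<mu> sets_\<mu>] by blast
  qed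
  have "distr \<mu> \<mu> T = \<mu>"
  proof (rule measure_eqI)
    fix A assume "A \<in> sets (distr \<mu> \<mu> T)"
    then have A: "A \<in> sets \<mu>" by simp
    define V where "V = T -` A \<inter> space \<mu>"
    have V: "V \<in> sets \<mu>" unfolding V_def by (rule measurable_sets[OF Tm A])
    have "T ` V = A"
    proof
      show "A \<subseteq> T ` V"
      proof
        fix a assume a: "a \<in> A"
        obtain b where b: "a = T b" using orthogonal_transformation_surj[OF orth] by (metis surjD)
        have "norm a = 1" using sets.sets_into_space[OF A] a space_\<mu> by auto
        then have "b \<in> V" using a b orthogonal_transformation_norm[OF orth, of b] by (simp add: V_def space_\<mu>)
        then show "a \<in> T ` V" using b by blast
      qed
    qed (auto simp: V_def)
    then have "emeasure \<mu> V = emeasure \<mu> A" using \<G>_\<mu>[OF T V] by simp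
    then show "emeasure (distr \<mu> \<mu> T) A = emeasure \<mu> A" using A Tm by (simp add: emeasure_distr V_def)
  qed simp
  then have "(\<integral>u. f u \<partial>\<mu>) = (\<integral>u. f u \<partial>distr \<mu> \<mu> T)" by simp
  also have "\<dots> = (\<integral>u. f (T u) \<partial>\<mu>)" by (rule integral_distr[OF Tm meas_\<mu>[OF f]])
  finally show ?thesis by simp
qed

definition \<Psi> :: "'a set \<Rightarrow> 'a \<Rightarrow> real" where
  "\<Psi> K \<xi> = (\<integral>u. (support_fun K u - \<xi> \<bullet> u) powr p \<partial>\<mu>)"

lemma gap_nonneg: "compact K \<Longrightarrow> \<xi> \<in> K \<Longrightarrow> 0 \<le> support_fun K u - \<xi> \<bullet> u"
  using support_fun_upper[of K \<xi> u] by simp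

lemma support_fun_le_norm:
  assumes "compact K" "K \<noteq> {}" "K \<subseteq> cball 0 B" "norm u = 1" shows "\<bar>support_fun K u\<bar> \<le> B"
proof -
  obtain x where "x \<in> K" "x \<bullet> u = support_fun K u" using support_fun_attained[OF assms(1,2)] by blast
  moreover have "norm x \<le> B" using \<open>x \<in> K\<close> assms(3) by auto
  ultimately show ?thesis using Cauchy_Schwarz_ineq2[of x u] assms(4) by simp
qed

lemma integrable_powr_gap:
  assumes "compact K" "\<xi> \<in> K"
  shows "integrable \<mu> (\<lambda>u. (support_fun K u - \<xi> \<bullet> u) powr p)"
proof -
  have ne: "K \<noteq> {}" using assms by auto
  obtain B where B: "B > 0" "\<And>x. x \<in> K \<Longrightarrow> norm x \<le> B" using compact_imp_bounded[OF assms(1)] bounded_pos by metis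
  then have sub: "K \<subseteq> cball 0 B" by auto
  have [measurable]: "support_fun K \<in> borel_measurable borel" by (rule borel_measurable_support_fun[OF assms(1) ne])
  show ?thesis
  proof (rule integrable_\<mu>[where C="(2 * B) powr p"])
    fix u :: 'a assume u: "norm u = 1"
    have "\<bar>\<xi> \<bullet> u\<bar> \<le> B" using Cauchy_Schwarz_ineq2[of \<xi> u] B(2)[OF assms(2)] u by simp
    then have "support_fun K u - \<xi> \<bullet> u \<le> 2 * B" using support_fun_le_norm[OF assms(1) ne sub u] by linarith
    then show "\<bar>(support_fun K u - \<xi> \<bullet> u) powr p\<bar> \<le> (2 * B) powr p"
      using gap_nonneg[OF assms, of u] p by (simp add: powr_mono2)
  qed measurable
qed

lemma \<Psi>_concave:
  assumes "compact K" "\<xi> \<in> K" "\<eta> \<in> K" "0 \<le> s" "s \<le> 1" "(1 - s) *\<^sub>R \<xi> + s *\<^sub>R \<eta> \<in> K"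
  shows "(1 - s) * \<Psi> K \<xi> + s * \<Psi> K \<eta> \<le> \<Psi> K ((1 - s) *\<^sub>R \<xi> + s *\<^sub>R \<eta>)"
proof -
  note i = integrable_powr_gap[OF assms(1,2)] integrable_powr_gap[OF assms(1,3)] integrable_powr_gap[OF assms(1,6)]
  have "(1 - s) * \<Psi> K \<xi> + s * \<Psi> K \<eta> = (\<integral>u. (1 - s) * (support_fun K u - \<xi> \<bullet> u) powr p + s * (support_fun K u - \<eta> \<bullet> u) powr p \<partial>\<mu>)"
    using i by (simp add: \<Psi>_def)
  also have "\<dots> \<le> \<Psi> K ((1 - s) *\<^sub>R \<xi> + s *\<^sub>R \<eta>)"
    unfolding \<Psi>_def
  proof (rule integral_mono)
    fix u
    have "(1 - s) * (support_fun K u - \<xi> \<bullet> u) + s * (support_fun K u - \<eta> \<bullet> u) = support_fun K u - ((1 - s) *\<^sub>R \<xi> + s *\<^sub>R \<eta>) \<bullet> u"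
      by (simp add: inner_add_left algebra_simps)
    then show "(1 - s) * (support_fun K u - \<xi> \<bullet> u) powr p + s * (support_fun K u - \<eta> \<bullet> u) powr p
       \<le> (support_fun K u - ((1 - s) *\<^sub>R \<xi> + s *\<^sub>R \<eta>) \<bullet> u) powr p"
      using powr_concave_unit[OF p gap_nonneg[OF assms(1,2)] gap_nonneg[OF assms(1,3)] assms(4,5), of u u] by simp
  qed (use i in auto)
  finally show ?thesis .
qed

lemma powr_gap_diff:
  assumes K: "compact K" "\<xi> \<in> K" "compact K'" "\<eta> \<in> K'" "d \<ge> 0"
    and d: "\<And>u. norm u = 1 \<Longrightarrow> \<bar>(support_fun K u - \<xi> \<bullet> u) - (support_fun K' u - \<eta> \<bullet> u)\<bar> \<le> d"
  shows "\<bar>\<Psi> K \<xi> - \<Psi> K' \<eta>\<bar> \<le> d powr p * measure \<mu> (space \<mu>)"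
proof -
  note i = integrable_powr_gap[OF K(1,2)] integrable_powr_gap[OF K(3,4)]
  have "\<bar>\<Psi> K \<xi> - \<Psi> K' \<eta>\<bar> = \<bar>\<integral>u. (support_fun K u - \<xi> \<bullet> u) powr p - (support_fun K' u - \<eta> \<bullet> u) powr p \<partial>\<mu>\<bar>"
    using i by (simp add: \<Psi>_def)
  also have "\<dots> \<le> (\<integral>u. \<bar>(support_fun K u - \<xi> \<bullet> u) powr p - (support_fun K' u - \<eta> \<bullet> u) powr p\<bar> \<partial>\<mu>)"
    by (rule integral_abs_bound)
  also have "\<dots> \<le> (\<integral>u. d powr p \<partial>\<mu>)"
  proof (rule integral_mono)
    fix u assume "u \<in> space \<mu>"
    then have u: "norm u = 1" by (simp add: space_\<mu>)
    have "\<bar>(support_fun K u - \<xi> \<bullet> u) powr p - (support_fun K' u - \<eta> \<bullet> u) powr p\<bar>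
      \<le> \<bar>(support_fun K u - \<xi> \<bullet> u) - (support_fun K' u - \<eta> \<bullet> u)\<bar> powr p"
      by (rule powr_diff_le[OF p gap_nonneg[OF K(1,2)] gap_nonneg[OF K(3,4)]])
    also have "\<dots> \<le> d powr p" using d[OF u] p by (intro powr_mono2) auto
    finally show "\<bar>(support_fun K u - \<xi> \<bullet> u) powr p - (support_fun K' u - \<eta> \<bullet> u) powr p\<bar> \<le> d powr p" .
  qed (use i in auto)
  finally show ?thesis by (simp add: mult.commute)
qed

lemma continuous_on_\<Psi>:
  assumes "compact K" shows "continuous_on K (\<Psi> K)"
proof (cases "K = {}")
  case False
  show ?thesis
    unfolding continuous_on_def
  proof
    fix \<xi> assume xi: "\<xi> \<in> K"
    have "((\<lambda>\<eta>. norm (\<xi> - \<eta>) powr p * measure \<mu> (space \<mu>)) \<longlongrightarrow> norm (\<xi> - \<xi>) powr p * measure \<mu> (space \<mu>)) (at \<xi> within K)"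
      using p by (intro tendsto_intros tendsto_powr') auto
    then have lim: "((\<lambda>\<eta>. norm (\<xi> - \<eta>) powr p * measure \<mu> (space \<mu>)) \<longlongrightarrow> 0) (at \<xi> within K)" by simp
    have "((\<lambda>\<eta>. \<Psi> K \<eta> - \<Psi> K \<xi>) \<longlongrightarrow> 0) (at \<xi> within K)"
    proof (rule Lim_null_comparison[OF _ lim])
      show "\<forall>\<^sub>F \<eta> in at \<xi> within K. norm (\<Psi> K \<eta> - \<Psi> K \<xi>) \<le> norm (\<xi> - \<eta>) powr p * measure \<mu> (space \<mu>)"
        unfolding eventually_at_filter
      proof (intro always_eventually allI impI)
        fix \<eta> assume "\<eta> \<in> K"
        have "\<bar>(support_fun K u - \<eta> \<bullet> u) - (support_fun K u - \<xi> \<bullet> u)\<bar> \<le> norm (\<xi> - \<eta>)" if "norm u = 1" for u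
          using Cauchy_Schwarz_ineq2[of "\<xi> - \<eta>" u] that by (simp add: inner_diff_left)
        then show "norm (\<Psi> K \<eta> - \<Psi> K \<xi>) \<le> norm (\<xi> - \<eta>) powr p * measure \<mu> (space \<mu>)"
          using powr_gap_diff[OF assms \<open>\<eta> \<in> K\<close> assms xi norm_ge_zero, of "\<xi> - \<eta>"] by (simp only: real_norm_def)
      qed
    qed
    then show "(\<Psi> K \<longlongrightarrow> \<Psi> K \<xi>) (at \<xi> within K)" by (rule LIM_zero_cancel)
  qed
qed simp

lemma support_fun_\<G>:
  assumes "T \<in> \<G>" "T ` K = K" shows "support_fun K (T u) = support_fun K u"
proof -
  have "support_fun K (T u) = (SUP x\<in>T ` K. x \<bullet> T u)" using assms(2) by (simp add: support_fun_def)
  also have "\<dots> = (SUP x\<in>K. T x \<bullet> T u)" by (simp add: image_image)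
  also have "\<dots> = support_fun K u" using \<G>_orth[OF assms(1)] by (simp add: support_fun_def orthogonal_transformation_def)
  finally show ?thesis .
qed

lemma \<Psi>_\<G>:
  assumes "T \<in> \<G>" "T ` K = K" "compact K" "\<xi> \<in> K" shows "\<Psi> K (T \<xi>) = \<Psi> K \<xi>"
proof -
  have [measurable]: "support_fun K \<in> borel_measurable borel" using assms by (intro borel_measurable_support_fun) auto
  have "\<Psi> K (T \<xi>) = (\<integral>u. (support_fun K (T u) - T \<xi> \<bullet> T u) powr p \<partial>\<mu>)"
    unfolding \<Psi>_def by (rule integral_\<G>[OF assms(1), symmetric]) measurable
  also have "\<dots> = \<Psi> K \<xi>"
    using \<G>_orth[OF assms(1)] by (simp add: \<Psi>_def support_fun_\<G>[OF assms(1,2)] orthogonal_transformation_def)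
  finally show ?thesis .
qed

text \<open>The maximisers form a compact convex \<open>\<G>\<close>-invariant set, whose point of least norm is fixed by \<open>\<G>\<close>.\<close>

lemma invariant_maximiser:
  assumes K: "compact K" "convex K" "K \<noteq> {}" and inv: "\<And>T. T \<in> \<G> \<Longrightarrow> T ` K = K"
  obtains \<xi> where "\<xi> \<in> K" "\<And>\<eta>. \<eta> \<in> K \<Longrightarrow> \<Psi> K \<eta> \<le> \<Psi> K \<xi>" "\<And>T. T \<in> \<G> \<Longrightarrow> T \<xi> = \<xi>"
proof -
  obtain \<xi>0 where x0: "\<xi>0 \<in> K" "\<And>\<eta>. \<eta> \<in> K \<Longrightarrow> \<Psi> K \<eta> \<le> \<Psi> K \<xi>0"
    using continuous_attains_sup[OF K(1,3) continuous_on_\<Psi>[OF K(1)]] by blast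
  define A where "A = {\<xi>\<in>K. \<Psi> K \<xi> = \<Psi> K \<xi>0}"
  have cl: "closed A"
    unfolding A_def using continuous_closed_preimage[OF continuous_on_\<Psi>[OF K(1)] compact_imp_closed[OF K(1)], of "{\<Psi> K \<xi>0}"]
    by (simp add: vimage_def Int_def)
  have cv: "convex A"
    unfolding convex_alt
  proof (intro ballI allI impI)
    fix \<xi> \<eta> and s :: real assume *: "\<xi> \<in> A" "\<eta> \<in> A" "0 \<le> s \<and> s \<le> 1"
    have k: "(1 - s) *\<^sub>R \<xi> + s *\<^sub>R \<eta> \<in> K" using K(2) * unfolding convex_alt A_def by auto
    have "(1 - s) * \<Psi> K \<xi>0 + s * \<Psi> K \<xi>0 \<le> \<Psi> K ((1 - s) *\<^sub>R \<xi> + s *\<^sub>R \<eta>)"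
      using \<Psi>_concave[OF K(1) _ _ _ _ k] * by (auto simp: A_def)
    then have "\<Psi> K \<xi>0 \<le> \<Psi> K ((1 - s) *\<^sub>R \<xi> + s *\<^sub>R \<eta>)" by (simp add: algebra_simps)
    then show "(1 - s) *\<^sub>R \<xi> + s *\<^sub>R \<eta> \<in> A" using x0(2)[OF k] k by (simp add: A_def)
  qed
  have ne: "A \<noteq> {}" using x0 by (auto simp: A_def)
  define \<xi> where "\<xi> = closest_point A 0"
  have xA: "\<xi> \<in> A" unfolding \<xi>_def by (rule closest_point_in_set[OF cl ne])
  show ?thesis
  proof (rule that)
    show "\<xi> \<in> K" using xA by (simp add: A_def)
    show "\<Psi> K \<eta> \<le> \<Psi> K \<xi>" if "\<eta> \<in> K" for \<eta> using xA x0(2)[OF that] by (simp add: A_def)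
    fix T assume T: "T \<in> \<G>"
    have "T \<xi> \<in> K" using xA inv[OF T] by (auto simp: A_def)
    then have "T \<xi> \<in> A" using xA \<Psi>_\<G>[OF T inv[OF T] K(1)] by (auto simp: A_def)
    moreover have "dist 0 (T \<xi>) \<le> dist 0 z" if "z \<in> A" for z
      using closest_point_le[OF cl that, of 0] orthogonal_transformation_norm[OF \<G>_orth[OF T], of \<xi>] by (simp add: \<xi>_def)
    ultimately show "T \<xi> = \<xi>" unfolding \<xi>_def by (intro closest_point_unique[OF cv cl]) (auto simp: \<xi>_def)
  qed
qed

text \<open>The fixed-point equation expresses that the normals in \<open>\<Omega>\<close> alone cut
  out K. The maximality of the origin fixes the position of K and makes \<open>\<Psi> K 0\<close>
  the maximum over all base points.\<close>

definition good :: "'a set \<Rightarrow> bool" where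
  "good K \<longleftrightarrow> compact K \<and> convex K \<and> interior K \<noteq> {} \<and> K = wulff \<Omega> (support_fun K) \<and>
     (\<forall>T\<in>\<G>. T ` K = K) \<and> 0 \<in> K \<and> (\<forall>\<xi>\<in>K. \<Psi> K \<xi> \<le> \<Psi> K 0)"

lemma \<Psi>_translate:
  assumes "compact K" "K \<noteq> {}" shows "\<Psi> ((+) a ` K) (a + \<eta>) = \<Psi> K \<eta>"
proof -
  have "support_fun ((+) a ` K) u - (a + \<eta>) \<bullet> u = support_fun K u - \<eta> \<bullet> u" for u
    unfolding support_fun_plus[OF assms] inner_add_left by simp
  then show ?thesis by (simp only: \<Psi>_def)
qed

lemma good_translate:
  assumes K: "compact K" "convex K" "interior K \<noteq> {}" and w: "K = wulff \<Omega> (support_fun K)"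
    and inv: "\<And>T. T \<in> \<G> \<Longrightarrow> T ` K = K"
    and \<xi>: "\<xi> \<in> K" "\<And>\<eta>. \<eta> \<in> K \<Longrightarrow> \<Psi> K \<eta> \<le> \<Psi> K \<xi>" "\<And>T. T \<in> \<G> \<Longrightarrow> T \<xi> = \<xi>"
  shows "good ((+) (- \<xi>) ` K)" and "\<Psi> ((+) (- \<xi>) ` K) 0 = \<Psi> K \<xi>"
proof -
  have ne: "K \<noteq> {}" using \<xi> by auto
  show eq: "\<Psi> ((+) (- \<xi>) ` K) 0 = \<Psi> K \<xi>" using \<Psi>_translate[OF K(1) ne, of "- \<xi>" \<xi>] by simp
  show "good ((+) (- \<xi>) ` K)" unfolding good_def
  proof (intro conjI ballI)
    show "compact ((+) (- \<xi>) ` K)" by (rule compact_translation[OF K(1)])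
    show "convex ((+) (- \<xi>) ` K)" by (rule convex_translation[OF K(2)])
    show "interior ((+) (- \<xi>) ` K) \<noteq> {}" unfolding interior_translation using K(3) by blast
    have "(+) (- \<xi>) ` K = wulff \<Omega> (\<lambda>u. support_fun K u + (- \<xi>) \<bullet> u)"
      by (subst w) (rule wulff_translate)
    moreover have "support_fun ((+) (- \<xi>) ` K) = (\<lambda>u. support_fun K u + (- \<xi>) \<bullet> u)"
      by (rule ext) (rule support_fun_plus[OF K(1) ne])
    ultimately show "(+) (- \<xi>) ` K = wulff \<Omega> (support_fun ((+) (- \<xi>) ` K))" by metis
    show "0 \<in> (+) (- \<xi>) ` K" using \<xi>(1) by (intro image_eqI[of _ _ \<xi>]) auto
    fix T assume T: "T \<in> \<G>"
    have l: "linear T" by (rule orthogonal_transformation_linear[OF \<G>_orth[OF T]])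
    have "T ` (+) (- \<xi>) ` K = (+) (- \<xi>) ` T ` K"
      using \<xi>(3)[OF T] by (simp add: image_image linear_add[OF l] linear_neg[OF l] linear_diff[OF l])
    then show "T ` (+) (- \<xi>) ` K = (+) (- \<xi>) ` K" using inv[OF T] by simp
  next
    fix \<eta> assume "\<eta> \<in> (+) (- \<xi>) ` K"
    then obtain x where x: "x \<in> K" "\<eta> = - \<xi> + x" by auto
    show "\<Psi> ((+) (- \<xi>) ` K) \<eta> \<le> \<Psi> ((+) (- \<xi>) ` K) 0"
      unfolding eq x(2) \<Psi>_translate[OF K(1) ne] by (rule \<xi>(2)[OF x(1)])
  qed
qed

lemma \<Psi>_scale:
  assumes "compact K" "K \<noteq> {}" "s > 0" shows "\<Psi> ((*\<^sub>R) s ` K) (s *\<^sub>R \<eta>) = s powr p * \<Psi> K \<eta>"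
proof -
  have "(s * support_fun K u - s * (\<eta> \<bullet> u)) powr p = s powr p * (support_fun K u - \<eta> \<bullet> u) powr p" for u
    using assms(3) by (simp add: right_diff_distrib[symmetric] powr_mult)
  then show ?thesis
    unfolding \<Psi>_def using assms by (simp add: support_fun_scaleR)
qed

lemma good_scale:
  assumes "good K" "s > 0"
  shows "good ((*\<^sub>R) s ` K)" and "\<Psi> ((*\<^sub>R) s ` K) 0 = s powr p * \<Psi> K 0"
proof -
  have K: "compact K" "convex K" "interior K \<noteq> {}" "K = wulff \<Omega> (support_fun K)" "0 \<in> K"
    and inv: "\<And>T. T \<in> \<G> \<Longrightarrow> T ` K = K" and mx: "\<And>\<xi>. \<xi> \<in> K \<Longrightarrow> \<Psi> K \<xi> \<le> \<Psi> K 0"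
    using assms(1) by (auto simp: good_def)
  have ne: "K \<noteq> {}" using K by auto
  show eq: "\<Psi> ((*\<^sub>R) s ` K) 0 = s powr p * \<Psi> K 0" using \<Psi>_scale[OF K(1) ne assms(2), of 0] by simp
  show "good ((*\<^sub>R) s ` K)" unfolding good_def
  proof (intro conjI ballI)
    show "compact ((*\<^sub>R) s ` K)" by (rule compact_scaling[OF K(1)])
    show "convex ((*\<^sub>R) s ` K)" by (rule convex_scaling[OF K(2)])
    show "interior ((*\<^sub>R) s ` K) \<noteq> {}"
      using K(3) assms(2) interior_injective_linear_image[of "(*\<^sub>R) s" K] by (auto simp: linear_scaleR inj_on_def)
    have "(*\<^sub>R) s ` K = wulff \<Omega> (\<lambda>u. s * support_fun K u)"
      by (subst K(4)) (rule wulff_scale[OF assms(2)])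
    moreover have "support_fun ((*\<^sub>R) s ` K) = (\<lambda>u. s * support_fun K u)"
      by (rule ext) (rule support_fun_scaleR[OF K(1) ne less_imp_le[OF assms(2)]])
    ultimately show "(*\<^sub>R) s ` K = wulff \<Omega> (support_fun ((*\<^sub>R) s ` K))" by metis
    show "0 \<in> (*\<^sub>R) s ` K" using K(5) by (intro image_eqI[of _ _ 0]) auto
    fix T assume T: "T \<in> \<G>"
    have l: "linear T" by (rule orthogonal_transformation_linear[OF \<G>_orth[OF T]])
    have "T ` (*\<^sub>R) s ` K = (*\<^sub>R) s ` T ` K" by (simp add: image_image linear_cmul[OF l])
    then show "T ` (*\<^sub>R) s ` K = (*\<^sub>R) s ` K" using inv[OF T] by simp
  next
    fix \<eta> assume "\<eta> \<in> (*\<^sub>R) s ` K"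
    then obtain x where x: "x \<in> K" "\<eta> = s *\<^sub>R x" by auto
    show "\<Psi> ((*\<^sub>R) s ` K) \<eta> \<le> \<Psi> ((*\<^sub>R) s ` K) 0"
      unfolding eq x(2) \<Psi>_scale[OF K(1) ne assms(2)] by (intro mult_left_mono mx[OF x(1)]) simp
  qed
qed

end

section \<open>Volume of translates and dilates\<close>

lemma emeasure_lborel_translation:
  fixes K :: "'a::euclidean_space set"
  assumes [measurable]: "K \<in> sets borel"
  shows "emeasure lborel ((+) a ` K) = emeasure lborel K"
proof -
  have im: "(+) a ` K = (+) (- a) -` K"
  proof (intro set_eqI iffI)
    fix x assume "x \<in> (+) (- a) -` K"
    then show "x \<in> (+) a ` K" by (intro image_eqI[of _ _ "- a + x"]) auto
  qed auto
  have "emeasure lborel K = emeasure (distr lborel borel ((+) (- a))) K" by (simp only: lborel_distr_plus)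
  also have "\<dots> = emeasure lborel ((+) (- a) -` K)" by (subst emeasure_distr) auto
  finally show ?thesis by (simp add: im)
qed

lemma measure_lborel_translation:
  "compact K \<Longrightarrow> measure lborel ((+) a ` K) = measure lborel (K :: 'a::euclidean_space set)"
  using emeasure_lborel_translation[of K a] by (simp add: measure_def borel_closed compact_imp_closed)

lemma measure_lborel_scaleR:
  "compact K \<Longrightarrow> s > 0 \<Longrightarrow> measure lborel ((*\<^sub>R) s ` K) = s ^ DIM('a) * measure lborel (K :: 'a::euclidean_space set)"
  using emeasure_lborel_scaleR(1)[of s K] by (simp add: measure_def borel_closed compact_imp_closed enn2real_mult)

lemma measure_lborel_pos_interior:
  assumes "compact (K :: 'a::euclidean_space set)" "interior K \<noteq> {}" shows "0 < measure lborel K"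
proof -
  obtain z where "z \<in> interior K" using assms by auto
  then obtain e where e: "e > 0" "ball z e \<subseteq> K" by (meson mem_interior)
  have fin: "emeasure lborel K < \<infinity>" by (rule emeasure_bounded_finite) (rule compact_imp_bounded[OF assms(1)])
  have "0 < emeasure lborel (ball z e)" by (rule emeasure_lborel_ball_pos[OF e(1)])
  also have "\<dots> \<le> emeasure lborel K"
    using e assms(1) by (intro emeasure_mono) (auto simp: borel_closed compact_imp_closed)
  finally show ?thesis using fin by (simp add: measure_def enn2real_positive_iff)
qed

section \<open>A priori bounds and existence of a minimiser\<close>

context Lp_problem
begin

interpretation finite_measure \<mu> by (rule fin_\<mu>)

lemma goodD:
  assumes "good K"
  shows "compact K" "convex K" "interior K \<noteq> {}" "K = wulff \<Omega> (support_fun K)" "0 \<in> K" "K \<noteq> {}"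
    and "\<And>T. T \<in> \<G> \<Longrightarrow> T ` K = K" and "\<And>\<xi>. \<xi> \<in> K \<Longrightarrow> \<Psi> K \<xi> \<le> \<Psi> K 0"
  using assms by (auto simp: good_def)

text \<open>The moment is continuous in \<open>e\<close>, homogeneous of degree p and, by
  \<open>nondeg\<close>, positive on the compact unit sphere of \<open>L\<close>, so it has a
  positive minimum there. If that sphere is empty, then only \<open>e = 0\<close> occurs, with
  \<open>0 powr p = 0\<close>.\<close>

lemma width_moment_pos:
  obtains c where "c > 0" "\<And>e. e \<in> L \<Longrightarrow> norm e powr p * c \<le> (\<integral>u. \<bar>e \<bullet> u\<bar> powr p \<partial>\<mu>)"
proof -
  define m where "m e = (\<integral>u. \<bar>e \<bullet> u\<bar> powr p \<partial>\<mu>)" for e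
  have int: "integrable \<mu> (\<lambda>u. \<bar>e \<bullet> u\<bar> powr p)" for e
  proof (rule integrable_\<mu>[where C="norm e powr p"])
    fix u :: 'a assume "norm u = 1"
    then have "\<bar>e \<bullet> u\<bar> \<le> norm e" using Cauchy_Schwarz_ineq2[of e u] by simp
    then show "\<bar>\<bar>e \<bullet> u\<bar> powr p\<bar> \<le> norm e powr p" using p by (simp add: powr_mono2)
  qed measurable
  have diff: "\<bar>m e - m e'\<bar> \<le> norm (e - e') powr p * measure \<mu> (space \<mu>)" for e e'
  proof -
    have "\<bar>m e - m e'\<bar> = \<bar>\<integral>u. \<bar>e \<bullet> u\<bar> powr p - \<bar>e' \<bullet> u\<bar> powr p \<partial>\<mu>\<bar>" using int by (simp add: m_def)
    also have "\<dots> \<le> (\<integral>u. \<bar>\<bar>e \<bullet> u\<bar> powr p - \<bar>e' \<bullet> u\<bar> powr p\<bar> \<partial>\<mu>)" by (rule integral_abs_bound)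
    also have "\<dots> \<le> (\<integral>u. norm (e - e') powr p \<partial>\<mu>)"
    proof (rule integral_mono)
      fix u assume "u \<in> space \<mu>"
      then have u: "norm u = 1" by (simp add: space_\<mu>)
      have "\<bar>\<bar>e \<bullet> u\<bar> powr p - \<bar>e' \<bullet> u\<bar> powr p\<bar> \<le> \<bar>\<bar>e \<bullet> u\<bar> - \<bar>e' \<bullet> u\<bar>\<bar> powr p" by (rule powr_diff_le[OF p]) auto
      also have "\<dots> \<le> norm (e - e') powr p"
      proof (rule powr_mono2)
        have "\<bar>\<bar>e \<bullet> u\<bar> - \<bar>e' \<bullet> u\<bar>\<bar> \<le> \<bar>(e - e') \<bullet> u\<bar>" by (simp add: inner_diff_left)
        also have "\<dots> \<le> norm (e - e')" using Cauchy_Schwarz_ineq2[of "e - e'" u] u by simp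
        finally show "\<bar>\<bar>e \<bullet> u\<bar> - \<bar>e' \<bullet> u\<bar>\<bar> \<le> norm (e - e')" .
      qed (use p in auto)
      finally show "\<bar>\<bar>e \<bullet> u\<bar> powr p - \<bar>e' \<bullet> u\<bar> powr p\<bar> \<le> norm (e - e') powr p" .
    qed (use int in auto)
    finally show ?thesis by (simp add: mult.commute)
  qed
  have cont: "continuous_on S m" for S
    unfolding continuous_on_def
  proof
    fix e assume "e \<in> S"
    have "((\<lambda>e'. norm (e' - e) powr p * measure \<mu> (space \<mu>)) \<longlongrightarrow> norm (e - e) powr p * measure \<mu> (space \<mu>)) (at e within S)"
      using p by (intro tendsto_intros tendsto_powr') auto
    then have lim: "((\<lambda>e'. norm (e' - e) powr p * measure \<mu> (space \<mu>)) \<longlongrightarrow> 0) (at e within S)" by simp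
    have "((\<lambda>e'. m e' - m e) \<longlongrightarrow> 0) (at e within S)"
      by (rule Lim_null_comparison[OF always_eventually lim]) (simp only: diff real_norm_def simp_thms)
    then show "(m \<longlongrightarrow> m e) (at e within S)" by (rule LIM_zero_cancel)
  qed
  have scale: "m (s *\<^sub>R e) = s powr p * m e" if "s \<ge> 0" for s e
    using that by (simp add: m_def abs_mult powr_mult)
  have pos: "m e > 0" if e: "e \<in> L" "e \<noteq> 0" for e
  proof -
    have "m e \<noteq> 0"
    proof
      assume "m e = 0"
      then have "AE u in \<mu>. \<bar>e \<bullet> u\<bar> powr p = 0"
        using integral_nonneg_eq_0_iff_AE[OF int[of e]] by (simp add: m_def)
      then show False using nondeg[OF e] by simp
    qed
    moreover have "m e \<ge> 0" unfolding m_def by simp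
    ultimately show ?thesis by simp
  qed
  show ?thesis
  proof (cases "L \<inter> sphere 0 1 = {}")
    case True
    have "e = 0" if "e \<in> L" for e
    proof (rule ccontr)
      assume "e \<noteq> 0"
      then have "(1 / norm e) *\<^sub>R e \<in> L \<inter> sphere 0 1" using subspace_scale[OF L that] by simp
      then show False using True by blast
    qed
    note triv = this
    have "norm e powr p * 1 \<le> (\<integral>u. \<bar>e \<bullet> u\<bar> powr p \<partial>\<mu>)" if "e \<in> L" for e
      using triv[OF that] by simp
    then show ?thesis by (rule that[OF zero_less_one])
  next
    case False
    have "compact (sphere 0 1 \<inter> L)" by (intro compact_Int_closed compact_sphere closed_subspace[OF L])
    then have "compact (L \<inter> sphere 0 1)" by (simp add: Int_commute)
    from continuous_attains_inf[OF this False cont]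
    obtain e0 where e0: "e0 \<in> L \<inter> sphere 0 1" "\<And>e. e \<in> L \<inter> sphere 0 1 \<Longrightarrow> m e0 \<le> m e" by blast
    show ?thesis
    proof (rule that[of "m e0"])
      have "e0 \<noteq> 0" using e0(1) by auto
      then show "m e0 > 0" using pos[of e0] e0(1) by blast
      fix e assume e: "e \<in> L"
      show "norm e powr p * m e0 \<le> (\<integral>u. \<bar>e \<bullet> u\<bar> powr p \<partial>\<mu>)"
        unfolding m_def[symmetric]
      proof (cases "e = 0")
        case False
        have "(1 / norm e) *\<^sub>R e \<in> L \<inter> sphere 0 1" using subspace_scale[OF L e] False by simp
        then have "m e0 \<le> m ((1 / norm e) *\<^sub>R e)" by (rule e0(2))
        then have "norm e powr p * m e0 \<le> norm e powr p * m ((1 / norm e) *\<^sub>R e)" by (intro mult_left_mono) auto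
        also have "\<dots> = m (norm e *\<^sub>R ((1 / norm e) *\<^sub>R e))" by (rule scale[symmetric]) simp
        also have "norm e *\<^sub>R ((1 / norm e) *\<^sub>R e) = e" using False by simp
        finally show "norm e powr p * m e0 \<le> m e" .
      qed (simp add: m_def)
    qed
  qed
qed

text \<open>At the midpoint of two points x, y of K the gap in a direction u of \<open>L\<close> is
  at least half of \<open>\<bar>(x - y) \<bullet> u\<bar>\<close>. Maximality of the origin bounds
  the integral of the p-th power of this gap by \<open>\<Psi> K 0\<close>, which controls the
  component of x - y in \<open>L\<close>; the other components are left to
  \<open>bounded_control\<close>.\<close>

lemma good_bounded:
  obtains B where "B > 0" "\<And>K. good K \<Longrightarrow> \<Psi> K 0 \<le> M \<Longrightarrow> K \<subseteq> cball 0 B"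
proof -
  obtain c where c: "c > 0" "\<And>e. e \<in> L \<Longrightarrow> norm e powr p * c \<le> (\<integral>u. \<bar>e \<bullet> u\<bar> powr p \<partial>\<mu>)"
    using width_moment_pos by blast
  define D where "D = 2 * (max M 0 / c) powr (1 / p)"
  have width: "\<bar>(x - y) \<bullet> e\<bar> \<le> D * norm e" if K: "good K" "\<Psi> K 0 \<le> M" and xy: "x \<in> K" "y \<in> K" and e: "e \<in> L" for K x y e
  proof -
    obtain P Z where PZ: "P \<in> span L" "\<And>w. w \<in> span L \<Longrightarrow> orthogonal Z w" "x - y = P + Z"
      using orthogonal_subspace_decomp_exists by metis
    have P: "P \<in> L" using PZ(1) by (simp add: span_eq_iff[THEN iffD2, OF L])
    have in_L: "(x - y) \<bullet> u = P \<bullet> u" if "u \<in> L" for u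
      using PZ(2)[of u] span_base[OF that] by (simp add: PZ(3) inner_add_left orthogonal_def)
    define w where "w = (1/2) *\<^sub>R x + (1/2) *\<^sub>R y"
    have w: "w \<in> K" unfolding w_def using goodD(2)[OF K(1)] xy by (simp add: convex_def)
    have half: "\<bar>(1/2) *\<^sub>R P \<bullet> u\<bar> \<le> support_fun K u - w \<bullet> u" if "u \<in> L" for u
      using support_fun_upper[OF goodD(1)[OF K(1)] xy(1), of u] support_fun_upper[OF goodD(1)[OF K(1)] xy(2), of u] in_L[OF that]
      by (simp add: w_def inner_add_left inner_diff_left abs_le_iff field_simps)
    have "norm ((1/2) *\<^sub>R P) powr p * c \<le> (\<integral>u. \<bar>(1/2) *\<^sub>R P \<bullet> u\<bar> powr p \<partial>\<mu>)"
      by (rule c(2)) (rule subspace_scale[OF L P])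
    also have "\<dots> \<le> \<Psi> K w"
      unfolding \<Psi>_def
    proof (rule integral_mono_AE)
      show "integrable \<mu> (\<lambda>u. \<bar>(1/2) *\<^sub>R P \<bullet> u\<bar> powr p)"
      proof (rule integrable_\<mu>[where C="norm ((1/2) *\<^sub>R P) powr p"])
        fix u :: 'a assume "norm u = 1"
        then have "\<bar>(1/2) *\<^sub>R P \<bullet> u\<bar> \<le> norm ((1/2) *\<^sub>R P)" using Cauchy_Schwarz_ineq2[of "(1/2) *\<^sub>R P" u] by simp
        from powr_mono2[OF less_imp_le[OF p(1)] abs_ge_zero this]
        show "\<bar>\<bar>(1/2) *\<^sub>R P \<bullet> u\<bar> powr p\<bar> \<le> norm ((1/2) *\<^sub>R P) powr p" by (simp only: abs_of_nonneg[OF powr_ge_zero])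
      qed measurable
      show "integrable \<mu> (\<lambda>u. (support_fun K u - w \<bullet> u) powr p)" by (rule integrable_powr_gap[OF goodD(1)[OF K(1)] w])
      show "AE u in \<mu>. \<bar>(1/2) *\<^sub>R P \<bullet> u\<bar> powr p \<le> (support_fun K u - w \<bullet> u) powr p"
        using AE_L by eventually_elim (use half p in \<open>intro powr_mono2, auto\<close>)
    qed
    also have "\<dots> \<le> \<Psi> K 0" by (rule goodD(8)[OF K(1) w])
    also have "\<dots> \<le> max M 0" using K(2) by simp
    finally have "(norm P / 2) powr p \<le> max M 0 / c" using c(1) by (simp add: pos_le_divide_eq)
    then have "((norm P / 2) powr p) powr (1 / p) \<le> (max M 0 / c) powr (1 / p)" using p by (intro powr_mono2) auto
    then have "norm P \<le> D" using p by (simp add: powr_powr D_def)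
    have "\<bar>(x - y) \<bullet> e\<bar> = \<bar>P \<bullet> e\<bar>" using in_L[OF e] by simp
    also have "\<dots> \<le> norm P * norm e" by (rule Cauchy_Schwarz_ineq2)
    also have "\<dots> \<le> D * norm e" using \<open>norm P \<le> D\<close> by (rule mult_right_mono) simp
    finally show ?thesis .
  qed
  obtain B where B: "\<And>K. compact K \<and> convex K \<and> K = wulff \<Omega> (support_fun K) \<and>
          (\<forall>x\<in>K. \<forall>y\<in>K. \<forall>e\<in>L. \<bar>(x - y) \<bullet> e\<bar> \<le> D * norm e) \<Longrightarrow> (\<forall>x\<in>K. \<forall>y\<in>K. norm (x - y) \<le> B)"
    using bounded_control by metis
  show ?thesis
  proof (rule that[of "max B 1"])
    fix K assume K: "good K" "\<Psi> K 0 \<le> M"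
    have "\<forall>x\<in>K. \<forall>y\<in>K. norm (x - y) \<le> B"
      by (rule B) (use goodD(1,2,4)[OF K(1)] width[OF K] in blast)
    then show "K \<subseteq> cball 0 (max B 1)" using goodD(5)[OF K(1)] by (force simp: le_max_iff_disj)
  qed simp
qed

text \<open>Uniform limits of support functions of good bodies: an interior ball of the limit body absorbs the error.\<close>

lemma good_limit:
  assumes app: "\<And>\<epsilon>. \<epsilon> > 0 \<Longrightarrow> \<exists>K'. good K' \<and> K' \<subseteq> cball 0 B \<and> 1 \<le> measure lborel K' \<and>
      (\<forall>u. norm u = 1 \<longrightarrow> \<bar>support_fun K' u - \<gamma> u\<bar> \<le> \<epsilon>) \<and> \<Psi> K' 0 \<le> m + \<epsilon>"
  shows "\<exists>K. good K \<and> 1 \<le> measure lborel K \<and> \<Psi> K 0 \<le> m"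
proof -
  define K where "K = wulff (sphere 0 1) \<gamma>"
  have KI: "x \<in> K" if "\<And>u. norm u = 1 \<Longrightarrow> x \<bullet> u \<le> \<gamma> u" for x using that by (auto simp: K_def wulff_def)
  have KD: "x \<bullet> u \<le> \<gamma> u" if "x \<in> K" "norm u = 1" for x u using that by (auto simp: K_def wulff_def)
  have le_eps: "a \<le> b" if "\<And>\<epsilon>. \<epsilon> > 0 \<Longrightarrow> a \<le> b + \<epsilon>" for a b :: real using that by (rule field_le_epsilon)
  have \<gamma>_le: "\<gamma> u \<le> B" if u: "norm u = 1" for u
  proof (rule le_eps)
    fix \<epsilon> :: real assume "\<epsilon> > 0"
    then obtain K' where K': "good K'" "K' \<subseteq> cball 0 B" "\<And>u. norm u = 1 \<Longrightarrow> \<bar>support_fun K' u - \<gamma> u\<bar> \<le> \<epsilon>" using app by metis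
    have "\<bar>support_fun K' u\<bar> \<le> B" by (rule support_fun_le_norm[OF goodD(1,6)[OF K'(1)] K'(2) u])
    then show "\<gamma> u \<le> B + \<epsilon>" using K'(3)[OF u] by linarith
  qed
  have KB: "K \<subseteq> cball 0 B"
  proof
    fix x assume x: "x \<in> K"
    show "x \<in> cball 0 B"
    proof (cases "x = 0")
      case True
      obtain b :: 'a where "b \<in> Basis" using nonempty_Basis by blast
      then show ?thesis using KD[OF x, of b] \<gamma>_le[of b] True by simp
    next
      case False
      have "norm x = x \<bullet> (x /\<^sub>R norm x)" using False by (simp add: power2_norm_eq_inner[symmetric] power2_eq_square)
      also have "\<dots> \<le> B" using KD[OF x, of "x /\<^sub>R norm x"] \<gamma>_le[of "x /\<^sub>R norm x"] False by simp
      finally show ?thesis by simp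
    qed
  qed
  have cK: "compact K"
    using closed_wulff[of "sphere 0 1" \<gamma>] bounded_subset[OF bounded_cball KB] by (simp add: compact_eq_bounded_closed K_def)
  have vK: "convex K" unfolding K_def by (rule convex_wulff)
  have vol: "1 \<le> measure lborel K"
  proof -
    \<comment> \<open>Upper semicontinuity of the volume: each outer approximation
      \<open>W k\<close> contains a body of volume at least 1, and their intersection lies in
      K.\<close>
    define W where "W k = wulff (sphere 0 1) (\<lambda>u. \<gamma> u + 1 / real (Suc k)) \<inter> cball 0 B" for k
    have Wc: "compact (W k)" for k unfolding W_def by (subst Int_commute) (rule compact_Int_closed[OF compact_cball closed_wulff])
    have Wb: "W k \<in> sets borel" for k using Wc[of k] by (simp add: borel_closed compact_imp_closed)
    have fin: "emeasure lborel (W k) < \<infinity>" for k by (rule emeasure_bounded_finite) (rule compact_imp_bounded[OF Wc])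
    have "emeasure lborel (W k) \<ge> 1" for k
    proof -
      have "1 / real (Suc k) > 0" by simp
      then obtain K' where K': "good K'" "K' \<subseteq> cball 0 B" "1 \<le> measure lborel K'" "\<And>u. norm u = 1 \<Longrightarrow> \<bar>support_fun K' u - \<gamma> u\<bar> \<le> 1 / real (Suc k)"
        using app by metis
      have "K' \<subseteq> W k"
      proof
        fix x assume x: "x \<in> K'"
        have "x \<bullet> u \<le> \<gamma> u + 1 / real (Suc k)" if "norm u = 1" for u
          using support_fun_upper[OF goodD(1)[OF K'(1)] x, of u] K'(4)[OF that] by linarith
        then show "x \<in> W k" using x K'(2) by (auto simp: W_def wulff_def)
      qed
      then have "emeasure lborel K' \<le> emeasure lborel (W k)" using Wb by (intro emeasure_mono) auto
      moreover have "ennreal 1 \<le> ennreal (measure lborel K')" using K'(3) by (rule ennreal_leI)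
      moreover have "emeasure lborel K' = ennreal (measure lborel K')"
        using emeasure_bounded_finite[OF compact_imp_bounded[OF goodD(1)[OF K'(1)]]] by (intro emeasure_eq_ennreal_measure) (simp add: less_top)
      ultimately show ?thesis by (metis ennreal_1 order_trans)
    qed
    moreover have "(\<lambda>k. emeasure lborel (W k)) \<longlonglongrightarrow> emeasure lborel (\<Inter>k. W k)"
    proof (rule Lim_emeasure_decseq)
      show "decseq W"
      proof (rule decseq_SucI)
        fix k
        have "1 / real (Suc (Suc k)) \<le> 1 / real (Suc k)" by (intro divide_left_mono) auto
        then show "W (Suc k) \<subseteq> W k" by (force simp: W_def wulff_def)
      qed
    qed (use Wb fin in \<open>auto simp: less_top\<close>)
    ultimately have "1 \<le> emeasure lborel (\<Inter>k. W k)" by (intro LIMSEQ_le_const) auto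
    also have "(\<Inter>k. W k) \<subseteq> K"
    proof
      fix x assume x: "x \<in> (\<Inter>k. W k)"
      show "x \<in> K"
      proof (rule KI, rule le_eps)
        fix u :: 'a and \<epsilon> :: real assume u: "norm u = 1" and e: "\<epsilon> > 0"
        obtain k where "inverse (real (Suc k)) < \<epsilon>" using reals_Archimedean[OF e] by blast
        moreover have "x \<bullet> u \<le> \<gamma> u + 1 / real (Suc k)" using x u by (auto simp: W_def wulff_def)
        ultimately show "x \<bullet> u \<le> \<gamma> u + \<epsilon>" by (simp add: inverse_eq_divide)
      qed
    qed
    then have "emeasure lborel (\<Inter>k. W k) \<le> emeasure lborel K"
      using cK by (intro emeasure_mono) (auto simp: borel_closed compact_imp_closed)
    finally have "ennreal 1 \<le> emeasure lborel K" by simp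
    moreover have "emeasure lborel K = ennreal (measure lborel K)"
      using emeasure_bounded_finite[OF compact_imp_bounded[OF cK]] by (intro emeasure_eq_ennreal_measure) (simp add: less_top)
    ultimately show ?thesis by (simp add: ennreal_le_iff)
  qed
  \<comment> \<open>The lower bound on the volume keeps the limit from collapsing into a
    hyperplane.\<close>
  have iK: "interior K \<noteq> {}"
  proof
    assume "interior K = {}"
    then have "negligible K" using negligible_convex_interior[OF vK] by simp
    then have "emeasure lborel K = 0"
      using null_sets_completion_iff[of K lborel] cK by (auto simp: negligible_iff_null_sets borel_closed compact_imp_closed)
    then show False using vol by (simp add: measure_def)
  qed
  then obtain z \<rho> where z: "\<rho> > 0" "cball z \<rho> \<subseteq> K" by (meson ex_in_conv mem_interior_cball)
  have zr: "z \<bullet> u + \<rho> \<le> \<gamma> u" if u: "norm u = 1" for u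
  proof -
    have "z + \<rho> *\<^sub>R u \<in> K" using z u by (intro subsetD[OF z(2)]) (simp add: dist_norm)
    from KD[OF this u] u show ?thesis by (simp add: inner_add_left power2_norm_eq_inner[symmetric])
  qed
  have zB: "norm z \<le> B" using KB z by (force simp: less_imp_le)
  \<comment> \<open>The homothety with centre \<open>z\<close> and ratio
    \<open>1 - \<epsilon> / \<rho>\<close>. As the ball of radius \<open>\<rho>\<close> about
    \<open>z\<close> lies in K, it tightens every constraint by \<open>\<epsilon>\<close>, which is
    the error of the approximating support functions.\<close>
  define push where "push \<epsilon> x = z + (1 - \<epsilon> / \<rho>) *\<^sub>R (x - z)" for \<epsilon> x
  have push_inner: "push \<epsilon> x \<bullet> u \<le> \<gamma> u - \<epsilon> + (1 - \<epsilon> / \<rho>) * t" if "norm u = 1" "0 \<le> \<epsilon>" "\<epsilon> \<le> \<rho>" "x \<bullet> u \<le> \<gamma> u + t" for \<epsilon> x u t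
  proof -
    have "push \<epsilon> x \<bullet> u = (\<epsilon> / \<rho>) * (z \<bullet> u) + (1 - \<epsilon> / \<rho>) * (x \<bullet> u)"
      by (simp add: push_def inner_add_left inner_diff_left algebra_simps)
    also have "\<dots> \<le> (\<epsilon> / \<rho>) * (\<gamma> u - \<rho>) + (1 - \<epsilon> / \<rho>) * (\<gamma> u + t)"
      using that z(1) zr[OF that(1)] by (intro add_mono mult_left_mono) auto
    also have "\<dots> = \<gamma> u - \<epsilon> + (1 - \<epsilon> / \<rho>) * t" using z(1) by (simp add: algebra_simps)
    finally show ?thesis .
  qed
  have push_lim: "x \<bullet> u \<le> c" if "\<And>\<epsilon>. 0 < \<epsilon> \<Longrightarrow> \<epsilon> \<le> \<rho> \<Longrightarrow> push \<epsilon> x \<bullet> u \<le> c + \<epsilon>" for x u c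
  proof -
    define e where "e k = \<rho> / real (Suc k)" for k
    have e: "0 < e k" "e k \<le> \<rho>" for k using z(1) by (auto simp: e_def divide_simps)
    have "e \<longlonglongrightarrow> 0" unfolding e_def by (rule LIMSEQ_Suc[OF lim_const_over_n])
    then have "(\<lambda>k. z + (1 - e k / \<rho>) *\<^sub>R (x - z)) \<longlonglongrightarrow> z + (1 - 0 / \<rho>) *\<^sub>R (x - z)"
      by (intro tendsto_intros) (use z(1) in auto)
    from tendsto_inner[OF this tendsto_const] tendsto_add[OF tendsto_const \<open>e \<longlonglongrightarrow> 0\<close>]
    have "(\<lambda>k. push (e k) x \<bullet> u) \<longlonglongrightarrow> x \<bullet> u" "(\<lambda>k. c + e k) \<longlonglongrightarrow> c"
      unfolding push_def by simp_all
    then show ?thesis using LIMSEQ_le[of "\<lambda>k. push (e k) x \<bullet> u" "x \<bullet> u" "\<lambda>k. c + e k" c] that e by auto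
  qed
  \<comment> \<open>A priori the support function of a Wulff shape could be smaller than
    \<open>\<gamma>\<close>. But points of the approximating bodies, pushed inwards, lie in K and
    almost attain the value \<open>\<gamma> u\<close>.\<close>
  have hK: "support_fun K u = \<gamma> u" if u: "norm u = 1" for u
  proof (rule antisym)
    have ne: "K \<noteq> {}" using iK by auto
    show "support_fun K u \<le> \<gamma> u" by (rule support_fun_least[OF ne]) (rule KD[OF _ u])
    show "\<gamma> u \<le> support_fun K u"
    proof -
      have bnd: "\<gamma> u \<le> support_fun K u + (2 + (2 * B) / \<rho>) * \<epsilon>" if e: "0 < \<epsilon>" "\<epsilon> \<le> \<rho>" for \<epsilon>
      proof -
        obtain K' where K': "good K'" "K' \<subseteq> cball 0 B" "\<And>u. norm u = 1 \<Longrightarrow> \<bar>support_fun K' u - \<gamma> u\<bar> \<le> \<epsilon>" using app[OF e(1)] by metis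
        obtain x where x: "x \<in> K'" "x \<bullet> u = support_fun K' u" using support_fun_attained[OF goodD(1,6)[OF K'(1)]] by blast
        have "push \<epsilon> x \<in> K"
        proof (rule KI)
          fix v :: 'a assume v: "norm v = 1"
          have "x \<bullet> v \<le> \<gamma> v + \<epsilon>" using support_fun_upper[OF goodD(1)[OF K'(1)] x(1), of v] K'(3)[OF v] by linarith
          from push_inner[OF v _ e(2) this] have "push \<epsilon> x \<bullet> v \<le> \<gamma> v - \<epsilon> + (1 - \<epsilon> / \<rho>) * \<epsilon>" using e by simp
          also have "\<dots> \<le> \<gamma> v - \<epsilon> + 1 * \<epsilon>" using e z(1) by (intro add_left_mono mult_right_mono) auto
          finally show "push \<epsilon> x \<bullet> v \<le> \<gamma> v" by simp
        qed
        then have "push \<epsilon> x \<bullet> u \<le> support_fun K u" by (rule support_fun_upper[OF cK])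
        moreover have "push \<epsilon> x \<bullet> u = x \<bullet> u - (\<epsilon> / \<rho>) * ((x - z) \<bullet> u)"
          by (simp add: push_def inner_add_left inner_diff_left algebra_simps)
        moreover have "(\<epsilon> / \<rho>) * ((x - z) \<bullet> u) \<le> (\<epsilon> / \<rho>) * (2 * B)"
        proof (rule mult_left_mono)
          have "(x - z) \<bullet> u \<le> norm (x - z)" using norm_cauchy_schwarz[of "x - z" u] u by simp
          also have "\<dots> \<le> norm x + norm z" by (rule norm_triangle_ineq4)
          also have "\<dots> \<le> 2 * B" using zB x K'(2) by auto
          finally show "(x - z) \<bullet> u \<le> 2 * B" .
        qed (use e z in auto)
        moreover have "\<gamma> u \<le> x \<bullet> u + \<epsilon>" using K'(3)[OF u] x(2) by linarith
        moreover have "(\<epsilon> / \<rho>) * (2 * B) = (2 * B) / \<rho> * \<epsilon>" by simp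
        ultimately have "\<gamma> u \<le> support_fun K u + (1 + (2 * B) / \<rho>) * \<epsilon>"
          unfolding distrib_right[of 1] mult_1_left by linarith
        then show ?thesis using e by (simp add: distrib_right)
      qed
      define e where "e k = \<rho> / real (Suc k)" for k
      have e: "0 < e k" "e k \<le> \<rho>" for k using z(1) by (auto simp: e_def divide_simps)
      have "e \<longlonglongrightarrow> 0" unfolding e_def by (rule LIMSEQ_Suc[OF lim_const_over_n])
      then have "(\<lambda>k. support_fun K u + (2 + (2 * B) / \<rho>) * e k) \<longlonglongrightarrow> support_fun K u + (2 + (2 * B) / \<rho>) * 0"
        by (intro tendsto_intros)
      then show ?thesis using bnd[OF e] LIMSEQ_le_const by fastforce
    qed
  qed
  have wK: "K = wulff \<Omega> (support_fun K)"
  proof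
    show "K \<subseteq> wulff \<Omega> (support_fun K)" using support_fun_upper[OF cK] by (auto simp: wulff_def)
    show "wulff \<Omega> (support_fun K) \<subseteq> K"
    proof
      fix x assume x: "x \<in> wulff \<Omega> (support_fun K)"
      show "x \<in> K"
      proof (rule KI, rule push_lim)
        fix v :: 'a and \<epsilon> :: real assume v: "norm v = 1" and e: "0 < \<epsilon>" "\<epsilon> \<le> \<rho>"
        obtain K' where K': "good K'" "\<And>u. norm u = 1 \<Longrightarrow> \<bar>support_fun K' u - \<gamma> u\<bar> \<le> \<epsilon>" using app[OF e(1)] by metis
        have "push \<epsilon> x \<in> wulff \<Omega> (support_fun K')"
          unfolding wulff_def
        proof safe
          fix u assume u: "u \<in> \<Omega>"
          then have nu: "norm u = 1" using \<Omega>_sphere by auto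
          have "x \<bullet> u \<le> \<gamma> u + 0" using x u hK[OF nu] by (auto simp: wulff_def)
          from push_inner[OF nu _ e(2) this] e have "push \<epsilon> x \<bullet> u \<le> \<gamma> u - \<epsilon>" by simp
          then show "push \<epsilon> x \<bullet> u \<le> support_fun K' u" using K'(2)[OF nu] by linarith
        qed
        then have "push \<epsilon> x \<in> K'" using goodD(4)[OF K'(1)] by simp
        then have "push \<epsilon> x \<bullet> v \<le> support_fun K' v" by (rule support_fun_upper[OF goodD(1)[OF K'(1)]])
        then show "push \<epsilon> x \<bullet> v \<le> \<gamma> v + \<epsilon>" using K'(2)[OF v] by linarith
      qed
    qed
  qed
  have \<gamma>_inv: "\<gamma> (T u) = \<gamma> u" if T: "T \<in> \<G>" and u: "norm u = 1" for T u
  proof -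
    have Tu: "norm (T u) = 1" using orthogonal_transformation_norm[OF \<G>_orth[OF T]] u by simp
    have "\<bar>\<gamma> (T u) - \<gamma> u\<bar> \<le> 0 + \<epsilon>" if "\<epsilon> > 0" for \<epsilon>
    proof -
      have "\<epsilon> / 2 > 0" using that by simp
      then obtain K' where K': "good K'" "\<And>u. norm u = 1 \<Longrightarrow> \<bar>support_fun K' u - \<gamma> u\<bar> \<le> \<epsilon> / 2" using app by metis
      show ?thesis using K'(2)[OF u] K'(2)[OF Tu] support_fun_\<G>[OF T goodD(7)[OF K'(1) T], of u] by linarith
    qed
    then have "\<bar>\<gamma> (T u) - \<gamma> u\<bar> \<le> 0" by (rule le_eps)
    then show ?thesis by simp
  qed
  have inv: "T ` K = K" if T: "T \<in> \<G>" for T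
  proof -
    have orth: "orthogonal_transformation T" by (rule \<G>_orth[OF T])
    have surj: "\<exists>y. x = T y" for x using orthogonal_transformation_surj[OF orth] by (metis surjD)
    have "T y \<in> K \<longleftrightarrow> y \<in> K" for y
    proof
      assume y: "y \<in> K"
      show "T y \<in> K"
      proof (rule KI)
        fix u :: 'a assume u: "norm u = 1"
        obtain v where v: "u = T v" using surj by blast
        have nv: "norm v = 1" using u v orthogonal_transformation_norm[OF orth, of v] by simp
        show "T y \<bullet> u \<le> \<gamma> u" using KD[OF y nv] \<gamma>_inv[OF T nv] orth by (simp add: v orthogonal_transformation_def)
      qed
    next
      assume y: "T y \<in> K"
      show "y \<in> K"
      proof (rule KI)
        fix v :: 'a assume v: "norm v = 1"
        have nTv: "norm (T v) = 1" using v orthogonal_transformation_norm[OF orth, of v] by simp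
        show "y \<bullet> v \<le> \<gamma> v" using KD[OF y nTv] \<gamma>_inv[OF T v] orth by (simp add: orthogonal_transformation_def)
      qed
    qed
    then show ?thesis using surj by (auto simp: image_iff) metis
  qed
  have z0: "0 \<in> K"
  proof (rule KI)
    fix u :: 'a assume u: "norm u = 1"
    show "0 \<bullet> u \<le> \<gamma> u"
    proof (rule le_eps)
      fix \<epsilon> :: real assume "\<epsilon> > 0"
      then obtain K' where K': "good K'" "\<And>u. norm u = 1 \<Longrightarrow> \<bar>support_fun K' u - \<gamma> u\<bar> \<le> \<epsilon>" using app by metis
      show "0 \<bullet> u \<le> \<gamma> u + \<epsilon>"
        using support_fun_upper[OF goodD(1)[OF K'(1)] goodD(5)[OF K'(1)], of u] K'(2)[OF u] by simp
    qed
  qed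
  \<comment> \<open>A point of K pushed inwards lies in \<open>K'\<close>, where
    \<open>\<Psi>\<close> is largest at the origin. The push moves it by at most
    \<open>\<epsilon> / \<rho>\<close> times \<open>2 * B\<close>, and the support functions differ
    by \<open>\<epsilon>\<close>; hence the factor \<open>1 + 2 * B / \<rho>\<close>.\<close>
  have compare: "\<Psi> K \<xi> \<le> m + \<epsilon> + ((1 + 2 * B / \<rho>) * \<epsilon>) powr p * measure \<mu> (space \<mu>)
      \<and> \<Psi> K \<xi> \<le> \<Psi> K 0 + 2 * (((1 + 2 * B / \<rho>) * \<epsilon>) powr p * measure \<mu> (space \<mu>))"
    if e: "0 < \<epsilon>" "\<epsilon> \<le> \<rho>" and xi: "\<xi> \<in> K" for \<epsilon> \<xi>
  proof -
    obtain K' where K': "good K'" "\<And>u. norm u = 1 \<Longrightarrow> \<bar>support_fun K' u - \<gamma> u\<bar> \<le> \<epsilon>" "\<Psi> K' 0 \<le> m + \<epsilon>" using app[OF e(1)] by metis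
    let ?d = "(1 + 2 * B / \<rho>) * \<epsilon>"
    have B0: "B \<ge> 0" using zB norm_ge_zero[of z] by linarith
    have d0: "?d \<ge> 0" "\<epsilon> \<le> ?d" using B0 z(1) e by (auto simp: distrib_right)
    have pK: "push \<epsilon> \<xi> \<in> K'"
    proof (subst goodD(4)[OF K'(1)], unfold wulff_def, safe)
      fix u assume u: "u \<in> \<Omega>"
      then have nu: "norm u = 1" using \<Omega>_sphere by auto
      have "\<xi> \<bullet> u \<le> \<gamma> u + 0" using KD[OF xi nu] by simp
      from push_inner[OF nu _ e(2) this] e have "push \<epsilon> \<xi> \<bullet> u \<le> \<gamma> u - \<epsilon>" by simp
      then show "push \<epsilon> \<xi> \<bullet> u \<le> support_fun K' u" using K'(2)[OF nu] by linarith
    qed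
    have "\<bar>\<Psi> K \<xi> - \<Psi> K' (push \<epsilon> \<xi>)\<bar> \<le> ?d powr p * measure \<mu> (space \<mu>)"
    proof (rule powr_gap_diff[OF cK xi goodD(1)[OF K'(1)] pK d0(1)])
      fix u :: 'a assume u: "norm u = 1"
      have eq: "\<xi> - push \<epsilon> \<xi> = (\<epsilon> / \<rho>) *\<^sub>R (\<xi> - z)" by (simp add: push_def algebra_simps)
      have "\<bar>(\<xi> - push \<epsilon> \<xi>) \<bullet> u\<bar> \<le> norm (\<xi> - push \<epsilon> \<xi>)" using Cauchy_Schwarz_ineq2[of "\<xi> - push \<epsilon> \<xi>" u] u by simp
      also have "\<dots> = (\<epsilon> / \<rho>) * norm (\<xi> - z)" unfolding eq using e z(1) by simp
      also have "\<dots> \<le> (\<epsilon> / \<rho>) * (2 * B)"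
      proof (rule mult_left_mono)
        have "norm (\<xi> - z) \<le> norm \<xi> + norm z" by (rule norm_triangle_ineq4)
        also have "\<dots> \<le> 2 * B" using zB xi KB by auto
        finally show "norm (\<xi> - z) \<le> 2 * B" .
      qed (use e z in auto)
      also have "(\<epsilon> / \<rho>) * (2 * B) = 2 * B / \<rho> * \<epsilon>" by simp
      finally have "\<bar>\<xi> \<bullet> u - push \<epsilon> \<xi> \<bullet> u\<bar> \<le> 2 * B / \<rho> * \<epsilon>" by (simp only: inner_diff_left)
      then show "\<bar>(support_fun K u - \<xi> \<bullet> u) - (support_fun K' u - push \<epsilon> \<xi> \<bullet> u)\<bar> \<le> ?d"
        using K'(2)[OF u] hK[OF u] by (simp add: distrib_right)
    qed
    moreover have "\<Psi> K' (push \<epsilon> \<xi>) \<le> \<Psi> K' 0" by (rule goodD(8)[OF K'(1) pK])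
    moreover have "\<bar>\<Psi> K' 0 - \<Psi> K 0\<bar> \<le> ?d powr p * measure \<mu> (space \<mu>)"
    proof (rule powr_gap_diff[OF goodD(1)[OF K'(1)] goodD(5)[OF K'(1)] cK z0 d0(1)])
      fix u :: 'a assume u: "norm u = 1"
      show "\<bar>(support_fun K' u - 0 \<bullet> u) - (support_fun K u - 0 \<bullet> u)\<bar> \<le> ?d"
        using K'(2)[OF u] hK[OF u] d0(2) by simp
    qed
    ultimately show ?thesis using K'(3) by linarith
  qed
  define e where "e k = \<rho> / real (Suc k)" for k
  have e: "0 < e k" "e k \<le> \<rho>" for k using z(1) by (auto simp: e_def divide_simps)
  have e0: "e \<longlonglongrightarrow> 0" unfolding e_def by (rule LIMSEQ_Suc[OF lim_const_over_n])
  have plim: "(\<lambda>k. ((1 + 2 * B / \<rho>) * e k) powr p * measure \<mu> (space \<mu>)) \<longlonglongrightarrow> 0"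
  proof -
    have B0: "B \<ge> 0" using zB norm_ge_zero[of z] by linarith
    have "(\<lambda>k. ((1 + 2 * B / \<rho>) * e k) powr p * measure \<mu> (space \<mu>)) \<longlonglongrightarrow> ((1 + 2 * B / \<rho>) * 0) powr p * measure \<mu> (space \<mu>)"
      using p e e0 B0 z(1) by (intro tendsto_intros tendsto_powr' always_eventually) (auto intro!: mult_nonneg_nonneg add_nonneg_nonneg simp: less_imp_le)
    then show ?thesis by simp
  qed
  have 1: "\<Psi> K \<xi> \<le> \<Psi> K 0" if "\<xi> \<in> K" for \<xi>
  proof -
    have "(\<lambda>k. \<Psi> K 0 + 2 * (((1 + 2 * B / \<rho>) * e k) powr p * measure \<mu> (space \<mu>))) \<longlonglongrightarrow> \<Psi> K 0 + 2 * 0"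
      by (intro tendsto_intros plim)
    from LIMSEQ_le_const[OF this, of "\<Psi> K \<xi>"] compare[OF e that] show ?thesis by auto
  qed
  have 2: "\<Psi> K 0 \<le> m"
  proof -
    have "(\<lambda>k. m + e k + ((1 + 2 * B / \<rho>) * e k) powr p * measure \<mu> (space \<mu>)) \<longlonglongrightarrow> m + 0 + 0"
      by (intro tendsto_add tendsto_const plim e0)
    from LIMSEQ_le_const[OF this, of "\<Psi> K 0"] compare[OF e z0] show ?thesis by auto
  qed
  have "good K" unfolding good_def using cK vK iK wK inv z0 1 by blast
  then show ?thesis using vol 2 by blast
qed

lemma wulff_\<G>:
  assumes T: "T \<in> \<G>" and H: "\<And>u. u \<in> \<Omega> \<Longrightarrow> H (T u) = H u"
  shows "T ` wulff \<Omega> H = wulff \<Omega> H"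
proof -
  have orth: "orthogonal_transformation T" by (rule \<G>_orth[OF T])
  have "T y \<in> wulff \<Omega> H \<longleftrightarrow> y \<in> wulff \<Omega> H" for y
  proof -
    have "T y \<in> wulff \<Omega> H \<longleftrightarrow> (\<forall>u\<in>T ` \<Omega>. T y \<bullet> u \<le> H u)" by (simp add: wulff_def \<G>_\<Omega>[OF T])
    also have "\<dots> \<longleftrightarrow> (\<forall>u\<in>\<Omega>. T y \<bullet> T u \<le> H (T u))" by blast
    also have "\<dots> \<longleftrightarrow> y \<in> wulff \<Omega> H" using orth H by (simp add: wulff_def orthogonal_transformation_def)
    finally show ?thesis .
  qed
  moreover have "\<exists>y. x = T y" for x using orthogonal_transformation_surj[OF orth] by (metis surjD)
  ultimately show ?thesis by (auto simp: image_iff) metis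
qed

text \<open>The Wulff shape of the constant 1 is moved so that an invariant maximiser becomes the
  origin, and dilated to reach the required volume.\<close>

lemma exists_good: "\<exists>K. good K \<and> 1 \<le> measure lborel K"
proof -
  define U where "U = wulff \<Omega> (\<lambda>_. 1 :: real)"
  have cU: "compact U" using bounded_unit closed_wulff[of \<Omega> "\<lambda>_. 1"] by (simp add: U_def compact_eq_bounded_closed)
  have vU: "convex U" unfolding U_def by (rule convex_wulff)
  have sub: "ball 0 1 \<subseteq> U"
  proof
    fix x :: 'a assume x: "x \<in> ball 0 1"
    show "x \<in> U" unfolding U_def wulff_def
    proof safe
      fix u assume "u \<in> \<Omega>"
      then have "norm u = 1" using \<Omega>_sphere by auto
      then show "x \<bullet> u \<le> 1" using norm_cauchy_schwarz[of x u] x by simp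
    qed
  qed
  then have iU: "interior U \<noteq> {}" by (metis centre_in_ball empty_iff interior_maximal open_ball subsetD zero_less_one)
  have ne: "U \<noteq> {}" using iU by auto
  have wU: "U = wulff \<Omega> (support_fun U)" unfolding U_def by (rule wulff_support_idem) (use cU ne in \<open>auto simp: U_def\<close>)
  have inv: "T ` U = U" if "T \<in> \<G>" for T unfolding U_def by (rule wulff_\<G>[OF that]) simp
  obtain \<xi> where \<xi>: "\<xi> \<in> U" "\<And>\<eta>. \<eta> \<in> U \<Longrightarrow> \<Psi> U \<eta> \<le> \<Psi> U \<xi>" "\<And>T. T \<in> \<G> \<Longrightarrow> T \<xi> = \<xi>"
    using invariant_maximiser[OF cU vU ne inv] by metis
  define K where "K = (+) (- \<xi>) ` U"
  have gK: "good K" unfolding K_def by (rule good_translate(1)[OF cU vU iU wU]) (use inv \<xi> in auto)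
  have v: "measure lborel K > 0" by (rule measure_lborel_pos_interior[OF goodD(1,3)[OF gK]])
  define s where "s = max 1 (1 / measure lborel K)"
  have s: "s \<ge> 1" by (simp add: s_def)
  have "1 \<le> s * measure lborel K" using v by (auto simp: s_def max_def divide_simps split: if_splits)
  also have "\<dots> \<le> s ^ DIM('a) * measure lborel K"
    using s v power_increasing[of 1 "DIM('a)" s] by (intro mult_right_mono) (auto simp: Suc_leI)
  also have "\<dots> = measure lborel ((*\<^sub>R) s ` K)"
    using s by (intro measure_lborel_scaleR[symmetric] goodD(1)[OF gK]) simp
  finally have "1 \<le> measure lborel ((*\<^sub>R) s ` K)" .
  moreover have "good ((*\<^sub>R) s ` K)" using s by (intro good_scale(1)[OF gK]) simp
  ultimately show ?thesis by blast
qed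

lemma \<Psi>_nonneg: "0 \<le> \<Psi> K \<xi>"
  unfolding \<Psi>_def by (rule integral_nonneg_AE) simp

lemma interior_ball_gap:
  assumes "compact K" "cball z r \<subseteq> K" "r > 0" "norm u = 1"
  shows "r \<le> support_fun K u - z \<bullet> u"
proof -
  have "z + r *\<^sub>R u \<in> K" using assms by (intro subsetD[OF assms(2)]) (simp add: dist_norm)
  from support_fun_upper[OF assms(1) this, of u] show ?thesis
    using assms(4) by (simp add: inner_add_left power2_norm_eq_inner[symmetric])
qed

lemma measure_\<mu>_pos: "0 < measure \<mu> (space \<mu>)"
  using nontriv by (simp add: emeasure_eq_measure zero_less_measure_iff)

lemma \<Psi>_good_pos: assumes "good K" shows "0 < \<Psi> K 0"
proof -
  obtain z r where z: "r > 0" "cball z r \<subseteq> K" using goodD(3)[OF assms] by (meson ex_in_conv mem_interior_cball)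
  have zK: "z \<in> K" using z by (intro subsetD[OF z(2)]) simp
  have "0 < r powr p * measure \<mu> (space \<mu>)" using z measure_\<mu>_pos by simp
  also have "\<dots> = (\<integral>u. r powr p \<partial>\<mu>)" by simp
  also have "\<dots> \<le> \<Psi> K z"
    unfolding \<Psi>_def
  proof (rule integral_mono)
    fix u assume "u \<in> space \<mu>"
    then show "r powr p \<le> (support_fun K u - z \<bullet> u) powr p"
      using interior_ball_gap[OF goodD(1)[OF assms] z(2,1), of u] z p by (intro powr_mono2) (auto simp: space_\<mu>)
  qed (use integrable_powr_gap[OF goodD(1)[OF assms] zK] in auto)
  also have "\<dots> \<le> \<Psi> K 0" by (rule goodD(8)[OF assms zK])
  finally show ?thesis .
qed

text \<open>Both sides of the last inequality have degree p under dilations of \<open>K'\<close>, so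
  it holds without any condition on the volume of \<open>K'\<close>.\<close>

lemma exists_minimiser:
  obtains K where "good K" "measure lborel K = 1"
    "\<And>K'. good K' \<Longrightarrow> \<Psi> K 0 * measure lborel K' powr (p / DIM('a)) \<le> \<Psi> K' 0"
proof -
  define S where "S = {\<Psi> K 0 | K. good K \<and> 1 \<le> measure lborel K}"
  have ne: "S \<noteq> {}" using exists_good by (auto simp: S_def)
  have bb: "bdd_below S" unfolding S_def by (rule bdd_belowI[of _ 0]) (use \<Psi>_nonneg in auto)
  define m where "m = Inf S"
  have "\<exists>K. good K \<and> 1 \<le> measure lborel K \<and> \<Psi> K 0 \<le> m + 1 / real (Suc i)" for i
  proof -
    have "m < m + 1 / real (Suc i)" by simp
    then obtain s where "s \<in> S" "s < m + 1 / real (Suc i)" unfolding m_def using cInf_less_iff[OF ne bb] by metis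
    then show ?thesis unfolding S_def by (force intro: less_imp_le)
  qed
  then obtain Ks where Ks: "\<And>i. good (Ks i)" "\<And>i. 1 \<le> measure lborel (Ks i)" "\<And>i. \<Psi> (Ks i) 0 \<le> m + 1 / real (Suc i)" by metis
  obtain B where B: "B > 0" "\<And>K. good K \<Longrightarrow> \<Psi> K 0 \<le> m + 1 \<Longrightarrow> K \<subseteq> cball 0 B" using good_bounded[of "m + 1"] by blast
  have KB: "Ks i \<subseteq> cball 0 B" for i
  proof (rule B(2)[OF Ks(1)])
    have "1 / real (Suc i) \<le> 1" by (simp add: divide_simps)
    then show "\<Psi> (Ks i) 0 \<le> m + 1" using Ks(3)[of i] by linarith
  qed
  define hs where "hs i u = support_fun (Ks i) u" for i u
  \<comment> \<open>Blaschke's selection theorem in terms of support functions: for bodies inside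
    the ball of radius \<open>B\<close> these are bounded by \<open>B\<close> and
    \<open>B\<close>-Lipschitz on the sphere.\<close>
  obtain \<gamma> k where \<gamma>: "strict_mono (k :: nat \<Rightarrow> nat)"
      "\<And>e. 0 < e \<Longrightarrow> \<exists>N. \<forall>n x. n \<ge> N \<and> x \<in> sphere 0 1 \<longrightarrow> norm (hs (k n) x - \<gamma> x) < e"
  proof (rule Arzela_Ascoli[of "sphere (0::'a) 1" hs B])
    fix n and x :: 'a assume "x \<in> sphere 0 1"
    then show "norm (hs n x) \<le> B"
      using support_fun_le_norm[OF goodD(1,6)[OF Ks(1)] KB] by (simp add: hs_def)
  next
    fix x :: 'a and e :: real assume e: "0 < e"
    have "norm (hs n x - hs n y) < e" if "norm (x - y) < e / B" for n y
    proof -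
      have "norm (hs n x - hs n y) \<le> B * norm (x - y)"
        using support_fun_lipschitz[OF goodD(1,6)[OF Ks(1)] KB] by (simp add: hs_def)
      also have "\<dots> < e" using that B(1) by (simp add: pos_less_divide_eq mult.commute)
      finally show ?thesis .
    qed
    then show "\<exists>d>0. \<forall>n y. y \<in> sphere 0 1 \<and> norm (x - y) < d \<longrightarrow> norm (hs n x - hs n y) < e"
      using e B(1) by (intro exI[of _ "e / B"]) simp
  qed auto
  have "\<exists>K. good K \<and> 1 \<le> measure lborel K \<and> \<Psi> K 0 \<le> m"
  proof (rule good_limit[of B \<gamma> m])
    fix \<epsilon> :: real assume e: "\<epsilon> > 0"
    obtain n1 where n1: "\<And>n x. n \<ge> n1 \<Longrightarrow> norm x = 1 \<Longrightarrow> \<bar>hs (k n) x - \<gamma> x\<bar> < \<epsilon>" using \<gamma>(2)[OF e] by auto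
    obtain n2 where n2: "inverse (real (Suc n2)) < \<epsilon>" using reals_Archimedean[OF e] by blast
    define n where "n = max n1 n2"
    have kn: "n2 \<le> k n" using seq_suble[OF \<gamma>(1), of n] by (simp add: n_def)
    have "1 / real (Suc (k n)) \<le> 1 / real (Suc n2)" using kn by (intro divide_left_mono) auto
    then have "\<Psi> (Ks (k n)) 0 \<le> m + \<epsilon>" using Ks(3)[of "k n"] n2 by (simp add: inverse_eq_divide)
    moreover have "\<forall>u. norm u = 1 \<longrightarrow> \<bar>support_fun (Ks (k n)) u - \<gamma> u\<bar> \<le> \<epsilon>"
      using n1[of n] by (auto simp: hs_def n_def intro: less_imp_le)
    ultimately show "\<exists>K'. good K' \<and> K' \<subseteq> cball 0 B \<and> 1 \<le> measure lborel K' \<and>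
      (\<forall>u. norm u = 1 \<longrightarrow> \<bar>support_fun K' u - \<gamma> u\<bar> \<le> \<epsilon>) \<and> \<Psi> K' 0 \<le> m + \<epsilon>"
      using Ks(1,2) KB by blast
  qed
  then obtain K where K: "good K" "1 \<le> measure lborel K" "\<Psi> K 0 \<le> m" by blast
  have min: "\<Psi> K 0 \<le> \<Psi> K' 0" if "good K'" "1 \<le> measure lborel K'" for K'
    using K(3) cInf_lower[OF _ bb, of "\<Psi> K' 0"] that by (force simp: m_def S_def)
  have scaled: "\<Psi> K 0 * measure lborel K' powr (p / DIM('a)) \<le> \<Psi> K' 0" if K': "good K'" for K'
  proof -
    have v: "measure lborel K' > 0" by (rule measure_lborel_pos_interior[OF goodD(1,3)[OF K']])
    define s where "s = measure lborel K' powr (- 1 / DIM('a))"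
    have s: "s > 0" using v by (simp add: s_def)
    have "s ^ DIM('a) = measure lborel K' powr (- 1)"
      unfolding s_def using v by (simp add: powr_power)
    then have "measure lborel ((*\<^sub>R) s ` K') = 1"
      using v by (simp add: measure_lborel_scaleR[OF goodD(1)[OF K'] s] powr_minus)
    then have "\<Psi> K 0 \<le> \<Psi> ((*\<^sub>R) s ` K') 0" by (intro min good_scale(1)[OF K' s]) simp
    also have "\<dots> = s powr p * \<Psi> K' 0" by (rule good_scale(2)[OF K' s])
    finally have "\<Psi> K 0 * measure lborel K' powr (p / DIM('a)) \<le> (s powr p * \<Psi> K' 0) * measure lborel K' powr (p / DIM('a))"
      by (rule mult_right_mono) simp
    also have "\<dots> = (s powr p * measure lborel K' powr (p / DIM('a))) * \<Psi> K' 0" by simp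
    also have "s powr p * measure lborel K' powr (p / DIM('a)) = 1"
      unfolding s_def using v by (simp add: powr_powr powr_add[symmetric])
    finally show ?thesis by simp
  qed
  \<comment> \<open>A volume above 1 would contradict the scaled inequality for K itself, since
    \<open>\<Psi> K 0 > 0\<close>.\<close>
  have "measure lborel K = 1"
  proof (rule ccontr)
    assume "measure lborel K \<noteq> 1"
    then have gt: "1 < measure lborel K" using K(2) by simp
    have "1 powr (p / DIM('a)) < measure lborel K powr (p / DIM('a))"
      using gt p by (intro powr_less_mono2) auto
    then have "\<Psi> K 0 * 1 < \<Psi> K 0 * measure lborel K powr (p / DIM('a))"
      using \<Psi>_good_pos[OF K(1)] by (intro mult_strict_left_mono) auto
    then show False using scaled[OF K(1)] by simp
  qed
  with K(1) scaled show ?thesis using that by blast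
qed

text \<open>If the support function vanished on a set of positive measure, moving the base point towards an
  interior point by \<open>s\<close> would gain a multiple of \<open>s powr p\<close> and lose only \<open>O(s)\<close>.\<close>

lemma AE_support_pos:
  assumes K: "good K" shows "AE u in \<mu>. 0 < support_fun K u"
proof -
  let ?h = "support_fun K"
  have hm: "?h \<in> borel_measurable borel" by (rule borel_measurable_support_fun[OF goodD(1,6)[OF K]])
  define Z where "Z = {u \<in> space \<mu>. ?h u = 0}"
  have Zm: "Z \<in> sets \<mu>" unfolding Z_def using meas_\<mu>[OF hm] by measurable
  have h0: "0 \<le> ?h u" for u using support_fun_upper[OF goodD(1)[OF K] goodD(5)[OF K], of u] by simp
  obtain z r where z: "r > 0" "cball z r \<subseteq> K" using goodD(3)[OF K] by (meson ex_in_conv mem_interior_cball)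
  have zK: "z \<in> K" using z by (intro subsetD[OF z(2)]) simp
  \<comment> \<open>Moving the base point from 0 to \<open>s *\<^sub>R z\<close> retains, by
    concavity, the fraction \<open>1 - s\<close> of every p-th power, and on \<open>Z\<close> it
    creates gaps of size at least \<open>s * r\<close>.\<close>
  have bound: "measure \<mu> Z \<le> s powr (1 - p) * (\<Psi> K 0 / r powr p)" if s: "0 < s" "s < 1" for s
  proof -
    have szK: "s *\<^sub>R z \<in> K"
      using goodD(2)[OF K] zK goodD(5)[OF K] s unfolding convex_alt by (metis add_0 less_eq_real_def scale_zero_right)
    have i0: "integrable \<mu> (\<lambda>u. ?h u powr p)" using integrable_powr_gap[OF goodD(1,5)[OF K]] by simp
    have iZ: "integrable \<mu> (\<lambda>u. (s * r) powr p * indicator Z u)"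
      using Zm by (intro integrable_mult_right integrable_real_indicator) (auto simp: emeasure_eq_measure)
    have "(1 - s) * \<Psi> K 0 + (s * r) powr p * measure \<mu> Z = (\<integral>u. (1 - s) * ?h u powr p + (s * r) powr p * indicator Z u \<partial>\<mu>)"
      using i0 iZ Zm by (simp add: \<Psi>_def)
    also have "\<dots> \<le> \<Psi> K (s *\<^sub>R z)"
      unfolding \<Psi>_def
    proof (rule integral_mono)
      fix u assume u: "u \<in> space \<mu>"
      have gap: "r \<le> ?h u - z \<bullet> u" using interior_ball_gap[OF goodD(1)[OF K] z(2,1)] u by (simp add: space_\<mu>)
      have eq: "?h u - s *\<^sub>R z \<bullet> u = (1 - s) * ?h u + s * (?h u - z \<bullet> u)" by (simp add: algebra_simps)
      have sr: "s * r \<le> s * (?h u - z \<bullet> u)" using gap s by (intro mult_left_mono) auto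
      show "(1 - s) * ?h u powr p + (s * r) powr p * indicator Z u \<le> (?h u - s *\<^sub>R z \<bullet> u) powr p"
      proof (cases "u \<in> Z")
        case True
        then have "?h u = 0" by (simp add: Z_def)
        then show ?thesis using True sr s z p unfolding eq by (simp add: powr_mono2)
      next
        case False
        have "(1 - s) * ?h u powr p + s * (?h u - z \<bullet> u) powr p \<le> ((1 - s) * ?h u + s * (?h u - z \<bullet> u)) powr p"
          using gap z s by (intro powr_concave_unit[OF p h0]) auto
        moreover have "0 \<le> s * (?h u - z \<bullet> u) powr p" using s by simp
        ultimately show ?thesis using False unfolding eq by simp
      qed
    qed (use i0 iZ integrable_powr_gap[OF goodD(1)[OF K] szK] in auto)
    also have "\<dots> \<le> \<Psi> K 0" by (rule goodD(8)[OF K szK])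
    finally have "s powr p * r powr p * measure \<mu> Z \<le> s * \<Psi> K 0" using s z by (simp add: powr_mult algebra_simps)
    then have "measure \<mu> Z \<le> s * \<Psi> K 0 / (s powr p * r powr p)" using s z by (simp add: pos_le_divide_eq mult.commute)
    also have "\<dots> = (s / s powr p) * (\<Psi> K 0 / r powr p)" by simp
    also have "s / s powr p = s powr (1 - p)" using s by (simp add: powr_diff)
    finally show ?thesis .
  qed
  have "measure \<mu> Z \<le> 0"
  proof (rule LIMSEQ_le_const)
    have "(\<lambda>k. 1 / (real k + 2)) \<longlonglongrightarrow> 0" by real_asymp
    then have "(\<lambda>k. (1 / (real k + 2)) powr (1 - p) * (\<Psi> K 0 / r powr p)) \<longlonglongrightarrow> 0 powr (1 - p) * (\<Psi> K 0 / r powr p)"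
      using p by (intro tendsto_intros tendsto_powr' always_eventually) auto
    then show "(\<lambda>k. (1 / (real k + 2)) powr (1 - p) * (\<Psi> K 0 / r powr p)) \<longlonglongrightarrow> 0" by simp
    show "\<exists>N. \<forall>n\<ge>N. measure \<mu> Z \<le> (1 / (real n + 2)) powr (1 - p) * (\<Psi> K 0 / r powr p)"
      by (intro exI[of _ 0] allI impI bound) auto
  qed
  then have "Z \<in> null_sets \<mu>" using Zm by (simp add: null_sets_def emeasure_eq_measure measure_le_0_iff)
  then have "AE u in \<mu>. u \<notin> Z" by (rule AE_not_in)
  then show ?thesis
    using AE_space by eventually_elim (use h0 in \<open>auto simp: Z_def less_eq_real_def\<close>)
qed

text \<open>One-sided: the variation \<open>h + t f\<close> is compared with \<open>K\<close> at the base point \<open>t \<xi>\<close>, where \<open>\<xi>\<close> is an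
  invariant maximiser for the varied body; concavity then gives the derivative of the maximum
  without any control on \<open>\<xi>\<close> beyond boundedness.\<close>

lemma euler_lagrange_le:
  fixes f :: "'a \<Rightarrow> real"
  assumes K: "good K" "measure lborel K = 1"
    and min: "\<And>K'. good K' \<Longrightarrow> \<Psi> K 0 * measure lborel K' powr (p / DIM('a)) \<le> \<Psi> K' 0"
    and B0: "body_around_0 ((+) (- z) ` K) r R"
    and f: "f \<in> borel_measurable borel" "continuous_on (sphere 0 1) f"
      "\<And>T u. T \<in> \<G> \<Longrightarrow> norm u = 1 \<Longrightarrow> f (T u) = f u"
    and \<eta>: "\<eta> > 0" "\<And>u. norm u = 1 \<Longrightarrow> support_fun K u < \<eta> \<Longrightarrow> f u = 0"
  shows "\<Psi> K 0 * (\<integral>u. f u / support_fun ((+) (- z) ` K) u \<partial>body_around_0.\<nu> ((+) (- z) ` K))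
      \<le> (\<integral>u. support_fun K u powr (p - 1) * f u \<partial>\<mu>)"
proof -
  \<comment> \<open>The origin may be a boundary point of K, so the variation of the volume is
    computed for \<open>K0\<close>; the perturbed bodies are translated back as
    \<open>Kk\<close>.\<close>
  define K0 where "K0 = (+) (- z) ` K"
  define h where "h = support_fun K"
  note Kc = goodD[OF K(1)]
  interpret B: body_around_0 K0 r R unfolding K0_def by (rule B0)
  have h0: "support_fun K0 u = h u - z \<bullet> u" for u
    unfolding K0_def h_def using support_fun_plus[OF Kc(1,6), of "- z" u] by simp
  have hnn: "0 \<le> h u" for u using support_fun_upper[OF Kc(1,5), of u] by (simp add: h_def)
  have hm [measurable]: "h \<in> borel_measurable borel" unfolding h_def by (rule borel_measurable_support_fun[OF Kc(1,6)])
  note fm [measurable] = f(1)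
  have KW: "K = wulff \<Omega> h" using Kc(4) by (simp add: h_def)
  have K0W: "K0 = wulff \<Omega> (support_fun K0)"
  proof -
    have "K0 = wulff \<Omega> (\<lambda>u. h u + (- z) \<bullet> u)" unfolding K0_def by (subst KW) (rule wulff_translate)
    also have "(\<lambda>u. h u + (- z) \<bullet> u) = support_fun K0" using h0 by auto
    finally show ?thesis .
  qed
  have "compact (f ` sphere 0 1)" by (rule compact_continuous_image[OF f(2) compact_sphere])
  then obtain F where F: "F > 0" "\<And>u. norm u = 1 \<Longrightarrow> \<bar>f u\<bar> \<le> F"
    using compact_imp_bounded[of "f ` sphere 0 1"] unfolding bounded_pos by auto
  \<comment> \<open>\<open>r / (2 * F)\<close> is the smallness demanded by
    \<open>wulff_variation\<close>. \<open>\<eta> / (4 * F)\<close> ensures that t f is at most h /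
    4, because \<open>f\<close> vanishes where h is below \<open>\<eta>\<close>. Together with
    \<open>1/2\<close> this keeps the base point \<open>t k *\<^sub>R \<xi> k\<close> inside
    K.\<close>
  define t0 where "t0 = Min {1/2, r / (2 * F), \<eta> / (4 * F), 1}"
  have t0: "t0 > 0" "t0 \<le> 1/2" "t0 * F \<le> r / 2" "t0 * F \<le> \<eta> / 4"
  proof -
    show "t0 > 0" using B.r_pos F(1) \<eta>(1) by (simp add: t0_def)
    show "t0 \<le> 1/2" by (simp add: t0_def)
    have "t0 \<le> r / (2 * F)" "t0 \<le> \<eta> / (4 * F)" by (simp_all add: t0_def)
    then show "t0 * F \<le> r / 2" "t0 * F \<le> \<eta> / 4" using F(1) by (simp_all add: field_simps)
  qed
  define t where "t k = t0 / (real k + 1)" for k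
  have t: "t k > 0" "t k \<le> t0" for k
    using t0(1) by (auto simp: t_def divide_simps)
  have tF: "t k * F \<le> t0 * F" for k using t(2) F(1) by (intro mult_right_mono) auto
  have tr: "t k * F \<le> r / 2" for k using tF[of k] t0(3) by linarith
  have tlim: "t \<longlonglongrightarrow> 0" unfolding t_def by real_asymp
  interpret W: wulff_variation K0 r R \<Omega> f F t
    by unfold_locales (use \<Omega>_compact \<Omega>_sphere K0W f F t tr tlim in auto)
  define Kk where "Kk k = (+) z ` W.P.Kt k" for k
  have Kk_eq: "Kk k = wulff \<Omega> (\<lambda>u. h u + t k * f u)" for k
    unfolding Kk_def W.P.Kt_def wulff_translate by (simp add: h0 algebra_simps)
  have cK: "compact (Kk k)" for k unfolding Kk_def by (rule compact_translation[OF W.P.T.compact])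
  have vK: "convex (Kk k)" for k unfolding Kk_def by (rule convex_translation[OF W.P.T.convex])
  have iK: "interior (Kk k) \<noteq> {}" for k
    unfolding Kk_def interior_translation using W.P.T.zero_interior[of k] by blast
  have nK: "Kk k \<noteq> {}" for k using iK[of k] by auto
  have wK: "Kk k = wulff \<Omega> (support_fun (Kk k))" for k
    unfolding Kk_eq by (rule wulff_support_idem) (use cK[of k] nK[of k] in \<open>auto simp: Kk_eq\<close>)
  have inv: "T ` Kk k = Kk k" if T: "T \<in> \<G>" for T k
    unfolding Kk_eq
  proof (rule wulff_\<G>[OF T])
    fix u assume "u \<in> \<Omega>"
    then have "norm u = 1" using \<Omega>_sphere by auto
    then show "h (T u) + t k * f (T u) = h u + t k * f u"
      using support_fun_\<G>[OF T Kc(7)[OF T]] f(3)[OF T] by (simp add: h_def)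
  qed
  have "\<exists>\<xi>. \<xi> \<in> Kk k \<and> (\<forall>\<eta>\<in>Kk k. \<Psi> (Kk k) \<eta> \<le> \<Psi> (Kk k) \<xi>) \<and> (\<forall>T\<in>\<G>. T \<xi> = \<xi>)" for k
    using invariant_maximiser[OF cK vK nK inv] by metis
  then obtain \<xi> where \<xi>: "\<And>k. \<xi> k \<in> Kk k" "\<And>k \<eta>. \<eta> \<in> Kk k \<Longrightarrow> \<Psi> (Kk k) \<eta> \<le> \<Psi> (Kk k) (\<xi> k)"
      "\<And>k T. T \<in> \<G> \<Longrightarrow> T (\<xi> k) = \<xi> k" by metis
  define V where "V k = measure lborel (W.P.Kt k)" for k
  have V: "measure lborel (Kk k) = V k" for k unfolding V_def Kk_def by (rule measure_lborel_translation[OF W.P.T.compact])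
  have low: "\<Psi> K 0 * V k powr (p / DIM('a)) \<le> \<Psi> (Kk k) (\<xi> k)" for k
  proof -
    have g: "good ((+) (- \<xi> k) ` Kk k)" "\<Psi> ((+) (- \<xi> k) ` Kk k) 0 = \<Psi> (Kk k) (\<xi> k)"
      by (rule good_translate[OF cK vK iK wK]; use inv \<xi> in auto)+
    show ?thesis using min[OF g(1)] unfolding g(2) measure_lborel_translation[OF cK] V .
  qed
  have xi_le: "\<xi> k \<bullet> u \<le> h u + t k * f u" if "u \<in> \<Omega>" for k u
    using \<xi>(1)[of k] that unfolding Kk_eq wulff_def by auto
  define y where "y k u = h u - (t k *\<^sub>R \<xi> k) \<bullet> u" for k u
  \<comment> \<open>The gaps at the base point stay above a quarter of h; where \<open>f\<close> is
    nonzero they are thus at least \<open>\<eta> / 4\<close>, which bounds their powers with the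
    negative exponent \<open>p - 1\<close>.\<close>
  have y_low: "h u / 4 \<le> y k u" if u: "u \<in> \<Omega>" for k u
  proof -
    have nu: "norm u = 1" using u \<Omega>_sphere by auto
    have tf: "t k * f u \<le> h u / 4"
    proof (cases "h u < \<eta>")
      case True
      then show ?thesis using \<eta>(2)[OF nu] hnn[of u] by (simp add: h_def)
    next
      case False
      have "t k * f u \<le> t k * F" using F(2)[OF nu] t(1)[of k] by (intro mult_left_mono) auto
      then show ?thesis using tF[of k] t0(4) False by linarith
    qed
    have "t k * (\<xi> k \<bullet> u) \<le> t k * (h u + h u / 4)" using xi_le[OF u, of k] tf t(1)[of k] by (intro mult_left_mono) auto
    also have "\<dots> \<le> (1/2) * (h u + h u / 4)" using t(2)[of k] t0(2) hnn[of u] by (intro mult_right_mono) auto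
    finally show ?thesis using hnn[of u] by (simp add: y_def)
  qed
  have txi: "t k *\<^sub>R \<xi> k \<in> K" for k
    unfolding KW wulff_def
  proof safe
    fix u assume u: "u \<in> \<Omega>"
    show "(t k *\<^sub>R \<xi> k) \<bullet> u \<le> h u" using y_low[OF u, of k] hnn[of u] by (simp add: y_def)
  qed
  define d where "d k u = y k u powr (p - 1) * f u" for k u
  have dm [measurable]: "d k \<in> borel_measurable borel" for k unfolding d_def y_def by measurable
  have dbound: "\<bar>d k u\<bar> \<le> (\<eta> / 4) powr (p - 1) * F" if u: "u \<in> \<Omega>" for k u
  proof (cases "h u < \<eta>")
    case True
    have "norm u = 1" using u \<Omega>_sphere by auto
    then show ?thesis using \<eta>(2)[of u] True F by (simp add: d_def h_def)
  next
    case False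
    have "norm u = 1" using u \<Omega>_sphere by auto
    moreover have "y k u powr (p - 1) \<le> (\<eta> / 4) powr (p - 1)"
      using False y_low[OF u, of k] \<eta>(1) p by (intro powr_mono2') auto
    ultimately show ?thesis unfolding d_def abs_mult using F by (intro mult_mono) auto
  qed
  have dint: "integrable \<mu> (d k)" for k
    by (rule integrable_const_bound[of _ "(\<eta> / 4) powr (p - 1) * F"])
      (use AE_\<Omega> dbound meas_\<mu>[OF dm] in auto)
  have up: "\<Psi> (Kk k) (\<xi> k) \<le> \<Psi> K 0 + p * t k * (\<integral>u. d k u \<partial>\<mu>)" for k
  proof -
    define A where "A u = support_fun (Kk k) u - \<xi> k \<bullet> u" for u
    have A0: "0 \<le> A u" for u using support_fun_upper[OF cK \<xi>(1), of k u] by (simp add: A_def)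
    have iA: "integrable \<mu> (\<lambda>u. A u powr p)" unfolding A_def by (rule integrable_powr_gap[OF cK \<xi>(1)])
    have ih: "integrable \<mu> (\<lambda>u. h u powr p)" using integrable_powr_gap[OF Kc(1,5)] by (simp add: h_def)
    have iy: "integrable \<mu> (\<lambda>u. y k u powr p)" unfolding y_def h_def by (rule integrable_powr_gap[OF Kc(1) txi])
    have tk: "0 \<le> t k" "t k \<le> 1" using t(1)[of k] t(2)[of k] t0(2) by linarith+
    \<comment> \<open>The convex combination of the gap of K at 0 and the gap of \<open>Kk k\<close>
      at \<open>\<xi> k\<close> is at most the gap of K at the base point plus t^2 f. The weight t^2
      is the point: after division by t the perturbation contributes to first order, and K enters
      only through its maximality at 0.\<close>
    have pt: "(1 - t k) * h u powr p + t k * A u powr p \<le> y k u powr p + p * (t k)\<^sup>2 * d k u" if u: "u \<in> \<Omega>" for u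
    proof -
      have nu: "norm u = 1" using u \<Omega>_sphere by auto
      have "A u \<le> h u + t k * f u - \<xi> k \<bullet> u"
        using support_fun_wulff_le[of \<Omega> "\<lambda>u. h u + t k * f u" u] nK[of k] u unfolding A_def Kk_eq by auto
      then have "t k * A u \<le> t k * (h u + t k * f u - \<xi> k \<bullet> u)" using tk by (intro mult_left_mono) auto
      then have le: "(1 - t k) * h u + t k * A u \<le> y k u + (t k)\<^sup>2 * f u"
        by (simp add: y_def algebra_simps power2_eq_square)
      have nn: "0 \<le> (1 - t k) * h u + t k * A u" using tk hnn A0 by simp
      have "(1 - t k) * h u powr p + t k * A u powr p \<le> ((1 - t k) * h u + t k * A u) powr p"
        by (rule powr_concave_unit[OF p hnn A0 tk])
      also have "\<dots> \<le> (y k u + (t k)\<^sup>2 * f u) powr p" using le nn p by (intro powr_mono2) auto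
      also have "\<dots> \<le> y k u powr p + p * (t k)\<^sup>2 * d k u"
      proof (cases "h u < \<eta>")
        case True
        then show ?thesis using \<eta>(2)[OF nu] by (simp add: d_def h_def)
      next
        case False
        then have "y k u > 0" using y_low[OF u, of k] \<eta>(1) by linarith
        from powr_le_tangent[OF p _ this, of "y k u + (t k)\<^sup>2 * f u"] le nn show ?thesis
          by (simp add: d_def mult_ac)
      qed
      finally show ?thesis .
    qed
    have "(1 - t k) * \<Psi> K 0 + t k * \<Psi> (Kk k) (\<xi> k) = (\<integral>u. (1 - t k) * h u powr p + t k * A u powr p \<partial>\<mu>)"
      using ih iA by (simp add: \<Psi>_def A_def h_def)
    also have "\<dots> \<le> (\<integral>u. y k u powr p + p * (t k)\<^sup>2 * d k u \<partial>\<mu>)"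
      by (rule integral_mono_AE) (use ih iA iy dint AE_\<Omega> pt in auto)
    also have "\<dots> = \<Psi> K (t k *\<^sub>R \<xi> k) + p * (t k)\<^sup>2 * (\<integral>u. d k u \<partial>\<mu>)"
      using iy dint by (simp add: \<Psi>_def y_def h_def)
    also have "\<dots> \<le> \<Psi> K 0 + p * (t k)\<^sup>2 * (\<integral>u. d k u \<partial>\<mu>)" using Kc(8)[OF txi] by simp
    finally have "t k * \<Psi> (Kk k) (\<xi> k) \<le> t k * (\<Psi> K 0 + p * t k * (\<integral>u. d k u \<partial>\<mu>))"
      by (simp add: algebra_simps power2_eq_square)
    then show ?thesis using t(1)[of k] by simp
  qed
  have dlim: "(\<lambda>k. \<integral>u. d k u \<partial>\<mu>) \<longlonglongrightarrow> (\<integral>u. h u powr (p - 1) * f u \<partial>\<mu>)"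
  proof (rule integral_dominated_convergence[of _ _ _ "\<lambda>_. (\<eta> / 4) powr (p - 1) * F"])
    show "(\<lambda>u. h u powr (p - 1) * f u) \<in> borel_measurable \<mu>" by (rule meas_\<mu>) measurable
    show "d k \<in> borel_measurable \<mu>" for k by (rule meas_\<mu>[OF dm])
    show "AE u in \<mu>. norm (d k u) \<le> (\<eta> / 4) powr (p - 1) * F" for k using AE_\<Omega> by eventually_elim (use dbound in simp)
    show "AE u in \<mu>. (\<lambda>k. d k u) \<longlonglongrightarrow> h u powr (p - 1) * f u"
      using AE_\<Omega> AE_support_pos[OF K(1)]
    proof eventually_elim
      fix u assume u: "u \<in> \<Omega>" and hp: "0 < support_fun K u"
      have xb: "norm (t k *\<^sub>R \<xi> k) \<le> t k * (norm z + 2 * R)" for k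
      proof -
        obtain x where x: "x \<in> W.P.Kt k" "\<xi> k = z + x" using \<xi>(1)[of k] unfolding Kk_def by auto
        then have "norm (\<xi> k) \<le> norm z + 2 * R"
          using norm_triangle_ineq[of z x] subsetD[OF W.P.T.outer_ball x(1)] by simp
        then show ?thesis using t(1)[of k] by (simp add: mult_left_mono)
      qed
      have "(\<lambda>k. t k * (norm z + 2 * R)) \<longlonglongrightarrow> 0 * (norm z + 2 * R)" by (intro tendsto_intros tlim)
      then have "(\<lambda>k. t k *\<^sub>R \<xi> k) \<longlonglongrightarrow> 0"
        by (intro Lim_null_comparison[OF always_eventually, of "\<lambda>k. t k *\<^sub>R \<xi> k"]) (use xb in auto)
      then have "(\<lambda>k. y k u) \<longlonglongrightarrow> h u - 0 \<bullet> u" unfolding y_def by (intro tendsto_intros)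
      then have "(\<lambda>k. y k u) \<longlonglongrightarrow> h u" by simp
      then show "(\<lambda>k. d k u) \<longlonglongrightarrow> h u powr (p - 1) * f u"
        unfolding d_def using hp by (intro tendsto_intros) (auto simp: h_def)
    qed
  qed simp
  define I where "I = (\<integral>u. f u / support_fun K0 u \<partial>B.\<nu>)"
  have V1: "measure lborel K0 = 1" unfolding K0_def measure_lborel_translation[OF Kc(1)] by (rule K(2))
  have q: "(\<lambda>k. (V k - 1) / t k) \<longlonglongrightarrow> real DIM('a) * I"
    using W.volume_quotient_lim unfolding V1 V_def I_def .
  have "(\<lambda>k. t k * ((V k - 1) / t k)) \<longlonglongrightarrow> 0 * (real DIM('a) * I)" by (intro tendsto_mult tlim q)
  moreover have "t k * ((V k - 1) / t k) = V k - 1" for k using t(1)[of k] by simp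
  ultimately have Vlim: "V \<longlonglongrightarrow> 1" using LIM_zero_cancel[of V 1 sequentially] by simp
  define a where "a = p / DIM('a)"
  have der: "((\<lambda>x. x powr a) has_real_derivative a) (at 1)"
    using has_real_derivative_powr[of 1 a] by simp
  \<comment> \<open>Caratheodory's form of the derivative at 1: the slope function \<open>G\<close>
    is continuous there and also covers indices with \<open>V k = 1\<close>.\<close>
  then obtain G where G: "\<And>x. x powr a - 1 powr a = G x * (x - 1)" "isCont G 1" "G 1 = a" unfolding CARAT_DERIV by blast
  have "(\<lambda>k. \<Psi> K 0 * (G (V k) * ((V k - 1) / t k))) \<longlonglongrightarrow> \<Psi> K 0 * (G 1 * (real DIM('a) * I))"
    by (intro tendsto_intros q isCont_tendsto_compose[OF G(2) Vlim])
  moreover have "G 1 * (real DIM('a) * I) = p * I" by (simp add: G(3) a_def)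
  moreover have "(\<lambda>k. p * (\<integral>u. d k u \<partial>\<mu>)) \<longlonglongrightarrow> p * (\<integral>u. h u powr (p - 1) * f u \<partial>\<mu>)" by (intro tendsto_intros dlim)
  moreover have "\<Psi> K 0 * (G (V k) * ((V k - 1) / t k)) \<le> p * (\<integral>u. d k u \<partial>\<mu>)" for k
  proof -
    have "\<Psi> K 0 * (V k powr a - 1) \<le> p * t k * (\<integral>u. d k u \<partial>\<mu>)"
      using order_trans[OF low up, of k] by (simp add: a_def right_diff_distrib)
    then have "(\<Psi> K 0 * (V k powr a - 1)) / t k \<le> p * (\<integral>u. d k u \<partial>\<mu>)"
      using t(1)[of k] by (simp add: pos_divide_le_eq mult_ac)
    then show ?thesis using G(1)[of "V k"] by simp
  qed
  ultimately have "\<Psi> K 0 * (p * I) \<le> p * (\<integral>u. h u powr (p - 1) * f u \<partial>\<mu>)"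
    by (metis (no_types, lifting) LIMSEQ_le)
  then have "\<Psi> K 0 * I \<le> (\<integral>u. h u powr (p - 1) * f u \<partial>\<mu>)" using p by (simp add: mult.left_commute)
  then show ?thesis by (simp add: I_def K0_def h_def)
qed

text \<open>The one-sided inequality, applied to \<open>f\<close> and to its negative.\<close>

lemma euler_lagrange:
  fixes f :: "'a \<Rightarrow> real"
  assumes K: "good K" "measure lborel K = 1"
    and min: "\<And>K'. good K' \<Longrightarrow> \<Psi> K 0 * measure lborel K' powr (p / DIM('a)) \<le> \<Psi> K' 0"
    and B0: "body_around_0 ((+) (- z) ` K) r R"
    and f: "f \<in> borel_measurable borel" "continuous_on (sphere 0 1) f"
      "\<And>T u. T \<in> \<G> \<Longrightarrow> norm u = 1 \<Longrightarrow> f (T u) = f u"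
    and \<eta>: "\<eta> > 0" "\<And>u. norm u = 1 \<Longrightarrow> support_fun K u < \<eta> \<Longrightarrow> f u = 0"
  shows "\<Psi> K 0 * (\<integral>u. f u / support_fun ((+) (- z) ` K) u \<partial>body_around_0.\<nu> ((+) (- z) ` K))
      = (\<integral>u. support_fun K u powr (p - 1) * f u \<partial>\<mu>)"
proof (rule antisym)
  have "\<Psi> K 0 * (\<integral>u. - f u / support_fun ((+) (- z) ` K) u \<partial>body_around_0.\<nu> ((+) (- z) ` K))
      \<le> (\<integral>u. support_fun K u powr (p - 1) * - f u \<partial>\<mu>)"
    by (rule euler_lagrange_le[OF K min B0 _ _ _ \<eta>(1)]) (use f \<eta>(2) in \<open>auto intro: continuous_intros\<close>)
  then show "(\<integral>u. support_fun K u powr (p - 1) * f u \<partial>\<mu>)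
      \<le> \<Psi> K 0 * (\<integral>u. f u / support_fun ((+) (- z) ` K) u \<partial>body_around_0.\<nu> ((+) (- z) ` K))" by simp
qed (rule euler_lagrange_le[OF K min B0 f(1,2) _ \<eta>(1)]; use f(3) \<eta>(2) in auto)

end

section \<open>Averaging over the group\<close>

text \<open>Points of the unit sphere are limits of interior points of the ball, so an identity
  almost everywhere on the ball determines continuous functions on the sphere as well.\<close>

lemma AE_lborel_continuous_eq:
  fixes a b :: "'a::euclidean_space \<Rightarrow> real"
  assumes ae: "AE x in lborel. x \<in> cball 0 1 \<longrightarrow> a x = b x" and cont: "continuous_on UNIV a" "continuous_on UNIV b"
    and x: "x \<in> cball 0 1"
  shows "a x = b x"
proof (rule ccontr)
  assume "a x \<noteq> b x"
  define U where "U = {y. a y \<noteq> b y} \<inter> ball 0 1"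
  have o: "open {y. a y \<noteq> b y}" using cont by (intro open_Collect_neq)
  have "x \<in> closure (ball 0 1)" using x by simp
  then have "U \<noteq> {}" using open_Int_closure_eq_empty[OF o, of "ball 0 1"] \<open>a x \<noteq> b x\<close> unfolding U_def by blast
  moreover have "open U" unfolding U_def using o by auto
  ultimately obtain z e where e: "e > 0" "ball z e \<subseteq> U" by (meson ex_in_conv open_contains_ball)
  have "AE y in lborel. y \<notin> ball z e" using ae by eventually_elim (use e(2) in \<open>auto simp: U_def subset_iff less_imp_le\<close>)
  then have "ball z e \<in> null_sets lborel" using AE_iff_null_sets[of "ball z e" lborel] by simp
  then show False using emeasure_lborel_ball_pos[OF e(1), of z] by auto
qed

text \<open>Averaging over the group without Haar measure: among the Lipschitz functions sharing the
  integrals and zeros of \<open>f\<close>, the one of least \<open>L\<^sup>2\<close> norm on the ball is invariant by the parallelogram law.\<close>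

lemma invariant_average:
  fixes f :: "'a::euclidean_space \<Rightarrow> real" and \<G> :: "('a \<Rightarrow> 'a) set" and \<M> :: "'a measure set"
  assumes orth: "\<And>T. T \<in> \<G> \<Longrightarrow> orthogonal_transformation T"
    and \<M>: "\<And>m. m \<in> \<M> \<Longrightarrow> sets m = sets borel" "\<And>m. m \<in> \<M> \<Longrightarrow> finite_measure m"
      "\<And>m. m \<in> \<M> \<Longrightarrow> AE u in m. norm u = 1" "\<And>m T. m \<in> \<M> \<Longrightarrow> T \<in> \<G> \<Longrightarrow> distr m borel T = m"
    and Z: "Z \<subseteq> sphere 0 1" "\<And>T u. T \<in> \<G> \<Longrightarrow> u \<in> Z \<Longrightarrow> T u \<in> Z" "\<And>u. u \<in> Z \<Longrightarrow> f u = 0"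
    and f: "\<And>x y. \<bar>f x - f y\<bar> \<le> l * dist x y" "\<And>x. \<bar>f x\<bar> \<le> F" "l \<ge> 0"
  obtains a where "continuous_on UNIV a" "\<And>T u. T \<in> \<G> \<Longrightarrow> norm u = 1 \<Longrightarrow> a (T u) = a u"
    "\<And>u. u \<in> Z \<Longrightarrow> a u = 0" "\<And>m. m \<in> \<M> \<Longrightarrow> (\<integral>u. a u \<partial>m) = (\<integral>u. f u \<partial>m)"
proof -
  \<comment> \<open>This class is closed under composition with members of \<open>\<G>\<close> and
    under midpoints, and its common bound and Lipschitz constant make it compact for uniform
    convergence on the ball.\<close>
  define adm where "adm a \<longleftrightarrow> (\<forall>x y. \<bar>a x - a y\<bar> \<le> l * dist x y) \<and> (\<forall>x. \<bar>a x\<bar> \<le> F) \<and> (\<forall>u\<in>Z. a u = 0) \<and>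
      (\<forall>m\<in>\<M>. (\<integral>u. a u \<partial>m) = (\<integral>u. f u \<partial>m))" for a :: "'a \<Rightarrow> real"
  have adm_f: "adm f" using f Z by (auto simp: adm_def)
  have cont: "continuous_on UNIV a" if "adm a" for a
  proof -
    have "l-lipschitz_on UNIV a" using that f(3) by (intro lipschitz_onI) (auto simp: adm_def dist_real_def)
    then show ?thesis by (rule lipschitz_on_continuous_on)
  qed
  have bm: "a \<in> borel_measurable borel" if "adm a" for a using cont[OF that] by (rule borel_measurable_continuous_onI)
  have im: "integrable m a" if "adm a" "m \<in> \<M>" for a m
  proof -
    interpret finite_measure m by (rule \<M>(2)[OF that(2)])
    show ?thesis
      by (rule integrable_const_bound[of _ F])
        (use that bm[OF that(1)] in \<open>auto simp: adm_def measurable_cong_sets[OF \<M>(1)[OF that(2)] refl]\<close>)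
  qed
  have lin: "linear T" if "T \<in> \<G>" for T by (rule orthogonal_transformation_linear[OF orth[OF that]])
  have Tm: "T \<in> borel \<rightarrow>\<^sub>M borel" if "T \<in> \<G>" for T
    using lin[OF that] by (intro borel_measurable_continuous_onI linear_continuous_on) (simp add: linear_conv_bounded_linear)
  have adm_T: "adm (\<lambda>x. a (T x))" if a: "adm a" and T: "T \<in> \<G>" for a T
    unfolding adm_def
  proof (intro conjI allI ballI)
    fix x y
    have "dist (T x) (T y) = dist x y" using orth[OF T] unfolding orthogonal_transformation_isometry by blast
    then show "\<bar>a (T x) - a (T y)\<bar> \<le> l * dist x y" using a unfolding adm_def by metis
    show "\<bar>a (T x)\<bar> \<le> F" using a by (simp add: adm_def)
  next
    fix u assume "u \<in> Z" then show "a (T u) = 0" using Z(2)[OF T] a by (simp add: adm_def)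
  next
    fix m assume m: "m \<in> \<M>"
    have "(\<integral>u. a (T u) \<partial>m) = (\<integral>u. a u \<partial>distr m borel T)"
      using Tm[OF T] bm[OF a] by (intro integral_distr[symmetric]) (simp_all add: measurable_cong_sets[OF \<M>(1)[OF m] refl])
    then show "(\<integral>u. a (T u) \<partial>m) = (\<integral>u. f u \<partial>m)" using \<M>(4)[OF m T] a m by (simp add: adm_def)
  qed
  have adm_mid: "adm (\<lambda>x. (a x + b x) / 2)" if a: "adm a" and b: "adm b" for a b
    unfolding adm_def
  proof (intro conjI allI ballI)
    fix x y
    have "\<bar>a x - a y\<bar> \<le> l * dist x y" "\<bar>b x - b y\<bar> \<le> l * dist x y" using a b by (auto simp: adm_def)
    then show "\<bar>(a x + b x) / 2 - (a y + b y) / 2\<bar> \<le> l * dist x y" by (simp add: abs_le_iff field_simps)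
    have "\<bar>a x\<bar> \<le> F" "\<bar>b x\<bar> \<le> F" using a b by (auto simp: adm_def)
    then show "\<bar>(a x + b x) / 2\<bar> \<le> F" by (simp add: abs_le_iff)
  next
    fix u assume "u \<in> Z" then show "(a u + b u) / 2 = 0" using a b by (simp add: adm_def)
  next
    fix m assume m: "m \<in> \<M>"
    show "(\<integral>u. (a u + b u) / 2 \<partial>m) = (\<integral>u. f u \<partial>m)"
      using im[OF a m] im[OF b m] a b m by (simp add: adm_def)
  qed
  define ib where "ib = (indicator (cball 0 1) :: 'a \<Rightarrow> real)"
  have ibm [measurable]: "ib \<in> borel_measurable borel" unfolding ib_def by (intro borel_measurable_indicator borel_closed) simp
  have dom: "integrable lborel (\<lambda>x. c * ib x)" for c
    unfolding ib_def using emeasure_bounded_finite[of "cball (0::'a) 1"]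
    by (intro integrable_mult_right integrable_real_indicator) auto
  define J where "J a = (\<integral>x. ib x * (a x)\<^sup>2 \<partial>lborel)" for a :: "'a \<Rightarrow> real"
  have sq: "(a x)\<^sup>2 \<le> F\<^sup>2" if "\<And>x. \<bar>a x\<bar> \<le> F" for a :: "'a \<Rightarrow> real" and x
    using power_mono[OF that[of x], of 2] by simp
  have iJ: "integrable lborel (\<lambda>x. ib x * (a x)\<^sup>2)" if "a \<in> borel_measurable borel" "\<And>x. \<bar>a x\<bar> \<le> F" for a
  proof (rule Bochner_Integration.integrable_bound[OF dom[of "F\<^sup>2"]])
    show "(\<lambda>x. ib x * (a x)\<^sup>2) \<in> borel_measurable lborel" using that(1) by simp
    show "AE x in lborel. norm (ib x * (a x)\<^sup>2) \<le> norm (F\<^sup>2 * ib x)"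
      using sq[OF that(2)] by (intro AE_I2) (auto simp: ib_def split: split_indicator)
  qed
  have J0: "0 \<le> J a" for a unfolding J_def by (rule integral_nonneg_AE) (simp add: ib_def)
  have J_T: "J (\<lambda>x. a (T x)) = J a" if a: "adm a" and T: "T \<in> \<G>" for a T
  proof -
    have "ib (T x) = ib x" for x
      using orthogonal_transformation_norm[OF orth[OF T], of x] by (simp add: ib_def indicator_def)
    then have "J (\<lambda>x. a (T x)) = (\<integral>x. ib (T x) * (a (T x))\<^sup>2 \<partial>lborel)" by (simp add: J_def)
    also have "\<dots> = (\<integral>x. ib x * (a x)\<^sup>2 \<partial>distr lborel borel T)"
      using Tm[OF T] bm[OF a] by (intro integral_distr[symmetric]) auto
    finally show ?thesis by (simp add: distr_lborel_orthogonal[OF orth[OF T]] J_def)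
  qed
  have "\<exists>a. adm a \<and> (\<forall>b. adm b \<longrightarrow> J a \<le> J b)"
  proof -
    define S where "S = J ` Collect adm"
    have ne: "S \<noteq> {}" using adm_f by (auto simp: S_def)
    have bb: "bdd_below S" unfolding S_def by (rule bdd_belowI[of _ 0]) (use J0 in auto)
    have "\<exists>a. adm a \<and> J a \<le> Inf S + 1 / real (Suc i)" for i
    proof -
      have "Inf S < Inf S + 1 / real (Suc i)" by simp
      then obtain s where "s \<in> S" "s < Inf S + 1 / real (Suc i)" using cInf_less_iff[OF ne bb] by metis
      then show ?thesis unfolding S_def by (force intro: less_imp_le)
    qed
    then obtain as where as: "\<And>i. adm (as i)" "\<And>i. J (as i) \<le> Inf S + 1 / real (Suc i)" by metis
    obtain \<gamma> k where \<gamma>: "strict_mono (k :: nat \<Rightarrow> nat)"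
      "\<And>e. 0 < e \<Longrightarrow> \<exists>N. \<forall>n x. n \<ge> N \<and> x \<in> cball 0 1 \<longrightarrow> norm (as (k n) x - \<gamma> x) < e"
    proof (rule Arzela_Ascoli[of "cball (0::'a) 1" as F])
      fix n and x :: 'a assume "x \<in> cball 0 1"
      show "norm (as n x) \<le> F" using as(1)[of n] by (simp add: adm_def)
    next
      fix x :: 'a and e :: real assume e: "0 < e"
      have "norm (as n x - as n y) < e" if "norm (x - y) < e / (l + 1)" for n y
      proof -
        have "norm (as n x - as n y) \<le> l * norm (x - y)" using as(1)[of n] by (simp add: adm_def dist_norm)
        also have "\<dots> \<le> (l + 1) * norm (x - y)" by (intro mult_right_mono) auto
        also have "\<dots> < e" using that f(3) by (simp add: pos_less_divide_eq mult.commute)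
        finally show ?thesis .
      qed
      then show "\<exists>d>0. \<forall>n y. y \<in> cball 0 1 \<and> norm (x - y) < d \<longrightarrow> norm (as n x - as n y) < e"
        using e f(3) by (intro exI[of _ "e / (l + 1)"]) simp
    qed auto
    have lim: "(\<lambda>n. as (k n) x) \<longlonglongrightarrow> \<gamma> x" if "x \<in> cball 0 1" for x
      unfolding LIMSEQ_def dist_norm using \<gamma>(2) that by blast
    \<comment> \<open>The limit is determined on the ball only. Composition with the nearest-point
      map extends it to the whole space without increasing the Lipschitz constant.\<close>
    define \<pi> where "\<pi> = closest_point (cball (0::'a) 1)"
    have \<pi>: "\<pi> x \<in> cball 0 1" for x unfolding \<pi>_def by (rule closest_point_in_set) auto
    have \<pi>1: "\<pi> x = x" if "x \<in> cball 0 1" for x unfolding \<pi>_def using that by (rule closest_point_self)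
    have \<pi>l: "dist (\<pi> x) (\<pi> y) \<le> dist x y" for x y unfolding \<pi>_def by (rule closest_point_lipschitz) auto
    define b where "b x = \<gamma> (\<pi> x)" for x
    have blim: "(\<lambda>n. as (k n) x) \<longlonglongrightarrow> b x" if "x \<in> cball 0 1" for x using lim[OF that] \<pi>1[OF that] by (simp add: b_def)
    have badm: "\<bar>b x\<bar> \<le> F" for x
      unfolding b_def
      by (rule LIMSEQ_le_const2[OF tendsto_rabs[OF lim[OF \<pi>]]]) (use as(1) in \<open>auto simp: adm_def\<close>)
    have blip: "\<bar>b x - b y\<bar> \<le> l * dist x y" for x y
    proof -
      have "\<bar>\<gamma> (\<pi> x) - \<gamma> (\<pi> y)\<bar> \<le> l * dist (\<pi> x) (\<pi> y)"
        by (rule LIMSEQ_le_const2[OF tendsto_rabs[OF tendsto_diff[OF lim[OF \<pi>] lim[OF \<pi>]]]]) (use as(1) in \<open>auto simp: adm_def\<close>)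
      also have "\<dots> \<le> l * dist x y" using \<pi>l f(3) by (rule mult_left_mono)
      finally show ?thesis by (simp add: b_def)
    qed
    have "l-lipschitz_on UNIV b" using blip f(3) by (intro lipschitz_onI) (auto simp: dist_real_def)
    then have bmeas [measurable]: "b \<in> borel_measurable borel"
      by (intro borel_measurable_continuous_onI lipschitz_on_continuous_on)
    have adm_b: "adm b"
      unfolding adm_def
    proof (intro conjI allI ballI blip badm)
      fix u assume u: "u \<in> Z"
      then have "(\<lambda>n. as (k n) u) \<longlonglongrightarrow> b u" using Z(1) by (intro blim) auto
      moreover have "as (k n) u = 0" for n using as(1)[of "k n"] u by (simp add: adm_def)
      ultimately show "b u = 0" using LIMSEQ_unique[of "\<lambda>_. 0" "b u" 0] by simp
    next
      fix m assume m: "m \<in> \<M>"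
      interpret finite_measure m by (rule \<M>(2)[OF m])
      have "(\<lambda>n. \<integral>u. as (k n) u \<partial>m) \<longlonglongrightarrow> (\<integral>u. b u \<partial>m)"
      proof (rule integral_dominated_convergence[of _ _ _ "\<lambda>_. F"])
        show "AE u in m. (\<lambda>n. as (k n) u) \<longlonglongrightarrow> b u" using \<M>(3)[OF m] by eventually_elim (use blim in auto)
        show "AE u in m. norm (as (k n) u) \<le> F" for n using as(1) by (simp add: adm_def)
      qed (use bmeas bm[OF as(1)] in \<open>simp_all add: measurable_cong_sets[OF \<M>(1)[OF m] refl]\<close>)
      moreover have "(\<integral>u. as (k n) u \<partial>m) = (\<integral>u. f u \<partial>m)" for n using as(1) m by (simp add: adm_def)
      ultimately have "(\<lambda>n::nat. \<integral>u. f u \<partial>m) \<longlonglongrightarrow> (\<integral>u. b u \<partial>m)" by simp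
      then show "(\<integral>u. b u \<partial>m) = (\<integral>u. f u \<partial>m)" by (simp add: LIMSEQ_const_iff)
    qed
    have Jlim: "(\<lambda>n. J (as (k n))) \<longlonglongrightarrow> J b"
      unfolding J_def
    proof (rule integral_dominated_convergence[of _ _ _ "\<lambda>x. F\<^sup>2 * ib x"])
      show "AE x in lborel. (\<lambda>n. ib x * (as (k n) x)\<^sup>2) \<longlonglongrightarrow> ib x * (b x)\<^sup>2"
      proof (rule AE_I2)
        fix x show "(\<lambda>n. ib x * (as (k n) x)\<^sup>2) \<longlonglongrightarrow> ib x * (b x)\<^sup>2"
          by (cases "x \<in> cball 0 1") (auto simp: ib_def intro!: tendsto_intros blim)
      qed
      show "AE x in lborel. norm (ib x * (as (k n) x)\<^sup>2) \<le> F\<^sup>2 * ib x" for n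
        using sq[of "as (k n)"] as(1)[of "k n"] by (intro AE_I2) (auto simp: adm_def ib_def split: split_indicator)
    qed (use bm[OF as(1)] dom in auto)
    have "(\<lambda>n. Inf S + 1 / real (Suc n)) \<longlonglongrightarrow> Inf S" by real_asymp
    then have "J b \<le> Inf S"
    proof (rule LIMSEQ_le[OF Jlim])
      have "J (as (k n)) \<le> Inf S + 1 / real (Suc n)" for n
      proof -
        have "1 / real (Suc (k n)) \<le> 1 / real (Suc n)" using seq_suble[OF \<gamma>(1), of n] by (intro divide_left_mono) auto
        then show ?thesis using as(2)[of "k n"] by linarith
      qed
      then show "\<exists>N. \<forall>n\<ge>N. J (as (k n)) \<le> Inf S + 1 / real (Suc n)" by blast
    qed
    then show ?thesis using adm_b cInf_lower[OF _ bb] by (intro exI[of _ b]) (force simp: S_def intro: order_trans)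
  qed
  then obtain a where a: "adm a" "\<And>b. adm b \<Longrightarrow> J a \<le> J b" by blast
  have "a (T u) = a u" if T: "T \<in> \<G>" and u: "norm u = 1" for T u
  proof -
    define b where "b x = a (T x)" for x
    have b: "adm b" unfolding b_def by (rule adm_T[OF a(1) T])
    note m = bm[OF a(1)] bm[OF b]
    note m [measurable]
    have bd: "\<bar>a x\<bar> \<le> F" "\<bar>b x\<bar> \<le> F" for x using a(1) b by (auto simp: adm_def)
    have bd2: "\<bar>(a x + b x) / 2\<bar> \<le> F" "\<bar>(a x - b x) / 2\<bar> \<le> F" for x using bd[of x] by (auto simp: abs_le_iff)
    have i: "integrable lborel (\<lambda>x. ib x * (a x)\<^sup>2)" "integrable lborel (\<lambda>x. ib x * (b x)\<^sup>2)"
      "integrable lborel (\<lambda>x. ib x * ((a x + b x) / 2)\<^sup>2)" "integrable lborel (\<lambda>x. ib x * ((a x - b x) / 2)\<^sup>2)"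
      using m bd bd2 by (auto intro!: iJ)
    \<comment> \<open>Parallelogram law: the midpoint is admissible and \<open>J b = J a\<close>, so
      minimality leaves norm 0 for the difference.\<close>
    have "J a / 2 + J b / 2 = (\<integral>x. ib x * (a x)\<^sup>2 / 2 + ib x * (b x)\<^sup>2 / 2 \<partial>lborel)"
      using i by (simp add: J_def)
    also have "\<dots> = (\<integral>x. ib x * ((a x + b x) / 2)\<^sup>2 + ib x * ((a x - b x) / 2)\<^sup>2 \<partial>lborel)"
      by (rule Bochner_Integration.integral_cong[OF refl]) (simp add: power2_eq_square field_simps)
    also have "\<dots> = J (\<lambda>x. (a x + b x) / 2) + J (\<lambda>x. (a x - b x) / 2)" using i by (simp add: J_def)
    finally have "J (\<lambda>x. (a x - b x) / 2) \<le> 0"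
      using a(2)[OF adm_mid[OF a(1) b]] J_T[OF a(1) T] unfolding b_def by linarith
    then have "J (\<lambda>x. (a x - b x) / 2) = 0" using J0 antisym by blast
    then have "AE x in lborel. ib x * ((a x - b x) / 2)\<^sup>2 = 0"
      unfolding J_def using i(4) by (subst (asm) integral_nonneg_eq_0_iff_AE) (auto simp: ib_def)
    then have "AE x in lborel. x \<in> cball 0 1 \<longrightarrow> a x = b x" by eventually_elim (auto simp: ib_def)
    from AE_lborel_continuous_eq[OF this cont[OF a(1)] cont[OF b], of u] u show ?thesis by (simp add: b_def)
  qed
  then show ?thesis using that[of a] cont[OF a(1)] a(1) by (auto simp: adm_def)
qed

section \<open>Surface area measure under similarities\<close>

definition normals_hit :: "'a::euclidean_space set \<Rightarrow> 'a set \<Rightarrow> 'a set" where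
  "normals_hit K \<omega> = {x \<in> frontier K. unit_normals K x \<inter> \<omega> \<noteq> {}}"

text \<open>A similarity maps the boundary to the boundary, and normals are turned by its orthogonal
  part only. Translations, dilations and orthogonal maps are the special cases of interest.\<close>

lemma normals_hit_similarity:
  fixes K :: "'a::euclidean_space set" and Q :: "'a \<Rightarrow> 'a"
  assumes Q: "orthogonal_transformation Q" and s: "s > 0"
  shows "hausdorff_measure k (normals_hit ((\<lambda>x. a + s *\<^sub>R Q x) ` K) (Q ` \<omega>)) = ennreal (s ^ k) * hausdorff_measure k (normals_hit K \<omega>)"
proof -
  define f where "f x = s *\<^sub>R Q x" for x
  have lQ: "linear Q" by (rule orthogonal_transformation_linear[OF Q])
  have lf: "linear f" unfolding f_def using lQ by (rule linear_compose_scale_right)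
  have jQ: "inj Q" by (rule orthogonal_transformation_inj[OF Q])
  have jf: "inj f" using jQ s by (auto simp: f_def inj_on_def)
  have Sf: "(\<lambda>x. a + s *\<^sub>R Q x) ` A = (+) a ` f ` A" for A by (simp add: f_def image_image)
  have "frontier (f ` K) = f ` frontier K"
    using closure_injective_linear_image[OF lf jf] interior_injective_linear_image[OF lf jf]
    by (metis frontier_def image_set_diff[OF jf])
  then have fr: "frontier ((\<lambda>x. a + s *\<^sub>R Q x) ` K) = (\<lambda>x. a + s *\<^sub>R Q x) ` frontier K"
    unfolding Sf frontier_translation by simp
  have Qv: "Q v \<in> unit_normals ((\<lambda>x. a + s *\<^sub>R Q x) ` K) (a + s *\<^sub>R Q x) \<longleftrightarrow> v \<in> unit_normals K x" for v x
  proof -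
    have "((a + s *\<^sub>R Q y) - (a + s *\<^sub>R Q x)) \<bullet> Q v = s * ((y - x) \<bullet> v)" for y
      using Q by (simp add: orthogonal_transformation_def inner_diff_left right_diff_distrib)
    then have "(((a + s *\<^sub>R Q y) - (a + s *\<^sub>R Q x)) \<bullet> Q v \<le> 0) = ((y - x) \<bullet> v \<le> 0)" for y
      using s by (simp add: mult_le_0_iff)
    then show ?thesis unfolding unit_normals_def using orthogonal_transformation_norm[OF Q] by simp
  qed
  have nh: "normals_hit ((\<lambda>x. a + s *\<^sub>R Q x) ` K) (Q ` \<omega>) = (\<lambda>x. a + s *\<^sub>R Q x) ` normals_hit K \<omega>"
    unfolding normals_hit_def fr using Qv by blast
  define A where "A = normals_hit K \<omega>"
  have "hausdorff_measure k ((+) a ` f ` A) = hausdorff_measure k (f ` A)"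
    by (rule hausdorff_measure_isometry) simp
  also have "\<dots> = hausdorff_measure k ((\<lambda>x. s *\<^sub>R x) ` Q ` A)" by (simp add: f_def image_image)
  also have "\<dots> = ennreal (s ^ k) * hausdorff_measure k (Q ` A)"
    by (rule hausdorff_measure_scaleR[OF s])
  also have "hausdorff_measure k (Q ` A) = hausdorff_measure k A"
    by (rule hausdorff_measure_isometry) (use Q in \<open>simp add: orthogonal_transformation_isometry\<close>)
  finally show ?thesis unfolding nh unfolding Sf A_def .
qed

lemma normals_hit_translation:
  "hausdorff_measure k (normals_hit ((+) a ` K) \<omega>) = hausdorff_measure k (normals_hit K \<omega>)" for K :: "'a::euclidean_space set"
  using normals_hit_similarity[OF orthogonal_transformation_id, of 1 k a K \<omega>] by simp

lemma surface_area_measure_alt: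
  "surface_area_measure K = measure_of (sphere 0 1) (sets sphere_borel) (\<lambda>\<omega>. hausdorff_measure (DIM('a) - 1) (normals_hit K \<omega>))"
  for K :: "'a::euclidean_space set"
  by (simp add: surface_area_measure_def normals_hit_def)

lemma surface_area_measure_translation:
  "surface_area_measure ((+) a ` K) = surface_area_measure (K :: 'a::euclidean_space set)"
proof -
  have "hausdorff_measure (DIM('a) - 1) (normals_hit ((+) a ` K) \<omega>) = hausdorff_measure (DIM('a) - 1) (normals_hit K \<omega>)" for \<omega>
    by (rule normals_hit_translation)
  then show ?thesis unfolding surface_area_measure_alt by simp
qed

lemma convex_body_around_0:
  fixes K :: "'a::euclidean_space set"
  assumes "convex_body K"
  obtains z r R where "body_around_0 ((+) (- z) ` K) r R"
proof -
  have K: "compact K" "convex K" "interior K \<noteq> {}" using assms by (auto simp: convex_body_def)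
  obtain z r where z: "r > 0" "cball z r \<subseteq> K" using K(3) by (meson ex_in_conv mem_interior_cball)
  have c: "compact ((+) (- z) ` K)" by (rule compact_translation[OF K(1)])
  obtain R where R: "(+) (- z) ` K \<subseteq> cball 0 R"
    using compact_imp_bounded[OF c] by (auto simp: bounded_iff subset_iff)
  have "cball 0 r \<subseteq> (+) (- z) ` K"
  proof
    fix x :: 'a assume "x \<in> cball 0 r"
    then have "z + x \<in> K" using z(2) by (auto simp: dist_norm subset_iff)
    then show "x \<in> (+) (- z) ` K" by (intro image_eqI[of _ _ "z + x"]) auto
  qed
  then have "body_around_0 ((+) (- z) ` K) r R"
    using c convex_translation[OF K(2)] z(1) R by unfold_locales auto
  then show ?thesis by (rule that)
qed

lemma surface_area_measure_convex_body:
  fixes K :: "'a::euclidean_space set"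
  assumes "convex_body K"
  shows "sets (surface_area_measure K) = sets sphere_borel"
    and "\<omega> \<in> sets sphere_borel \<Longrightarrow> emeasure (surface_area_measure K) \<omega> = hausdorff_measure (DIM('a) - 1) (normals_hit K \<omega>)"
proof -
  obtain z r R where B: "body_around_0 ((+) (- z) ` K) r R" using convex_body_around_0[OF assms] .
  interpret B: body_around_0 "(+) (- z) ` K" r R by (rule B)
  have t: "surface_area_measure ((+) (- z) ` K) = surface_area_measure K" by (rule surface_area_measure_translation)
  show "sets (surface_area_measure K) = sets sphere_borel" using B.sets_surface_area_measure unfolding t .
  assume w: "\<omega> \<in> sets sphere_borel"
  have "emeasure (surface_area_measure K) \<omega> = hausdorff_measure (DIM('a) - 1) (normals_hit ((+) (- z) ` K) \<omega>)"
    using B.emeasure_surface_area_measure[OF w] B.normals_hit_measure[of \<omega>] B.unit_normals_eq_M w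
    unfolding t B.sets_sphere_borel normals_hit_def by (metis (no_types, lifting) Collect_cong)
  also have "\<dots> = hausdorff_measure (DIM('a) - 1) (normals_hit K \<omega>)"
  by (rule normals_hit_translation)
  finally show "emeasure (surface_area_measure K) \<omega> = hausdorff_measure (DIM('a) - 1) (normals_hit K \<omega>)" .
qed

lemma surface_area_measure_orthogonal:
  fixes K :: "'a::euclidean_space set"
  assumes K: "convex_body K" and Q: "orthogonal_transformation Q" "Q ` K = K" and w: "\<omega> \<in> sets sphere_borel" "Q ` \<omega> \<in> sets sphere_borel"
  shows "emeasure (surface_area_measure K) (Q ` \<omega>) = emeasure (surface_area_measure K) \<omega>"
proof -
  have "hausdorff_measure (DIM('a) - 1) (normals_hit (Q ` K) (Q ` \<omega>)) = hausdorff_measure (DIM('a) - 1) (normals_hit K \<omega>)"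
    using normals_hit_similarity[OF Q(1), of 1 "DIM('a) - 1" 0 K \<omega>] by simp
  then show ?thesis unfolding Q(2) surface_area_measure_convex_body(2)[OF K w(1)] surface_area_measure_convex_body(2)[OF K w(2)] .
qed

lemma convex_body_scaleR:
  fixes K :: "'a::euclidean_space set"
  assumes "convex_body K" "s > 0" shows "convex_body ((*\<^sub>R) s ` K)"
  using assms compact_scaling[of K s] convex_scaling[of K s] interior_injective_linear_image[of "(*\<^sub>R) s" K]
  by (auto simp: convex_body_def linear_scaleR inj_on_def)

lemma surface_area_measure_scaleR:
  fixes K :: "'a::euclidean_space set"
  assumes K: "convex_body K" and s: "s > 0"
  shows "surface_area_measure ((*\<^sub>R) s ` K) = scale_measure (ennreal (s ^ (DIM('a) - 1))) (surface_area_measure K)"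
proof (rule measure_eqI)
  note K' = convex_body_scaleR[OF K s]
  show "sets (surface_area_measure ((*\<^sub>R) s ` K)) = sets (scale_measure (ennreal (s ^ (DIM('a) - 1))) (surface_area_measure K))"
    using surface_area_measure_convex_body(1)[OF K] surface_area_measure_convex_body(1)[OF K'] by simp
  fix \<omega> assume "\<omega> \<in> sets (surface_area_measure ((*\<^sub>R) s ` K))"
  then have w: "\<omega> \<in> sets sphere_borel" using surface_area_measure_convex_body(1)[OF K'] by simp
  have eq: "(\<lambda>x::'a. 0 + s *\<^sub>R x) = (*\<^sub>R) s" by (rule ext) simp
  show "emeasure (surface_area_measure ((*\<^sub>R) s ` K)) \<omega> = emeasure (scale_measure (ennreal (s ^ (DIM('a) - 1))) (surface_area_measure K)) \<omega>"
    unfolding emeasure_scale_measure surface_area_measure_convex_body(2)[OF K w] surface_area_measure_convex_body(2)[OF K' w]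
    using normals_hit_similarity[OF orthogonal_transformation_id s, of "DIM('a) - 1" 0 K \<omega>] unfolding eq image_ident .
qed

text \<open>The degree is n - 1 from the surface area plus 1 - p from the support function.\<close>

lemma Lp_surface_area_measure_scaleR:
  fixes K :: "'a::euclidean_space set"
  assumes K: "K \<in> convex_bodies_0" and s: "s > 0" and w: "\<omega> \<in> sets sphere_borel"
  shows "emeasure (Lp_surface_area_measure p ((*\<^sub>R) s ` K)) \<omega>
    = ennreal (s powr (real DIM('a) - p)) * emeasure (Lp_surface_area_measure p K) \<omega>"
proof -
  have cb: "convex_body K" and "0 \<in> K" using K by (auto simp: convex_bodies_0_def)
  then have K': "compact K" "K \<noteq> {}" by (auto simp: convex_body_def)
  note st = surface_area_measure_convex_body(1)[OF cb]
  have [measurable]: "support_fun K \<in> borel_measurable borel" by (rule borel_measurable_support_fun[OF K'])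
  have hm: "(\<lambda>u. ennreal (c * support_fun K u powr (1 - p))) \<in> borel_measurable (surface_area_measure K)" for c
    unfolding measurable_cong_sets[OF st refl] by (rule measurable_restrict_space1) measurable
  have wm: "\<omega> \<in> sets (surface_area_measure K)" using w st by simp
  have h0: "0 \<le> support_fun K u" for u using support_fun_upper[OF K'(1) \<open>0 \<in> K\<close>, of u] by simp
  define k1 where "k1 = ennreal (s ^ (DIM('a) - 1))"
  define k2 where "k2 = ennreal (s powr (1 - p))"
  define H where "H u = ennreal (support_fun K u powr (1 - p))" for u
  have Hm: "H \<in> borel_measurable (surface_area_measure K)" unfolding H_def using hm[of 1] by simp
  have gm: "(\<lambda>u. k2 * H u * indicator \<omega> u) \<in> borel_measurable (surface_area_measure K)" using Hm wm by measurable
  have "ennreal (support_fun ((*\<^sub>R) s ` K) u powr (1 - p)) = k2 * H u" for u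
    using K' s h0 by (simp add: support_fun_scaleR powr_mult k2_def H_def ennreal_mult)
  then have "Lp_surface_area_measure p ((*\<^sub>R) s ` K) = density (scale_measure k1 (surface_area_measure K)) (\<lambda>u. k2 * H u)"
    unfolding Lp_surface_area_measure_def surface_area_measure_scaleR[OF cb s] k1_def by simp
  then have "emeasure (Lp_surface_area_measure p ((*\<^sub>R) s ` K)) \<omega>
     = (\<integral>\<^sup>+u. k2 * H u * indicator \<omega> u \<partial>scale_measure k1 (surface_area_measure K))"
    using Hm wm by (simp add: emeasure_density)
  also have "\<dots> = k1 * (\<integral>\<^sup>+u. k2 * (H u * indicator \<omega> u) \<partial>surface_area_measure K)"
    using gm by (simp add: nn_integral_scale_measure mult.assoc)
  also have "\<dots> = k1 * (k2 * emeasure (Lp_surface_area_measure p K) \<omega>)"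
    unfolding Lp_surface_area_measure_def H_def[symmetric] using Hm wm by (simp add: nn_integral_cmult emeasure_density)
  also have "\<dots> = ennreal (s ^ (DIM('a) - 1)) * (ennreal (s powr (1 - p)) * emeasure (Lp_surface_area_measure p K) \<omega>)"
    by (simp only: k1_def k2_def)
  also have "\<dots> = ennreal (s ^ (DIM('a) - 1) * s powr (1 - p)) * emeasure (Lp_surface_area_measure p K) \<omega>"
    using s by (simp add: ennreal_mult mult.assoc)
  also have "s ^ (DIM('a) - 1) * s powr (1 - p) = s powr (real DIM('a) - p)"
    using s by (simp add: powr_realpow[symmetric] powr_add[symmetric] of_nat_diff Suc_leI)
  finally show ?thesis .
qed

section \<open>Solution of the variational problem\<close>

text \<open>The cut-off functions converge to the indicator of \<open>C\<close> and are bounded by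
  1. Only large \<open>k\<close> are assumed, because in the application a wide cut-off may reach
  into the region where the support function is small.\<close>

lemma emeasure_closed_by_lipschitz:
  fixes \<alpha> \<beta> :: "'a::euclidean_space measure"
  assumes sets: "sets \<alpha> = sets borel" "sets \<beta> = sets borel" and fin: "finite_measure \<alpha>" "finite_measure \<beta>"
    and C: "closed C" "C \<noteq> {}"
    and eq: "\<And>k. k \<ge> N \<Longrightarrow> A * (\<integral>u. max 0 (1 - real k * infdist u C) \<partial>\<alpha>) = B * (\<integral>u. max 0 (1 - real k * infdist u C) \<partial>\<beta>)"
  shows "A * measure \<alpha> C = B * measure \<beta> C"
proof -
  define f where "f k u = max 0 (1 - real k * infdist u C)" for k u
  have fl: "(\<lambda>k. f k u) \<longlonglongrightarrow> indicator C u" for u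
  proof (cases "u \<in> C")
    case True then show ?thesis by (simp add: f_def)
  next
    case False
    then have d: "infdist u C > 0" using C by (metis in_closed_iff_infdist_zero infdist_nonneg less_eq_real_def)
    obtain k0 :: nat where "1 / infdist u C \<le> real k0" using real_arch_simple by blast
    then have "f k u = 0" if "k \<ge> k0" for k
      using d that order_trans[of "1 / infdist u C" "real k0" "real k"] by (simp add: f_def pos_divide_le_eq max_def)
    then have "\<forall>\<^sub>F k in sequentially. f k u = 0" by (auto simp: eventually_sequentially)
    then show ?thesis using False by (simp add: tendsto_eventually)
  qed
  have bm: "f k \<in> borel_measurable borel" for k
    unfolding f_def by (intro borel_measurable_continuous_onI continuous_intros)
  have lim: "(\<lambda>k. \<integral>u. f k u \<partial>m) \<longlonglongrightarrow> measure m C" if m: "sets m = sets borel" "finite_measure m" for m :: "'a measure"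
  proof -
    interpret finite_measure m by (rule m)
    have Cm: "C \<in> sets m" using C m by simp
    have "(\<lambda>k. \<integral>u. f k u \<partial>m) \<longlonglongrightarrow> (\<integral>u. indicator C u \<partial>m)"
    proof (rule integral_dominated_convergence[of _ _ _ "\<lambda>_. 1"])
      show "f k \<in> borel_measurable m" for k using bm by (simp add: measurable_cong_sets[OF m(1) refl])
      show "AE u in m. norm (f k u) \<le> 1" for k by (rule AE_I2) (simp add: f_def infdist_nonneg)
    qed (use fl Cm in auto)
    then show ?thesis using Cm by simp
  qed
  have "(\<lambda>k. A * (\<integral>u. f k u \<partial>\<alpha>)) \<longlonglongrightarrow> A * measure \<alpha> C" by (intro tendsto_mult tendsto_const lim sets fin)
  moreover have "(\<lambda>k. B * (\<integral>u. f k u \<partial>\<beta>)) \<longlonglongrightarrow> B * measure \<beta> C" by (intro tendsto_mult tendsto_const lim sets fin)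
  moreover have "\<forall>\<^sub>F k in sequentially. A * (\<integral>u. f k u \<partial>\<alpha>) = B * (\<integral>u. f k u \<partial>\<beta>)"
    using eq by (auto simp: eventually_sequentially f_def)
  ultimately show ?thesis using tendsto_cong LIMSEQ_unique by metis
qed

context Lp_problem
begin

interpretation finite_measure \<mu> by (rule fin_\<mu>)

lemma good_convex_body: "good K \<Longrightarrow> convex_body K"
  using goodD[of K] by (simp add: convex_body_def)

text \<open>The Euler-Lagrange equation covers invariant functions that vanish where h is small.
  Averaged cut-off functions give closed subsets of the region where h is at least
  \<open>2 * \<eta>\<close>, closed sets generate the Borel sets, and letting \<open>\<eta>\<close>
  tend to 0 exhausts the region h > 0. Where h = 0 both sides vanish, the left by its density and
  the right by \<open>AE_support_pos\<close>.\<close>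

lemma exists_proportional:
  obtains K k where "good K" "k > 0" "\<And>\<omega>. \<omega> \<in> sets sphere_borel \<Longrightarrow> emeasure (Lp_surface_area_measure p K) \<omega> = ennreal k * emeasure \<mu> \<omega>"
proof -
  obtain K where K: "good K" "measure lborel K = 1"
    and min: "\<And>K'. good K' \<Longrightarrow> \<Psi> K 0 * measure lborel K' powr (p / DIM('a)) \<le> \<Psi> K' 0"
    using exists_minimiser by blast
  note Kc = goodD[OF K(1)]
  define h where "h = support_fun K"
  have hm [measurable]: "h \<in> borel_measurable borel" unfolding h_def by (rule borel_measurable_support_fun[OF Kc(1,6)])
  have hc: "continuous_on S h" for S unfolding h_def by (rule continuous_on_support_fun[OF Kc(1,6)])
  have hT: "h (T u) = h u" if "T \<in> \<G>" for T u unfolding h_def by (rule support_fun_\<G>[OF that Kc(7)[OF that]])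
  have h0: "0 \<le> h u" for u using support_fun_upper[OF Kc(1,5), of u] by (simp add: h_def)
  obtain R' where R': "R' > 0" "\<And>u v. \<bar>h u - h v\<bar> \<le> R' * norm (u - v)"
  proof -
    obtain R' where "R' > 0" "K \<subseteq> cball 0 R'"
      using compact_imp_bounded[OF Kc(1)] bounded_pos[of K] by (metis mem_cball_0 subsetI)
    then show ?thesis using that support_fun_lipschitz[OF Kc(1,6)] by (auto simp: h_def)
  qed
  define k0 where "k0 = \<Psi> K 0"
  have k0: "k0 > 0" unfolding k0_def by (rule \<Psi>_good_pos[OF K(1)])
  note cb = good_convex_body[OF K(1)]
  obtain z r R where "body_around_0 ((+) (- z) ` K) r R" using convex_body_around_0[OF cb] .
  moreover define K0 where "K0 = (+) (- z) ` K"
  ultimately have B0: "body_around_0 K0 r R" by simp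
  have EL: "k0 * (\<integral>u. f u / support_fun K0 u \<partial>body_around_0.\<nu> K0) = (\<integral>u. h u powr (p - 1) * f u \<partial>\<mu>)"
    if "f \<in> borel_measurable borel" "continuous_on (sphere 0 1) f" "\<And>T u. T \<in> \<G> \<Longrightarrow> norm u = 1 \<Longrightarrow> f (T u) = f u"
      "\<eta> > 0" "\<And>u. norm u = 1 \<Longrightarrow> h u < \<eta> \<Longrightarrow> f u = 0" for f \<eta>
    using that unfolding k0_def h_def K0_def
    by (intro euler_lagrange[OF K min B0[unfolded K0_def]]) auto
  have t: "surface_area_measure K0 = surface_area_measure K" unfolding K0_def by (rule surface_area_measure_translation)
  interpret B: body_around_0 K0 r R by (rule B0)
  obtain c where c: "c > 0"
    "\<And>f :: 'a \<Rightarrow> real. f \<in> borel_measurable borel \<Longrightarrow> c * (\<integral>u. f u / support_fun K0 u \<partial>B.\<nu>) = (\<integral>u. f u \<partial>B.\<sigma>)"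
    using B.integral_\<nu>_eq_\<sigma> by metis
  have sph: "sphere (0::'a) 1 \<in> sets borel" by simp
  have fin\<sigma>: "finite_measure B.\<sigma>" using B.finite_\<sigma> by (intro finite_measureI) simp
  have \<sigma>S: "emeasure B.\<sigma> X = emeasure (surface_area_measure K) (X \<inter> sphere 0 1)" if X: "X \<in> sets borel" for X
  proof -
    have "emeasure B.\<sigma> X = emeasure B.\<sigma> (X \<inter> sphere 0 1)"
      by (rule emeasure_eq_AE) (use B.AE_\<sigma> X in auto)
    also have "\<dots> = emeasure (surface_area_measure K) (X \<inter> sphere 0 1)"
      using B.emeasure_surface_area_measure[of "X \<inter> sphere 0 1"] X unfolding t B.sets_sphere_borel by auto
    finally show ?thesis .
  qed
  define \<mu>' where "\<mu>' = distr \<mu> borel (\<lambda>x. x)"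
  have idm: "(\<lambda>x. x) \<in> \<mu> \<rightarrow>\<^sub>M borel" by (rule meas_\<mu>) simp
  have sets\<mu>': "sets \<mu>' = sets borel" by (simp add: \<mu>'_def)
  have \<mu>'S: "emeasure \<mu>' X = emeasure \<mu> (X \<inter> sphere 0 1)" if X: "X \<in> sets borel" for X
    using X idm by (simp add: \<mu>'_def emeasure_distr space_\<mu> Int_commute)
  have fin\<mu>': "finite_measure \<mu>'" unfolding \<mu>'_def by (rule finite_measure_distr[OF idm])
  have AE\<mu>': "AE u in \<mu>'. norm u = 1"
    unfolding \<mu>'_def by (subst AE_distr_iff[OF idm]) (use AE_space in \<open>auto simp: space_\<mu>\<close>)
  have Tm: "T \<in> borel \<rightarrow>\<^sub>M borel" if "T \<in> \<G>" for T
    using orthogonal_transformation_linear[OF \<G>_orth[OF that]]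
    by (intro borel_measurable_continuous_onI linear_continuous_on) (simp add: linear_conv_bounded_linear)
  have vim: "T -` X \<inter> sphere 0 1 \<in> sets sphere_borel" "X \<inter> sphere 0 1 \<in> sets sphere_borel" "T ` (T -` X \<inter> sphere 0 1) = X \<inter> sphere 0 1"
    if T: "T \<in> \<G>" and X: "X \<in> sets borel" for T X
  proof -
    show "T -` X \<inter> sphere 0 1 \<in> sets sphere_borel" "X \<inter> sphere 0 1 \<in> sets sphere_borel"
      using X measurable_sets_borel[OF Tm[OF T] X] by (auto simp: B.sets_sphere_borel)
    have "surj T" by (rule orthogonal_transformation_surj[OF \<G>_orth[OF T]])
    then show "T ` (T -` X \<inter> sphere 0 1) = X \<inter> sphere 0 1"
      using orthogonal_transformation_norm[OF \<G>_orth[OF T]] by (force simp: surj_def image_iff)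
  qed
  have inv\<sigma>: "distr B.\<sigma> borel T = B.\<sigma>" if T: "T \<in> \<G>" for T
  proof (rule measure_eqI)
    fix X assume "X \<in> sets (distr B.\<sigma> borel T)"
    then have X: "X \<in> sets borel" by simp
    have "emeasure (distr B.\<sigma> borel T) X = emeasure B.\<sigma> (T -` X)" using Tm[OF T] X by (subst emeasure_distr) auto
    also have "\<dots> = emeasure (surface_area_measure K) (T -` X \<inter> sphere 0 1)"
      by (rule \<sigma>S) (rule measurable_sets_borel[OF Tm[OF T] X])
    also have "\<dots> = emeasure (surface_area_measure K) (X \<inter> sphere 0 1)"
      using surface_area_measure_orthogonal[OF cb \<G>_orth[OF T] Kc(7)[OF T] vim(1)[OF T X]] vim(2,3)[OF T X] by simp
    finally show "emeasure (distr B.\<sigma> borel T) X = emeasure B.\<sigma> X" using \<sigma>S[OF X] by simp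
  qed simp
  have inv\<mu>': "distr \<mu>' borel T = \<mu>'" if T: "T \<in> \<G>" for T
  proof (rule measure_eqI)
    have Tm': "T \<in> \<mu>' \<rightarrow>\<^sub>M borel" using Tm[OF T] by (simp add: measurable_cong_sets[OF sets\<mu>' refl])
    have sp: "space \<mu>' = UNIV" by (simp add: \<mu>'_def)
    fix X assume "X \<in> sets (distr \<mu>' borel T)"
    then have X: "X \<in> sets borel" by simp
    have "emeasure (distr \<mu>' borel T) X = emeasure \<mu>' (T -` X)" using Tm' X sp by (subst emeasure_distr) auto
    also have "\<dots> = emeasure \<mu> (T -` X \<inter> sphere 0 1)"
      by (rule \<mu>'S) (rule measurable_sets_borel[OF Tm[OF T] X])
    also have "\<dots> = emeasure \<mu> (X \<inter> sphere 0 1)"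
      using \<G>_\<mu>[OF T, of "T -` X \<inter> sphere 0 1"] vim[OF T X] by (simp add: sets_\<mu>)
    finally show "emeasure (distr \<mu>' borel T) X = emeasure \<mu>' X" using \<mu>'S[OF X] by simp
  qed (simp add: sets\<mu>')
  \<comment> \<open>The margin between \<open>\<eta>\<close> and \<open>2 * \<eta>\<close> leaves
    room for cut-off functions of subsets of \<open>E \<eta>\<close> that vanish where h is below
    \<open>\<eta>\<close>.\<close>
  define E where "E \<eta> = {u. norm u = 1 \<and> 2 * \<eta> \<le> h u}" for \<eta>
  have Ecl: "closed (E \<eta>)" for \<eta>
    unfolding E_def by (intro closed_Collect_conj closed_Collect_eq closed_Collect_le hc continuous_intros)
  \<comment> \<open>Truncating h at \<open>\<eta>\<close> keeps the measure finite. For functions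
    vanishing where h is below \<open>\<eta>\<close> the weight is as good as
    \<open>h u powr (p - 1)\<close>.\<close>
  define m2 where "m2 \<eta> = density \<mu>' (\<lambda>u. ennreal (max (h u) \<eta> powr (p - 1)))" for \<eta>
  have wm: "(\<lambda>u. max (h u) \<eta> powr (p - 1)) \<in> borel_measurable \<mu>'" for \<eta>
    unfolding measurable_cong_sets[OF sets\<mu>' refl] by measurable
  have m2fin: "finite_measure (m2 \<eta>)" if "\<eta> > 0" for \<eta>
  proof (rule finite_measureI)
    interpret m: finite_measure \<mu>' by (rule fin\<mu>')
    have "emeasure (m2 \<eta>) (space (m2 \<eta>)) = (\<integral>\<^sup>+u. ennreal (max (h u) \<eta> powr (p - 1)) \<partial>\<mu>')"
      unfolding m2_def using wm[of \<eta>] by (subst emeasure_density) (auto intro!: nn_integral_cong)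
    also have "\<dots> \<le> (\<integral>\<^sup>+u. ennreal (\<eta> powr (p - 1)) \<partial>\<mu>')"
      using that p by (intro nn_integral_mono ennreal_leI powr_mono2') auto
    also have "\<dots> < \<infinity>" using m.emeasure_finite by (simp add: ennreal_mult_less_top less_top[symmetric] ennreal_mult_eq_top_iff)
    finally show "emeasure (m2 \<eta>) (space (m2 \<eta>)) \<noteq> \<infinity>" by simp
  qed
  have m2inv: "distr (m2 \<eta>) borel T = m2 \<eta>" if T: "T \<in> \<G>" for T \<eta>
  proof -
    have "density (distr \<mu>' borel T) (\<lambda>u. ennreal (max (h u) \<eta> powr (p - 1))) = distr (density \<mu>' (\<lambda>u. ennreal (max (h (T u)) \<eta> powr (p - 1)))) borel T"
      using Tm[OF T] by (intro density_distr) (simp_all add: measurable_cong_sets[OF sets\<mu>' refl])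
    then show ?thesis by (simp add: m2_def hT[OF T] inv\<mu>'[OF T])
  qed
  have closed_eq: "k0 * measure B.\<sigma> C = c * measure (m2 \<eta>) C" if \<eta>: "\<eta> > 0" and C: "closed C" "C \<subseteq> E \<eta>" for C \<eta>
  proof (cases "C = {}")
    case False
    \<comment> \<open>From \<open>N\<close> on the cut-off vanishes beyond distance
      \<open>\<eta> / R'\<close> from \<open>C\<close>, and within this distance h changes by less
      than \<open>\<eta>\<close>.\<close>
    obtain N :: nat where N: "R' / \<eta> < real N" using reals_Archimedean2 by blast
    show ?thesis
    proof (rule emeasure_closed_by_lipschitz[OF _ _ fin\<sigma> m2fin[OF \<eta>] C(1) False, of N])
      show "sets (m2 \<eta>) = sets borel" by (simp add: m2_def sets\<mu>')
      fix k assume k: "k \<ge> N"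
      define f where "f u = max 0 (1 - real k * infdist u C)" for u
      have fl: "\<bar>f x - f y\<bar> \<le> real k * dist x y" for x y
      proof -
        have "\<bar>f x - f y\<bar> \<le> \<bar>real k * infdist x C - real k * infdist y C\<bar>" by (auto simp: f_def max_def abs_minus_commute)
        also have "\<dots> = real k * \<bar>infdist x C - infdist y C\<bar>" by (simp add: right_diff_distrib[symmetric] abs_mult)
        also have "\<dots> \<le> real k * dist x y" by (intro mult_left_mono infdist_triangle_abs) simp
        finally show ?thesis .
      qed
      have fb: "\<bar>f x\<bar> \<le> 1" for x by (simp add: f_def infdist_nonneg)
      have fz: "f u = 0" if "u \<in> {u. norm u = 1 \<and> h u < \<eta>}" for u
      proof (rule ccontr)
        assume "f u \<noteq> 0"
        have "real N \<le> real k" using k by simp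
        then have kp: "real k > 0" "R' / \<eta> < real k" using N divide_pos_pos[OF R'(1) \<eta>] by linarith+
        obtain x where x: "x \<in> C" "infdist u C = dist u x" using infdist_attains_inf[OF C(1) False] by metis
        have "real k * dist u x < 1" using \<open>f u \<noteq> 0\<close> x by (simp add: f_def max_def split: if_splits)
        then have "R' * dist u x * real k \<le> R'" using R'(1) by (simp add: mult_ac)
        moreover have "R' < \<eta> * real k" using kp \<eta> by (simp add: pos_divide_less_eq mult.commute)
        ultimately have "R' * dist u x * real k < \<eta> * real k" by simp
        then have "R' * dist u x < \<eta>" using kp by simp
        moreover have "2 * \<eta> \<le> h x" using x C by (auto simp: E_def)
        moreover have "h x - h u \<le> R' * dist u x" using R'(2)[of x u] by (simp add: dist_norm norm_minus_commute)
        ultimately show False using that by simp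
      qed
      obtain a where a: "continuous_on UNIV a" "\<And>T u. T \<in> \<G> \<Longrightarrow> norm u = 1 \<Longrightarrow> a (T u) = a u"
        "\<And>u. u \<in> {u. norm u = 1 \<and> h u < \<eta>} \<Longrightarrow> a u = 0" "\<And>m. m \<in> {B.\<sigma>, m2 \<eta>} \<Longrightarrow> (\<integral>u. a u \<partial>m) = (\<integral>u. f u \<partial>m)"
      proof (rule invariant_average[of \<G> "{B.\<sigma>, m2 \<eta>}" "{u. norm u = 1 \<and> h u < \<eta>}" f "real k" 1])
        show "AE u in m. norm u = 1" if "m \<in> {B.\<sigma>, m2 \<eta>}" for m
          using that B.AE_\<sigma> AE\<mu>' wm[of \<eta>] by (auto simp: m2_def AE_density)
        show "T u \<in> {u. norm u = 1 \<and> h u < \<eta>}" if "T \<in> \<G>" "u \<in> {u. norm u = 1 \<and> h u < \<eta>}" for T u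
          using that hT orthogonal_transformation_norm[OF \<G>_orth] by simp
      qed (use \<G>_orth fin\<sigma> m2fin[OF \<eta>] inv\<sigma> m2inv fl fb fz sets\<mu>' in \<open>auto simp: m2_def\<close>)
      have am: "a \<in> borel_measurable borel" using a(1) by (rule borel_measurable_continuous_onI)
      have "k0 * (\<integral>u. f u \<partial>B.\<sigma>) = k0 * (\<integral>u. a u \<partial>B.\<sigma>)" using a(4)[of B.\<sigma>] by simp
      also have "\<dots> = c * (k0 * (\<integral>u. a u / support_fun K0 u \<partial>B.\<nu>))" using c(2)[OF am] by (simp add: mult_ac)
      also have "k0 * (\<integral>u. a u / support_fun K0 u \<partial>B.\<nu>) = (\<integral>u. h u powr (p - 1) * a u \<partial>\<mu>)"
        using a(2,3) by (intro EL[OF am _ _ \<eta>]) (auto intro: continuous_on_subset[OF a(1)])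
      also have "\<dots> = (\<integral>u. max (h u) \<eta> powr (p - 1) * a u \<partial>\<mu>)"
      proof (rule Bochner_Integration.integral_cong[OF refl])
        fix u assume "u \<in> space \<mu>"
        then show "h u powr (p - 1) * a u = max (h u) \<eta> powr (p - 1) * a u"
          using a(3)[of u] by (cases "h u < \<eta>") (auto simp: space_\<mu> max_def)
      qed
      also have "\<dots> = (\<integral>u. max (h u) \<eta> powr (p - 1) * a u \<partial>\<mu>')"
        unfolding \<mu>'_def using am by (intro integral_distr[symmetric] idm) measurable
      also have "\<dots> = (\<integral>u. a u \<partial>m2 \<eta>)"
        unfolding m2_def using wm[of \<eta>] am by (subst integral_density) (auto simp: measurable_cong_sets[OF sets\<mu>' refl])
      also have "\<dots> = (\<integral>u. f u \<partial>m2 \<eta>)" using a(4)[of "m2 \<eta>"] by simp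
      finally show "k0 * (\<integral>u. max 0 (1 - real k * infdist u C) \<partial>B.\<sigma>) = c * (\<integral>u. max 0 (1 - real k * infdist u C) \<partial>m2 \<eta>)"
        by (simp only: f_def)
    qed simp
  qed simp
  define H where "H u = ennreal (h u powr (1 - p))" for u
  have Hm [measurable]: "H \<in> borel_measurable borel" unfolding H_def by measurable
  define G1 where "G1 = density B.\<sigma> (\<lambda>u. ennreal k0 * H u)"
  define G2 where "G2 = density \<mu>' (\<lambda>_. ennreal c)"
  have setsm2: "sets (m2 \<eta>) = sets borel" for \<eta> by (simp add: m2_def sets\<mu>')
  have Em: "E \<eta> \<in> sets borel" for \<eta> using Ecl by simp
  have G_eq: "emeasure G1 (X \<inter> E \<eta>) = emeasure G2 (X \<inter> E \<eta>)" if X: "X \<in> sets borel" and \<eta>: "\<eta> > 0" for X \<eta>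
  proof -
    define \<alpha> where "\<alpha> = density B.\<sigma> (\<lambda>u. ennreal k0 * indicator (E \<eta>) u)"
    define \<beta> where "\<beta> = density (m2 \<eta>) (\<lambda>u. ennreal c * indicator (E \<eta>) u)"
    have e\<alpha>: "emeasure \<alpha> C = ennreal (k0 * measure B.\<sigma> (C \<inter> E \<eta>))" if "C \<in> sets borel" for C
    proof -
      have "emeasure \<alpha> C = (\<integral>\<^sup>+u. ennreal k0 * indicator (C \<inter> E \<eta>) u \<partial>B.\<sigma>)"
        unfolding \<alpha>_def using that Em[of \<eta>] by (subst emeasure_density) (auto intro!: nn_integral_cong split: split_indicator)
      also have "\<dots> = ennreal k0 * emeasure B.\<sigma> (C \<inter> E \<eta>)" using that Em[of \<eta>] by (intro nn_integral_cmult_indicator) auto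
      finally show ?thesis using k0 by (simp add: finite_measure.emeasure_eq_measure[OF fin\<sigma>] ennreal_mult)
    qed
    have e\<beta>: "emeasure \<beta> C = ennreal (c * measure (m2 \<eta>) (C \<inter> E \<eta>))" if "C \<in> sets borel" for C
    proof -
      have "emeasure \<beta> C = (\<integral>\<^sup>+u. ennreal c * indicator (C \<inter> E \<eta>) u \<partial>m2 \<eta>)"
        unfolding \<beta>_def using that Em[of \<eta>] by (subst emeasure_density) (auto simp: setsm2 measurable_cong_sets[OF setsm2 refl] intro!: nn_integral_cong split: split_indicator)
      also have "\<dots> = ennreal c * emeasure (m2 \<eta>) (C \<inter> E \<eta>)" using that Em[of \<eta>] by (intro nn_integral_cmult_indicator) (auto simp: setsm2)
      finally show ?thesis using c(1) by (simp add: finite_measure.emeasure_eq_measure[OF m2fin[OF \<eta>]] ennreal_mult)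
    qed
    have "\<alpha> = \<beta>"
    proof (rule measure_eqI_generator_eq[where E="Collect closed" and \<Omega>=UNIV and A="\<lambda>_. UNIV"])
      have b: "sets borel = sigma_sets (UNIV::'a set) (Collect closed)" by (subst borel_eq_closed) simp
      show "sets \<alpha> = sigma_sets UNIV (Collect closed)" "sets \<beta> = sigma_sets UNIV (Collect closed)"
        unfolding b[symmetric] by (simp_all add: \<alpha>_def \<beta>_def setsm2)
      fix C :: "'a set" assume "C \<in> Collect closed"
      then have C: "closed C" by simp
      show "emeasure \<alpha> C = emeasure \<beta> C"
        using closed_eq[OF \<eta>, of "C \<inter> E \<eta>"] C Ecl[of \<eta>] by (simp add: e\<alpha> e\<beta> closed_Int)
    qed (auto simp: Int_stable_def e\<alpha>)
    have "emeasure G1 (X \<inter> E \<eta>) = (\<integral>\<^sup>+u. (ennreal k0 * indicator (E \<eta>) u) * (H u * indicator X u) \<partial>B.\<sigma>)"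
      unfolding G1_def using X Em[of \<eta>] by (subst emeasure_density) (auto intro!: nn_integral_cong split: split_indicator simp: mult_ac)
    also have "\<dots> = (\<integral>\<^sup>+u. H u * indicator X u \<partial>\<alpha>)"
      unfolding \<alpha>_def using X Em[of \<eta>] by (subst nn_integral_density) auto
    also have "\<dots> = (\<integral>\<^sup>+u. (ennreal c * indicator (E \<eta>) u) * (H u * indicator X u) \<partial>m2 \<eta>)"
      unfolding \<open>\<alpha> = \<beta>\<close> \<beta>_def using X Em[of \<eta>] by (subst nn_integral_density) (auto simp: measurable_cong_sets[OF setsm2 refl])
    also have "\<dots> = (\<integral>\<^sup>+u. ennreal (max (h u) \<eta> powr (p - 1)) * ((ennreal c * indicator (E \<eta>) u) * (H u * indicator X u)) \<partial>\<mu>')"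
      unfolding m2_def using X Em[of \<eta>] wm[of \<eta>] by (subst nn_integral_density) (auto simp: measurable_cong_sets[OF sets\<mu>' refl])
    also have "\<dots> = (\<integral>\<^sup>+u. ennreal c * indicator (X \<inter> E \<eta>) u \<partial>\<mu>')"
    proof (rule nn_integral_cong)
      fix u
      have "ennreal (max (h u) \<eta> powr (p - 1)) * H u = 1" if "u \<in> E \<eta>"
      proof -
        have "max (h u) \<eta> = h u" "h u > 0" using that \<eta> by (auto simp: E_def)
        then show ?thesis by (simp add: H_def ennreal_mult[symmetric] powr_add[symmetric])
      qed
      then show "ennreal (max (h u) \<eta> powr (p - 1)) * ((ennreal c * indicator (E \<eta>) u) * (H u * indicator X u)) = ennreal c * indicator (X \<inter> E \<eta>) u"
        by (auto split: split_indicator simp: mult_ac)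
    qed
    also have "\<dots> = emeasure G2 (X \<inter> E \<eta>)"
      unfolding G2_def using X Em[of \<eta>] by (subst emeasure_density) (auto simp: sets\<mu>')
    finally show ?thesis .
  qed
  have G_eq': "emeasure G1 X = emeasure G2 X" if X: "X \<in> sets borel" "X \<subseteq> {u. norm u = 1 \<and> 0 < h u}" for X
  proof -
    define A where "A k = X \<inter> E (1 / (real k + 1))" for k
    have inc: "incseq A"
    proof (rule incseq_SucI)
      fix k
      have "1 / (real (Suc k) + 1) \<le> 1 / (real k + 1)" by (simp add: frac_le)
      then show "A k \<subseteq> A (Suc k)" by (auto simp: A_def E_def)
    qed
    have un: "(\<Union>k. A k) = X"
    proof
      show "X \<subseteq> (\<Union>k. A k)"
      proof
        fix u assume u: "u \<in> X"
        then have "h u > 0" using X by auto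
        then obtain k where "inverse (real (Suc k)) < h u / 2" using reals_Archimedean[of "h u / 2"] by auto
        then have "2 * (1 / (real k + 1)) \<le> h u" by (simp add: inverse_eq_divide field_simps)
        then have "u \<in> A k" using u X by (auto simp: A_def E_def)
        then show "u \<in> (\<Union>k. A k)" by blast
      qed
    qed (auto simp: A_def)
    have sA: "A k \<in> sets borel" for k unfolding A_def using X Em by auto
    have "(\<lambda>k. emeasure G1 (A k)) \<longlonglongrightarrow> emeasure G1 X"
      using Lim_emeasure_incseq[of A G1] sA inc un by (simp add: G1_def image_subset_iff)
    moreover have "(\<lambda>k. emeasure G2 (A k)) \<longlonglongrightarrow> emeasure G2 X"
      using Lim_emeasure_incseq[of A G2] sA inc un by (simp add: G2_def sets\<mu>' image_subset_iff)
    moreover have "emeasure G1 (A k) = emeasure G2 (A k)" for k unfolding A_def by (rule G_eq[OF X(1)]) simp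
    ultimately show ?thesis by (simp add: LIMSEQ_unique)
  qed
  have samK: "surface_area_measure K = restrict_space B.\<sigma> (sphere 0 1)"
  proof (rule measure_eqI)
    show s: "sets (surface_area_measure K) = sets (restrict_space B.\<sigma> (sphere 0 1))"
      using surface_area_measure_convex_body(1)[OF cb] by (simp add: sets_restrict_space)
    fix X assume "X \<in> sets (surface_area_measure K)"
    then have X: "X \<in> sets sphere_borel" using surface_area_measure_convex_body(1)[OF cb] by simp
    then show "emeasure (surface_area_measure K) X = emeasure (restrict_space B.\<sigma> (sphere 0 1)) X"
      using B.emeasure_surface_area_measure[OF X] unfolding t B.sets_sphere_borel by (subst emeasure_restrict_space) auto
  qed
  have main: "ennreal k0 * emeasure (Lp_surface_area_measure p K) \<omega> = ennreal c * emeasure \<mu> \<omega>" if w: "\<omega> \<in> sets sphere_borel" for \<omega>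
  proof -
    have wb: "\<omega> \<in> sets borel" "\<omega> \<subseteq> sphere 0 1" using w by (auto simp: B.sets_sphere_borel)
    define X where "X = \<omega> \<inter> {u. norm u = 1 \<and> 0 < h u}"
    have hz: "h u = 0" if "\<not> 0 < h u" for u using h0[of u] that by linarith
    have Xb: "X \<in> sets borel" unfolding X_def using wb by measurable
    have "emeasure (Lp_surface_area_measure p K) \<omega> = (\<integral>\<^sup>+u. H u * indicator \<omega> u \<partial>restrict_space B.\<sigma> (sphere 0 1))"
      unfolding Lp_surface_area_measure_def samK h_def[symmetric] H_def[symmetric]
      using wb by (intro emeasure_density measurable_restrict_space1) (auto simp: sets_restrict_space_iff)
    also have "\<dots> = (\<integral>\<^sup>+u. H u * indicator X u \<partial>B.\<sigma>)"
      by (subst nn_integral_restrict_space)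
        (use wb p in \<open>auto intro!: nn_integral_cong split: split_indicator simp: X_def H_def dest!: hz\<close>)
    finally have "ennreal k0 * emeasure (Lp_surface_area_measure p K) \<omega> = (\<integral>\<^sup>+u. ennreal k0 * H u * indicator X u \<partial>B.\<sigma>)"
      using Xb by (simp add: nn_integral_cmult mult.assoc)
    also have "\<dots> = emeasure G1 X" unfolding G1_def using Xb by (subst emeasure_density) auto
    also have "\<dots> = emeasure G2 X" by (rule G_eq'[OF Xb]) (auto simp: X_def)
    also have "\<dots> = ennreal c * emeasure \<mu>' X"
      unfolding G2_def using Xb by (simp add: emeasure_density_const sets\<mu>')
    also have "emeasure \<mu>' X = emeasure \<mu> X"
    proof -
      have "X \<inter> sphere 0 1 = X" by (auto simp: X_def)
      then show ?thesis using \<mu>'S[OF Xb] by simp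
    qed
    also have "emeasure \<mu> X = emeasure \<mu> \<omega>"
    proof (rule emeasure_eq_AE)
      show "AE u in \<mu>. (u \<in> X) = (u \<in> \<omega>)"
        using AE_support_pos[OF K(1)] AE_space by eventually_elim (auto simp: X_def h_def space_\<mu>)
      show "X \<in> sets \<mu>" "\<omega> \<in> sets \<mu>" using Xb wb by (auto simp: sets_\<mu> B.sets_sphere_borel X_def)
    qed
    finally show ?thesis .
  qed
  show ?thesis
  proof (rule that[OF K(1), of "c / k0"])
    fix \<omega> :: "'a set" assume w: "\<omega> \<in> sets sphere_borel"
    have "ennreal (c / k0) * emeasure \<mu> \<omega> = ennreal (1 / k0) * (ennreal c * emeasure \<mu> \<omega>)"
      using k0 c by (simp add: mult.assoc[symmetric] ennreal_mult[symmetric])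
    also have "\<dots> = ennreal (1 / k0) * ennreal k0 * emeasure (Lp_surface_area_measure p K) \<omega>"
      by (simp only: main[OF w, symmetric] mult.assoc)
    also have "ennreal (1 / k0) * ennreal k0 = 1" using k0 by (simp add: ennreal_mult[symmetric])
    finally show "emeasure (Lp_surface_area_measure p K) \<omega> = ennreal (c / k0) * emeasure \<mu> \<omega>" by simp
  qed (use c k0 in simp)
qed

theorem solution:
  obtains K where "K \<in> convex_bodies_0" "\<mu> = Lp_surface_area_measure p K" "\<And>T. T \<in> \<G> \<Longrightarrow> T ` K = K"
proof -
  obtain K k where K: "good K" "k > 0"
    "\<And>\<omega>. \<omega> \<in> sets sphere_borel \<Longrightarrow> emeasure (Lp_surface_area_measure p K) \<omega> = ennreal k * emeasure \<mu> \<omega>"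
    using exists_proportional by blast
  have K0: "K \<in> convex_bodies_0" using good_convex_body[OF K(1)] goodD(5)[OF K(1)] by (simp add: convex_bodies_0_def)
  define e where "e = real DIM('a) - p"
  have e: "e > 0" using p DIM_positive[where 'a='a] unfolding e_def by linarith
  \<comment> \<open>The dilation factor that solves s^(n-p) = 1 / k.\<close>
  define s where "s = (1 / k) powr (1 / e)"
  have s: "s > 0" "s powr e = 1 / k" using K(2) e by (simp_all add: s_def powr_powr)
  define K' where "K' = (*\<^sub>R) s ` K"
  have g: "good K'" unfolding K'_def by (rule good_scale(1)[OF K(1) s(1)])
  have K'0: "K' \<in> convex_bodies_0" using good_convex_body[OF g] goodD(5)[OF g] by (simp add: convex_bodies_0_def)
  have "\<mu> = Lp_surface_area_measure p K'"
  proof (rule measure_eqI)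
    show "sets \<mu> = sets (Lp_surface_area_measure p K')"
      using surface_area_measure_convex_body(1)[OF good_convex_body[OF g]] by (simp add: sets_\<mu> Lp_surface_area_measure_def)
    fix \<omega> assume "\<omega> \<in> sets \<mu>"
    then have w: "\<omega> \<in> sets sphere_borel" by (simp add: sets_\<mu>)
    have "emeasure (Lp_surface_area_measure p K') \<omega> = ennreal (1 / k) * (ennreal k * emeasure \<mu> \<omega>)"
      unfolding K'_def Lp_surface_area_measure_scaleR[OF K0 s(1) w] K(3)[OF w] by (simp add: e_def[symmetric] s(2))
    also have "\<dots> = emeasure \<mu> \<omega>" using K(2) by (simp add: ennreal_mult[symmetric] mult.assoc[symmetric])
    finally show "emeasure \<mu> \<omega> = emeasure (Lp_surface_area_measure p K') \<omega>" by simp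
  qed
  then show ?thesis using that[OF K'0] goodD(7)[OF g] by blast
qed

end

section \<open>The two cases of the theorem\<close>

text \<open>Bodies cut out by \<open>S \<subseteq> L\<close> and the directions \<open>v - w\<close>: the fibre over \<open>x \<in> L\<close> is a
  simplex of size \<open>w \<bullet> x + b\<close>, and sliding along \<open>- w0\<close> shrinks that simplex to a point within the body.\<close>

lemma degenerate_control:
  fixes L S Bs :: "'a::euclidean_space set" and w w0 :: 'a
  defines "\<V> \<equiv> insert (- (\<Sum>b\<in>Bs. b)) Bs"
  assumes L: "subspace L" and Bs: "finite Bs" "pairwise orthogonal Bs" "\<And>b. b \<in> Bs \<Longrightarrow> norm b = 1"
    "\<And>b x. b \<in> Bs \<Longrightarrow> x \<in> L \<Longrightarrow> x \<bullet> b = 0" "\<And>z. (\<And>x. x \<in> L \<Longrightarrow> x \<bullet> z = 0) \<Longrightarrow> z \<in> span Bs"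
    and S: "S \<subseteq> L" and w: "w \<in> L" "w0 \<in> L" "0 < w \<bullet> w0" "\<And>u. u \<in> S \<Longrightarrow> 0 \<le> w0 \<bullet> u"
    and \<Omega>: "\<Omega> = S \<union> (\<lambda>v. (1 / norm (v - w)) *\<^sub>R (v - w)) ` \<V>"
  shows "\<exists>B. \<forall>K. K = wulff \<Omega> (support_fun K) \<and> (\<forall>x\<in>K. \<forall>y\<in>K. \<forall>e\<in>L. \<bar>(x - y) \<bullet> e\<bar> \<le> D * norm e) \<longrightarrow>
    (\<forall>x\<in>K. \<forall>y\<in>K. norm (x - y) \<le> B)"
proof -
  define k where "k = real (card Bs)"
  define v0 where "v0 = - (\<Sum>b\<in>Bs. b)"
  \<comment> \<open>A bound for the size of the fibres: a slide by \<open>s *\<^sub>R w0\<close>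
    within the body forces \<open>s * norm w0 \<le> D\<close>, and it lowers the size by
    \<open>s * (w \<bullet> w0)\<close>.\<close>
  define D1 where "D1 = \<bar>D\<bar> * (w \<bullet> w0) / norm w0"
  have D1: "0 \<le> D1" using w(3) by (simp add: D1_def)
  have w0: "w0 \<noteq> 0" using w(3) by auto
  have Lv: "x \<bullet> v = 0" if "v \<in> \<V>" "x \<in> L" for v x
    using that Bs(4) by (auto simp: \<V>_def inner_sum_right)
  have ne: "norm (v - w) > 0" if "v \<in> \<V>" for v
  proof -
    have "v \<noteq> w" using Lv[OF that w(1)] w(3) by (metis inner_eq_zero_iff inner_zero_left less_irrefl)
    then show ?thesis by simp
  qed
  have "norm (X - Z) \<le> \<bar>D\<bar> + k * (2 * (k + 1) * D1)"
    if K: "K = wulff \<Omega> (support_fun K)" and wd: "\<And>x y e. x \<in> K \<Longrightarrow> y \<in> K \<Longrightarrow> e \<in> L \<Longrightarrow> \<bar>(x - y) \<bullet> e\<bar> \<le> D * norm e"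
      and XZ: "X \<in> K" "Z \<in> K" for K X Z
  proof -
    define g where "g v = norm (v - w) * support_fun K ((1 / norm (v - w)) *\<^sub>R (v - w))" for v
    have memK: "x \<in> K \<longleftrightarrow> (\<forall>u\<in>S. x \<bullet> u \<le> support_fun K u) \<and> (\<forall>v\<in>\<V>. x \<bullet> v - x \<bullet> w \<le> g v)" for x
    proof -
      have "x \<bullet> ((1 / norm (v - w)) *\<^sub>R (v - w)) \<le> c \<longleftrightarrow> x \<bullet> v - x \<bullet> w \<le> norm (v - w) * c" if "v \<in> \<V>" for v c
        using ne[OF that] by (simp add: inner_diff_right pos_divide_le_eq mult.commute)
      then have "x \<in> wulff \<Omega> (support_fun K) \<longleftrightarrow> (\<forall>u\<in>S. x \<bullet> u \<le> support_fun K u) \<and> (\<forall>v\<in>\<V>. x \<bullet> v - x \<bullet> w \<le> g v)"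
        unfolding wulff_def \<Omega> g_def by blast
      then show ?thesis using K by simp
    qed
    \<comment> \<open>The vectors of \<open>\<V>\<close> sum to 0, so a vector \<open>y0\<close>
      with \<open>y0 \<bullet> v = g v - b\<close> for all of them can exist only if
      \<open>b\<close> is the mean of the values \<open>g v\<close>. This \<open>y0\<close> is the
      common centre of the fibres.\<close>
    define b where "b = (g v0 + (\<Sum>v\<in>Bs. g v)) / (k + 1)"
    have kp: "k \<ge> 0" by (simp add: k_def)
    define y0 where "y0 = (\<Sum>v\<in>Bs. (g v - b) *\<^sub>R v)"
    have y0B: "y0 \<bullet> v = g v - b" if v: "v \<in> Bs" for v
    proof -
      have "y0 \<bullet> v = (\<Sum>u\<in>Bs. (g u - b) * (u \<bullet> v))" by (simp add: y0_def inner_sum_left)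
      also have "\<dots> = (\<Sum>u\<in>Bs. if u = v then g v - b else 0)"
      proof (rule sum.cong[OF refl])
        fix u assume u: "u \<in> Bs"
        have "v \<bullet> v = 1" using Bs(3)[OF v] by (simp add: norm_eq_1)
        moreover have "u \<noteq> v \<Longrightarrow> u \<bullet> v = 0" using Bs(2) u v by (auto simp: pairwise_def orthogonal_def)
        ultimately show "(g u - b) * (u \<bullet> v) = (if u = v then g v - b else 0)" by auto
      qed
      also have "\<dots> = g v - b" using Bs(1) v by simp
      finally show ?thesis .
    qed
    have y0L: "x \<bullet> y0 = 0" if "x \<in> L" for x using that Bs(4) by (simp add: y0_def inner_sum_right)
    have "y0 \<bullet> v0 = - (\<Sum>v\<in>Bs. g v - b)" by (simp add: v0_def inner_sum_right y0B)
    also have "\<dots> = k * b - (\<Sum>v\<in>Bs. g v)" by (simp add: sum_subtractf k_def)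
    also have "\<dots> = (k + 1) * b - b - (\<Sum>v\<in>Bs. g v)" by (simp add: algebra_simps)
    also have "(k + 1) * b = g v0 + (\<Sum>v\<in>Bs. g v)" using kp by (simp add: b_def)
    also have "g v0 + (\<Sum>v\<in>Bs. g v) - b - (\<Sum>v\<in>Bs. g v) = g v0 - b" by simp
    finally have y0V: "y0 \<bullet> v = g v - b" if "v \<in> \<V>" for v using that y0B by (auto simp: \<V>_def v0_def)
    have main: "0 \<le> X \<bullet> w + b \<and> X \<bullet> w + b \<le> D1" if X: "X \<in> K" for X
    proof -
      \<comment> \<open>Adding the auxiliary constraints cancels the components in the complement of
        \<open>L\<close>, since \<open>\<V>\<close> sums to 0.\<close>
      have "(X \<bullet> v0 - X \<bullet> w) + (\<Sum>v\<in>Bs. X \<bullet> v - X \<bullet> w) \<le> g v0 + (\<Sum>v\<in>Bs. g v)"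
        using X unfolding memK by (intro add_mono sum_mono) (auto simp: \<V>_def v0_def)
      also have "(X \<bullet> v0 - X \<bullet> w) + (\<Sum>v\<in>Bs. X \<bullet> v - X \<bullet> w) = - (k + 1) * (X \<bullet> w)"
        by (simp add: v0_def inner_sum_right sum_subtractf k_def algebra_simps)
      also have "g v0 + (\<Sum>v\<in>Bs. g v) = (k + 1) * b" using kp by (simp add: b_def)
      finally have "0 \<le> (k + 1) * (X \<bullet> w + b)" by (simp add: algebra_simps)
      then have lo: "0 \<le> X \<bullet> w + b" using kp by (simp add: zero_le_mult_iff)
      obtain P Q where PQ: "P \<in> span L" "\<And>x. x \<in> span L \<Longrightarrow> orthogonal Q x" "X = P + Q"
        using orthogonal_subspace_decomp_exists by metis
      have PX: "P \<bullet> x = X \<bullet> x" if "x \<in> L" for x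
        using PQ(2)[OF span_base[OF that]] by (simp add: PQ(3) inner_add_left orthogonal_def)
      have PL: "P \<in> L" using PQ(1) span_eq_iff[THEN iffD2, OF L] by simp
      define s where "s = (X \<bullet> w + b) / (w \<bullet> w0)"
      have s: "0 \<le> s" using lo w(3) by (simp add: s_def)
      \<comment> \<open>The component of X in the complement of \<open>L\<close> is replaced by the
        centre of the fibre.\<close>
      define X' where "X' = P + y0"
      have X'S: "X' \<bullet> u = X \<bullet> u" if "u \<in> S" for u
        using that S PX y0L by (auto simp: X'_def inner_add_left inner_commute[of y0])
      have X'w: "X' \<bullet> w = X \<bullet> w" using PX[OF w(1)] y0L[OF w(1)] by (simp add: X'_def inner_add_left inner_commute[of y0])
      have X'v: "X' \<bullet> v = g v - b" if "v \<in> \<V>" for v using Lv[OF that PL] y0V[OF that] by (simp add: X'_def inner_add_left)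
      have "X' \<in> K" using X lo unfolding memK by (auto simp: X'S X'w X'v)
      moreover have "X' - s *\<^sub>R w0 \<in> K"
        unfolding memK
      proof (intro conjI ballI)
        fix u assume u: "u \<in> S"
        have "0 \<le> s * (w0 \<bullet> u)" using s w(4)[OF u] by simp
        moreover have "X \<bullet> u \<le> support_fun K u" using X u unfolding memK by blast
        ultimately show "(X' - s *\<^sub>R w0) \<bullet> u \<le> support_fun K u" by (simp add: inner_diff_left X'S[OF u])
      next
        fix v assume v: "v \<in> \<V>"
        have "s * (w0 \<bullet> w) = X \<bullet> w + b" using w(3) by (simp add: s_def inner_commute[of w0])
        then show "(X' - s *\<^sub>R w0) \<bullet> v - (X' - s *\<^sub>R w0) \<bullet> w \<le> g v"
          by (simp add: inner_diff_left X'v[OF v] X'w Lv[OF v w(2)])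
      qed
      ultimately have "\<bar>(X' - (X' - s *\<^sub>R w0)) \<bullet> w0\<bar> \<le> D * norm w0" by (rule wd[OF _ _ w(2)])
      then have "s * (norm w0 * norm w0) \<le> D * norm w0" by (simp add: power2_norm_eq_inner[symmetric] power2_eq_square abs_le_iff)
      then have "(s * norm w0) * norm w0 \<le> D * norm w0" by (simp add: mult.assoc)
      then have "s * norm w0 \<le> D" using w0 by simp
      then have "s \<le> \<bar>D\<bar> / norm w0" using w0 by (simp add: pos_le_divide_eq)
      then have "s * (w \<bullet> w0) \<le> (\<bar>D\<bar> / norm w0) * (w \<bullet> w0)" using w(3) by (intro mult_right_mono) auto
      then show ?thesis using lo w(3) by (simp add: s_def D1_def)
    qed
    have up: "(X - y0) \<bullet> v \<le> D1" if "X \<in> K" "v \<in> \<V>" for X v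
    proof -
      have "X \<bullet> v - X \<bullet> w \<le> g v" using that unfolding memK by blast
      then show ?thesis using main[OF that(1)] y0V[OF that(2)] by (simp add: inner_diff_left)
    qed
    \<comment> \<open>Since \<open>\<V>\<close> sums to 0, upper bounds for all its vectors imply
      lower bounds.\<close>
    have bb: "\<bar>(X - y0) \<bullet> v\<bar> \<le> (k + 1) * D1" if X: "X \<in> K" and v: "v \<in> Bs" for X v
    proof -
      have "- (\<Sum>u\<in>Bs. (X - y0) \<bullet> u) \<le> D1" using up[OF X, of v0] by (simp add: \<V>_def v0_def inner_sum_right)
      moreover have "(\<Sum>u\<in>Bs. (X - y0) \<bullet> u) = (X - y0) \<bullet> v + (\<Sum>u\<in>Bs - {v}. (X - y0) \<bullet> u)" using Bs(1) v by (rule sum.remove)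
      moreover have "(\<Sum>u\<in>Bs - {v}. (X - y0) \<bullet> u) \<le> (\<Sum>u\<in>Bs - {v}. D1)"
        using up[OF X] by (intro sum_mono) (auto simp: \<V>_def)
      moreover have "(\<Sum>u\<in>Bs - {v}. D1) \<le> k * D1"
        using D1 Bs(1) by (simp add: k_def mult_right_mono card_mono)
      moreover have "(X - y0) \<bullet> v \<le> D1" using up[OF X] v by (simp add: \<V>_def)
      moreover have "0 \<le> k * D1" using kp D1 by simp
      ultimately show ?thesis by (simp add: abs_le_iff distrib_right)
    qed
    obtain P Q where PQ: "P \<in> span L" "\<And>x. x \<in> span L \<Longrightarrow> orthogonal Q x" "X - Z = P + Q"
      using orthogonal_subspace_decomp_exists by metis
    have PL: "P \<in> L" using PQ(1) span_eq_iff[THEN iffD2, OF L] by simp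
    have "norm P * norm P \<le> D * norm P"
      using wd[OF XZ PL] PQ(2)[OF PQ(1)] by (simp add: PQ(3) inner_add_left orthogonal_def abs_le_iff power2_norm_eq_inner[symmetric] power2_eq_square)
    then have P: "norm P \<le> \<bar>D\<bar>" by (cases "P = 0") auto
    have Qs: "Q \<in> span Bs" using PQ(2) span_base by (intro Bs(5)) (auto simp: orthogonal_def inner_commute)
    have eq: "(\<Sum>v\<in>Bs. (Q \<bullet> v) *\<^sub>R v) = Q" by (rule orthonormal_basis_expand[OF Bs(2,3) Qs Bs(1)])
    have "norm (\<Sum>v\<in>Bs. (Q \<bullet> v) *\<^sub>R v) \<le> (\<Sum>v\<in>Bs. norm ((Q \<bullet> v) *\<^sub>R v))" by (rule norm_sum)
    then have "norm Q \<le> (\<Sum>v\<in>Bs. norm ((Q \<bullet> v) *\<^sub>R v))" by (simp only: eq)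
    also have "\<dots> \<le> (\<Sum>v\<in>Bs. 2 * (k + 1) * D1)"
    proof (rule sum_mono)
      fix v assume v: "v \<in> Bs"
      have "Q \<bullet> v = (P + Q) \<bullet> v" using Bs(4)[OF v PL] by (simp add: inner_add_left)
      also have "\<dots> = (X - y0) \<bullet> v - (Z - y0) \<bullet> v" unfolding PQ(3)[symmetric] by (simp add: inner_diff_left)
      finally have "\<bar>Q \<bullet> v\<bar> \<le> 2 * ((k + 1) * D1)" using bb[OF XZ(1) v] bb[OF XZ(2) v] by linarith
      then show "norm ((Q \<bullet> v) *\<^sub>R v) \<le> 2 * (k + 1) * D1" using Bs(3)[OF v] by (simp only: norm_scaleR real_norm_def mult_1_right mult.assoc)
    qed
    also have "\<dots> = k * (2 * (k + 1) * D1)" by (simp add: k_def)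
    finally show ?thesis using P norm_triangle_ineq[of P Q] by (simp add: PQ(3))
  qed
  then show ?thesis by (intro exI[of _ "\<bar>D\<bar> + k * (2 * (k + 1) * D1)"] allI impI ballI) (elim conjE, simp)
qed

text \<open>The support function of \<open>\<Omega>\<close> is positive and continuous on the
  compact sphere, so it has a minimum m > 0 there, and points of norm above 1 / m violate a
  constraint.\<close>

lemma bounded_wulff_unit:
  assumes \<Omega>: "compact \<Omega>" "\<Omega> \<noteq> {}" and pos: "\<And>e :: 'a::euclidean_space. norm e = 1 \<Longrightarrow> \<exists>u\<in>\<Omega>. 0 < e \<bullet> u"
  shows "bounded (wulff \<Omega> (\<lambda>_. 1))"
proof -
  have "sphere (0::'a) 1 \<noteq> {}" by simp
  then obtain e0 where e0: "e0 \<in> sphere 0 1" "\<And>e. e \<in> sphere 0 1 \<Longrightarrow> support_fun \<Omega> e0 \<le> support_fun \<Omega> e"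
    using continuous_attains_inf[OF compact_sphere _ continuous_on_support_fun[OF \<Omega>]] by metis
  define m where "m = support_fun \<Omega> e0"
  obtain u0 where "u0 \<in> \<Omega>" "0 < e0 \<bullet> u0" using pos[of e0] e0 by auto
  then have m: "m > 0" using support_fun_upper[OF \<Omega>(1), of u0 e0] by (simp add: m_def inner_commute)
  have "norm x \<le> 1 / m" if x: "x \<in> wulff \<Omega> (\<lambda>_. 1)" for x
  proof (cases "x = 0")
    case False
    define e where "e = (1 / norm x) *\<^sub>R x"
    obtain u where u: "u \<in> \<Omega>" "u \<bullet> e = support_fun \<Omega> e" using support_fun_attained[OF \<Omega>] by blast
    have "m \<le> e \<bullet> u" using e0(2)[of e] False u by (simp add: e_def m_def inner_commute)
    moreover have "x \<bullet> u \<le> 1" using x u(1) by (simp add: wulff_def)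
    ultimately show ?thesis using False m by (simp add: e_def field_simps)
  qed (use m in simp)
  then show ?thesis by (auto simp: bounded_iff)
qed

section \<open>Positive hulls and supports of measures\<close>

lemma pos_hull_scale: "x \<in> X \<Longrightarrow> c \<ge> 0 \<Longrightarrow> c *\<^sub>R x \<in> pos_hull X"
  unfolding pos_hull_def by (intro CollectI exI[of _ "1::nat"] exI[of _ "\<lambda>_. c"] exI[of _ "\<lambda>_. x"]) simp

lemma pos_hull_add:
  assumes "x \<in> pos_hull X" "y \<in> pos_hull X" shows "x + y \<in> pos_hull X"
proof -
  obtain k and c :: "nat \<Rightarrow> real" and f where x: "x = (\<Sum>i=1..k. c i *\<^sub>R f i)" "k \<ge> 1" "\<forall>i\<in>{1..k}. c i \<ge> 0 \<and> f i \<in> X"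
    using assms(1) unfolding pos_hull_def by blast
  obtain l and d :: "nat \<Rightarrow> real" and g where y: "y = (\<Sum>i=1..l. d i *\<^sub>R g i)" "l \<ge> 1" "\<forall>i\<in>{1..l}. d i \<ge> 0 \<and> g i \<in> X"
    using assms(2) unfolding pos_hull_def by blast
  define c' where "c' i = (if i \<le> k then c i else d (i - k))" for i
  define f' where "f' i = (if i \<le> k then f i else g (i - k))" for i
  have "(\<Sum>i=1..k + l. c' i *\<^sub>R f' i) = (\<Sum>i=1..k. c' i *\<^sub>R f' i) + (\<Sum>i=k + 1..k + l. c' i *\<^sub>R f' i)"
    by (rule sum.ub_add_nat) simp
  also have "(\<Sum>i=1..k. c' i *\<^sub>R f' i) = x" unfolding x(1) by (rule sum.cong) (auto simp: c'_def f'_def)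
  also have "(\<Sum>i=k + 1..k + l. c' i *\<^sub>R f' i) = (\<Sum>i=1..l. c' (i + k) *\<^sub>R f' (i + k))"
    using sum.shift_bounds_cl_nat_ivl[of "\<lambda>i. c' i *\<^sub>R f' i" 1 k l] by (simp add: add.commute)
  also have "\<dots> = y" unfolding y(1) by (rule sum.cong) (auto simp: c'_def f'_def)
  finally have e: "x + y = (\<Sum>i=1..k + l. c' i *\<^sub>R f' i)" by simp
  have m: "c' i \<ge> 0 \<and> f' i \<in> X" if "i \<in> {1..k + l}" for i
  proof (cases "i \<le> k")
    case True then show ?thesis using x(3) that by (simp add: c'_def f'_def)
  next
    case False
    then have "i - k \<in> {1..l}" using that by auto
    then show ?thesis using y(3) False by (simp add: c'_def f'_def)
  qed
  have "1 \<le> k + l" using x(2) by simp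
  with e m show ?thesis unfolding pos_hull_def by blast
qed

lemma pos_hull_scaleR:
  assumes "x \<in> pos_hull X" "t \<ge> 0" shows "t *\<^sub>R x \<in> pos_hull X"
proof -
  obtain k and c :: "nat \<Rightarrow> real" and f where x: "x = (\<Sum>i=1..k. c i *\<^sub>R f i)" "k \<ge> 1" "\<forall>i\<in>{1..k}. c i \<ge> 0 \<and> f i \<in> X"
    using assms(1) unfolding pos_hull_def by blast
  show ?thesis
    unfolding pos_hull_def x(1)
    by (intro CollectI exI[of _ k] exI[of _ "\<lambda>i. t * c i"] exI[of _ f]) (use x assms(2) in \<open>auto simp: scaleR_sum_right\<close>)
qed

lemma pos_hull_subset_span: "pos_hull X \<subseteq> span X"
  unfolding pos_hull_def by (auto intro!: span_sum span_scale intro: span_base)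

text \<open>The hull is a convex cone but need not be closed, so a missing point can be separated
  only weakly. Separation within the span keeps \<open>a\<close> nonzero there, and large multiples
  of a point of \<open>X\<close> force the sign.\<close>

lemma pos_hull_separation:
  fixes X :: "'a::euclidean_space set"
  assumes "pos_hull X \<noteq> span X" "X \<noteq> {}"
  obtains a where "a \<in> span X" "a \<noteq> 0" "\<And>u. u \<in> X \<Longrightarrow> 0 \<le> a \<bullet> u"
proof -
  obtain q where q: "q \<in> span X" "q \<notin> pos_hull X" using assms(1) pos_hull_subset_span by blast
  define S where "S = (\<lambda>c. c - q) ` pos_hull X"
  obtain x where x: "x \<in> X" using assms(2) by blast
  have "convex (pos_hull X)" unfolding convex_def using pos_hull_add pos_hull_scaleR by blast
  then have "convex S" unfolding S_def by (rule convex_translation_subtract)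
  moreover have "S \<noteq> {}" using pos_hull_scale[OF x, of 1] by (auto simp: S_def)
  moreover have "0 \<notin> S" using q by (auto simp: S_def)
  ultimately obtain a where a: "a \<in> span S" "a \<noteq> 0" "\<And>y. y \<in> S \<Longrightarrow> 0 \<le> a \<bullet> y"
    using separating_hyperplane_set_0_inspan by metis
  have "S \<subseteq> span X" using q(1) pos_hull_subset_span by (auto simp: S_def intro: span_diff)
  then have aL: "a \<in> span X" using a(1) span_mono[of S "span X"] by (auto simp: span_span)
  have "0 \<le> a \<bullet> u" if u: "u \<in> X" for u
  proof (rule ccontr)
    assume neg: "\<not> 0 \<le> a \<bullet> u"
    define t where "t = (\<bar>a \<bullet> q\<bar> + 1) / - (a \<bullet> u)"
    have "t \<ge> 0" using neg unfolding t_def by (intro divide_nonneg_pos) auto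
    then have "0 \<le> a \<bullet> (t *\<^sub>R u - q)" using a(3) pos_hull_scale[OF u] by (simp add: S_def)
    then have "a \<bullet> q \<le> t * (a \<bullet> u)" by (simp add: inner_diff_right)
    also have "t * (a \<bullet> u) = - (\<bar>a \<bullet> q\<bar> + 1)" using neg by (simp add: t_def)
    finally show False by simp
  qed
  then show ?thesis using that aL a(2) by blast
qed

lemma measure_suppI: "x \<in> space \<mu> \<Longrightarrow> (\<And>U. open U \<Longrightarrow> x \<in> U \<Longrightarrow> emeasure \<mu> (U \<inter> space \<mu>) > 0) \<Longrightarrow> x \<in> measure_supp \<mu>"
  by (simp add: measure_supp_def)

text \<open>By the Lindelof property countably many null open sets cover the complement of the
  support, so it is null; this gives full measure of the support.\<close>

lemma measure_supp_sphere:
  fixes \<mu> :: "'a::euclidean_space measure"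
  assumes sets: "sets \<mu> = sets sphere_borel"
  shows "compact (measure_supp \<mu>)" and "measure_supp \<mu> \<subseteq> sphere 0 1" and "AE u in \<mu>. u \<in> measure_supp \<mu>"
    and "\<And>C. closed C \<Longrightarrow> AE u in \<mu>. u \<in> C \<Longrightarrow> measure_supp \<mu> \<subseteq> C"
proof -
  have sp: "space \<mu> = sphere 0 1" using sets_eq_imp_space_eq[OF sets] by (simp add: space_restrict_space)
  have om: "U \<inter> space \<mu> \<in> sets \<mu>" if "open U" for U :: "'a set"
    unfolding sets sp sets_restrict_space using that by (intro image_eqI[of _ _ U]) auto
  define \<U> where "\<U> = {U. open U \<and> emeasure \<mu> (U \<inter> space \<mu>) = 0}"
  have eq: "measure_supp \<mu> = sphere 0 1 - \<Union>\<U>"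
    unfolding measure_supp_def \<U>_def sp by (auto simp: zero_less_iff_neq_zero)
  have o: "open (\<Union>\<U>)" by (auto simp: \<U>_def)
  show "compact (measure_supp \<mu>)" unfolding eq using o by (intro compact_diff compact_sphere)
  show "measure_supp \<mu> \<subseteq> sphere 0 1" unfolding eq by blast
  have "open U" if "U \<in> \<U>" for U using that by (simp add: \<U>_def)
  then obtain \<U>' where U': "\<U>' \<subseteq> \<U>" "countable \<U>'" "\<Union>\<U>' = \<Union>\<U>"
    by (rule Lindelof)
  have "(\<Union>U\<in>\<U>'. U \<inter> space \<mu>) \<in> null_sets \<mu>"
  proof (rule null_sets_UN'[OF U'(2)])
    fix U assume "U \<in> \<U>'"
    then have "open U" "emeasure \<mu> (U \<inter> space \<mu>) = 0" using U'(1) by (auto simp: \<U>_def)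
    then show "U \<inter> space \<mu> \<in> null_sets \<mu>" using om by (intro null_setsI)
  qed
  then have "AE u in \<mu>. u \<notin> (\<Union>U\<in>\<U>'. U \<inter> space \<mu>)" by (rule AE_not_in)
  then show "AE u in \<mu>. u \<in> measure_supp \<mu>"
    using AE_space by eventually_elim (use U'(3) in \<open>auto simp: eq sp\<close>)
  show "measure_supp \<mu> \<subseteq> C" if C: "closed C" "AE u in \<mu>. u \<in> C" for C
  proof -
    have "AE u in \<mu>. u \<notin> (- C) \<inter> space \<mu>" using C(2) by eventually_elim auto
    moreover have "(- C) \<inter> space \<mu> \<in> sets \<mu>" using C(1) by (intro om) auto
    ultimately have "(- C) \<inter> space \<mu> \<in> null_sets \<mu>" using AE_iff_null_sets by blast
    then have "emeasure \<mu> ((- C) \<inter> space \<mu>) = 0" by (rule null_setsD1)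
    then have "- C \<in> \<U>" using C(1) by (auto simp: \<U>_def)
    then show ?thesis unfolding eq by blast
  qed
qed

text \<open>The symmetries are a set of maps closed under inverses; the empty set yields the
  existence statement without symmetry.\<close>

theorem Lp_minkowski_invariant:
  fixes \<mu> :: "'a::euclidean_space measure" and \<G> :: "('a \<Rightarrow> 'a) set"
  assumes p: "0 < p" "p < 1"
    and sets: "sets \<mu> = sets sphere_borel" and fin: "finite_measure \<mu>" and nontriv: "emeasure \<mu> (space \<mu>) \<noteq> 0"
    and supp: "span (measure_supp \<mu>) = UNIV \<or> pos_hull (measure_supp \<mu>) \<noteq> span (measure_supp \<mu>)"
    and orth: "\<And>T. T \<in> \<G> \<Longrightarrow> orthogonal_transformation T" and inv: "\<And>T. T \<in> \<G> \<Longrightarrow> inv T \<in> \<G>"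
    and fix_comp: "\<And>T x. T \<in> \<G> \<Longrightarrow> x \<in> (span (measure_supp \<mu>))\<^sup>\<bottom> \<Longrightarrow> T x = x"
    and \<mu>_inv: "\<And>T \<omega>. T \<in> \<G> \<Longrightarrow> \<omega> \<in> sets \<mu> \<Longrightarrow> emeasure \<mu> (T ` \<omega>) = emeasure \<mu> \<omega>"
  obtains K where "K \<in> convex_bodies_0" "\<mu> = Lp_surface_area_measure p K" "\<And>T. T \<in> \<G> \<Longrightarrow> T ` K = K"
proof -
  interpret finite_measure \<mu> by (rule fin)
  have sp: "space \<mu> = sphere 0 1" using sets_eq_imp_space_eq[OF sets] by (simp add: space_restrict_space)
  define S where "S = measure_supp \<mu>"
  define L where "L = span S"
  note Sf = measure_supp_sphere[OF sets, folded S_def]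
  have SL: "S \<subseteq> L" unfolding L_def by (rule span_superset)
  have subL: "subspace L" unfolding L_def by (rule subspace_span)
  have AE_L: "AE u in \<mu>. u \<in> L" using Sf(3) by eventually_elim (use SL in auto)
  have perp: "e \<bullet> x = 0" if e: "AE u in \<mu>. e \<bullet> u = 0" and x: "x \<in> L" for e x
  proof -
    have "S \<subseteq> {u. e \<bullet> u = 0}" by (rule Sf(4)) (use e in \<open>auto intro: closed_hyperplane\<close>)
    then have "L \<subseteq> {u. e \<bullet> u = 0}" unfolding L_def by (rule span_minimal) (rule subspace_hyperplane)
    then show ?thesis using x by blast
  qed
  have nondeg: "\<not> (AE u in \<mu>. e \<bullet> u = 0)" if "e \<in> L" "e \<noteq> 0" for e
    using perp[OF _ that(1), of e] that(2) by auto
  have ne: "S \<noteq> {}"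
  proof
    assume "S = {}"
    then have "AE u in \<mu>. False" using Sf(3) by simp
    then show False using nontriv emeasure_eq_0_AE[of "\<lambda>_. True" \<mu>] by simp
  qed
  have vim: "T -` X \<inter> sphere 0 1 \<in> sets \<mu>" "T ` (T -` X \<inter> sphere 0 1) = X \<inter> sphere 0 1"
    if T: "T \<in> \<G>" and X: "X \<in> sets borel" for T X
  proof -
    have "T \<in> borel \<rightarrow>\<^sub>M borel"
      using orthogonal_transformation_linear[OF orth[OF T]]
      by (intro borel_measurable_continuous_onI linear_continuous_on) (simp add: linear_conv_bounded_linear)
    from measurable_sets_borel[OF this X] show "T -` X \<inter> sphere 0 1 \<in> sets \<mu>"
      unfolding sets by (auto simp: sets_restrict_space)
    have "surj T" by (rule orthogonal_transformation_surj[OF orth[OF T]])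
    then show "T ` (T -` X \<inter> sphere 0 1) = X \<inter> sphere 0 1"
      using orthogonal_transformation_norm[OF orth[OF T]] by (force simp: surj_def image_iff)
  qed
  have sub: "T ` S \<subseteq> S" if T: "T \<in> \<G>" for T
  proof safe
    fix x assume x: "x \<in> S"
    show "T x \<in> S" unfolding S_def
    proof (rule measure_suppI)
      have "norm x = 1" using x Sf(2) by auto
      then show "T x \<in> space \<mu>" using orthogonal_transformation_norm[OF orth[OF T]] by (simp add: sp)
      fix U assume U: "open U" "T x \<in> U"
      have "open (T -` U)"
        using orthogonal_transformation_linear[OF orth[OF T]] U(1) by (intro open_vimage linear_continuous_on) (auto simp: linear_conv_bounded_linear)
      then have "emeasure \<mu> (T -` U \<inter> sphere 0 1) > 0" using x U(2) unfolding S_def measure_supp_def sp by auto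
      also have "emeasure \<mu> (T -` U \<inter> sphere 0 1) = emeasure \<mu> (U \<inter> sphere 0 1)"
        using \<mu>_inv[OF T vim(1)[OF T, of U]] vim(2)[OF T, of U] U(1) by simp
      finally show "emeasure \<mu> (U \<inter> space \<mu>) > 0" by (simp add: sp)
    qed
  qed
  have TS: "T ` S = S" if T: "T \<in> \<G>" for T
  proof
    show "T ` S \<subseteq> S" by (rule sub[OF T])
    have "T ` inv T ` S \<subseteq> T ` S" using sub[OF inv[OF T]] by (rule image_mono)
    then show "S \<subseteq> T ` S"
      using surj_f_inv_f[OF orthogonal_transformation_surj[OF orth[OF T]]] by (simp add: image_image)
  qed
  show ?thesis
  proof (cases "L = UNIV")
    case True
    \<comment> \<open>All directions belong to \<open>L\<close>, so the width in the direction x - y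
      itself bounds the distance of x and y.\<close>
    have "Lp_problem p \<mu> (sphere 0 1) L \<G>"
    proof (rule Lp_problem.intro[OF p sets fin compact_sphere order_refl _ subL AE_L nondeg nontriv orth _ \<mu>_inv])
      show "AE u in \<mu>. u \<in> sphere 0 1" using Sf(2,3) by (auto elim!: eventually_mono)
      show "T ` sphere 0 1 = sphere 0 1" if "T \<in> \<G>" for T
        using vim(2)[OF that, of UNIV] by simp
      show "bounded (wulff (sphere (0::'a) 1) (\<lambda>_. 1))"
        by (rule bounded_wulff_unit) (auto simp: norm_eq_1 intro!: bexI)
      fix D :: real
      have bd: "norm (x - y) \<le> \<bar>D\<bar>" if "\<bar>(x - y) \<bullet> (x - y)\<bar> \<le> D * norm (x - y)" for x y :: 'a
      proof (cases "x = y")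
        case False
        have "norm (x - y) * norm (x - y) \<le> D * norm (x - y)"
          using that by (simp add: power2_norm_eq_inner[symmetric] power2_eq_square)
        then show ?thesis using False by simp
      qed simp
      show "\<exists>B. \<forall>K. compact K \<and> convex K \<and> K = wulff (sphere 0 1) (support_fun K) \<and>
          (\<forall>x\<in>K. \<forall>y\<in>K. \<forall>e\<in>L. \<bar>(x - y) \<bullet> e\<bar> \<le> D * norm e) \<longrightarrow> (\<forall>x\<in>K. \<forall>y\<in>K. norm (x - y) \<le> B)"
        unfolding True
      proof (intro exI[of _ "\<bar>D\<bar>"] allI impI ballI, elim conjE)
        fix K and x y :: 'a assume "x \<in> K" "y \<in> K" "\<forall>x\<in>K. \<forall>y\<in>K. \<forall>e\<in>UNIV. \<bar>(x - y) \<bullet> e\<bar> \<le> D * norm e"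
        then have "\<bar>(x - y) \<bullet> (x - y)\<bar> \<le> D * norm (x - y)" by blast
        then show "norm (x - y) \<le> \<bar>D\<bar>" by (rule bd)
      qed
    qed
    then show ?thesis using Lp_problem.solution that by blast
  next
    case False
    then obtain a where a: "a \<in> L" "a \<noteq> 0" "\<And>u. u \<in> S \<Longrightarrow> 0 \<le> a \<bullet> u"
      using pos_hull_separation[of S] supp ne by (auto simp: L_def S_def)
    have bl: "bounded_linear (\<lambda>u::'a. u)" by (rule bounded_linear_ident)
    have bor: "f \<in> borel_measurable \<mu>" if "f \<in> borel_measurable borel" for f :: "'a \<Rightarrow> 'a"
      unfolding measurable_cong_sets[OF sets refl] by (rule measurable_restrict_space1[OF that])
    have iu: "integrable \<mu> (\<lambda>u. u)"
      by (rule integrable_const_bound[of _ 1]) (use AE_space bor[of "\<lambda>u. u"] in \<open>auto simp: sp\<close>)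
    \<comment> \<open>The mean of \<open>\<mu>\<close> lies in \<open>L\<close>, is fixed by
      \<open>\<G>\<close>, and satisfies \<open>0 < w \<bullet> a\<close> because \<open>a\<close>
      is nonnegative on the support and not almost everywhere orthogonal to it. With these
      properties it can tilt the auxiliary directions.\<close>
    define w where "w = (\<integral>u. u \<partial>\<mu>)"
    have wi: "w \<bullet> x = (\<integral>u. u \<bullet> x \<partial>\<mu>)" for x unfolding w_def using iu by simp
    have ii: "integrable \<mu> (\<lambda>u. u \<bullet> x)" for x using iu by simp
    have w0: "x \<bullet> w = 0" if "\<And>y. y \<in> L \<Longrightarrow> y \<bullet> x = 0" for x
    proof -
      have "w \<bullet> x = (\<integral>u. 0 \<partial>\<mu>)" unfolding wi by (rule integral_cong_AE) (use AE_L ii that in \<open>auto elim!: eventually_mono\<close>)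
      then show ?thesis by (simp add: inner_commute)
    qed
    have wL: "w \<in> L"
    proof -
      obtain P Q where PQ: "P \<in> span L" "\<And>x. x \<in> span L \<Longrightarrow> orthogonal Q x" "w = P + Q"
        using orthogonal_subspace_decomp_exists by metis
      have PL: "P \<in> L" using PQ(1) span_eq_iff[THEN iffD2, OF subL] by simp
      have QL: "y \<bullet> Q = 0" if "y \<in> L" for y using PQ(2)[OF span_base[OF that]] by (simp add: orthogonal_def inner_commute)
      then have "Q \<bullet> w = 0" by (rule w0)
      then have "Q = 0" using QL[OF PL] by (simp add: PQ(3) inner_add_right inner_commute)
      then show ?thesis using PL PQ(3) by simp
    qed
    have wa: "0 < w \<bullet> a"
    proof -
      have nn: "AE u in \<mu>. 0 \<le> u \<bullet> a" using Sf(3) by eventually_elim (use a(3) in \<open>simp add: inner_commute\<close>)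
      have "(\<integral>u. u \<bullet> a \<partial>\<mu>) \<noteq> 0"
      proof
        assume "(\<integral>u. u \<bullet> a \<partial>\<mu>) = 0"
        then have "AE u in \<mu>. u \<bullet> a = 0" using integral_nonneg_eq_0_iff_AE[OF ii nn] by simp
        then show False using nondeg[OF a(1,2)] by (simp add: inner_commute)
      qed
      moreover have "0 \<le> (\<integral>u. u \<bullet> a \<partial>\<mu>)" using nn by (rule integral_nonneg_AE)
      ultimately show ?thesis by (simp add: wi)
    qed
    have Tw: "T w = w" if T: "T \<in> \<G>" for T
    proof -
      have bT: "bounded_linear T" using orthogonal_transformation_linear[OF orth[OF T]] by (simp add: linear_conv_bounded_linear)
      have Tb: "T \<in> borel_measurable borel" by (intro borel_measurable_continuous_onI linear_continuous_on bT)
      have "space \<mu> = sphere 0 1" by (rule sp)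
      have TM: "T \<in> \<mu> \<rightarrow>\<^sub>M \<mu>"
        unfolding measurable_cong_sets[OF refl sets]
        by (rule measurable_restrict_space2) (use bor[OF Tb] orthogonal_transformation_norm[OF orth[OF T]] in \<open>auto simp: sp\<close>)
      have "distr \<mu> \<mu> T = \<mu>"
      proof (rule measure_eqI)
        fix X assume "X \<in> sets (distr \<mu> \<mu> T)"
        then have X: "X \<in> sets \<mu>" by simp
        then have Xb: "X \<in> sets borel" "X \<subseteq> sphere 0 1" unfolding sets by (auto simp: sets_restrict_space)
        have "emeasure (distr \<mu> \<mu> T) X = emeasure \<mu> (T -` X \<inter> sphere 0 1)" using TM X by (simp add: emeasure_distr sp)
        also have "\<dots> = emeasure \<mu> X" using \<mu>_inv[OF T vim(1)[OF T Xb(1)]] vim(2)[OF T Xb(1)] Xb(2) by (simp add: Int_absorb2)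
        finally show "emeasure (distr \<mu> \<mu> T) X = emeasure \<mu> X" .
      qed simp
      then have "w = (\<integral>u. u \<partial>distr \<mu> \<mu> T)" by (simp add: w_def)
      also have "\<dots> = (\<integral>u. T u \<partial>\<mu>)" by (rule integral_distr[OF TM bor]) simp
      also have "\<dots> = T w" unfolding w_def by (rule integral_bounded_linear[OF bT iu])
      finally show ?thesis by simp
    qed
    define V where "V = {y. \<forall>x\<in>L. orthogonal x y}"
    have sV: "subspace V" unfolding V_def by (rule subspace_orthogonal_to_vectors)
    obtain Bs where Bs: "Bs \<subseteq> V" "pairwise orthogonal Bs" "\<And>b. b \<in> Bs \<Longrightarrow> norm b = 1" "independent Bs" "span Bs = V"
    proof (rule orthonormal_basis_subspace[OF sV])
      fix B assume B: "B \<subseteq> V" "pairwise orthogonal B" "\<And>x. x \<in> B \<Longrightarrow> norm x = 1" "independent B" "span B = V"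
      show thesis by (rule that[OF B(1,2) _ B(4,5)]) (rule B(3))
    qed
    have fB: "finite Bs" using Bs(4) by (rule independent_imp_finite)
    have BL: "x \<bullet> b = 0" if "b \<in> Bs" "x \<in> L" for b x using Bs(1) that by (auto simp: orthogonal_def V_def)
    have BZ: "z \<in> span Bs" if "\<And>x. x \<in> L \<Longrightarrow> x \<bullet> z = 0" for z using that by (simp add: Bs(5) V_def orthogonal_def)
    \<comment> \<open>Vertices of a simplex about 0 in the complement of \<open>L\<close>. They are
      fixed by \<open>\<G>\<close>, and so is \<open>w\<close>, which makes \<open>\<Omega>\<close>
      invariant.\<close>
    define \<V> where "\<V> = insert (- (\<Sum>b\<in>Bs. b)) Bs"
    define n where "n v = (1 / norm (v - w)) *\<^sub>R (v - w)" for v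
    define \<Omega> where "\<Omega> = S \<union> n ` \<V>"
    have fV: "finite \<V>" using fB by (simp add: \<V>_def)
    have VL: "x \<bullet> v = 0" if "v \<in> \<V>" "x \<in> L" for v x using that BL by (auto simp: \<V>_def inner_sum_right)
    have wn: "w \<noteq> 0" using wa by auto
    have vw: "norm (v - w) > 0" if "v \<in> \<V>" for v
      using VL[OF that wL] wn by auto
    have c\<Omega>: "compact \<Omega>" unfolding \<Omega>_def using fV by (intro compact_Un Sf(1) finite_imp_compact finite_imageI)
    have s\<Omega>: "\<Omega> \<subseteq> sphere 0 1" using Sf(2) vw by (auto simp: \<Omega>_def n_def)
    have "Lp_problem p \<mu> \<Omega> L \<G>"
    proof (rule Lp_problem.intro[OF p sets fin c\<Omega> s\<Omega> _ subL AE_L nondeg nontriv orth _ \<mu>_inv])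
      show "AE u in \<mu>. u \<in> \<Omega>" using Sf(3) by (auto simp: \<Omega>_def elim!: eventually_mono)
      show "T ` \<Omega> = \<Omega>" if T: "T \<in> \<G>" for T
      proof -
        have l: "linear T" by (rule orthogonal_transformation_linear[OF orth[OF T]])
        have "T v = v" if "v \<in> \<V>" for v
          using VL[OF that] by (intro fix_comp[OF T]) (auto simp: orthogonal_comp_def orthogonal_def L_def S_def)
        then have "T (n v) = n v" if "v \<in> \<V>" for v
          using that by (simp add: n_def linear_scale[OF l] linear_diff[OF l] Tw[OF T])
        then have "T ` n ` \<V> = n ` \<V>" by (simp add: image_image)
        then show ?thesis using TS[OF T] by (simp add: \<Omega>_def image_Un)
      qed
      show "bounded (wulff \<Omega> (\<lambda>_. 1))"
      proof (rule bounded_wulff_unit[OF c\<Omega>])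
        show "\<Omega> \<noteq> {}" using ne by (simp add: \<Omega>_def)
        fix e :: 'a assume e: "norm e = 1"
        show "\<exists>u\<in>\<Omega>. 0 < e \<bullet> u"
        proof (rule ccontr)
          assume "\<not> (\<exists>u\<in>\<Omega>. 0 < e \<bullet> u)"
          then have neg: "e \<bullet> u \<le> 0" if "u \<in> \<Omega>" for u using that by force
          \<comment> \<open>The vectors of \<open>\<V>\<close> sum to 0, which gives
            \<open>0 \<le> w \<bullet> e\<close>, while integrating over the support gives the
            opposite inequality. Equality makes \<open>e\<close> orthogonal to \<open>L\<close>; its
            coefficients in the basis are then nonpositive with sum 0, so
            \<open>e = 0\<close>.\<close>
          have eV: "e \<bullet> v \<le> w \<bullet> e" if "v \<in> \<V>" for v
          proof -
            have "e \<bullet> n v \<le> 0" using that by (intro neg) (simp add: \<Omega>_def)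
            then have "e \<bullet> (v - w) \<le> 0" using vw[OF that] by (simp add: n_def divide_le_0_iff)
            then show ?thesis by (simp add: inner_diff_right inner_commute)
          qed
          have np: "AE u in \<mu>. 0 \<le> - (u \<bullet> e)" using Sf(3) by eventually_elim (use neg in \<open>simp add: \<Omega>_def inner_commute\<close>)
          then have "0 \<le> (\<integral>u. - (u \<bullet> e) \<partial>\<mu>)" by (rule integral_nonneg_AE)
          then have le: "w \<bullet> e \<le> 0" by (simp add: wi)
          have "- (\<Sum>b\<in>Bs. e \<bullet> b) \<le> w \<bullet> e" using eV[of "- (\<Sum>b\<in>Bs. b)"] by (simp add: \<V>_def inner_sum_right)
          moreover have sB: "e \<bullet> b \<le> w \<bullet> e" if "b \<in> Bs" for b using eV that by (simp add: \<V>_def)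
          moreover have "(\<Sum>b\<in>Bs. e \<bullet> b) \<le> 0" using sB le by (intro sum_nonpos) (auto intro: order_trans)
          ultimately have we: "w \<bullet> e = 0" and sum0: "(\<Sum>b\<in>Bs. e \<bullet> b) = 0" using le by linarith+
          have "(\<integral>u. - (u \<bullet> e) \<partial>\<mu>) = 0" using we by (simp add: wi)
          then have "AE u in \<mu>. e \<bullet> u = 0" using integral_nonneg_eq_0_iff_AE[OF _ np] ii by (simp add: inner_commute)
          then have "e \<bullet> x = 0" if "x \<in> L" for x using that by (rule perp)
          then have es: "e \<in> span Bs" by (intro BZ) (simp add: inner_commute)
          have "(\<Sum>b\<in>Bs. - (e \<bullet> b)) = 0" using sum0 by (simp add: sum_negf)
          then have "\<forall>b\<in>Bs. - (e \<bullet> b) = 0" using sB we fB by (subst (asm) sum_nonneg_eq_0_iff) auto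
          then have "(\<Sum>b\<in>Bs. (e \<bullet> b) *\<^sub>R b) = 0" by simp
          then have "e = 0" using orthonormal_basis_expand[OF Bs(2,3) es fB] by simp
          then show False using e by simp
        qed
      qed
      fix D :: real
      show "\<exists>B. \<forall>K. compact K \<and> convex K \<and> K = wulff \<Omega> (support_fun K) \<and>
          (\<forall>x\<in>K. \<forall>y\<in>K. \<forall>e\<in>L. \<bar>(x - y) \<bullet> e\<bar> \<le> D * norm e) \<longrightarrow> (\<forall>x\<in>K. \<forall>y\<in>K. norm (x - y) \<le> B)"
      proof -
        have "\<exists>B. \<forall>K. K = wulff \<Omega> (support_fun K) \<and> (\<forall>x\<in>K. \<forall>y\<in>K. \<forall>e\<in>L. \<bar>(x - y) \<bullet> e\<bar> \<le> D * norm e) \<longrightarrow>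
            (\<forall>x\<in>K. \<forall>y\<in>K. norm (x - y) \<le> B)"
          by (rule degenerate_control[OF subL fB Bs(2) _ _ _ SL wL a(1) wa])
            (simp_all add: Bs(3) BL BZ a(3) \<Omega>_def \<V>_def n_def)
        then obtain B where B: "\<forall>K. K = wulff \<Omega> (support_fun K) \<and> (\<forall>x\<in>K. \<forall>y\<in>K. \<forall>e\<in>L. \<bar>(x - y) \<bullet> e\<bar> \<le> D * norm e) \<longrightarrow>
            (\<forall>x\<in>K. \<forall>y\<in>K. norm (x - y) \<le> B)" ..
        show ?thesis by (intro exI[of _ B] allI impI) (elim conjE, rule B[THEN spec, THEN mp], rule conjI, assumption+)
      qed
    qed
    then show ?thesis using Lp_problem.solution that by blast
  qed
qed

theorem theorem1p3:
  fixes p :: real and \<mu> :: "(real^'n) measure" and L :: "(real^'n) set"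
  assumes p: "0 < p" "p < 1"
    and borel: "sets \<mu> = sets (sphere_borel :: (real^'n) measure)"
    and fin: "finite_measure \<mu>"
    and nontrivial: "emeasure \<mu> (space \<mu>) \<noteq> 0"
    and L: "L = span (measure_supp \<mu>)"
    and supp: "span (measure_supp \<mu>) = UNIV \<or>
               dim L \<le> CARD('n) - 1 \<and> pos_hull (measure_supp \<mu>) \<noteq> L"
  shows "(\<exists>K\<in>convex_bodies_0. \<mu> = Lp_surface_area_measure p K) \<and>
         (\<forall>G :: (real^'n^'n) set.
            closed_orthogonal_subgroup G \<and> (\<forall>A\<in>G. \<forall>x\<in>L\<^sup>\<bottom>. A *v x = x) \<and>
            measure_invariant G \<mu> \<longrightarrow>
              (\<exists>K\<in>convex_bodies_0. \<mu> = Lp_surface_area_measure p K \<and> body_invariant G K))"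
proof -
  have sp: "span (measure_supp \<mu>) = UNIV \<or> pos_hull (measure_supp \<mu>) \<noteq> span (measure_supp \<mu>)"
    using supp by (auto simp: L)
  \<comment> \<open>The first claim is the case without symmetries.\<close>
  obtain K0 where K0: "K0 \<in> convex_bodies_0" "\<mu> = Lp_surface_area_measure p K0"
    by (rule Lp_minkowski_invariant[OF p borel fin nontrivial sp, of "{}"]; simp?)
  have "\<exists>K\<in>convex_bodies_0. \<mu> = Lp_surface_area_measure p K \<and> body_invariant G K"
    if G: "closed_orthogonal_subgroup G" "\<forall>A\<in>G. \<forall>x\<in>L\<^sup>\<bottom>. A *v x = x" "measure_invariant G \<mu>" for G :: "(real^'n^'n) set"
  proof -
    have om: "orthogonal_matrix A" "matrix_inv A \<in> G" if "A \<in> G" for A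
      using G(1) that by (auto simp: closed_orthogonal_subgroup_def)
    have inv: "inv ((*v) A) = (*v) (matrix_inv A)" if "A \<in> G" for A
    proof (rule inv_equality)
      have "\<exists>B. A ** B = mat 1 \<and> B ** A = mat 1" using om(1)[OF that] by (auto simp: orthogonal_matrix_def)
      then have "A ** matrix_inv A = mat 1 \<and> matrix_inv A ** A = mat 1" unfolding matrix_inv_def by (rule someI_ex)
      then show "matrix_inv A *v (A *v x) = x" "A *v (matrix_inv A *v x) = x" for x
        by (simp_all add: matrix_vector_mul_assoc)
    qed
    obtain K where K: "K \<in> convex_bodies_0" "\<mu> = Lp_surface_area_measure p K" "\<And>T. T \<in> (*v) ` G \<Longrightarrow> T ` K = K"
    proof (rule Lp_minkowski_invariant[OF p borel fin nontrivial sp, of "(*v) ` G"])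
      show "orthogonal_transformation T" if "T \<in> (*v) ` G" for T
        using that om(1) by (auto simp: orthogonal_transformation_matrix)
      show "inv T \<in> (*v) ` G" if "T \<in> (*v) ` G" for T using that inv om(2) by auto
      show "T x = x" if "T \<in> (*v) ` G" "x \<in> (span (measure_supp \<mu>))\<^sup>\<bottom>" for T x
        using that G(2) by (auto simp: L)
      show "emeasure \<mu> (T ` \<omega>) = emeasure \<mu> \<omega>" if "T \<in> (*v) ` G" "\<omega> \<in> sets \<mu>" for T \<omega>
        using that G(3) by (auto simp: measure_invariant_def)
    qed (rule that)
    have "body_invariant G K" unfolding body_invariant_def using K(3) by blast
    then show ?thesis using K(1,2) by blast
  qed
  then show ?thesis using K0 by blast
qed

end
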